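(* Let $\Sigma^\star$ be the solution of $$[(I-K^\star)-\zeta I]\Sigma^\star+\Sigma^\star[(I-K^\star)-\zeta I]=\Gamma^\star,\qquad\zeta=\mathbf 1_{\{\varphi=1\}}/(2C_\varphi),\quad(\ast)$$ with $\varphi\in(0.5,1]$, $C_\varphi>0$, and $\Gamma^\star=\mathbb{E}[(I-\tilde K^\star)\Omega^\star(I-\tilde K^\star)^\top]$. Assume that: (i) $f$ and all realizations $F(\cdot;\xi)$ are twice continuously differentiable, $\gamma_H\le\lambda_{\min}(\nabla^2F(x;\xi))\le\lambda_{\max}(\nabla^2F(x;\xi))\le\Upsilon_H$ for all $x,\xi$ with constants $\Upsilon_H>\gamma_H>0$, and $\nabla^2f$ is $\Upsilon_L$-Lipschitz; (ii) for some $q_g>2$, $C_{g,1},C_{g,2}>0$ and all $t\ge0$, $\mathbb{E}[g_t\mid\mathcal F_{t-1}]=\nabla f_t$ and $\mathbb{E}[\|g_t-\nabla f_t\|^{q_g}\mid\mathcal F_{t-1}]\le C_{g,1}\|x_t-x^\star\|^{q_g}+C_{g,2}$; (iii) for some $C_{H,1},C_{H,2}>0$ and all $t\ge0$, $\mathbb{E}[H_t\mid\mathcal F_{t-1}]=\nabla^2f_t$ and $\mathbb{E}[\|H_t-\nabla^2f_t\|^2\mid\mathcal F_{t-1}]\le C_{H,1}\|x_t-x^\star\|^2+C_{H,2}$; (iv) $C_\varphi>0.5/\lambda_{\min}(I-K^\star)$ if $\varphi=1$. (a) Suppose the Newton system is solved exactly, i.e. $x_{t+1}=x_t-\varphi_tB_t^{-1}g_t$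 with $\varphi_t=C_\varphi/(t+1)^\varphi$, and correspondingly $K^\star=\tilde K^\star=0$. Then $\Sigma^\star=\frac12\Omega^\star$ for $\varphi\in(0.5,1)$ and $\Sigma^\star=\frac{C_\varphi}{2C_\varphi-1}\Omega^\star$ for $\varphi=1$. In the latter case, setting $\varphi=C_\varphi=1$ gives $\sqrt t\,(x_t-x^\star)\xrightarrow{d}\mathcal N(0,\Omega^\star)$. (b) Suppose the iterates are those of the accelerated sketched method $x_{t+1}=x_t+\varphi_tz_{t,\tau}$ (context), that in addition there are $\gamma_S,\Upsilon_S>0$ with $Z_t\succeq\gamma_SI$ for all $t\ge0$ and $\mathbb{E}[\|S\|\|S^\dagger\|]\le\Upsilon_S$, and that $\tau(1-\sqrt{\mu_t/\nu_t})^{\tau-2}\le\gamma_H/(4\Upsilon_H)$ for all $t\ge0$. If $\gamma^\star=1$, then $\Sigma^\star$ is the solution of $$[(I-\mathcal C^\star)-\zeta I]\Sigma^\star+\Sigma^\star[(I-\mathcal C^\star)-\zeta I]=\mathcal G^\star,$$ where $\tilde{\mathcal C}^\star=\prod_{j=0}^{\tau-1}\big(I-B^\star S_j(S_j^\top(B^\star)^2S_j)^\dagger S_j^\top B^\star\big)$, $\mathcal C^\star=\mathbb{E}[\tilde{\mathcal C}^\star]$ and $\mathcal G^\star=\mathbb{E}[(I-\tilde{\mathcal C}^\star)\Omega^\star(I-\tilde{\mathcal C}^\star)^\top]$.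
   Context: Problem: $f(x)=\mathbb{E}_{\xi\sim\mathcal P}[F(x;\xi)]$ on $\mathbb{R}^d$, $x^\star=\arg\min f$; $\nabla f_t=\nabla f(x_t)$, $\nabla^2f_t=\nabla^2f(x_t)$. $\|\cdot\|$ is the $\ell_2$/spectral norm, $^\dagger$ the Moore–Penrose pseudoinverse, $\prod_{k=i}^jA_k=A_jA_{j-1}\cdots A_i$. Data and Hessian average: $x_0\in\mathbb{R}^d$ is fixed, $\xi_0,\xi_1,\ldots$ are i.i.d. $\sim\mathcal P$, $g_t=\nabla F(x_t;\xi_t)$, $H_t=\nabla^2F(x_t;\xi_t)$, $B_t=\frac1t\sum_{i=0}^{t-1}H_i$ for $t\ge1$, and $B_0$ is a fixed symmetric matrix with $\gamma_HI\preceq B_0\preceq\Upsilon_HI$. Sketches: $S$ is a random matrix in $\mathbb{R}^{d\times s}$; $\tau\ge1$ is a fixed integer; $\{S_{t,j}\}_{t\ge0,\,0\le j\le\tau-1}$ are i.i.d. copies of $S$, independent of all data. Filtration: $\mathcal F_t=\sigma(\{\xi_i,\{S_{i,j}\}_j\}_{i=0}^t)$, $\mathcal F_{-1}$ trivial. Solver parameters: with $S$ independent of $\mathcal F_{t-1}$ let $\tilde Z_t=B_tS(S^\top B_t^2S)^\dagger S^\top B_t$, $Z_t=\mathbb{E}[\tilde Z_t\mid\mathcal F_{t-1}]$, $\mu_t=\inf_{a\ne0}\frac{a^\top Z_ta}{a^\top a}$, $\nu_t=\sup_{a\ne0}\frac{a^\top\mathbb{E}[\tilde Z_tZ_t^{-1}\tilde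 Z_t\mid\mathcal F_{t-1}]a}{a^\top Z_ta}$, $\gamma_t=1/\sqrt{\mu_t\nu_t}$, $\alpha_t=1/(1+\gamma_t\nu_t)$, $\beta_t=1-\sqrt{\mu_t/\nu_t}$. Solver: $z_{t,0}=v_{t,0}=0$ and, for $0\le j\le\tau-1$: $y_{t,j}=\alpha_tv_{t,j}+(1-\alpha_t)z_{t,j}$, $\omega_{t,j}=B_tS_{t,j}(S_{t,j}^\top B_t^2S_{t,j})^\dagger S_{t,j}^\top(B_ty_{t,j}+g_t)$, $z_{t,j+1}=y_{t,j}-\omega_{t,j}$, $v_{t,j+1}=\beta_tv_{t,j}+(1-\beta_t)y_{t,j}-\gamma_t\omega_{t,j}$. Outer update: $x_{t+1}=x_t+\varphi_tz_{t,\tau}$, $\varphi_t=C_\varphi/(t+1)^\varphi$. Convention in the condition on $\tau$: $0^0=1$, $0^{-1}=+\infty$. Limit quantities: $B^\star=\nabla^2f(x^\star)$, $\Omega^\star=(B^\star)^{-1}\mathbb{E}[\nabla F(x^\star;\xi)\nabla F(x^\star;\xi)^\top](B^\star)^{-1}$; $S_0,\ldots,S_{\tau-1}$ i.i.d. copies of $S$; $\tilde Z^\star_j=B^\star S_j(S_j^\top(B^\star)^2S_j)^\dagger S_j^\top B^\star$, $Z^\star=\mathbb{E}[\tilde Z^\star_0]$; $(\mu^\star,\nu^\star,\alpha^\star,\beta^\star,\gamma^\star)$ are defined by the formulas above with $\tilde Z^\star_0,Z^\star$ in place of $\tilde Z_t,Z_t$. For the accelerated sketched method, $$\tilde C^\star_j=\begin{pmatrix}1-\alpha^\star&\alpha^\star\\(1-\alpha^\star)(1-\beta^\star)&\alpha^\star+\beta^\star-\alpha^\star\beta^\star\end{pmatrix}\otimes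 I_d-\begin{pmatrix}1-\alpha^\star&\alpha^\star\\(1-\alpha^\star)\gamma^\star&\alpha^\star\gamma^\star\end{pmatrix}\otimes\tilde Z^\star_j,$$ $\tilde K^\star=\begin{pmatrix}I&0\end{pmatrix}\tilde C^\star_{\tau-1}\cdots\tilde C^\star_0\begin{pmatrix}I\\ I\end{pmatrix}$, $K^\star=\mathbb{E}[\tilde K^\star]$. (In the exact-solve regime, both are $0$.) Expectations defining $K^\star,\Gamma^\star,\mathcal C^\star,\mathcal G^\star$ are over the sketches. *)

theory Defs
  imports "HOL-Probability.Probability"
begin

text \<open>
  Conventions: \<open>real^'d\<close> is Euclidean space with dimension \<open>CARD('d)\<close>, \<open>real^'s^'d\<close> is the type of
  matrices with \<open>'d\<close>-indexed rows and \<open>'s\<close>-indexed columns.  The library's \<open>norm\<close> on matrices is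
  the Frobenius norm; the spectral norm is \<open>spectral_norm\<close> below.
\<close>

definition gradient :: "(real^'d \<Rightarrow> real) \<Rightarrow> real^'d \<Rightarrow> real^'d" where
  "gradient f x = (THE D. GDERIV f x :> D)"

definition hessian :: "(real^'d \<Rightarrow> real) \<Rightarrow> real^'d \<Rightarrow> real^'d^'d" where
  "hessian f x = matrix (frechet_derivative (gradient f) (at x))"

definition twice_continuously_differentiable :: "(real^'d \<Rightarrow> real) \<Rightarrow> bool" where
  "twice_continuously_differentiable f \<longleftrightarrow>
     (\<forall>x. f differentiable (at x)) \<and>
     (\<forall>x. gradient f differentiable (at x)) \<and>
     continuous_on UNIV (hessian f)"

definition spectral_norm :: "real^'n^'m \<Rightarrow> real" where
  "spectral_norm A = onorm ((*v) A)"

definition real_eigenvalues :: "real^'n^'n \<Rightarrow> real set" where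
  "real_eigenvalues A = {l. \<exists>v. v \<noteq> 0 \<and> A *v v = l *\<^sub>R v}"

text \<open>The next two are only applied to symmetric matrices, which have real spectrum.\<close>

definition lambda_min :: "real^'n^'n \<Rightarrow> real" where
  "lambda_min A = Min (real_eigenvalues A)"

definition lambda_max :: "real^'n^'n \<Rightarrow> real" where
  "lambda_max A = Max (real_eigenvalues A)"

definition loewner_le :: "real^'n^'n \<Rightarrow> real^'n^'n \<Rightarrow> bool" where
  "loewner_le A B \<longleftrightarrow>
     transpose (B - A) = B - A \<and> (\<forall>v. 0 \<le> v \<bullet> ((B - A) *v v))"

text \<open>The four Penrose equations.\<close>

definition pinv :: "real^'n^'m \<Rightarrow> real^'m^'n" where
  "pinv A = (THE X. A ** X ** A = A \<and> X ** A ** X = X \<and>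
                    transpose (A ** X) = A ** X \<and> transpose (X ** A) = X ** A)"

definition outer :: "real^'m \<Rightarrow> real^'n \<Rightarrow> real^'n^'m" where
  "outer u v = (\<chi> i j. u $ i * v $ j)"

definition kron :: "real^'b^'a \<Rightarrow> real^'n^'m \<Rightarrow> real^('b \<times> 'n)^('a \<times> 'm)" where
  "kron A B = (\<chi> p q. A $ fst p $ fst q * B $ snd p $ snd q)"

text \<open>\<open>rev_prod A n\<close> is \<open>A (n-1) ** \<dots> ** A 0\<close>.\<close>

primrec rev_prod :: "(nat \<Rightarrow> real^'n^'n) \<Rightarrow> nat \<Rightarrow> real^'n^'n" where
  "rev_prod A 0 = mat 1"
| "rev_prod A (Suc n) = A n ** rev_prod A n"

definition solves_lyapunov :: "real^'n^'n \<Rightarrow> real \<Rightarrow> real^'n^'n \<Rightarrow> real^'n^'n \<Rightarrow> bool" where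
  "solves_lyapunov K \<zeta> G X \<longleftrightarrow>
     ((mat 1 - K) - \<zeta> *\<^sub>R mat 1) ** X + X ** ((mat 1 - K) - \<zeta> *\<^sub>R mat 1) = G"

text \<open>The preimage events of the family \<open>X i\<close>, \<open>i \<in> I\<close>, of random elements of \<open>N\<close>.\<close>

definition events_of :: "'a measure \<Rightarrow> 'i set \<Rightarrow> ('i \<Rightarrow> 'a \<Rightarrow> 'b) \<Rightarrow> 'b measure \<Rightarrow> 'a set set" where
  "events_of M I X N = {X i -` A \<inter> space M | i A. i \<in> I \<and> A \<in> sets N}"

text \<open>
  The sigma-algebra generated by data and sketches with outer index strictly below \<open>t\<close>, that is
  \<open>\<F>\<close> with index \<open>t - 1\<close>; for \<open>t = 0\<close> it is trivial.
\<close>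

definition past ::
  "'a measure \<Rightarrow> 'x measure \<Rightarrow> (nat \<Rightarrow> 'a \<Rightarrow> 'x) \<Rightarrow> (nat \<Rightarrow> nat \<Rightarrow> 'a \<Rightarrow> real^'s^'d) \<Rightarrow> nat
     \<Rightarrow> nat \<Rightarrow> 'a measure" where
  "past M P \<xi> S \<tau> t =
     sigma (space M) (events_of M {..<t} \<xi> P
                      \<union> events_of M ({..<t} \<times> {..<\<tau>}) (\<lambda>(i, j). S i j) borel)"

text \<open>
  The library only has conditional expectations of real functions; vectors and matrices are treated
  entrywise.  For non-integrable arguments \<open>real_cond_exp\<close> carries no information.
\<close>

definition cond_exp_vec ::
  "'a measure \<Rightarrow> 'a measure \<Rightarrow> ('a \<Rightarrow> real^'n) \<Rightarrow> 'a \<Rightarrow> real^'n" where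
  "cond_exp_vec M G X \<omega> = (\<chi> i. real_cond_exp M G (\<lambda>w. X w $ i) \<omega>)"

definition cond_exp_mat ::
  "'a measure \<Rightarrow> 'a measure \<Rightarrow> ('a \<Rightarrow> real^'n^'m) \<Rightarrow> 'a \<Rightarrow> real^'n^'m" where
  "cond_exp_mat M G X \<omega> = (\<chi> i j. real_cond_exp M G (\<lambda>w. X w $ i $ j) \<omega>)"

text \<open>
  The possibly degenerate Gaussian law with mean \<open>m\<close> and positive semidefinite covariance \<open>V\<close>:
  the law of \<open>m + A z\<close> with \<open>z\<close> standard normal and \<open>A A\<^sup>T = V\<close>
  (it does not depend on the choice of \<open>A\<close>).
\<close>

definition multivariate_normal :: "real^'n \<Rightarrow> real^'n^'n \<Rightarrow> (real^'n) measure" where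
  "multivariate_normal m V =
     (let A = (SOME A :: real^'n^'n. A ** transpose A = V)
      in distr (\<Pi>\<^sub>M i\<in>UNIV. density lborel std_normal_density) borel
           (\<lambda>z. m + A *v (\<chi> i. z i)))"

definition converges_in_distribution ::
  "'a measure \<Rightarrow> (nat \<Rightarrow> 'a \<Rightarrow> 'b::topological_space) \<Rightarrow> 'b measure \<Rightarrow> bool" where
  "converges_in_distribution M X N \<longleftrightarrow>
     (\<forall>n. X n \<in> borel_measurable M) \<and>
     (\<forall>h :: 'b \<Rightarrow> real. continuous_on UNIV h \<and> bounded (range h) \<longrightarrow>
        (\<lambda>n. LINT \<omega>|M. h (X n \<omega>)) \<longlonglongrightarrow> (LINT y|N. h y))"

definition sketch_mat :: "real^'d^'d \<Rightarrow> real^'s^'d \<Rightarrow> real^'d^'d" where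
  "sketch_mat B S = B ** S ** pinv (transpose S ** (B ** B) ** S) ** transpose S"

definition Ztilde :: "real^'d^'d \<Rightarrow> real^'s^'d \<Rightarrow> real^'d^'d" where
  "Ztilde B S = sketch_mat B S ** B"

text \<open>Here \<open>S\<close> is meant to be a sketch independent of \<open>G\<close>, and \<open>B\<close> to be \<open>G\<close>-measurable.\<close>

definition cond_Z ::
  "'a measure \<Rightarrow> 'a measure \<Rightarrow> ('a \<Rightarrow> real^'d^'d) \<Rightarrow> ('a \<Rightarrow> real^'s^'d) \<Rightarrow> 'a \<Rightarrow> real^'d^'d" where
  "cond_Z M G B S = cond_exp_mat M G (\<lambda>\<omega>. Ztilde (B \<omega>) (S \<omega>))"

definition cond_ZZinvZ ::
  "'a measure \<Rightarrow> 'a measure \<Rightarrow> ('a \<Rightarrow> real^'d^'d) \<Rightarrow> ('a \<Rightarrow> real^'s^'d) \<Rightarrow> 'a \<Rightarrow> real^'d^'d" where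
  "cond_ZZinvZ M G B S =
     cond_exp_mat M G
       (\<lambda>\<omega>. Ztilde (B \<omega>) (S \<omega>) ** matrix_inv (cond_Z M G B S \<omega>) ** Ztilde (B \<omega>) (S \<omega>))"

text \<open>In \<open>nu_of W Z\<close>, \<open>W\<close> stands for the (conditional) mean of \<open>Ztilde ** matrix_inv Z ** Ztilde\<close>.\<close>

definition mu_of :: "real^'d^'d \<Rightarrow> real" where
  "mu_of Z = (INF a\<in>{a. a \<noteq> 0}. (a \<bullet> (Z *v a)) / (a \<bullet> a))"

definition nu_of :: "real^'d^'d \<Rightarrow> real^'d^'d \<Rightarrow> real" where
  "nu_of W Z = (SUP a\<in>{a. a \<noteq> 0}. (a \<bullet> (W *v a)) / (a \<bullet> (Z *v a)))"

definition gamma_of :: "real \<Rightarrow> real \<Rightarrow> real" where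
  "gamma_of \<mu> \<nu> = 1 / sqrt (\<mu> * \<nu>)"

definition alpha_of :: "real \<Rightarrow> real \<Rightarrow> real" where
  "alpha_of \<mu> \<nu> = 1 / (1 + gamma_of \<mu> \<nu> * \<nu>)"

definition beta_of :: "real \<Rightarrow> real \<Rightarrow> real" where
  "beta_of \<mu> \<nu> = 1 - sqrt (\<mu> / \<nu>)"

text \<open>The pair \<open>(z, v)\<close> after \<open>j\<close> inner iterations for the Newton system with matrix \<open>B\<close> and gradient \<open>g\<close>.\<close>

primrec solver ::
  "real \<Rightarrow> real \<Rightarrow> real \<Rightarrow> real^'d^'d \<Rightarrow> real^'d \<Rightarrow> (nat \<Rightarrow> real^'s^'d) \<Rightarrow> nat
     \<Rightarrow> (real^'d) \<times> (real^'d)" where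
  "solver \<alpha> \<beta> \<gamma> B g S 0 = (0, 0)"
| "solver \<alpha> \<beta> \<gamma> B g S (Suc j) =
     (let (z, v) = solver \<alpha> \<beta> \<gamma> B g S j;
          y = \<alpha> *\<^sub>R v + (1 - \<alpha>) *\<^sub>R z;
          w = sketch_mat B (S j) *v (B *v y + g)
      in (y - w, \<beta> *\<^sub>R v + (1 - \<beta>) *\<^sub>R y - \<gamma> *\<^sub>R w))"

text \<open>
  Integer powers with \<open>0\<^sup>0 = 1\<close> and \<open>0\<close> to a negative power equal to \<open>\<infinity>\<close>
  (\<open>powi\<close> alone would yield \<open>0\<close> there).
\<close>

definition epowi :: "real \<Rightarrow> int \<Rightarrow> ereal" where
  "epowi r k = (if r = 0 \<and> k < 0 then \<infinity> else ereal (r powi k))"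

definition Omega_star ::
  "'x measure \<Rightarrow> (real^'d \<Rightarrow> 'x \<Rightarrow> real) \<Rightarrow> real^'d^'d \<Rightarrow> real^'d \<Rightarrow> real^'d^'d" where
  "Omega_star P F Bs xs =
     matrix_inv Bs
     ** (LINT d|P. outer (gradient (\<lambda>u. F u d) xs) (gradient (\<lambda>u. F u d) xs))
     ** matrix_inv Bs"

definition Z_star :: "(real^'s^'d) measure \<Rightarrow> real^'d^'d \<Rightarrow> real^'d^'d" where
  "Z_star D Bs = (LINT S|D. Ztilde Bs S)"

definition ZZinvZ_star :: "(real^'s^'d) measure \<Rightarrow> real^'d^'d \<Rightarrow> real^'d^'d" where
  "ZZinvZ_star D Bs = (LINT S|D. Ztilde Bs S ** matrix_inv (Z_star D Bs) ** Ztilde Bs S)"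

definition mat2 :: "real \<Rightarrow> real \<Rightarrow> real \<Rightarrow> real \<Rightarrow> real^2^2" where
  "mat2 a b c d = vector [vector [a, b], vector [c, d]]"

definition Ctilde :: "real \<Rightarrow> real \<Rightarrow> real \<Rightarrow> real^'d^'d \<Rightarrow> real^(2 \<times> 'd)^(2 \<times> 'd)" where
  "Ctilde \<alpha> \<beta> \<gamma> Z =
     kron (mat2 (1 - \<alpha>) \<alpha> ((1 - \<alpha>) * (1 - \<beta>)) (\<alpha> + \<beta> - \<alpha> * \<beta>)) (mat 1)
     - kron (mat2 (1 - \<alpha>) \<alpha> ((1 - \<alpha>) * \<gamma>) (\<alpha> * \<gamma>)) Z"

text \<open>The block row \<open>(I 0)\<close> and the block column \<open>(I; I)\<close>.\<close>

definition row_I0 :: "real^(2 \<times> 'd)^'d" where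
  "row_I0 = (\<chi> i q. if q = (1, i) then 1 else 0)"

definition col_II :: "real^'d^(2 \<times> 'd)" where
  "col_II = (\<chi> p j. if snd p = j then 1 else 0)"

definition Ktilde ::
  "real \<Rightarrow> real \<Rightarrow> real \<Rightarrow> real^'d^'d \<Rightarrow> nat \<Rightarrow> (nat \<Rightarrow> real^'s^'d) \<Rightarrow> real^'d^'d" where
  "Ktilde \<alpha> \<beta> \<gamma> Bs \<tau> S =
     row_I0 ** rev_prod (\<lambda>j. Ctilde \<alpha> \<beta> \<gamma> (Ztilde Bs (S j))) \<tau> ** col_II"

definition plain_prod :: "real^'d^'d \<Rightarrow> nat \<Rightarrow> (nat \<Rightarrow> real^'s^'d) \<Rightarrow> real^'d^'d" where
  "plain_prod Bs \<tau> S =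
     rev_prod (\<lambda>j. mat 1 - Bs ** S j ** pinv (transpose (S j) ** (Bs ** Bs) ** S j)
                           ** transpose (S j) ** Bs) \<tau>"

text \<open>The law of \<open>\<tau>\<close> i.i.d. sketches; the sketches are the coordinate maps.\<close>

definition sketches :: "(real^'s^'d) measure \<Rightarrow> nat \<Rightarrow> (nat \<Rightarrow> real^'s^'d) measure" where
  "sketches D \<tau> = (\<Pi>\<^sub>M j\<in>{..<\<tau>}. D)"

definition mean_of ::
  "(nat \<Rightarrow> real^'s^'d) measure \<Rightarrow> ((nat \<Rightarrow> real^'s^'d) \<Rightarrow> real^'d^'d) \<Rightarrow> real^'d^'d" where
  "mean_of N K = (LINT S|N. K S)"

definition Gamma_of ::
  "(nat \<Rightarrow> real^'s^'d) measure \<Rightarrow> ((nat \<Rightarrow> real^'s^'d) \<Rightarrow> real^'d^'d) \<Rightarrow> real^'d^'d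
     \<Rightarrow> real^'d^'d" where
  "Gamma_of N K Om = (LINT S|N. (mat 1 - K S) ** Om ** transpose (mat 1 - K S))"

end

theory Submission
  imports Defs
begin

text \<open>
  Part (b).  The coefficient matrices of the accelerated method have row sums \<open>1\<close> and, if
  \<open>\<gamma>\<^sup>\<star> = 1\<close>, so have those multiplying \<open>Z\<^sub>j\<close>; hence they map the column \<open>(I; I)\<close> to itself times
  \<open>I - Z\<^sub>j\<close>, and the two random products agree pointwise.  Each \<open>Z\<^sub>j\<close> is an orthogonal
  projection, so by independence \<open>K = (I - Z)\<^sup>\<tau>\<close> with \<open>0 \<le> Z \<le> I\<close>.  A vector \<open>v\<close> with \<open>Z v = 0\<close>
  satisfies \<open>S\<^sup>T B\<^sup>\<star> v = 0\<close> almost surely, so \<open>B\<^sub>0\<^sup>-\<^sup>1 B\<^sup>\<star> v\<close> is in the kernel of \<open>Z\<^sub>0\<close> and \<open>v = 0\<close>.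
  Thus \<open>I - K - \<zeta> I\<close> is positive definite and the Lyapunov equation has at most one solution.

  Part (a).  With \<open>\<eta>\<^sub>t = \<nabla>F(x\<^sup>\<star>; \<xi>\<^sub>t)\<close>, an i.i.d. sequence, and \<open>e\<^sub>t = x\<^sub>t - x\<^sup>\<star>\<close>, the recursion telescopes to
  \<open>n e\<^sub>n = - \<Sum> (B\<^sup>\<star>)\<^sup>-\<^sup>1 \<eta>\<^sub>t + \<Sum> m\<^sub>t + \<Sum> r\<^sub>t\<close> with martingale differences \<open>m\<^sub>t\<close> whose second moments tend to
  \<open>0\<close>, and a drift \<open>r\<^sub>t\<close> bounded by \<open>\<bar>B\<^sub>t - B\<^sup>\<star>\<bar> \<bar>e\<^sub>t\<bar> + \<bar>e\<^sub>t\<bar>\<^sup>2\<close>.  The descent inequality gives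
  \<open>E(f(x\<^sub>t) - f(x\<^sup>\<star>)) \<rightarrow> 0\<close> only at a slow rate, but a maximal inequality shows that, with probability close to
  \<open>1\<close>, the iterates never leave a small ball after some time \<open>m\<close>.  On that event the second
  moments of \<open>e\<^sub>t\<close> and \<open>B\<^sub>t - B\<^sup>\<star>\<close> are \<open>O(t\<^sup>-\<^sup>3\<^sup>/\<^sup>4)\<close>, so the drift sum is \<open>O(n\<^sup>1\<^sup>/\<^sup>4) = o(\<surd>n)\<close>, and the
  i.i.d. central limit theorem finishes the proof.
\<close>

section \<open>Linear algebra\<close>

text \<open>The obstacle in (a): the descent inequality sees \<open>B t\<close> only through its
  spectral bounds and contracts at \<open>rate = c ^ 3 / U ^ 3\<close> over t + 1. This may be tiny,
  whereas the drift sum is o(sqrt n) only if second moments decay faster than t^(-1/2). Once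
  \<open>B t\<close> is near the limit Hessian, the squared error contracts at nearly 2 over t + 1,
  but the correction is cubic in the errors of iterate and matrix, and the noise is controlled in
  mean square only. Weighting with the indicator of staying in a small ball turns one factor of the
  cubic term into a small constant. The indicator up to time t is a function of the past, so the
  noise stays centred. The matrix error is an average over all past errors and contracts at rate 1
  only; a combination of error and average still contracts at 7/8, and 3/4 is a convenient exponent
  between 1/2 and 7/8. In (b) the pseudoinverse is discontinuous where the rank of the sketch drops,
  so even the measurability of the random projections rests on a variational formula.\<close>

lemma matrix_add_rdistrib:
  fixes A B :: "real^'n^'m"
  shows "(A + B) ** C = A ** C + B ** C"
  by (simp add: matrix_matrix_mult_def vec_eq_iff sum.distrib distrib_right)

lemma matrix_sub_ldistrib:
  fixes A :: "real^'n^'m"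
  shows "A ** (B - C) = A ** B - A ** C"
  by (simp add: matrix_matrix_mult_def vec_eq_iff sum_subtractf right_diff_distrib)

lemma matrix_sub_rdistrib:
  fixes A B :: "real^'n^'m"
  shows "(A - B) ** C = A ** C - B ** C"
  by (simp add: matrix_matrix_mult_def vec_eq_iff sum_subtractf left_diff_distrib)

lemma borel_measurable_vecI:
  fixes f :: "'a \<Rightarrow> ('b::euclidean_space)^'n"
  assumes "\<And>i. (\<lambda>x. f x $ i) \<in> borel_measurable M"
  shows "f \<in> borel_measurable M"
  by (subst borel_measurable_euclidean_space)
    (auto simp: Basis_vec_def inner_axis assms intro!: borel_measurable_inner)

lemma inner_matrix_vector_transpose:
  fixes A :: "real^'n^'m"
  shows "v \<bullet> (A *v w) = (transpose A *v v) \<bullet> w"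
  by (simp add: dot_lmul_matrix[symmetric] transpose_matrix_vector)

lemma inner_symmetric_matrix:
  fixes A :: "real^'n^'n"
  assumes "transpose A = A"
  shows "v \<bullet> (A *v w) = (A *v v) \<bullet> w"
  using inner_matrix_vector_transpose[of v A w] assms by simp

lemma norm_matrix_vector_le:
  fixes A :: "real^'n^'m"
  shows "norm (A *v v) \<le> norm A * norm v"
proof -
  have "(norm (A *v v))\<^sup>2 = (\<Sum>i\<in>UNIV. (A $ i \<bullet> v)\<^sup>2)"
    by (simp add: norm_eq_sqrt_inner inner_vec_def matrix_vector_mult_def power2_eq_square sum_nonneg)
  also have "\<dots> \<le> (\<Sum>i\<in>UNIV. (norm (A $ i))\<^sup>2 * (norm v)\<^sup>2)"
    by (intro sum_mono) (metis Cauchy_Schwarz_ineq2 abs_le_square_iff abs_mult abs_norm_cancel power_mult_distrib)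
  also have "\<dots> = (norm A * norm v)\<^sup>2"
    by (simp add: power_mult_distrib norm_vec_def L2_set_def sum_nonneg sum_distrib_right)
  finally show ?thesis by (rule power2_le_imp_le) simp
qed

lemma norm_matrix_le_sum:
  fixes A :: "real^'n^'m"
  shows "norm A \<le> (\<Sum>i\<in>UNIV. \<Sum>j\<in>UNIV. \<bar>A $ i $ j\<bar>)"
proof -
  have "norm A \<le> (\<Sum>i\<in>UNIV. norm (A $ i))" by (simp add: norm_vec_def L2_set_le_sum)
  also have "\<dots> \<le> (\<Sum>i\<in>UNIV. \<Sum>j\<in>UNIV. \<bar>A $ i $ j\<bar>)"
    by (intro sum_mono) (simp add: norm_le_l1_cart)
  finally show ?thesis .
qed

lemma matrix_entry_le_norm:
  fixes A :: "real^'n^'m"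
  shows "\<bar>A $ i $ j\<bar> \<le> norm A"
  by (meson component_le_norm_cart order_trans Finite_Cartesian_Product.norm_nth_le)

text \<open>Each entry is at most the operator norm. The dimension factor is crude but only enters
  constants; it leads from spectral bounds to the Frobenius norm in which matrices are
  integrated.\<close>

lemma norm_matrix_le_spectral_norm:
  fixes A :: "real^'n^'m"
  shows "norm A \<le> real CARD('m) * real CARD('n) * spectral_norm A"
proof -
  have "norm A \<le> (\<Sum>i\<in>(UNIV::'m set). \<Sum>j\<in>(UNIV::'n set). spectral_norm A)"
    using norm_matrix_le_sum[of A] unfolding spectral_norm_def
    by (rule order_trans) (intro sum_mono matrix_component_le_onorm)
  then show ?thesis by simp
qed

text \<open>The form at \<open>t *\<^sub>R v + w\<close> is a quadratic in \<open>t\<close> that is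
  never negative, so its discriminant is not positive. Applied to images and to null vectors, this
  does the work of the spectral theorem below.\<close>

lemma PSD_Cauchy_Schwarz:
  fixes A :: "real^'n^'n"
  assumes sym: "transpose A = A" and psd: "\<And>v. 0 \<le> v \<bullet> (A *v v)"
  shows "(v \<bullet> (A *v w))\<^sup>2 \<le> (v \<bullet> (A *v v)) * (w \<bullet> (A *v w))"
proof -
  have q: "0 \<le> (v \<bullet> (A *v v)) * t\<^sup>2 + 2 * (v \<bullet> (A *v w)) * t + w \<bullet> (A *v w)" for t
  proof -
    have "w \<bullet> (A *v v) = v \<bullet> (A *v w)" 
      using inner_symmetric_matrix[OF sym, of w v] by (simp add: inner_commute)
    then show ?thesis
      using psd[of "t *\<^sub>R v + w"]
      by (simp add: matrix_vector_right_distrib matrix_vector_mult_scaleR inner_add_left inner_add_right power2_eq_square algebra_simps)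
  qed
  show ?thesis
  proof (cases "v \<bullet> (A *v v) = 0")
    case True
    have "v \<bullet> (A *v w) = 0"
    proof (rule ccontr)
      assume n: "v \<bullet> (A *v w) \<noteq> 0"
      \<comment> \<open>With vanishing leading coefficient the form is affine in \<open>t\<close>;
        this \<open>t\<close> would give it the value -1.\<close>
      have "0 \<le> 2 * (v \<bullet> (A *v w)) * (- (w \<bullet> (A *v w) + 1) / (2 * (v \<bullet> (A *v w)))) + w \<bullet> (A *v w)"
        using q[of "- (w \<bullet> (A *v w) + 1) / (2 * (v \<bullet> (A *v w)))"] True by simp
      then show False using n by simp
    qed
    then show ?thesis using True by simp
  next
    case False
    let ?a = "v \<bullet> (A *v v)" and ?b = "v \<bullet> (A *v w)" and ?c = "w \<bullet> (A *v w)"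
    have a: "?a > 0" using False psd[of v] by simp
    \<comment> \<open>The minimizer \<open>t = - ?b / ?a\<close>, with a factor \<open>?a\<close> to
      clear the denominator.\<close>
    have "0 \<le> ?a * (?a * (- ?b / ?a)\<^sup>2 + 2 * ?b * (- ?b / ?a) + ?c)"
      by (intro mult_nonneg_nonneg q) (use a in simp)
    also have "\<dots> = ?a * ?c - ?b\<^sup>2"
      using a by (simp add: field_simps power2_eq_square)
    finally show ?thesis by simp
  qed
qed

text \<open>Cauchy-Schwarz for the form of \<open>A\<close> with \<open>A *v w\<close> as one
  argument, divided by the squared norm of \<open>A *v w\<close>. Keeping the form itself on the
  right costs only one factor \<open>U\<close>; this is what later makes \<open>W\<close> a strict
  contraction.\<close>

lemma PSD_image_norm_le:
  fixes A :: "real^'n^'n"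
  assumes sym: "transpose A = A" and psd: "\<And>v. 0 \<le> v \<bullet> (A *v v)"
    and up: "\<And>v. v \<bullet> (A *v v) \<le> U * (norm v)\<^sup>2"
  shows "(norm (A *v w))\<^sup>2 \<le> U * (w \<bullet> (A *v w))"
proof -
  let ?z = "A *v w"
  have "((norm ?z)\<^sup>2)\<^sup>2 = (?z \<bullet> (A *v w))\<^sup>2" by (simp add: power2_norm_eq_inner)
  also have "\<dots> \<le> (?z \<bullet> (A *v ?z)) * (w \<bullet> (A *v w))"
    by (rule PSD_Cauchy_Schwarz[OF sym psd])
  also have "\<dots> \<le> (U * (norm ?z)\<^sup>2) * (w \<bullet> (A *v w))"
    by (intro mult_right_mono up psd)
  finally have "(norm ?z)\<^sup>2 * (norm ?z)\<^sup>2 \<le> (norm ?z)\<^sup>2 * (U * (w \<bullet> (A *v w)))"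
    by (simp add: power2_eq_square algebra_simps)
  then show ?thesis
  proof (cases "norm ?z = 0")
    case True
    have "0 \<le> U * (w \<bullet> (A *v w))" using True by simp
    then show ?thesis using True by simp
  next
    case False
    then have "0 < (norm ?z)\<^sup>2" by simp
    then show ?thesis using \<open>(norm ?z)\<^sup>2 * (norm ?z)\<^sup>2 \<le> (norm ?z)\<^sup>2 * (U * (w \<bullet> (A *v w)))\<close>
      by (rule mult_left_le_imp_le[rotated])
  qed
qed

lemma PSD_norm_le:
  fixes A :: "real^'n^'n"
  assumes sym: "transpose A = A" and low: "\<And>v. c * (norm v)\<^sup>2 \<le> v \<bullet> (A *v v)" and "0 \<le> c"
    and up: "\<And>v. v \<bullet> (A *v v) \<le> U * (norm v)\<^sup>2" and "0 \<le> U"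
  shows "norm (A *v w) \<le> U * norm w"
proof -
  have psd: "0 \<le> v \<bullet> (A *v v)" for v
    using low[of v] \<open>0 \<le> c\<close> by (meson mult_nonneg_nonneg order_trans zero_le_power2)
  have "(norm (A *v w))\<^sup>2 \<le> U * (w \<bullet> (A *v w))" by (rule PSD_image_norm_le[OF sym psd up])
  also have "\<dots> \<le> U * (U * (norm w)\<^sup>2)" using \<open>0 \<le> U\<close> by (intro mult_left_mono up)
  also have "\<dots> = (U * norm w)\<^sup>2" by (simp add: power2_eq_square)
  finally show ?thesis by (rule power2_le_imp_le) (use \<open>0 \<le> U\<close> in simp)
qed

text \<open>The form attains its minimum \<open>l\<close> on the compact unit sphere. Then
  \<open>A - l *\<^sub>R mat 1\<close> is positive semidefinite and its form vanishes at the
  minimizer, which is therefore a null vector by Cauchy-Schwarz.\<close>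

lemma Rayleigh_minimum:
  fixes A :: "real^'n^'n"
  assumes sym: "transpose A = A"
  obtains v l where "norm v = 1" "A *v v = l *\<^sub>R v" "\<And>w. l * (norm w)\<^sup>2 \<le> w \<bullet> (A *v w)"
proof -
  have "continuous_on (sphere 0 1) (\<lambda>v. v \<bullet> (A *v v))"
    by (intro continuous_intros)
  moreover have "sphere (0::real^'n) 1 \<noteq> {}" by simp
  ultimately obtain v where v: "v \<in> sphere 0 1" and
    min: "\<And>w. w \<in> sphere 0 1 \<Longrightarrow> v \<bullet> (A *v v) \<le> w \<bullet> (A *v w)"
    using continuous_attains_inf[of "sphere (0::real^'n) 1" "\<lambda>v. v \<bullet> (A *v v)"] by auto
  define l where "l = v \<bullet> (A *v v)"
  have nv: "norm v = 1" using v by simp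
  have low: "l * (norm w)\<^sup>2 \<le> w \<bullet> (A *v w)" for w
  proof (cases "w = 0")
    case False
    have "l \<le> (w /\<^sub>R norm w) \<bullet> (A *v (w /\<^sub>R norm w))"
      unfolding l_def by (rule min) (use False in simp)
    also have "\<dots> = (w \<bullet> (A *v w)) / (norm w)\<^sup>2"
      by (simp add: matrix_vector_mult_scaleR power2_eq_square divide_inverse)
    finally show ?thesis using False by (simp add: field_simps)
  qed simp
  define M where "M = A - l *\<^sub>R mat 1"
  have Mv: "M *v w = A *v w - l *\<^sub>R w" for w
    by (simp add: M_def matrix_vector_mult_diff_rdistrib flip: scaleR_matrix_vector_assoc)
  have symM: "transpose M = M"
    using sym by (auto simp: M_def transpose_def mat_def vec_eq_iff)
  have psdM: "0 \<le> w \<bullet> (M *v w)" for w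
    using low[of w] by (simp add: Mv inner_diff_right power2_norm_eq_inner)
  have "v \<bullet> (M *v v) = 0" using nv
    by (simp add: Mv inner_diff_right l_def flip: power2_norm_eq_inner)
  then have "((M *v v) \<bullet> (M *v v))\<^sup>2 \<le> 0"
    using PSD_Cauchy_Schwarz[OF symM psdM, of "M *v v" v] by simp
  then have "M *v v = 0" by simp
  then have "A *v v = l *\<^sub>R v" by (simp add: Mv)
  then show thesis using that nv low by blast
qed

text \<open>\<open>lambda_min\<close> and \<open>lambda_max\<close> are \<open>Min\<close> and
  \<open>Max\<close> of this set and carry information only if it is finite. Eigenvectors of
  distinct eigenvalues are orthogonal, hence independent.\<close>

lemma finite_real_eigenvalues:
  fixes A :: "real^'n^'n"
  assumes sym: "transpose A = A"
  shows "finite (real_eigenvalues A)"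
proof -
  define e where "e l = (SOME v. v \<noteq> 0 \<and> A *v v = l *\<^sub>R v)" for l
  have e: "e l \<noteq> 0" "A *v e l = l *\<^sub>R e l" if "l \<in> real_eigenvalues A" for l
    using someI_ex[of "\<lambda>v. v \<noteq> 0 \<and> A *v v = l *\<^sub>R v"] that
    unfolding e_def real_eigenvalues_def by auto
  have orth: "e l \<bullet> e m = 0" if "l \<in> real_eigenvalues A" "m \<in> real_eigenvalues A" "l \<noteq> m" for l m
  proof -
    have "m * (e l \<bullet> e m) = l * (e l \<bullet> e m)"
      using inner_symmetric_matrix[OF sym, of "e l" "e m"] e that by simp
    then show ?thesis using that by simp
  qed
  have inj: "inj_on e (real_eigenvalues A)"
    by (rule inj_onI) (metis e(1) inner_eq_zero_iff orth)
  have "pairwise orthogonal (e ` real_eigenvalues A)"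
    unfolding pairwise_def orthogonal_def using orth by auto
  moreover have "0 \<notin> e ` real_eigenvalues A" using e by auto
  ultimately have "finite (e ` real_eigenvalues A)"
    using pairwise_orthogonal_independent independent_imp_finite by blast
  then show ?thesis using inj finite_imageD by blast
qed

text \<open>The minimum of the Rayleigh quotient is itself an eigenvalue, so
  \<open>lambda_min A\<close> lies below it and hence below every value of the quotient.\<close>

lemma lambda_min_le:
  fixes A :: "real^'n^'n"
  assumes sym: "transpose A = A"
  shows "lambda_min A * (norm v)\<^sup>2 \<le> v \<bullet> (A *v v)"
    and "lambda_min A \<in> real_eigenvalues A"
proof -
  obtain w l where w: "norm w = 1" "A *v w = l *\<^sub>R w" "\<And>w. l * (norm w)\<^sup>2 \<le> w \<bullet> (A *v w)"
    using Rayleigh_minimum[OF sym] by metis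
  then have "w \<noteq> 0" by force
  then have l: "l \<in> real_eigenvalues A" using w(2) unfolding real_eigenvalues_def by blast
  then have "lambda_min A \<le> l"
    unfolding lambda_min_def using finite_real_eigenvalues[OF sym] by simp
  then have "lambda_min A * (norm v)\<^sup>2 \<le> l * (norm v)\<^sup>2"
    by (simp add: mult_right_mono)
  then show "lambda_min A * (norm v)\<^sup>2 \<le> v \<bullet> (A *v v)" using w(3)[of v] by simp
  show "lambda_min A \<in> real_eigenvalues A"
    unfolding lambda_min_def using finite_real_eigenvalues[OF sym] l by (intro Min_in) auto
qed

lemma lambda_max_ge:
  fixes A :: "real^'n^'n"
  assumes sym: "transpose A = A"
  shows "v \<bullet> (A *v v) \<le> lambda_max A * (norm v)\<^sup>2"
proof -
  have "transpose (-A) = -A" using sym by (simp add: transpose_def vec_eq_iff)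
  then obtain w l where w: "norm w = 1" "(-A) *v w = l *\<^sub>R w" "\<And>w. l * (norm w)\<^sup>2 \<le> w \<bullet> ((-A) *v w)"
    using Rayleigh_minimum[of "-A"] by metis
  have mv: "(-A) *v w = - (A *v w)" for w
    by (simp add: matrix_vector_mult_def vec_eq_iff sum_negf)
  have "A *v w = (-l) *\<^sub>R w" using w(2) by (metis mv minus_minus scaleR_minus_left)
  moreover have "w \<noteq> 0" using w(1) by force
  ultimately have l: "-l \<in> real_eigenvalues A" unfolding real_eigenvalues_def by blast
  then have "-l \<le> lambda_max A"
    unfolding lambda_max_def using finite_real_eigenvalues[OF sym] by simp
  then have "-l * (norm v)\<^sup>2 \<le> lambda_max A * (norm v)\<^sup>2"
    by (intro mult_right_mono) auto
  then show ?thesis using w(3)[of v] by (simp add: mv)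
qed

section \<open>Inverses of coercive matrices\<close>

lemma invertible_if_coercive:
  fixes A :: "real^'n^'n"
  assumes "0 < c" and low: "\<And>v. c * (norm v)\<^sup>2 \<le> v \<bullet> (A *v v)"
  shows "invertible A"
proof -
  have "v = 0" if "A *v v = 0" for v
  proof -
    have "c * (norm v)\<^sup>2 \<le> 0" using low[of v] that by simp
    then show ?thesis using \<open>0 < c\<close> by (simp add: mult_le_0_iff)
  qed
  then show ?thesis
    by (metis invertible_left_inverse matrix_left_invertible_ker)
qed

lemma matrix_inv_inverse:
  fixes A :: "real^'n^'n"
  assumes "invertible A"
  shows "A ** matrix_inv A = mat 1" "matrix_inv A ** A = mat 1"
  using someI_ex[of "\<lambda>A'. A ** A' = mat 1 \<and> A' ** A = mat 1"] assms
  unfolding matrix_inv_def invertible_def by auto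

lemma matrix_inv_mult_vec:
  fixes A :: "real^'n^'n"
  assumes "invertible A"
  shows "A *v (matrix_inv A *v v) = v" "matrix_inv A *v (A *v v) = v"
  using matrix_inv_inverse[OF assms] by (simp_all add: matrix_vector_mul_assoc)

lemma norm_matrix_inv_vec_le:
  fixes A :: "real^'n^'n"
  assumes c: "0 < c" and low: "\<And>v. c * (norm v)\<^sup>2 \<le> v \<bullet> (A *v v)"
  shows "norm (matrix_inv A *v v) \<le> norm v / c"
proof -
  let ?w = "matrix_inv A *v v"
  have "c * (norm ?w)\<^sup>2 \<le> ?w \<bullet> v"
    using low[of ?w] matrix_inv_mult_vec(1)[OF invertible_if_coercive[OF c low]] by simp
  also have "\<dots> \<le> norm ?w * norm v" by (rule norm_cauchy_schwarz)
  finally have "norm ?w * (c * norm ?w) \<le> norm ?w * norm v" by (simp add: power2_eq_square algebra_simps)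
  then have "c * norm ?w \<le> norm v"
    by (cases "norm ?w = 0") auto
  then show ?thesis using c by (simp add: field_simps)
qed

text \<open>Substitute \<open>v = A *v w\<close>: the form becomes
  \<open>w \<bullet> (A *v w)\<close>, which is at least \<open>c\<close> times |w|^2, and |w| is at
  least |v| / \<open>U\<close>.\<close>

lemma matrix_inv_coercive:
  fixes A :: "real^'n^'n"
  assumes c: "0 < c" and U: "0 < U" and low: "\<And>v. c * (norm v)\<^sup>2 \<le> v \<bullet> (A *v v)"
    and up: "\<And>v. norm (A *v v) \<le> U * norm v"
  shows "c / U\<^sup>2 * (norm v)\<^sup>2 \<le> v \<bullet> (matrix_inv A *v v)"
proof -
  let ?w = "matrix_inv A *v v"
  have Aw: "A *v ?w = v" by (rule matrix_inv_mult_vec(1)[OF invertible_if_coercive[OF c low]])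
  have "(norm v)\<^sup>2 \<le> (U * norm ?w)\<^sup>2" using up[of ?w] Aw by (intro power_mono) auto
  then have "c / U\<^sup>2 * (norm v)\<^sup>2 \<le> c / U\<^sup>2 * (U * norm ?w)\<^sup>2" using c by (intro mult_left_mono) auto
  also have "\<dots> = c * (norm ?w)\<^sup>2" using U by (simp add: field_simps power2_eq_square)
  also have "\<dots> \<le> v \<bullet> ?w" using low[of ?w] Aw by (simp add: inner_commute)
  finally show ?thesis .
qed

lemma transpose_matrix_inv:
  fixes A :: "real^'n^'n"
  assumes "invertible A" "transpose A = A"
  shows "transpose (matrix_inv A) = matrix_inv A"
  by (metis assms matrix_inv_inverse matrix_mul_assoc matrix_mul_lid matrix_mul_rid matrix_transpose_mul transpose_mat)

text \<open>Cholesky by induction on a set \<open>T\<close> of indices outside which the rows of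
  \<open>V\<close> vanish. Keeping the columns of \<open>A\<close> outside \<open>T\<close> zero
  reserves column \<open>p\<close> for the next pivot. The result ensures that the
  \<open>SOME\<close> in \<open>multivariate_normal\<close> picks a genuine factor.\<close>

lemma PSD_factorization_aux:
  fixes V :: "real^'n^'n"
  assumes "finite T"
  shows "transpose V = V \<Longrightarrow> (\<And>v. 0 \<le> v \<bullet> (V *v v)) \<Longrightarrow> (\<And>i j. i \<notin> T \<Longrightarrow> V $ i $ j = 0)
    \<Longrightarrow> \<exists>A :: real^'n^'n. A ** transpose A = V \<and> (\<forall>i k. k \<notin> T \<longrightarrow> A $ i $ k = 0)"
  using assms
proof (induction T arbitrary: V)
  case empty
  then have "V = 0" by (simp add: vec_eq_iff)
  then show ?case by (intro exI[of _ 0]) (simp add: vec_eq_iff)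
next
  case (insert p T)
  note sym = insert.prems(1) and psd = insert.prems(2)
  have symE: "V $ i $ j = V $ j $ i" for i j
    using sym by (metis transpose_def vec_lambda_beta)
  have ent: "axis i 1 \<bullet> (V *v axis j 1) = V $ i $ j" for i j
    by (simp add: matrix_vector_mult_basis inner_axis' column_def)
  have Vax: "axis i 1 \<bullet> (V *v w) = (V *v w) $ i" for i w
    by (simp add: inner_axis')
  show ?case
  proof (cases "V $ p $ p = 0")
    case True
    \<comment> \<open>A zero pivot forces its whole row to vanish, so \<open>T\<close> alone already
      carries \<open>V\<close>.\<close>
    have "V $ p $ j = 0" for j
    proof -
      have "(V $ p $ j)\<^sup>2 \<le> 0"
        using PSD_Cauchy_Schwarz[OF sym psd, of "axis p 1" "axis j 1"] True by (simp add: ent)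
      then show ?thesis by simp
    qed
    then have "\<exists>A :: real^'n^'n. A ** transpose A = V \<and> (\<forall>i k. k \<notin> T \<longrightarrow> A $ i $ k = 0)"
      using insert.prems insert.IH[of V] by (metis insertE)
    then show ?thesis by auto
  next
    case False
    define c where "c = V $ p $ p"
    have c: "c > 0" using False psd[of "axis p 1"] by (simp add: ent c_def)
    \<comment> \<open>The Schur complement of the pivot \<open>c\<close>. Its form at
      \<open>v\<close> is the minimum of the form of \<open>V\<close> over the line through
      \<open>v\<close> in the direction of axis \<open>p\<close>, hence nonnegative.\<close>
    define W :: "real^'n^'n" where "W = (\<chi> i j. V $ i $ j - V $ i $ p * V $ j $ p / c)"
    have symW: "transpose W = W" using symE by (simp add: W_def transpose_def vec_eq_iff mult.commute)
    have psdW: "0 \<le> v \<bullet> (W *v v)" for v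
    proof -
      have "v \<bullet> (W *v v) = v \<bullet> (V *v v) - (v \<bullet> (V *v axis p 1))\<^sup>2 / c"
        by (simp add: W_def inner_vec_def matrix_vector_mult_def sum_subtractf sum_distrib_left sum_distrib_right
            power2_eq_square sum_product sum_divide_distrib algebra_simps axis_def if_distrib sum.delta cong: if_cong)
      moreover have "(v \<bullet> (V *v axis p 1))\<^sup>2 \<le> (v \<bullet> (V *v v)) * c"
        using PSD_Cauchy_Schwarz[OF sym psd, of v "axis p 1"] by (simp add: ent c_def)
      ultimately show ?thesis using c by (simp add: pos_divide_le_eq)
    qed
    have "W $ i $ j = 0" if "i \<notin> T" for i j
    proof (cases "i = p")
      case True then show ?thesis using c symE[of j p] by (simp add: W_def c_def)
    next
      case False then show ?thesis using insert.prems(3) that by (simp add: W_def)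
    qed
    then obtain A :: "real^'n^'n" where A: "A ** transpose A = W" "\<And>i k. k \<notin> T \<Longrightarrow> A $ i $ k = 0"
      using insert.IH[OF symW psdW] by blast
    \<comment> \<open>Column \<open>p\<close> adds back the rank-one part that the Schur complement
      removed.\<close>
    define A' :: "real^'n^'n" where "A' = (\<chi> i k. if k = p then V $ i $ p / sqrt c else A $ i $ k)"
    have "(A' ** transpose A') $ i $ j = V $ i $ j" for i j
    proof -
      have "(A' ** transpose A') $ i $ j = (\<Sum>k\<in>UNIV. A' $ i $ k * A' $ j $ k)"
        by (simp add: matrix_matrix_mult_def transpose_def)
      also have "\<dots> = (\<Sum>k\<in>UNIV. A $ i $ k * A $ j $ k + (if k = p then V $ i $ p * V $ j $ p / c else 0))"
        using A(2) insert.hyps c by (intro sum.cong) (auto simp: A'_def)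
      also have "\<dots> = W $ i $ j + V $ i $ p * V $ j $ p / c"
        by (simp add: sum.distrib flip: A(1)) (simp add: matrix_matrix_mult_def transpose_def)
      finally show ?thesis by (simp add: W_def)
    qed
    moreover have "A' $ i $ k = 0" if "k \<notin> insert p T" for i k
      using that A(2) by (simp add: A'_def)
    ultimately show ?thesis by (intro exI[of _ A']) (simp add: vec_eq_iff)
  qed
qed

lemma PSD_factorization:
  fixes V :: "real^'n^'n"
  assumes "transpose V = V" "\<And>v. 0 \<le> v \<bullet> (V *v v)"
  obtains A :: "real^'n^'n" where "A ** transpose A = V"
  using PSD_factorization_aux[of UNIV V] assms by auto

section \<open>Pseudoinverses and sketched projections\<close>

lemma bounded_linear_matrix_vec_left: "bounded_linear (\<lambda>A::real^'n^'m. A *v v)"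
  unfolding linear_conv_bounded_linear[symmetric]
  by (rule linearI) (simp_all add: matrix_vector_mult_add_rdistrib scaleR_matrix_vector_assoc)

text \<open>\<open>A ** X\<close> and \<open>A ** Y\<close> are both the orthogonal projection onto
  the range of \<open>A\<close>, hence equal, and likewise \<open>X ** A\<close> and
  \<open>Y ** A\<close>; then \<open>X = X ** A ** X = Y ** A ** Y = Y\<close>. This justifies the
  \<open>THE\<close> in \<open>pinv\<close>.\<close>

lemma is_pinv_unique:
  fixes A :: "real^'n^'m"
  assumes X: "A ** X ** A = A" "X ** A ** X = X" "transpose (A ** X) = A ** X" "transpose (X ** A) = X ** A"
    and Y: "A ** Y ** A = A" "Y ** A ** Y = Y" "transpose (A ** Y) = A ** Y" "transpose (Y ** A) = Y ** A"
  shows "X = Y"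
proof -
  have "A ** X = transpose ((A ** Y) ** (A ** X))" by (simp add: X Y matrix_mul_assoc)
  also have "\<dots> = (A ** X) ** (A ** Y)"
    by (simp only: matrix_transpose_mul[of "A ** Y"] X(3) Y(3))
  also have "\<dots> = A ** Y" by (simp add: X matrix_mul_assoc)
  finally have 1: "A ** X = A ** Y" .
  have "X ** A = transpose (X ** (A ** Y ** A))" by (simp add: X Y)
  also have "\<dots> = transpose ((X ** A) ** (Y ** A))" by (simp only: matrix_mul_assoc)
  also have "\<dots> = (Y ** A) ** (X ** A)"
    by (simp only: matrix_transpose_mul[of "X ** A"] X(4) Y(4))
  also have "\<dots> = Y ** (A ** X ** A)" by (simp only: matrix_mul_assoc)
  also have "\<dots> = Y ** A" by (simp only: X(1))
  finally have 2: "X ** A = Y ** A" .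
  show ?thesis by (metis 1 2 X(2) Y(2) matrix_mul_assoc)
qed

lemma orthogonal_projection_matrix:
  fixes K :: "(real^'n) set"
  assumes "subspace K"
  obtains Q :: "real^'n^'n" where "transpose Q = Q" "\<And>v. Q *v v \<in> K" "\<And>v. v \<in> K \<Longrightarrow> Q *v v = v"
proof -
  obtain B where B: "B \<subseteq> K" "pairwise orthogonal B" "\<And>x. x \<in> B \<Longrightarrow> norm x = 1"
    "independent B" "span B = K"
    using orthonormal_basis_subspace[OF assms] by metis
  have fin: "finite B" using B(4) independent_imp_finite by blast
  define Q :: "real^'n^'n" where "Q = (\<Sum>b\<in>B. outer b b)"
  have Qv: "Q *v v = (\<Sum>b\<in>B. (b \<bullet> v) *\<^sub>R b)" for v
  proof -
    have "Q *v v = (\<Sum>b\<in>B. outer b b *v v)"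
      unfolding Q_def using fin by (induction B) (auto simp: matrix_vector_mult_add_rdistrib)
    also have "\<dots> = (\<Sum>b\<in>B. (b \<bullet> v) *\<^sub>R b)"
      by (intro sum.cong refl)
        (simp add: outer_def matrix_vector_mult_def inner_vec_def vec_eq_iff sum_distrib_left mult_ac)
    finally show ?thesis .
  qed
  have outer_sym: "transpose (outer b b) = outer b b" for b :: "real^'n"
    by (simp add: outer_def transpose_def vec_eq_iff mult.commute)
  show thesis
  proof (rule that)
    have tr_add: "transpose (X + Y) = transpose X + transpose Y" for X Y :: "real^'n^'n"
      by (simp add: transpose_def vec_eq_iff)
    show "transpose Q = Q"
      unfolding Q_def using fin by (induction B) (auto simp: tr_add outer_sym, simp add: transpose_def vec_eq_iff)
    show "Q *v v \<in> K" for v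
      unfolding Qv using B(1) assms by (intro subspace_sum subspace_scale) auto
    show "Q *v v = v" if "v \<in> K" for v
    proof -
      have "v \<in> span B" using that B by simp
      then show ?thesis
      proof (induction rule: span_induct_alt)
        case base then show ?case by simp
      next
        case (step c x y)
        have "Q *v x = (\<Sum>b\<in>B. if b = x then x else 0)"
          unfolding Qv using step B(2,3) 
          by (intro sum.cong refl) (auto simp: pairwise_def orthogonal_def norm_eq_1)
        then have "Q *v x = x" using fin step by simp
        then show ?case using step by (simp add: matrix_vector_right_distrib matrix_vector_mult_scaleR)
      qed
    qed
  qed
qed

text \<open>With \<open>Q\<close> the orthogonal projection onto the kernel of \<open>G\<close>, the
  matrix \<open>G + Q\<close> is invertible, and its inverse minus \<open>Q\<close> satisfies the
  four Penrose equations. This constructs the pseudoinverse without diagonalizing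
  \<open>G\<close>.\<close>

lemma symmetric_pinv:
  fixes G :: "real^'n^'n"
  assumes sym: "transpose G = G"
  shows "G ** pinv G ** G = G" "pinv G ** G ** pinv G = pinv G" "transpose (pinv G) = pinv G"
proof -
  define K where "K = {v. G *v v = 0}"
  have "subspace K"
    by (auto simp: K_def subspace_def matrix_vector_right_distrib matrix_vector_mult_scaleR)
  then obtain Q :: "real^'n^'n" where Q: "transpose Q = Q" "\<And>v. Q *v v \<in> K" "\<And>v. v \<in> K \<Longrightarrow> Q *v v = v"
    using orthogonal_projection_matrix by metis
  have GQ: "G ** Q = 0"
    using Q(2) by (simp add: matrix_eq K_def flip: matrix_vector_mul_assoc)
  have QG: "Q ** G = 0"
    using arg_cong[OF GQ, of transpose] Q(1) sym
    by (simp add: matrix_transpose_mul) (simp add: transpose_def vec_eq_iff)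
  have QQ: "Q ** Q = Q"
    using Q by (simp add: matrix_eq flip: matrix_vector_mul_assoc)
  have "v = 0" if "(G + Q) *v v = 0" for v
  proof -
    have "Q *v ((G + Q) *v v) = 0" using that by simp
    then have "Q *v v = 0"
      by (simp add: matrix_vector_mul_assoc matrix_add_ldistrib QG QQ)
    then have "G *v v = 0" using that by (simp add: matrix_vector_mult_add_rdistrib)
    then show "v = 0" using Q(3)[of v] \<open>Q *v v = 0\<close> by (simp add: K_def)
  qed
  then have inv: "invertible (G + Q)"
    by (metis invertible_left_inverse matrix_left_invertible_ker)
  define J where "J = matrix_inv (G + Q)"
  have J: "(G + Q) ** J = mat 1" "J ** (G + Q) = mat 1"
    using matrix_inv_inverse[OF inv] by (auto simp: J_def)
  have "(G + Q) ** Q = Q" by (simp add: matrix_add_rdistrib GQ QQ)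
  then have JQ: "J ** Q = Q" by (metis J(2) matrix_mul_assoc matrix_mul_lid)
  have "Q ** (G + Q) = Q" by (simp add: matrix_add_ldistrib QG QQ)
  then have QJ: "Q ** J = Q" by (metis J(1) matrix_mul_assoc matrix_mul_rid)
  have GJ: "G ** J = mat 1 - Q" using J(1) by (simp add: matrix_add_rdistrib QJ algebra_simps eq_diff_eq)
  have JG: "J ** G = mat 1 - Q" using J(2) by (simp add: matrix_add_ldistrib JQ algebra_simps eq_diff_eq)
  define X where "X = J - Q"
  have GX: "G ** X = mat 1 - Q" by (simp add: X_def GJ GQ matrix_sub_ldistrib)
  have XG: "X ** G = mat 1 - Q" by (simp add: X_def JG QG matrix_sub_rdistrib)
  have symI: "transpose (mat 1 - Q) = mat 1 - Q"
    using Q(1) by (auto simp: transpose_def mat_def vec_eq_iff)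
  have P: "G ** X ** G = G" "X ** G ** X = X" "transpose (G ** X) = G ** X" "transpose (X ** G) = X ** G"
  proof -
    show "G ** X ** G = G" by (simp add: GX matrix_sub_rdistrib QG)
    have "Q ** X = 0" by (simp add: X_def matrix_sub_ldistrib QJ QQ)
    then show "X ** G ** X = X" by (simp add: XG matrix_sub_rdistrib)
  qed (simp_all add: GX XG symI)
  have pinv_eq: "pinv G = X"
    unfolding pinv_def
  proof (rule the_equality)
    show "G ** X ** G = G \<and> X ** G ** X = X \<and> transpose (G ** X) = G ** X \<and> transpose (X ** G) = X ** G"
      by (intro conjI P)
    show "Y = X" if "G ** Y ** G = G \<and> Y ** G ** Y = Y \<and> transpose (G ** Y) = G ** Y \<and> transpose (Y ** G) = Y ** G"
      for Y
      using that by (elim conjE) (rule is_pinv_unique[OF _ _ _ _ P], assumption+)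
  qed
  show "G ** pinv G ** G = G" "pinv G ** G ** pinv G = pinv G" using P pinv_eq by auto
  \<comment> \<open>The Penrose equations of a symmetric \<open>G\<close> are invariant under
    transposition, so uniqueness applies.\<close>
  have "transpose X = X"
  proof (rule is_pinv_unique[of G])
    show "G ** transpose X ** G = G" using arg_cong[OF P(1), of transpose]
      by (simp add: sym matrix_mul_assoc matrix_transpose_mul)
    show "transpose X ** G ** transpose X = transpose X" using arg_cong[OF P(2), of transpose]
      by (simp add: sym matrix_mul_assoc matrix_transpose_mul)
    show "transpose (G ** transpose X) = G ** transpose X" using P(4)
      by (simp add: sym matrix_transpose_mul)
    show "transpose (transpose X ** G) = transpose X ** G" using P(3)
      by (simp add: sym matrix_transpose_mul)
  qed (use P in auto)
  then show "transpose (pinv G) = pinv G" using pinv_eq by simp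
qed

text \<open>\<open>Ztilde B S\<close> is the orthogonal projection onto the range of \<open>B ** S\<close>.\<close>

lemma Ztilde_props:
  fixes B :: "real^'d^'d" and S :: "real^'s^'d"
  assumes sym: "transpose B = B"
  shows "transpose (Ztilde B S) = Ztilde B S"
    and "Ztilde B S ** Ztilde B S = Ztilde B S"
    and "Ztilde B S ** (B ** S) = B ** S"
    and "Ztilde B S *v v = (B ** S) *v ((pinv (transpose S ** (B ** B) ** S) ** transpose S ** B) *v v)"
proof -
  define A where "A = B ** S"
  define G where "G = transpose S ** (B ** B) ** S"
  have At: "transpose A = transpose S ** B" by (simp add: A_def matrix_transpose_mul sym)
  have G: "G = transpose A ** A" unfolding At by (simp add: G_def A_def matrix_mul_assoc)
  have symG: "transpose G = G" by (simp add: G matrix_transpose_mul)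
  note X = symmetric_pinv[OF symG]
  have Z: "Ztilde B S = A ** pinv G ** transpose A"
    unfolding Ztilde_def sketch_mat_def At G_def[symmetric] by (simp add: A_def matrix_mul_assoc)
  show "transpose (Ztilde B S) = Ztilde B S"
    by (simp add: Z matrix_transpose_mul X matrix_mul_assoc)
  have GXG: "G ** (pinv G ** G - mat 1) = 0"
    by (simp add: matrix_sub_ldistrib matrix_mul_assoc X)
  \<comment> \<open>Since \<open>G = transpose A ** A\<close>, a null vector of \<open>G\<close> is
    one of \<open>A\<close>; thus \<open>G ** pinv G ** G = G\<close> improves to
    \<open>A ** pinv G ** G = A\<close>.\<close>
  have "A *v ((pinv G ** G - mat 1) *v v) = 0" for v
  proof -
    let ?w = "(pinv G ** G - mat 1) *v v"
    have "(A *v ?w) \<bullet> (A *v ?w) = ?w \<bullet> (G *v ?w)"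
      by (simp add: G inner_matrix_vector_transpose inner_commute flip: matrix_vector_mul_assoc)
    also have "G *v ?w = 0" by (simp add: GXG matrix_vector_mul_assoc)
    finally show ?thesis by simp
  qed
  then have "A ** (pinv G ** G - mat 1) = 0" by (simp add: matrix_eq flip: matrix_vector_mul_assoc)
  then have AXG: "A ** pinv G ** G = A" by (simp add: matrix_sub_ldistrib matrix_mul_assoc)
  then show ZA: "Ztilde B S ** (B ** S) = B ** S"
    unfolding A_def[symmetric] Z by (simp add: G flip: matrix_mul_assoc)
  show "Ztilde B S ** Ztilde B S = Ztilde B S"
    by (subst (2) Z) (simp add: matrix_mul_assoc ZA[folded A_def], simp add: Z)
  show "Ztilde B S *v v = (B ** S) *v ((pinv (transpose S ** (B ** B) ** S) ** transpose S ** B) *v v)"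
    by (simp add: Z flip: A_def G_def) (simp add: At matrix_mul_assoc matrix_vector_mul_assoc)
qed

lemma Ztilde_inner:
  fixes B :: "real^'d^'d" and S :: "real^'s^'d"
  assumes sym: "transpose B = B"
  shows "v \<bullet> (Ztilde B S *v v) = (norm (Ztilde B S *v v))\<^sup>2"
    and "norm (Ztilde B S *v v) \<le> norm v"
proof -
  have "(norm (Ztilde B S *v v))\<^sup>2 = (Ztilde B S *v v) \<bullet> (Ztilde B S *v v)" by (simp add: power2_norm_eq_inner)
  also have "\<dots> = v \<bullet> (Ztilde B S *v (Ztilde B S *v v))"
    by (simp add: inner_symmetric_matrix[OF Ztilde_props(1)[OF sym]])
  also have "\<dots> = v \<bullet> (Ztilde B S *v v)" by (simp add: matrix_vector_mul_assoc Ztilde_props(2)[OF sym])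
  finally show 1: "v \<bullet> (Ztilde B S *v v) = (norm (Ztilde B S *v v))\<^sup>2" by simp
  have "(norm (Ztilde B S *v v))\<^sup>2 \<le> norm v * norm (Ztilde B S *v v)"
    unfolding 1[symmetric] by (rule norm_cauchy_schwarz)
  then show "norm (Ztilde B S *v v) \<le> norm v"
    by (cases "norm (Ztilde B S *v v) = 0") (auto simp: power2_eq_square)
qed

text \<open>The range of the projection is that of \<open>B ** S\<close>, so its kernel is that of
  \<open>transpose S ** B\<close>. In this form a null vector belonging to one matrix
  \<open>B\<close> can be carried over to another.\<close>

lemma Ztilde_vec_eq_0_iff:
  fixes B :: "real^'d^'d" and S :: "real^'s^'d"
  assumes sym: "transpose B = B"
  shows "Ztilde B S *v v = 0 \<longleftrightarrow> transpose S *v (B *v v) = 0"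
proof
  assume "Ztilde B S *v v = 0"
  moreover have "transpose S ** B = transpose S ** B ** Ztilde B S"
    using arg_cong[OF Ztilde_props(3)[OF sym, of S], of transpose]
    by (simp add: matrix_transpose_mul sym Ztilde_props(1)[OF sym])
  ultimately show "transpose S *v (B *v v) = 0"
    by (metis matrix_vector_mul_assoc matrix_vector_mult_0_right)
next
  assume "transpose S *v (B *v v) = 0"
  then show "Ztilde B S *v v = 0"
    unfolding Ztilde_def sketch_mat_def by (simp flip: matrix_vector_mul_assoc)
qed

text \<open>The form of an orthogonal projection at \<open>v\<close> is |v|^2 minus the squared
  distance of \<open>v\<close> to the range, a supremum over \<open>w\<close>. Each member of it is
  continuous in \<open>S\<close>, although the pseudoinverse is not, and continuity in
  \<open>w\<close> lets a countable dense \<open>W\<close> suffice.\<close>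

lemma Ztilde_quadratic_gt_iff:
  fixes B :: "real^'d^'d" and S :: "real^'s^'d"
  assumes sym: "transpose B = B"
    and dense: "\<And>X. open X \<Longrightarrow> X \<noteq> {} \<Longrightarrow> \<exists>w\<in>W. w \<in> X"
  shows "c < v \<bullet> (Ztilde B S *v v) \<longleftrightarrow> (\<exists>w\<in>W. c < (norm v)\<^sup>2 - (norm (v - (B ** S) *v w))\<^sup>2)"
proof -
  let ?A = "B ** S" and ?P = "Ztilde B S"
  have bound: "(norm v)\<^sup>2 - (norm (v - ?A *v w))\<^sup>2 \<le> v \<bullet> (?P *v v)" for w
  proof -
    have "?A *v w = ?P *v (?A *v w)"
      by (simp add: matrix_vector_mul_assoc Ztilde_props(3)[OF sym])
    then have 1: "v \<bullet> (?A *v w) = (?P *v v) \<bullet> (?A *v w)"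
      using inner_symmetric_matrix[OF Ztilde_props(1)[OF sym], of v S "?A *v w"] by simp
    have "0 \<le> (norm (?P *v v - ?A *v w))\<^sup>2" by simp
    also have "\<dots> = v \<bullet> (?P *v v) - 2 * (v \<bullet> (?A *v w)) + (norm (?A *v w))\<^sup>2"
      unfolding 1 Ztilde_inner(1)[OF sym]
      by (simp add: power2_norm_eq_inner inner_diff_left inner_diff_right inner_commute[of "?A *v w" "?P *v v"])
    finally show ?thesis
      by (simp add: power2_norm_eq_inner[of "v - ?A *v w"] power2_norm_eq_inner[of v]
          power2_norm_eq_inner[of "?A *v w"] inner_diff_left inner_diff_right inner_commute[of "?A *v w" v])
  qed
  obtain w0 where w0: "?P *v v = ?A *v w0" using Ztilde_props(4)[OF sym] by blast
  have att: "(norm v)\<^sup>2 - (norm (v - ?A *v w0))\<^sup>2 = v \<bullet> (?P *v v)"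
  proof -
    have "(norm (v - ?P *v v))\<^sup>2 = (norm v)\<^sup>2 - 2 * (v \<bullet> (?P *v v)) + (norm (?P *v v))\<^sup>2"
      by (simp add: power2_norm_eq_inner inner_diff_left inner_diff_right inner_commute[of "?P *v v" v])
    then show ?thesis using Ztilde_inner(1)[OF sym, of v S] w0 by simp
  qed
  show ?thesis
  proof
    assume c: "c < v \<bullet> (?P *v v)"
    have "open {w. c < (norm v)\<^sup>2 - (norm (v - ?A *v w))\<^sup>2}"
      by (intro open_Collect_less continuous_intros)
    moreover have "w0 \<in> {w. c < (norm v)\<^sup>2 - (norm (v - ?A *v w))\<^sup>2}" using c att by simp
    ultimately show "\<exists>w\<in>W. c < (norm v)\<^sup>2 - (norm (v - ?A *v w))\<^sup>2" using dense by blast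
  qed (use bound order_less_le_trans in blast)
qed

lemma Ztilde_measurable:
  fixes B :: "real^'d^'d"
  assumes sym: "transpose B = B"
  shows "(Ztilde B :: real^'s^'d \<Rightarrow> _) \<in> borel_measurable borel"
proof -
  obtain W :: "(real^'s) set" where W: "countable W" "\<And>X. open X \<Longrightarrow> X \<noteq> {} \<Longrightarrow> \<exists>w\<in>W. w \<in> X"
    by (rule countable_dense_setE) blast
  have quad: "(\<lambda>S::real^'s^'d. v \<bullet> (Ztilde B S *v v)) \<in> borel_measurable borel" for v
  proof (rule borel_measurableI_greater)
    fix c
    have eq: "c < v \<bullet> (Ztilde B S *v v) \<longleftrightarrow> (\<exists>w\<in>W. c < (norm v)\<^sup>2 - (norm (v - (B ** S) *v w))\<^sup>2)"
      for S :: "real^'s^'d"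
      by (rule Ztilde_quadratic_gt_iff[OF sym W(2)])
    have "open {S::real^'s^'d. c < (norm v)\<^sup>2 - (norm (v - (B ** S) *v w))\<^sup>2}" for w
    proof -
      have "bounded_linear (\<lambda>S::real^'s^'d. B *v (S *v w))"
        by (rule bounded_linear_compose[OF matrix_vector_mul_bounded_linear bounded_linear_matrix_vec_left])
      then have "continuous_on UNIV (\<lambda>S::real^'s^'d. (B ** S) *v w)"
        by (simp add: linear_continuous_on flip: matrix_vector_mul_assoc)
      then show ?thesis by (intro open_Collect_less continuous_intros)
    qed
    then have "{S::real^'s^'d. \<exists>w\<in>W. c < (norm v)\<^sup>2 - (norm (v - (B ** S) *v w))\<^sup>2} \<in> sets borel"
      by (intro borel_open) (simp add: Collect_bex_eq open_UN)
    then show "{S::real^'s^'d \<in> space borel. c < v \<bullet> (Ztilde B S *v v)} \<in> sets borel"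
      by (simp only: eq space_borel UNIV_I simp_thms)
  qed
  have "(\<lambda>S::real^'s^'d. Ztilde B S $ i $ j) \<in> borel_measurable borel" for i j
  proof -
    have "(\<lambda>S::real^'s^'d. Ztilde B S $ i $ j) = (\<lambda>S. ((axis i 1 + axis j 1) \<bullet> (Ztilde B S *v (axis i 1 + axis j 1))
      - axis i 1 \<bullet> (Ztilde B S *v axis i 1) - axis j 1 \<bullet> (Ztilde B S *v axis j 1)) / 2)"
    proof
      fix S :: "real^'s^'d"
      have "axis k 1 \<bullet> (Ztilde B S *v axis l 1) = Ztilde B S $ k $ l" for k l
        by (simp add: matrix_vector_mult_basis inner_axis' column_def)
      moreover have "Ztilde B S $ j $ i = Ztilde B S $ i $ j"
        using arg_cong[OF Ztilde_props(1)[OF sym, of S], of "\<lambda>A. A $ i $ j"] by (simp add: transpose_def)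
      ultimately show "Ztilde B S $ i $ j = ((axis i 1 + axis j 1) \<bullet> (Ztilde B S *v (axis i 1 + axis j 1))
        - axis i 1 \<bullet> (Ztilde B S *v axis i 1) - axis j 1 \<bullet> (Ztilde B S *v axis j 1)) / 2"
        by (simp add: matrix_vector_right_distrib inner_add_left inner_add_right)
    qed
    then show ?thesis
      by (rule ssubst) (intro borel_measurable_divide borel_measurable_diff quad borel_measurable_const)
  qed
  then show ?thesis by (intro borel_measurable_vecI)
qed

section \<open>The iteration matrices when \<gamma> = 1\<close>

lemma rev_prod_cong: "(\<And>i. i < n \<Longrightarrow> A i = A' i) \<Longrightarrow> rev_prod A n = rev_prod A' n"
  by (induction n) auto

lemma Ctilde_col_II:
  fixes Z :: "real^'d^'d"
  shows "Ctilde \<alpha> \<beta> 1 Z ** col_II = col_II ** (mat 1 - Z)"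
proof -
  have "(Ctilde \<alpha> \<beta> 1 Z ** col_II) $ (a, i) $ j = (col_II ** (mat 1 - Z)) $ (a, i) $ j" for a i j
  proof -
    have sum2: "(\<Sum>q\<in>UNIV. h q) = (\<Sum>k\<in>UNIV. h (1, k)) + (\<Sum>k\<in>UNIV. h (2, k))" for h :: "2 \<times> 'd \<Rightarrow> real"
    proof -
      have "(\<Sum>q\<in>UNIV. h q) = (\<Sum>(b, k)\<in>UNIV \<times> UNIV. h (b, k))" by simp
      also have "\<dots> = (\<Sum>b\<in>UNIV. \<Sum>k\<in>UNIV. h (b, k))" by (rule sum.cartesian_product[symmetric])
      finally show ?thesis by (simp add: sum_2)
    qed
    have a: "a = 1 \<or> a = 2" using exhaust_2 by auto
    have sc: "(\<Sum>k\<in>UNIV. (\<Sum>l\<in>UNIV. 0::real)) = 0" by simp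
    have "(Ctilde \<alpha> \<beta> 1 Z ** col_II) $ (a, i) $ j =
        Ctilde \<alpha> \<beta> 1 Z $ (a, i) $ (1, j) + Ctilde \<alpha> \<beta> 1 Z $ (a, i) $ (2, j)"
      unfolding matrix_matrix_mult_def by (simp add: sum2 col_II_def if_distrib cong: if_cong)
    also have "\<dots> = mat 1 $ i $ j - Z $ i $ j"
      using a by (auto simp: Ctilde_def kron_def mat2_def algebra_simps)
    also have "\<dots> = (col_II ** (mat 1 - Z)) $ (a, i) $ j"
      unfolding matrix_matrix_mult_def by (simp add: col_II_def if_distrib if_distribR cong: if_cong)
    finally show ?thesis .
  qed
  then show ?thesis by (simp add: vec_eq_iff split_paired_all)
qed

lemma plain_prod_eq: "plain_prod B n S = rev_prod (\<lambda>j. mat 1 - Ztilde B (S j)) n"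
  by (simp add: plain_prod_def Ztilde_def sketch_mat_def)

lemma Ktilde_gamma_1:
  fixes B :: "real^'d^'d"
  shows "Ktilde \<alpha> \<beta> 1 B n S = plain_prod B n S"
proof -
  have "rev_prod (\<lambda>j. Ctilde \<alpha> \<beta> 1 (Ztilde B (S j))) n ** col_II = col_II ** plain_prod B n S"
    unfolding plain_prod_eq
  proof (induction n)
    case (Suc n)
    have "rev_prod (\<lambda>j. Ctilde \<alpha> \<beta> 1 (Ztilde B (S j))) (Suc n) ** col_II
        = Ctilde \<alpha> \<beta> 1 (Ztilde B (S n)) ** (rev_prod (\<lambda>j. Ctilde \<alpha> \<beta> 1 (Ztilde B (S j))) n ** col_II)"
      by (simp only: rev_prod.simps matrix_mul_assoc)
    also have "\<dots> = (Ctilde \<alpha> \<beta> 1 (Ztilde B (S n)) ** col_II) ** rev_prod (\<lambda>j. mat 1 - Ztilde B (S j)) n"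
      by (simp only: Suc matrix_mul_assoc)
    also have "\<dots> = col_II ** rev_prod (\<lambda>j. mat 1 - Ztilde B (S j)) (Suc n)"
      by (simp only: Ctilde_col_II rev_prod.simps matrix_mul_assoc)
    finally show ?case .
  qed simp
  moreover have "row_I0 ** col_II = (mat 1 :: real^'d^'d)"
  proof -
    have "(row_I0 ** col_II) $ i $ j = (mat 1 :: real^'d^'d) $ i $ j" for i j :: 'd
    proof -
      have "(row_I0 ** col_II) $ i $ j = (\<Sum>q\<in>UNIV. if q = (1::2, i) then mat 1 $ i $ j else 0)"
        unfolding matrix_matrix_mult_def vec_lambda_beta
        by (intro sum.cong refl) (auto simp: row_I0_def col_II_def mat_def)
      then show ?thesis by simp
    qed
    then show ?thesis by (simp add: vec_eq_iff)
  qed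
  ultimately have "row_I0 ** (rev_prod (\<lambda>j. Ctilde \<alpha> \<beta> 1 (Ztilde B (S j))) n ** col_II) = plain_prod B n S"
    by (simp only: matrix_mul_assoc matrix_mul_lid)
  then show ?thesis by (simp only: Ktilde_def matrix_mul_assoc)
qed

text \<open>The bound does not depend on the sketch, so it makes the expectations over sketches
  exist.\<close>

lemma norm_matrix_le_of_contraction:
  fixes A :: "real^'n^'n"
  assumes "\<And>v. norm (A *v v) \<le> norm v"
  shows "norm A \<le> (real CARD('n))\<^sup>2"
proof -
  have "spectral_norm A \<le> 1" unfolding spectral_norm_def by (rule onorm_bound) (use assms in auto)
  then have "real CARD('n) * real CARD('n) * spectral_norm A \<le> real CARD('n) * real CARD('n) * 1"
    by (intro mult_left_mono) auto
  then show ?thesis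
    unfolding power2_eq_square using norm_matrix_le_spectral_norm[of A] by linarith
qed

lemma borel_measurable_vec_nth [measurable (raw)]:
  fixes f :: "'a \<Rightarrow> ('b::euclidean_space)^'n"
  assumes "f \<in> borel_measurable M"
  shows "(\<lambda>x. f x $ i) \<in> borel_measurable M"
  by (rule borel_measurable_continuous_on[OF _ assms]) (intro continuous_intros)

lemma borel_measurable_matrix_mult:
  fixes A :: "'a \<Rightarrow> real^'n^'m" and B :: "'a \<Rightarrow> real^'k^'n"
  assumes [measurable]: "A \<in> borel_measurable M" "B \<in> borel_measurable M"
  shows "(\<lambda>x. A x ** B x) \<in> borel_measurable M"
proof (intro borel_measurable_vecI)
  fix i j
  have "(\<lambda>x. \<Sum>k\<in>UNIV. A x $ i $ k * B x $ k $ j) \<in> borel_measurable M"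
    using assms by (intro borel_measurable_sum borel_measurable_times borel_measurable_vec_nth)
  then show "(\<lambda>x. (A x ** B x) $ i $ j) \<in> borel_measurable M"
    by (simp add: matrix_matrix_mult_def)
qed

lemma bounded_linear_matrix_mult_left: "bounded_linear (\<lambda>A::real^'n^'m. A ** (B::real^'k^'n))"
  unfolding linear_conv_bounded_linear[symmetric]
  by (rule linearI) (simp_all add: matrix_add_rdistrib scalar_matrix_assoc)

lemma bounded_linear_matrix_mult_right: "bounded_linear (\<lambda>B::real^'k^'n. (A::real^'n^'m) ** B)"
  unfolding linear_conv_bounded_linear[symmetric]
  by (rule linearI) (simp_all add: matrix_add_ldistrib matrix_scalar_ac scalar_matrix_assoc)

lemma Ztilde_compl_contraction:
  fixes B :: "real^'d^'d" and S :: "real^'s^'d"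
  assumes sym: "transpose B = B"
  shows "norm ((mat 1 - Ztilde B S) *v v) \<le> norm v"
proof -
  have "(norm ((mat 1 - Ztilde B S) *v v))\<^sup>2 = (norm v)\<^sup>2 - (norm (Ztilde B S *v v))\<^sup>2"
    using Ztilde_inner(1)[OF sym, of v S]
    by (simp add: matrix_vector_mult_diff_rdistrib power2_norm_eq_inner inner_diff_left inner_diff_right inner_commute)
  also have "\<dots> \<le> (norm v)\<^sup>2" by simp
  finally show ?thesis by (rule power2_le_imp_le) simp
qed

lemma plain_prod_contraction:
  fixes B :: "real^'d^'d" and S :: "nat \<Rightarrow> real^'s^'d"
  assumes sym: "transpose B = B"
  shows "norm (plain_prod B n S *v v) \<le> norm v"
  unfolding plain_prod_eq
proof (induction n)
  case (Suc n)
  then show ?case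
    using Ztilde_compl_contraction[OF sym] order_trans by (simp flip: matrix_vector_mul_assoc) blast
qed simp

section \<open>Averages over independent sketches\<close>

locale sketch_law = prob_space D for D :: "(real^'s^'d) measure" +
  fixes B :: "real^'d^'d"
  assumes sets_D: "sets D = sets borel" and sym: "transpose B = B"
begin

lemma Ztilde_measurable_D [measurable]: "Ztilde B \<in> borel_measurable D"
  using Ztilde_measurable[OF sym] sets_D by (simp cong: measurable_cong_sets)

lemma integrable_Ztilde: "integrable D (Ztilde B)"
  by (rule integrable_const_bound[where B="(real CARD('d))\<^sup>2"])
    (auto intro!: norm_matrix_le_of_contraction Ztilde_inner(2) sym)

abbreviation "W \<equiv> mat 1 - Z_star D B"

lemma W_eq: "W = (LINT S|D. mat 1 - Ztilde B S)"
  using integrable_Ztilde by (simp add: Z_star_def Bochner_Integration.integral_diff prob_space)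

lemma integrable_W: "integrable D (\<lambda>S. mat 1 - Ztilde B S)"
  using integrable_Ztilde by simp

lemma plain_prod_measurable:
  assumes "{..<n} \<subseteq> J"
  shows "plain_prod B n \<in> borel_measurable (Pi\<^sub>M J (\<lambda>_. D))"
  using assms unfolding plain_prod_eq
proof (induction n)
  case (Suc n)
  have [measurable]: "(\<lambda>S. S n) \<in> measurable (Pi\<^sub>M J (\<lambda>_. D)) D"
    using Suc.prems by (intro measurable_component_singleton) auto
  have "{..<n} \<subseteq> J" using Suc.prems by auto
  then show ?case using Suc.IH by (auto intro!: borel_measurable_matrix_mult)
qed simp

lemma integrable_plain_prod: "integrable (sketches D n) (plain_prod B n)"
proof -
  interpret N: prob_space "sketches D n" unfolding sketches_def by (intro prob_space_PiM prob_space_axioms)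
  show ?thesis
    by (rule N.integrable_const_bound[where B="(real CARD('d))\<^sup>2"])
      (auto intro!: norm_matrix_le_of_contraction plain_prod_contraction sym plain_prod_measurable simp: sketches_def)
qed

text \<open>Fubini on the last coordinate: \<open>rev_prod\<close> puts the newest factor on the
  left, so integrating that factor first multiplies the earlier product by the constant matrix
  \<open>W\<close>.\<close>

lemma mean_plain_prod: "mean_of (sketches D n) (plain_prod B n) = rev_prod (\<lambda>_. W) n"
proof (induction n)
  case 0
  interpret N: prob_space "sketches D 0" unfolding sketches_def by (intro prob_space_PiM prob_space_axioms)
  show ?case by (simp add: mean_of_def plain_prod_eq N.prob_space)
next
  case (Suc n)
  interpret P: product_sigma_finite "\<lambda>_::nat. D" by unfold_locales
  have "mean_of (sketches D (Suc n)) (plain_prod B (Suc n))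
      = (LINT S|Pi\<^sub>M (insert n {..<n}) (\<lambda>_. D). plain_prod B (Suc n) S)"
    by (simp add: mean_of_def sketches_def lessThan_Suc)
  also have "\<dots> = (LINT S|sketches D n. LINT s|D. plain_prod B (Suc n) (S(n := s)))"
    using integrable_plain_prod[of "Suc n"] unfolding sketches_def
    by (intro P.product_integral_insert) (simp_all add: lessThan_Suc)
  also have "\<dots> = (LINT S|sketches D n. LINT s|D. (mat 1 - Ztilde B s) ** plain_prod B n S)"
    unfolding plain_prod_eq by (intro Bochner_Integration.integral_cong refl) (simp cong: rev_prod_cong)
  also have "\<dots> = (LINT S|sketches D n. W ** plain_prod B n S)"
    unfolding W_eq
    by (intro Bochner_Integration.integral_cong refl integral_bounded_linear[OF bounded_linear_matrix_mult_left integrable_W])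
  also have "\<dots> = W ** mean_of (sketches D n) (plain_prod B n)"
    unfolding mean_of_def
    by (intro integral_bounded_linear[OF bounded_linear_matrix_mult_right integrable_plain_prod])
  finally show ?case by (simp add: Suc)
qed

lemma Z_star_inner: "v \<bullet> (Z_star D B *v v) = (LINT S|D. (norm (Ztilde B S *v v))\<^sup>2)"
    "integrable D (\<lambda>S. (norm (Ztilde B S *v v))\<^sup>2)"
proof -
  have bl: "bounded_linear (\<lambda>A::real^'d^'d. v \<bullet> (A *v v))"
    by (rule bounded_linear_compose[OF bounded_linear_inner_right bounded_linear_matrix_vec_left])
  show "v \<bullet> (Z_star D B *v v) = (LINT S|D. (norm (Ztilde B S *v v))\<^sup>2)"
    unfolding Z_star_def using integral_bounded_linear[OF bl integrable_Ztilde]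
    by (simp add: Ztilde_inner(1)[OF sym])
  show "integrable D (\<lambda>S. (norm (Ztilde B S *v v))\<^sup>2)"
    using integrable_bounded_linear[OF bl integrable_Ztilde]
    by (simp add: Ztilde_inner(1)[OF sym])
qed

lemma transpose_Z_star: "transpose (Z_star D B) = Z_star D B"
proof -
  have bl: "bounded_linear (\<lambda>A::real^'d^'d. transpose A)"
    unfolding linear_conv_bounded_linear[symmetric]
    by (rule linearI) (simp_all add: transpose_def vec_eq_iff)
  have "transpose (Z_star D B) = (LINT S|D. transpose (Ztilde B S))"
    unfolding Z_star_def by (rule integral_bounded_linear[OF bl integrable_Ztilde, symmetric])
  then show ?thesis by (simp add: Ztilde_props(1)[OF sym] Z_star_def)
qed

lemma transpose_W: "transpose W = W"
proof -
  have "transpose W = mat 1 - transpose (Z_star D B)" by (auto simp: transpose_def mat_def vec_eq_iff)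
  then show ?thesis by (simp add: transpose_Z_star)
qed

text \<open>\<open>W\<close> lies between 0 and the identity, so |W w|^2 is at most the form of
  \<open>W\<close> at \<open>w\<close>, which is below |w|^2 because the mean projection is
  positive. One strict and \<open>n - 1\<close> weak contractions keep the image of \<open>v\<close>
  strictly shorter than \<open>v\<close>.\<close>

lemma W_power_coercive:
  assumes pos: "\<And>v. v \<noteq> 0 \<Longrightarrow> v \<bullet> (Z_star D B *v v) \<noteq> 0" and "n \<ge> 1" "v \<noteq> 0"
  shows "v \<bullet> (rev_prod (\<lambda>_. W) n *v v) < v \<bullet> v"
proof -
  have W: "w \<bullet> (W *v w) = (norm w)\<^sup>2 - w \<bullet> (Z_star D B *v w)" for w
    by (simp add: matrix_vector_mult_diff_rdistrib inner_diff_right power2_norm_eq_inner)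
  have Z0: "0 \<le> w \<bullet> (Z_star D B *v w)" for w
    unfolding Z_star_inner by (rule Bochner_Integration.integral_nonneg) simp
  have psd: "0 \<le> w \<bullet> (W *v w)" for w
  proof -
    have "(LINT S|D. (norm (Ztilde B S *v w))\<^sup>2) \<le> (LINT S|D. (norm w)\<^sup>2)"
      by (intro integral_mono Z_star_inner(2)) (auto intro!: power_mono Ztilde_inner(2) sym)
    then show ?thesis unfolding W Z_star_inner(1) by (simp add: prob_space)
  qed
  have lt: "norm (W *v w) < norm w" if "w \<noteq> 0" for w
  proof -
    have "(norm (W *v w))\<^sup>2 \<le> 1 * (w \<bullet> (W *v w))"
      by (rule PSD_image_norm_le[OF transpose_W psd]) (simp add: W Z0)
    also have "\<dots> < (norm w)\<^sup>2" using pos[OF that] Z0[of w] by (simp add: W)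
    finally show ?thesis by (rule power2_less_imp_less) simp
  qed
  then have le: "norm (W *v w) \<le> norm w" for w by (cases "w = 0") (auto simp: less_imp_le)
  have "norm (rev_prod (\<lambda>_. W) n *v v) < norm v"
    using \<open>n \<ge> 1\<close>
  proof (induction n rule: nat_induct_at_least)
    case base then show ?case using lt[OF \<open>v \<noteq> 0\<close>] by simp
  next
    case (Suc n)
    then show ?case using le[of "rev_prod (\<lambda>_. W) n *v v"] by (simp flip: matrix_vector_mul_assoc)
  qed
  then have "norm v * norm (rev_prod (\<lambda>_. W) n *v v) < norm v * norm v"
    using \<open>v \<noteq> 0\<close> by simp
  then show ?thesis
    using norm_cauchy_schwarz[of v "rev_prod (\<lambda>_. W) n *v v"]
    by (simp add: power2_norm_eq_inner flip: power2_eq_square)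
qed

lemma transpose_W_power: "transpose (rev_prod (\<lambda>_. W) n) = rev_prod (\<lambda>_. W) n"
proof -
  have comm: "rev_prod (\<lambda>_. W) n ** W = W ** rev_prod (\<lambda>_. W) n" for n
  proof (induction n)
    case (Suc n)
    have "rev_prod (\<lambda>_. W) (Suc n) ** W = W ** (rev_prod (\<lambda>_. W) n ** W)"
      by (simp only: rev_prod.simps matrix_mul_assoc)
    then show ?case by (simp only: Suc rev_prod.simps)
  qed simp
  show ?thesis
    by (induction n) (simp_all add: matrix_transpose_mul transpose_W comm)
qed

end

text \<open>Pair the homogeneous equation for \<open>E = X - Y\<close> with \<open>E\<close> in the
  Frobenius inner product. The two terms are sums of values of the form of \<open>A\<close>, over
  the columns and over the rows of \<open>E\<close>, so every one of these values vanishes.\<close>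

lemma lyapunov_unique:
  fixes A X Y :: "real^'n^'n"
  assumes pos: "\<And>v. v \<noteq> 0 \<Longrightarrow> 0 < v \<bullet> (A *v v)"
    and eq: "A ** X + X ** A = A ** Y + Y ** A"
  shows "X = Y"
proof -
  define E where "E = X - Y"
  have nn: "0 \<le> v \<bullet> (A *v v)" for v using pos[of v] by (cases "v = 0") auto
  have E0: "A ** E + E ** A = 0"
    using eq by (simp add: E_def matrix_sub_ldistrib matrix_sub_rdistrib algebra_simps)
  have 1: "E \<bullet> (A ** E) = (\<Sum>j\<in>UNIV. column j E \<bullet> (A *v column j E))"
    unfolding inner_vec_def matrix_matrix_mult_def matrix_vector_mult_def column_def
    by (simp, rule sum.swap)
  have 2: "E \<bullet> (E ** A) = (\<Sum>i\<in>UNIV. E $ i \<bullet> (A *v E $ i))"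
  proof -
    have "E $ i \<bullet> (E ** A) $ i = E $ i \<bullet> (A *v E $ i)" for i
      unfolding inner_vec_def matrix_matrix_mult_def matrix_vector_mult_def
      by (simp add: sum_distrib_left, subst sum.swap) (simp add: mult_ac)
    then show ?thesis by (simp add: inner_vec_def[of E])
  qed
  have "E \<bullet> (A ** E) + E \<bullet> (E ** A) = 0"
    using E0 by (metis inner_add_right inner_zero_right)
  moreover have "0 \<le> E \<bullet> (A ** E)" unfolding 1 by (intro sum_nonneg nn)
  moreover have "0 \<le> E \<bullet> (E ** A)" unfolding 2 by (intro sum_nonneg nn)
  ultimately have "(\<Sum>i\<in>UNIV. E $ i \<bullet> (A *v E $ i)) = 0" unfolding 2[symmetric] by linarith
  then have "E $ i \<bullet> (A *v E $ i) = 0" for i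
    using nn by (simp add: sum_nonneg_eq_0_iff)
  then have "E $ i = 0" for i using pos[of "E $ i"] by force
  then have "E = 0" by (simp add: vec_eq_iff)
  then show ?thesis by (simp add: E_def)
qed

section \<open>Gradients and Hessians\<close>

text \<open>\<open>gradient\<close> is a \<open>THE\<close>: the vector of partial derivatives
  represents the derivative, and two representing vectors agree when tested on their
  difference.\<close>

lemma has_derivative_gradient:
  fixes f :: "real^'d \<Rightarrow> real"
  assumes "f differentiable (at x)"
  shows "(f has_derivative (\<lambda>h. h \<bullet> gradient f x)) (at x)"
proof -
  obtain f' where f': "(f has_derivative f') (at x)" using assms unfolding differentiable_def by blast
  have lin: "linear f'" using f' has_derivative_linear by blast
  define D where "D = (\<chi> i. f' (axis i 1))"
  have "f' h = h \<bullet> D" for h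
  proof -
    have "f' h = f' (\<Sum>i\<in>UNIV. (h $ i) *\<^sub>R axis i 1)"
      using basis_expansion[of h] by (simp add: scalar_mult_eq_scaleR)
    also have "\<dots> = (\<Sum>i\<in>UNIV. h $ i * f' (axis i 1))"
      by (simp add: linear_sum[OF lin] linear_scale[OF lin])
    finally show ?thesis by (simp add: D_def inner_vec_def)
  qed
  then have D: "(f has_derivative (\<lambda>h. h \<bullet> D)) (at x)" using f' ext[of f' "\<lambda>h. h \<bullet> D"] by simp
  have "GDERIV f x :> gradient f x"
    unfolding gradient_def
  proof (rule theI)
    show "GDERIV f x :> D" using D by (simp add: gderiv_def)
    fix E assume "GDERIV f x :> E"
    then have "(\<lambda>h. h \<bullet> E) = (\<lambda>h. h \<bullet> D)"
      using D has_derivative_unique unfolding gderiv_def by blast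
    then have "(E - D) \<bullet> E = (E - D) \<bullet> D" by metis
    then have "(E - D) \<bullet> (E - D) = 0" by (simp add: inner_diff_right)
    then show "E = D" by simp
  qed
  then show ?thesis by (simp add: gderiv_def)
qed

lemma has_derivative_hessian:
  fixes f :: "real^'d \<Rightarrow> real"
  assumes "gradient f differentiable (at x)"
  shows "(gradient f has_derivative (\<lambda>h. hessian f x *v h)) (at x)"
proof -
  have d: "(gradient f has_derivative frechet_derivative (gradient f) (at x)) (at x)"
    using assms frechet_derivative_works by blast
  then have "linear (frechet_derivative (gradient f) (at x))" by (rule has_derivative_linear)
  then have "(*v) (hessian f x) = frechet_derivative (gradient f) (at x)"
    unfolding hessian_def by (simp add: matrix_works fun_eq_iff)
  then show ?thesis using d by simp
qed

text \<open>The derivative as a limit along a sequence: in this form measurability passes to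
  gradients and Hessians, and dominated convergence applies.\<close>

lemma directional_difference_quotient:
  fixes f :: "'a::real_normed_vector \<Rightarrow> 'b::real_normed_vector"
  assumes "(f has_derivative f') (at x)"
  shows "(\<lambda>n. real (Suc n) *\<^sub>R (f (x + (1 / real (Suc n)) *\<^sub>R e) - f x)) \<longlonglongrightarrow> f' e"
proof -
  interpret bounded_linear f' using assms by (rule has_derivative_bounded_linear)
  have "((\<lambda>t. f (x + t *\<^sub>R e)) has_derivative (\<lambda>t. f' (t *\<^sub>R e))) (at 0)"
    by (rule has_derivative_compose[where f="\<lambda>t. x + t *\<^sub>R e" and g=f, simplified])
      (auto intro!: derivative_eq_intros assms)
  then have "((\<lambda>t. f (x + t *\<^sub>R e)) has_vector_derivative f' e) (at 0)"
    by (simp add: has_vector_derivative_def scaleR)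
  then have lim: "((\<lambda>h. norm (f (x + h *\<^sub>R e) - f x - h *\<^sub>R f' e) / norm h) \<longlongrightarrow> 0) (at 0)"
    by (simp add: has_vector_derivative_def has_derivative_at)
  have eq: "norm (f (x + h *\<^sub>R e) - f x - h *\<^sub>R f' e) / norm h = norm ((f (x + h *\<^sub>R e) - f x) /\<^sub>R h - f' e)"
    if "h \<noteq> 0" for h
  proof -
    have "(f (x + h *\<^sub>R e) - f x) /\<^sub>R h - f' e = (f (x + h *\<^sub>R e) - f x - h *\<^sub>R f' e) /\<^sub>R h"
      using that by (simp add: scaleR_diff_right)
    then show ?thesis by (simp add: divide_inverse mult.commute)
  qed
  have "((\<lambda>h. norm ((f (x + h *\<^sub>R e) - f x) /\<^sub>R h - f' e)) \<longlongrightarrow> 0) (at 0)"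
    by (rule Lim_cong_within[THEN iffD1, OF refl refl refl _ lim]) (use eq in auto)
  then have "((\<lambda>h. (f (x + h *\<^sub>R e) - f x) /\<^sub>R h - f' e) \<longlongrightarrow> 0) (at 0)"
    by (rule tendsto_norm_zero_cancel)
  then have "((\<lambda>h. (f (x + h *\<^sub>R e) - f x) /\<^sub>R h) \<longlongrightarrow> f' e) (at 0)"
    by (simp add: LIM_zero_iff)
  moreover have "filterlim (\<lambda>n. 1 / real (Suc n)) (at 0) sequentially"
    unfolding filterlim_at using LIMSEQ_inverse_real_of_nat by (simp add: inverse_eq_divide)
  ultimately have "(\<lambda>n. (f (x + (1 / real (Suc n)) *\<^sub>R e) - f x) /\<^sub>R (1 / real (Suc n))) \<longlonglongrightarrow> f' e"
    by (rule filterlim_compose)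
  then show ?thesis by (simp add: inverse_eq_divide)
qed

section \<open>Mean value inequalities and symmetry of the Hessian\<close>

lemma segment_mvt:
  fixes f :: "'a::real_normed_vector \<Rightarrow> real"
  assumes "\<And>x. (f has_derivative f' x) (at x)"
  obtains s where "0 < s" "s < 1" "f u - f w = f' (w + s *\<^sub>R (u - w)) (u - w)"
proof -
  let ?h = "\<lambda>s. f (w + s *\<^sub>R (u - w))"
  have der: "(?h has_real_derivative f' (w + s *\<^sub>R (u - w)) (u - w)) (at s)" for s
  proof -
    interpret bounded_linear "f' (w + s *\<^sub>R (u - w))" using assms by (rule has_derivative_bounded_linear)
    have "(?h has_derivative (\<lambda>t. f' (w + s *\<^sub>R (u - w)) (t *\<^sub>R (u - w)))) (at s)"
      by (rule has_derivative_compose[where f="\<lambda>s. w + s *\<^sub>R (u - w)" and g=f])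
        (auto intro!: derivative_eq_intros assms)
    then show ?thesis
      by (simp add: has_field_derivative_def scaleR mult_commute_abs)
  qed
  obtain s where "0 < s" "s < 1" "?h 1 - ?h 0 = (1 - 0) * f' (w + s *\<^sub>R (u - w)) (u - w)"
    using MVT2[of 0 1 ?h "\<lambda>s. f' (w + s *\<^sub>R (u - w)) (u - w)"] der by auto
  then show thesis using that by simp
qed

text \<open>The mean value theorem fails for vector-valued maps but holds after pairing with a fixed
  \<open>z\<close>, on which the intermediate point depends. The applications take for
  \<open>z\<close> either the vector to be estimated or the increment.\<close>

lemma vector_mvt:
  fixes g :: "real^'d \<Rightarrow> real^'d"
  assumes "\<And>x. (g has_derivative (\<lambda>h. H x *v h)) (at x)"
  obtains s where "0 < s" "s < 1" "(g u - g w) \<bullet> z = (H (w + s *\<^sub>R (u - w)) *v (u - w)) \<bullet> z"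
proof -
  have "((\<lambda>x. g x \<bullet> z) has_derivative (\<lambda>h. (H x *v h) \<bullet> z)) (at x)" for x
    by (rule has_derivative_inner_left) (rule assms)
  then show thesis using segment_mvt[of "\<lambda>x. g x \<bullet> z" "\<lambda>x h. (H x *v h) \<bullet> z" u w] that
    by (metis inner_diff_left)
qed

lemma lipschitz_of_derivative_bound:
  fixes g :: "real^'d \<Rightarrow> real^'d"
  assumes der: "\<And>x. (g has_derivative (\<lambda>h. H x *v h)) (at x)" and bd: "\<And>x v. norm (H x *v v) \<le> U * norm v"
  shows "norm (g u - g w) \<le> U * norm (u - w)"
proof -
  let ?z = "g u - g w"
  obtain s where s: "?z \<bullet> ?z = (H (w + s *\<^sub>R (u - w)) *v (u - w)) \<bullet> ?z"
    using vector_mvt[OF der] by metis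
  also have "\<dots> \<le> norm (H (w + s *\<^sub>R (u - w)) *v (u - w)) * norm ?z" by (rule norm_cauchy_schwarz)
  also have "\<dots> \<le> (U * norm (u - w)) * norm ?z" by (intro mult_right_mono bd) simp
  finally have "norm ?z * norm ?z \<le> (U * norm (u - w)) * norm ?z" by (simp add: power2_norm_eq_inner flip: power2_eq_square)
  then show ?thesis
    by (cases "norm ?z = 0") (auto intro: order_trans[OF _ bd[of 0 "u - w"]])
qed

lemma monotone_of_derivative_bound:
  fixes g :: "real^'d \<Rightarrow> real^'d"
  assumes der: "\<And>x. (g has_derivative (\<lambda>h. H x *v h)) (at x)" and bd: "\<And>x v. c * (norm v)\<^sup>2 \<le> v \<bullet> (H x *v v)"
  shows "c * (norm (u - w))\<^sup>2 \<le> (g u - g w) \<bullet> (u - w)"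
proof -
  obtain s where s: "(g u - g w) \<bullet> (u - w) = (H (w + s *\<^sub>R (u - w)) *v (u - w)) \<bullet> (u - w)"
    using vector_mvt[OF der] by metis
  then show ?thesis using bd[of "u - w" "w + s *\<^sub>R (u - w)"] by (simp add: inner_commute)
qed

text \<open>One mean value step in direction \<open>u\<close> leaves a difference of two values of
  \<open>g\<close>, and each is expanded at \<open>x\<close>. The remainders at
  \<open>s *\<^sub>R u + t *\<^sub>R v\<close> and at \<open>s *\<^sub>R u\<close> contribute |u| +
  |v| and |u|.\<close>

lemma second_difference_bound:
  fixes f :: "real^'d \<Rightarrow> real"
  assumes der: "\<And>y. (f has_derivative (\<lambda>h. h \<bullet> g y)) (at y)"
    and R: "\<And>w. norm w < \<delta> \<Longrightarrow> norm (g (x + w) - g x - A *v w) \<le> \<epsilon> * norm w"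
    and t: "0 < t" "t * (norm u + norm v) < \<delta>" and "0 \<le> \<epsilon>"
  shows "\<bar>(f (x + t *\<^sub>R u + t *\<^sub>R v) - f (x + t *\<^sub>R u) - f (x + t *\<^sub>R v) + f x) - t\<^sup>2 * (u \<bullet> (A *v v))\<bar>
    \<le> t\<^sup>2 * \<epsilon> * (norm u * (2 * norm u + norm v))"
proof -
  let ?h = "\<lambda>s. f (x + s *\<^sub>R u + t *\<^sub>R v) - f (x + s *\<^sub>R u)"
  let ?h' = "\<lambda>s. u \<bullet> (g (x + s *\<^sub>R u + t *\<^sub>R v) - g (x + s *\<^sub>R u))"
  have "(?h has_real_derivative ?h' s) (at s)" for s
  proof -
    have 1: "((\<lambda>s. f (x + s *\<^sub>R u + t *\<^sub>R v)) has_derivative (\<lambda>r. (r *\<^sub>R u) \<bullet> g (x + s *\<^sub>R u + t *\<^sub>R v))) (at s)"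
      by (rule has_derivative_compose[where f="\<lambda>s. x + s *\<^sub>R u + t *\<^sub>R v" and g=f])
        (auto intro!: derivative_eq_intros der)
    have 2: "((\<lambda>s. f (x + s *\<^sub>R u)) has_derivative (\<lambda>r. (r *\<^sub>R u) \<bullet> g (x + s *\<^sub>R u))) (at s)"
      by (rule has_derivative_compose[where f="\<lambda>s. x + s *\<^sub>R u" and g=f])
        (auto intro!: derivative_eq_intros der)
    show ?thesis
      using has_derivative_diff[OF 1 2]
      by (simp add: has_field_derivative_def mult_commute_abs inner_diff_right flip: right_diff_distrib)
  qed
  then obtain s where s: "0 < s" "s < t" "?h t - ?h 0 = (t - 0) * ?h' s"
    using MVT2[of 0 t ?h ?h'] t by auto
  define r where "r w = g (x + w) - g x - A *v w" for w
  have n1: "norm (s *\<^sub>R u + t *\<^sub>R v) \<le> t * (norm u + norm v)"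
    using s t by (intro order_trans[OF norm_triangle_ineq]) (simp add: distrib_left mult_right_mono)
  have n2: "norm (s *\<^sub>R u) \<le> t * norm u" using s t by (simp add: mult_right_mono)
  have "t * norm u \<le> t * (norm u + norm v)" using t by (intro mult_left_mono) auto
  then have small: "norm (s *\<^sub>R u + t *\<^sub>R v) < \<delta>" "norm (s *\<^sub>R u) < \<delta>" using n1 n2 t by linarith+
  have "norm (r (s *\<^sub>R u + t *\<^sub>R v)) \<le> \<epsilon> * (t * (norm u + norm v))"
    using R[OF small(1)] mult_left_mono[OF n1 \<open>0 \<le> \<epsilon>\<close>] by (simp add: r_def)
  moreover have "norm (r (s *\<^sub>R u)) \<le> \<epsilon> * (t * norm u)"
    using R[OF small(2)] mult_left_mono[OF n2 \<open>0 \<le> \<epsilon>\<close>] by (simp add: r_def)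
  ultimately have rr: "norm (r (s *\<^sub>R u + t *\<^sub>R v) - r (s *\<^sub>R u)) \<le> t * \<epsilon> * (2 * norm u + norm v)"
    using norm_triangle_ineq4[of "r (s *\<^sub>R u + t *\<^sub>R v)" "r (s *\<^sub>R u)"] by (simp add: algebra_simps)
  have h's: "?h' s = t * (u \<bullet> (A *v v)) + u \<bullet> (r (s *\<^sub>R u + t *\<^sub>R v) - r (s *\<^sub>R u))"
    by (simp add: r_def matrix_vector_right_distrib matrix_vector_mult_scaleR inner_diff_right inner_add_right algebra_simps)
  have "?h t - ?h 0 = (t - 0) * (t * (u \<bullet> (A *v v)) + u \<bullet> (r (s *\<^sub>R u + t *\<^sub>R v) - r (s *\<^sub>R u)))"
    using s(3) unfolding h's .
  then have "(f (x + t *\<^sub>R u + t *\<^sub>R v) - f (x + t *\<^sub>R u) - f (x + t *\<^sub>R v) + f x) - t\<^sup>2 * (u \<bullet> (A *v v))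
      = t * (u \<bullet> (r (s *\<^sub>R u + t *\<^sub>R v) - r (s *\<^sub>R u)))"
    by (simp add: distrib_left power2_eq_square)
  then have "\<bar>(f (x + t *\<^sub>R u + t *\<^sub>R v) - f (x + t *\<^sub>R u) - f (x + t *\<^sub>R v) + f x) - t\<^sup>2 * (u \<bullet> (A *v v))\<bar>
      = t * \<bar>u \<bullet> (r (s *\<^sub>R u + t *\<^sub>R v) - r (s *\<^sub>R u))\<bar>"
    using t by (simp add: abs_mult)
  also have "\<dots> \<le> t * (norm u * (t * \<epsilon> * (2 * norm u + norm v)))"
    using t by (intro mult_left_mono order_trans[OF Cauchy_Schwarz_ineq2] rr) auto
  finally show ?thesis by (simp add: power2_eq_square algebra_simps)
qed

text \<open>The second difference does not change when \<open>u\<close> and \<open>v\<close> are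
  exchanged, yet it approximates t^2 times either bilinear value up to a multiple of t^2
  \<epsilon>.\<close>

lemma second_derivative_symmetric:
  fixes f :: "real^'d \<Rightarrow> real"
  assumes der: "\<And>y. (f has_derivative (\<lambda>h. h \<bullet> g y)) (at y)"
    and der2: "(g has_derivative (\<lambda>h. A *v h)) (at x)"
  shows "transpose A = A"
proof -
  have "u \<bullet> (A *v v) = v \<bullet> (A *v u)" for u v
  proof -
    define C where "C = norm u * (2 * norm u + norm v) + norm v * (2 * norm v + norm u)"
    have C0: "0 \<le> C" by (simp add: C_def)
    have bound: "\<bar>u \<bullet> (A *v v) - v \<bullet> (A *v u)\<bar> \<le> \<epsilon> * C" if "0 < \<epsilon>" for \<epsilon>
    proof -
      obtain \<delta> where \<delta>: "0 < \<delta>" "\<And>y. norm (y - x) < \<delta> \<Longrightarrow> norm (g y - g x - A *v (y - x)) \<le> \<epsilon> * norm (y - x)"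
        using der2 \<open>0 < \<epsilon>\<close> unfolding has_derivative_at_alt by blast
      have R: "norm (g (x + w) - g x - A *v w) \<le> \<epsilon> * norm w" if "norm w < \<delta>" for w
        using \<delta>(2)[of "x + w"] that by simp
      \<comment> \<open>Half of the admissible radius; the 1 in the denominator covers
        \<open>u = v = 0\<close>.\<close>
      define t where "t = \<delta> / (2 * (norm u + norm v + 1))"
      have n: "0 < norm u + norm v + 1" by (simp add: add_nonneg_pos)
      have t: "0 < t" using \<delta> n by (simp add: t_def)
      have "t * (norm u + norm v) \<le> t * (norm u + norm v + 1)" using t by simp
      also have "\<dots> = \<delta> / 2" using n by (simp add: t_def field_simps)
      finally have t2: "t * (norm u + norm v) < \<delta>" using \<delta> by simp
      let ?\<phi> = "f (x + t *\<^sub>R u + t *\<^sub>R v) - f (x + t *\<^sub>R u) - f (x + t *\<^sub>R v) + f x"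
      have 1: "\<bar>?\<phi> - t\<^sup>2 * (u \<bullet> (A *v v))\<bar> \<le> t\<^sup>2 * \<epsilon> * (norm u * (2 * norm u + norm v))"
        using second_difference_bound[OF der R t t2] \<open>0 < \<epsilon>\<close> by simp
      have 2: "\<bar>?\<phi> - t\<^sup>2 * (v \<bullet> (A *v u))\<bar> \<le> t\<^sup>2 * \<epsilon> * (norm v * (2 * norm v + norm u))"
        using second_difference_bound[OF der R t, where u=v and v=u] t2 \<open>0 < \<epsilon>\<close> by (simp add: algebra_simps)
      have "t\<^sup>2 * \<bar>u \<bullet> (A *v v) - v \<bullet> (A *v u)\<bar> = \<bar>t\<^sup>2 * (u \<bullet> (A *v v)) - t\<^sup>2 * (v \<bullet> (A *v u))\<bar>"
        by (simp add: abs_mult flip: right_diff_distrib)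
      also have "\<dots> \<le> t\<^sup>2 * \<epsilon> * (norm u * (2 * norm u + norm v)) + t\<^sup>2 * \<epsilon> * (norm v * (2 * norm v + norm u))"
        using 1 2 by linarith
      also have "\<dots> = t\<^sup>2 * (\<epsilon> * C)" by (simp add: C_def algebra_simps)
      finally show ?thesis using t by simp
    qed
    have "\<bar>u \<bullet> (A *v v) - v \<bullet> (A *v u)\<bar> \<le> 0"
    proof (rule field_le_epsilon)
      fix e :: real assume "0 < e"
      have "\<bar>u \<bullet> (A *v v) - v \<bullet> (A *v u)\<bar> \<le> (e / (C + 1)) * C" using bound[of "e / (C + 1)"] \<open>0 < e\<close> C0 by simp
      also have "\<dots> \<le> e" using \<open>0 < e\<close> C0 by (simp add: field_simps)
      finally show "\<bar>u \<bullet> (A *v v) - v \<bullet> (A *v u)\<bar> \<le> 0 + e" by simp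
    qed
    then show ?thesis by simp
  qed
  then have "axis i 1 \<bullet> (A *v axis j 1) = axis j 1 \<bullet> (A *v axis i 1)" for i j by blast
  then show ?thesis
    by (simp add: matrix_vector_mult_basis inner_axis' column_def transpose_def vec_eq_iff)
qed

section \<open>Smooth and strongly convex functions\<close>

lemma
  assumes "twice_continuously_differentiable f"
  shows tcd_has_derivative: "(f has_derivative (\<lambda>h. h \<bullet> gradient f x)) (at x)"
    and tcd_gradient_has_derivative: "(gradient f has_derivative (\<lambda>h. hessian f x *v h)) (at x)"
    and transpose_hessian: "transpose (hessian f x) = hessian f x"
proof -
  show 1: "(f has_derivative (\<lambda>h. h \<bullet> gradient f x)) (at x)" for x
    using assms has_derivative_gradient unfolding twice_continuously_differentiable_def by blast
  show 2: "(gradient f has_derivative (\<lambda>h. hessian f x *v h)) (at x)"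
    using assms has_derivative_hessian unfolding twice_continuously_differentiable_def by blast
  show "transpose (hessian f x) = hessian f x"
    by (rule second_derivative_symmetric[OF 1 2])
qed

lemma gradient_at_arg_min:
  assumes "twice_continuously_differentiable f" "is_arg_min f (\<lambda>_. True) x"
  shows "gradient f x = 0"
proof -
  have "(\<lambda>h. h \<bullet> gradient f x) = (\<lambda>h. 0)"
    by (rule has_derivative_local_min[OF tcd_has_derivative[OF assms(1)]])
      (use assms(2) in \<open>auto simp: is_arg_min_def not_less\<close>)
  then show ?thesis by (metis inner_eq_zero_iff)
qed

text \<open>A mean value argument in place of integration; it costs a factor 2 against the sharp
  constant \<open>U / 2\<close>, which affects only constants later.\<close>

lemma descent_bound:
  fixes f :: "real^'d \<Rightarrow> real"
  assumes der: "\<And>y. (f has_derivative (\<lambda>h. h \<bullet> g y)) (at y)"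
    and lip: "\<And>u w. norm (g u - g w) \<le> U * norm (u - w)" and "0 \<le> U"
  shows "f y \<le> f x + (y - x) \<bullet> g x + U * (norm (y - x))\<^sup>2"
proof -
  obtain s where s: "0 < s" "s < 1" "f y - f x = (y - x) \<bullet> g (x + s *\<^sub>R (y - x))"
    using segment_mvt[OF der] by metis
  have "(y - x) \<bullet> (g (x + s *\<^sub>R (y - x)) - g x) \<le> norm (y - x) * (U * norm (s *\<^sub>R (y - x)))"
    using lip[of "x + s *\<^sub>R (y - x)" x]
    by (intro order_trans[OF norm_cauchy_schwarz] mult_left_mono) auto
  also have "\<dots> = s * (U * (norm (y - x))\<^sup>2)" using s by (simp add: power2_eq_square)
  also have "\<dots> \<le> 1 * (U * (norm (y - x))\<^sup>2)" using s \<open>0 \<le> U\<close> by (intro mult_right_mono) auto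
  finally show ?thesis using s(3) by (simp add: inner_diff_right)
qed

text \<open>Compare \<open>x\<close> with the midpoint \<open>m\<close>, whose value is at least the
  minimum. Beyond \<open>m\<close> the monotonicity bound carries a factor of at least 1/2, and the
  halved segment contributes another 1/2: hence \<open>c / 4\<close>.\<close>

lemma strong_convexity_gap:
  fixes f :: "real^'d \<Rightarrow> real"
  assumes der: "\<And>y. (f has_derivative (\<lambda>h. h \<bullet> g y)) (at y)"
    and mono: "\<And>u w. c * (norm (u - w))\<^sup>2 \<le> (g u - g w) \<bullet> (u - w)" and "0 \<le> c" "g xs = 0"
    and min: "\<And>y. f xs \<le> f y"
  shows "c / 4 * (norm (x - xs))\<^sup>2 \<le> f x - f xs"
proof -
  define m where "m = xs + (1/2) *\<^sub>R (x - xs)"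
  have xm: "x - m = (1/2) *\<^sub>R (x - xs)" by (simp add: m_def algebra_simps flip: scaleR_add_left)
  obtain s where s: "0 < s" "s < 1" "f x - f m = (x - m) \<bullet> g (m + s *\<^sub>R (x - m))"
    using segment_mvt[OF der] by metis
  define r where "r = 1/2 + s/2"
  have eq: "m + s *\<^sub>R (x - m) - xs = r *\<^sub>R (x - xs)"
    by (simp add: xm) (simp add: m_def r_def algebra_simps)
  have "c * (norm (r *\<^sub>R (x - xs)))\<^sup>2 \<le> g (m + s *\<^sub>R (x - m)) \<bullet> (r *\<^sub>R (x - xs))"
    using mono[of "m + s *\<^sub>R (x - m)" xs] by (simp add: eq \<open>g xs = 0\<close>)
  then have "r * (r * (c * (norm (x - xs))\<^sup>2)) \<le> r * (g (m + s *\<^sub>R (x - m)) \<bullet> (x - xs))"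
    by (simp add: power_mult_distrib power2_eq_square mult_ac)
  then have "r * (c * (norm (x - xs))\<^sup>2) \<le> g (m + s *\<^sub>R (x - m)) \<bullet> (x - xs)"
    using s by (simp add: r_def)
  moreover have "1/2 * (c * (norm (x - xs))\<^sup>2) \<le> r * (c * (norm (x - xs))\<^sup>2)"
    using s \<open>0 \<le> c\<close> by (intro mult_right_mono) (auto simp: r_def)
  moreover have "f x - f m = 1/2 * (g (m + s *\<^sub>R (x - m)) \<bullet> (x - xs))"
    unfolding s(3) by (simp add: xm inner_commute)
  ultimately have "c / 4 * (norm (x - xs))\<^sup>2 \<le> f x - f m" by simp
  then show ?thesis using min[of m] by simp
qed

section \<open>The central limit theorem in several dimensions\<close>

text \<open>The phases bring in sines and make products of waves sums of waves again, and the
  expectation of such a function is determined by the characteristic function. These test functions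
  link characteristic functions to convergence in distribution in any dimension.\<close>

inductive trig_poly :: "(real^'n \<Rightarrow> real) \<Rightarrow> bool" where
  wave: "trig_poly (\<lambda>x. a * cos (\<theta> \<bullet> x + c))"
| add: "trig_poly f \<Longrightarrow> trig_poly g \<Longrightarrow> trig_poly (\<lambda>x. f x + g x)"

lemma trig_poly_wave_mult:
  assumes "trig_poly g"
  shows "trig_poly (\<lambda>x. a * cos (\<theta> \<bullet> x + c) * g x)"
  using assms
proof induction
  case (wave b \<psi> d)
  have "(\<lambda>x. a * cos (\<theta> \<bullet> x + c) * (b * cos (\<psi> \<bullet> x + d)))
    = (\<lambda>x. a * b / 2 * cos ((\<theta> - \<psi>) \<bullet> x + (c - d)) + a * b / 2 * cos ((\<theta> + \<psi>) \<bullet> x + (c + d)))"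
  proof
    fix x
    have "cos ((\<theta> - \<psi>) \<bullet> x + (c - d)) + cos ((\<theta> + \<psi>) \<bullet> x + (c + d))
        = 2 * (cos (\<theta> \<bullet> x + c) * cos (\<psi> \<bullet> x + d))"
      using cos_times_cos[of "\<theta> \<bullet> x + c" "\<psi> \<bullet> x + d"] by (simp add: inner_diff_left inner_add_left algebra_simps)
    from arg_cong[OF this, of "\<lambda>r. a * b / 2 * r"]
    show "a * cos (\<theta> \<bullet> x + c) * (b * cos (\<psi> \<bullet> x + d))
      = a * b / 2 * cos ((\<theta> - \<psi>) \<bullet> x + (c - d)) + a * b / 2 * cos ((\<theta> + \<psi>) \<bullet> x + (c + d))"
      unfolding distrib_left by (simp add: mult_ac)
  qed
  then show ?case by (simp only: trig_poly.intros)
next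
  case (add f g)
  then show ?case using trig_poly.add[OF add.IH] by (simp add: distrib_left)
qed

lemma trig_poly_mult:
  assumes "trig_poly f" "trig_poly g"
  shows "trig_poly (\<lambda>x. f x * g x)"
  using assms
proof induction
  case (wave a \<theta> c) then show ?case by (rule trig_poly_wave_mult)
next
  case (add f1 f2)
  then show ?case using trig_poly.add[of "\<lambda>x. f1 x * g x" "\<lambda>x. f2 x * g x"] by (simp add: distrib_right)
qed

lemma trig_poly_const: "trig_poly (\<lambda>x. a)"
  using trig_poly.wave[of a 0 0] by simp

lemma trig_poly_sum:
  assumes "finite I" "\<And>i. i \<in> I \<Longrightarrow> trig_poly (f i)"
  shows "trig_poly (\<lambda>x. \<Sum>i\<in>I. f i x)"
  using assms by (induction I) (auto intro: trig_poly.add trig_poly_const)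

lemma trig_poly_polynomial_sin:
  fixes p :: "real^'n \<Rightarrow> real"
  assumes "real_polynomial_function p"
  shows "trig_poly (\<lambda>x. p (\<chi> i. sin (c * x $ i)))"
  using assms
proof induction
  case (linear f)
  \<comment> \<open>A sine is a cosine with phase -pi/2, and a linear map combines finitely many of
    them.\<close>
  have eq: "f (\<chi> i. sin (c * x $ i)) = (\<Sum>i\<in>UNIV. f (axis i 1) * cos ((c *\<^sub>R axis i 1) \<bullet> x + (- (pi/2))))" for x
  proof -
    have lin: "linear f" using linear bounded_linear.linear by blast
    have "f (\<chi> i. sin (c * x $ i)) = f (\<Sum>i\<in>UNIV. (sin (c * x $ i)) *\<^sub>R axis i 1)"
      using basis_expansion[of "\<chi> i. sin (c * x $ i)"] by (simp add: scalar_mult_eq_scaleR)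
    also have "\<dots> = (\<Sum>i\<in>UNIV. f (axis i 1) * sin (c * x $ i))"
      by (simp add: linear_sum[OF lin] linear_scale[OF lin] mult.commute)
    finally show ?thesis by (simp add: inner_axis' cos_diff)
  qed
  show ?case unfolding eq by (intro trig_poly_sum trig_poly.wave) auto
qed (auto intro: trig_poly_const trig_poly.add trig_poly_mult)

lemma trig_poly_bounded_continuous:
  assumes "trig_poly f"
  shows "continuous_on UNIV f" "\<exists>K. \<forall>x. \<bar>f x\<bar> \<le> K"
proof -
  show "continuous_on UNIV f" using assms by induction (auto intro!: continuous_intros)
  show "\<exists>K. \<forall>x. \<bar>f x\<bar> \<le> K" using assms
  proof induction
    case (wave a \<theta> c)
    have "\<bar>a * cos (\<theta> \<bullet> x + c)\<bar> \<le> \<bar>a\<bar> * 1" for x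
      unfolding abs_mult by (intro mult_left_mono) auto
    then show ?case by blast
  next
    case (add f g)
    then obtain K L where "\<forall>x. \<bar>f x\<bar> \<le> K" "\<forall>x. \<bar>g x\<bar> \<le> L" by blast
    then have "\<forall>x. \<bar>f x + g x\<bar> \<le> K + L" by (meson abs_triangle_ineq add_mono order_trans)
    then show ?case by blast
  qed
qed

lemma (in prob_space) integrable_bounded_continuous:
  fixes h :: "'b::topological_space \<Rightarrow> real"
  assumes "continuous_on UNIV h" "\<And>x. \<bar>h x\<bar> \<le> K" "X \<in> borel_measurable M"
  shows "integrable M (\<lambda>\<omega>. h (X \<omega>))"
  by (rule integrable_const_bound[where B=K])
    (use assms borel_measurable_continuous_on[OF assms(1,3)] in auto)

lemma trig_poly_integral_tendsto:
  fixes X :: "nat \<Rightarrow> 'a \<Rightarrow> real^'n"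
  assumes M: "prob_space M" and N: "prob_space N" "sets N = sets borel"
    and X: "\<And>n. X n \<in> borel_measurable M"
    and conv: "\<And>\<theta> c. (\<lambda>n. LINT \<omega>|M. cos (\<theta> \<bullet> X n \<omega> + c)) \<longlonglongrightarrow> (LINT y|N. cos (\<theta> \<bullet> y + c))"
    and "trig_poly q"
  shows "(\<lambda>n. LINT \<omega>|M. q (X n \<omega>)) \<longlonglongrightarrow> (LINT y|N. q y)"
  using \<open>trig_poly q\<close>
proof induction
  case (wave a \<theta> c)
  then show ?case using tendsto_mult_left[OF conv, of a] by simp
next
  case (add f g)
  interpret M: prob_space M by fact
  interpret N: prob_space N by fact
  have id: "(\<lambda>y. y) \<in> borel_measurable N" using N(2) by (simp cong: measurable_cong_sets)
  have i: "integrable M (\<lambda>\<omega>. f (X n \<omega>))" "integrable M (\<lambda>\<omega>. g (X n \<omega>))" for n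
    using M.integrable_bounded_continuous[OF _ _ X] trig_poly_bounded_continuous add.hyps by metis+
  have j: "integrable N f" "integrable N g"
    using N.integrable_bounded_continuous[OF _ _ id] trig_poly_bounded_continuous add.hyps by metis+
  show ?case using tendsto_add[OF add.IH] i j by simp
qed

text \<open>
  On the box with half-width \<open>R\<close> the map \<open>x \<mapsto> (sin (c x\<^sub>i))\<^sub>i\<close> with \<open>c = \<pi>/(2R)\<close> is
  invertible, so \<open>h\<close> agrees there with a continuous function of these sines, which
  Stone-Weierstrass approximates uniformly on all of the space by trigonometric polynomials.
\<close>

lemma trig_poly_approximation:
  fixes h :: "real^'n \<Rightarrow> real"
  assumes h: "continuous_on UNIV h" "\<And>x. \<bar>h x\<bar> \<le> K" and "0 < R" "0 < \<epsilon>"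
  obtains q where "trig_poly q" "\<And>x. norm x \<le> R \<Longrightarrow> \<bar>h x - q x\<bar> \<le> \<epsilon>" "\<And>x. \<bar>h x - q x\<bar> \<le> 2 * K + \<epsilon>"
proof -
  define c where "c = pi / (2 * R)"
  have c: "0 < c" using \<open>0 < R\<close> by (simp add: c_def)
  define C :: "(real^'n) set" where "C = cbox (\<chi> i. -1) (\<chi> i. 1)"
  define H where "H y = h (\<chi> i. arcsin (y $ i) / c)" for y :: "real^'n"
  have C: "y \<in> C \<longleftrightarrow> (\<forall>i. -1 \<le> y $ i \<and> y $ i \<le> 1)" for y
    by (simp add: C_def mem_box_cart)
  have "continuous_on C (\<lambda>y. \<chi> i. arcsin (y $ i) / c)"
    using c by (intro continuous_intros) (auto simp: C)
  then have "continuous_on C H"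
    unfolding H_def by (rule continuous_on_compose2[OF h(1)]) auto
  then obtain p where p: "real_polynomial_function p" "\<And>y. y \<in> C \<Longrightarrow> \<bar>H y - p y\<bar> < \<epsilon>"
    using Stone_Weierstrass_real_polynomial_function[of C H \<epsilon>] \<open>0 < \<epsilon>\<close> by (auto simp: C_def)
  define s where "s x = (\<chi> i. sin (c * x $ i))" for x :: "real^'n"
  have sC: "s x \<in> C" for x by (simp add: C s_def)
  show thesis
  proof (rule that[of "\<lambda>x. p (s x)"])
    show "trig_poly (\<lambda>x. p (s x))" unfolding s_def by (rule trig_poly_polynomial_sin[OF p(1)])
    show "\<bar>h x - p (s x)\<bar> \<le> \<epsilon>" if "norm x \<le> R" for x
    proof -
      have "arcsin (sin (c * x $ i)) / c = x $ i" for i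
      proof -
        have "\<bar>x $ i\<bar> \<le> R" using component_le_norm_cart[of x i] that by linarith
        then have "\<bar>c * x $ i\<bar> \<le> c * R" using c by (simp add: abs_mult)
        also have "c * R = pi / 2" using \<open>0 < R\<close> by (simp add: c_def)
        finally have "arcsin (sin (c * x $ i)) = c * x $ i" by (intro arcsin_sin) auto
        then show ?thesis using c by simp
      qed
      then have "H (s x) = h x" by (simp add: H_def s_def)
      then show ?thesis using p(2)[OF sC, of x] by simp
    qed
    \<comment> \<open>\<open>s x\<close> lies in the cube for every \<open>x\<close>, so even far
      out \<open>p (s x)\<close> is within \<epsilon> of some value of \<open>h\<close>, and
      \<open>h\<close> is bounded by \<open>K\<close>.\<close>
    show "\<bar>h x - p (s x)\<bar> \<le> 2 * K + \<epsilon>" for x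
      using p(2)[OF sC, of x] h(2)[of x] h(2)[of "\<chi> i. arcsin (s x $ i) / c"] by (simp add: H_def)
  qed
qed

lemma (in prob_space) bounded_approximation_integral:
  fixes X :: "'a \<Rightarrow> real^'n"
  assumes h: "continuous_on UNIV h" "\<And>x. \<bar>h x\<bar> \<le> K" and q: "trig_poly q"
    and X[measurable]: "X \<in> borel_measurable M" and "0 \<le> \<epsilon>"
    and near: "\<And>x. norm x \<le> R \<Longrightarrow> \<bar>h x - q x\<bar> \<le> \<epsilon>" and far: "\<And>x. \<bar>h x - q x\<bar> \<le> 2 * K + \<epsilon>"
  shows "\<bar>(LINT \<omega>|M. h (X \<omega>)) - (LINT \<omega>|M. q (X \<omega>))\<bar> \<le> \<epsilon> + 2 * K * prob {\<omega> \<in> space M. R < norm (X \<omega>)}"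
proof -
  let ?A = "{\<omega> \<in> space M. R < norm (X \<omega>)}"
  have A: "?A \<in> sets M" by measurable
  obtain L where L: "\<And>x. \<bar>q x\<bar> \<le> L" using trig_poly_bounded_continuous(2)[OF q] by blast
  have i: "integrable M (\<lambda>\<omega>. h (X \<omega>))" "integrable M (\<lambda>\<omega>. q (X \<omega>))"
    using integrable_bounded_continuous[OF h X] integrable_bounded_continuous[OF trig_poly_bounded_continuous(1)[OF q] L X] by auto
  have K: "0 \<le> K" using h(2)[of 0] by linarith
  have "\<bar>(LINT \<omega>|M. h (X \<omega>)) - (LINT \<omega>|M. q (X \<omega>))\<bar> = \<bar>LINT \<omega>|M. h (X \<omega>) - q (X \<omega>)\<bar>"
    using i by simp
  also have "\<dots> \<le> (LINT \<omega>|M. \<bar>h (X \<omega>) - q (X \<omega>)\<bar>)" by (rule integral_abs_bound)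
  also have "\<dots> \<le> (LINT \<omega>|M. \<epsilon> + 2 * K * indicator ?A \<omega>)"
  proof (rule integral_mono)
    show "integrable M (\<lambda>\<omega>. \<epsilon> + 2 * K * indicator ?A \<omega>)"
      using A by (intro Bochner_Integration.integrable_add integrable_mult_right integrable_real_indicator)
        (auto simp: emeasure_eq_measure)
    show "\<bar>h (X \<omega>) - q (X \<omega>)\<bar> \<le> \<epsilon> + 2 * K * indicator ?A \<omega>" if "\<omega> \<in> space M" for \<omega>
      using near[of "X \<omega>"] far[of "X \<omega>"] that by (auto simp: indicator_def)
  qed (use i in auto)
  also have "\<dots> = \<epsilon> + 2 * K * prob ?A"
    using A by (subst Bochner_Integration.integral_add)
      (auto simp: prob_space emeasure_eq_measure intro!: integrable_real_indicator)
  finally show ?thesis .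
qed

lemma (in prob_space) single_tight:
  fixes X :: "'a \<Rightarrow> real^'n"
  assumes X[measurable]: "X \<in> borel_measurable M" and "0 < \<epsilon>"
  shows "\<exists>R. prob {\<omega> \<in> space M. R < norm (X \<omega>)} < \<epsilon>"
proof -
  let ?A = "\<lambda>n::nat. {\<omega> \<in> space M. real n < norm (X \<omega>)}"
  have "(\<lambda>n. prob (?A n)) \<longlonglongrightarrow> prob (\<Inter>n. ?A n)"
    by (rule finite_Lim_measure_decseq) (auto simp: decseq_def)
  moreover have "\<omega> \<notin> (\<Inter>n. ?A n)" for \<omega>
  proof -
    obtain n where "norm (X \<omega>) < real n" using reals_Archimedean2 by blast
    then have "\<omega> \<notin> ?A n" by simp
    then show ?thesis by blast
  qed
  then have "(\<Inter>n. ?A n) = {}" by blast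
  ultimately have "(\<lambda>n. prob (?A n)) \<longlonglongrightarrow> 0" by simp
  then have "\<forall>\<^sub>F n in sequentially. prob (?A n) < \<epsilon>" using \<open>0 < \<epsilon>\<close> by (rule order_tendstoD(2))
  then show ?thesis by (auto simp: eventually_sequentially)
qed

lemma prob_tail_antimono:
  assumes "prob_space M" "X \<in> borel_measurable M" "R \<le> R'"
  shows "measure M {\<omega> \<in> space M. R' < norm (X \<omega>)} \<le> measure M {\<omega> \<in> space M. R < norm (X \<omega>)}"
proof -
  interpret prob_space M by fact
  note [measurable] = assms(2)
  show ?thesis using assms(3) by (intro finite_measure_mono) auto
qed

text \<open>Outside a large ball the trigonometric approximation of \<open>h\<close> is merely
  bounded, but by tightness little mass lies there; inside it is uniformly good.\<close>

theorem converges_in_distribution_cos: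
  fixes X :: "nat \<Rightarrow> 'a \<Rightarrow> real^'n"
  assumes M: "prob_space M" and N: "prob_space N" "sets N = sets borel"
    and X: "\<And>n. X n \<in> borel_measurable M"
    and tight: "\<And>\<epsilon>. 0 < \<epsilon> \<Longrightarrow> \<exists>R. \<forall>\<^sub>F n in sequentially. measure M {\<omega> \<in> space M. R < norm (X n \<omega>)} \<le> \<epsilon>"
    and conv: "\<And>\<theta> c. (\<lambda>n. LINT \<omega>|M. cos (\<theta> \<bullet> X n \<omega> + c)) \<longlonglongrightarrow> (LINT y|N. cos (\<theta> \<bullet> y + c))"
  shows "converges_in_distribution M X N"
  unfolding converges_in_distribution_def
proof (intro conjI allI impI X)
  fix h :: "real^'n \<Rightarrow> real"
  assume asm: "continuous_on UNIV h \<and> bounded (range h)"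
  interpret M: prob_space M by fact
  interpret N: prob_space N by fact
  have id: "(\<lambda>y. y) \<in> borel_measurable N" using N(2) by (simp cong: measurable_cong_sets)
  obtain K where K: "0 < K" "\<And>x. \<bar>h x\<bar> \<le> K" using asm unfolding bounded_pos by auto
  show "(\<lambda>n. LINT \<omega>|M. h (X n \<omega>)) \<longlonglongrightarrow> (LINT y|N. h y)"
  proof (rule tendstoI)
    fix \<epsilon> :: real assume "0 < \<epsilon>"
    \<comment> \<open>This makes the tail term \<open>2 * K * \<delta>\<close> equal to \<epsilon> /
      8. Each approximation then costs \<epsilon> / 4, and the convergence of the trigonometric
      expectations another \<epsilon> / 8.\<close>
    define \<delta> where "\<delta> = \<epsilon> / (16 * K)"
    have \<delta>: "0 < \<delta>" using \<open>0 < \<epsilon>\<close> K by (simp add: \<delta>_def)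
    obtain R1 where R1: "\<forall>\<^sub>F n in sequentially. measure M {\<omega> \<in> space M. R1 < norm (X n \<omega>)} \<le> \<delta>"
      using tight[OF \<delta>] by blast
    obtain R2 where R2: "measure N {y \<in> space N. R2 < norm y} < \<delta>"
      using N.single_tight[OF id \<delta>] by blast
    obtain R where R: "0 < R" "R1 \<le> R" "R2 \<le> R"
      by (rule that[of "max 1 (max R1 R2)"]) auto
    obtain q where q: "trig_poly q" "\<And>x. norm x \<le> R \<Longrightarrow> \<bar>h x - q x\<bar> \<le> \<epsilon> / 8" "\<And>x. \<bar>h x - q x\<bar> \<le> 2 * K + \<epsilon> / 8"
      using trig_poly_approximation[of h K R "\<epsilon> / 8"] asm K R \<open>0 < \<epsilon>\<close> by auto
    have "\<forall>\<^sub>F n in sequentially. \<bar>(LINT \<omega>|M. q (X n \<omega>)) - (LINT y|N. q y)\<bar> < \<epsilon> / 8"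
      using trig_poly_integral_tendsto[OF M N X conv q(1)] \<open>0 < \<epsilon>\<close>
      by (auto dest: tendstoD[where e="\<epsilon> / 8"] simp: dist_real_def)
    then show "\<forall>\<^sub>F n in sequentially. dist (LINT \<omega>|M. h (X n \<omega>)) (LINT y|N. h y) < \<epsilon>"
      using R1
    proof eventually_elim
      case (elim n)
      have K\<delta>: "2 * K * \<delta> = \<epsilon> / 8" using K by (simp add: \<delta>_def)
      have "measure M {\<omega> \<in> space M. R < norm (X n \<omega>)} \<le> \<delta>"
        using elim(2) prob_tail_antimono[OF M X R(2), of n] by linarith
      then have "2 * K * measure M {\<omega> \<in> space M. R < norm (X n \<omega>)} \<le> 2 * K * \<delta>"
        using K by (intro mult_left_mono) auto
      moreover have "\<bar>(LINT \<omega>|M. h (X n \<omega>)) - (LINT \<omega>|M. q (X n \<omega>))\<bar> \<le> \<epsilon> / 8 + 2 * K * measure M {\<omega> \<in> space M. R < norm (X n \<omega>)}"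
        by (rule M.bounded_approximation_integral) (use asm K q X \<open>0 < \<epsilon>\<close> in auto)
      ultimately have 1: "\<bar>(LINT \<omega>|M. h (X n \<omega>)) - (LINT \<omega>|M. q (X n \<omega>))\<bar> \<le> \<epsilon> / 4" using K\<delta> by linarith
      have "measure N {y \<in> space N. R < norm y} \<le> \<delta>"
        using R2 prob_tail_antimono[OF N(1) id R(3)] by linarith
      then have "2 * K * measure N {y \<in> space N. R < norm y} \<le> 2 * K * \<delta>"
        using K by (intro mult_left_mono) auto
      moreover have "\<bar>(LINT y|N. h y) - (LINT y|N. q y)\<bar> \<le> \<epsilon> / 8 + 2 * K * measure N {y \<in> space N. R < norm y}"
        by (rule N.bounded_approximation_integral) (use asm K q id \<open>0 < \<epsilon>\<close> in auto)
      ultimately have 2: "\<bar>(LINT y|N. h y) - (LINT y|N. q y)\<bar> \<le> \<epsilon> / 4" using K\<delta> by linarith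
      show ?case using 1 2 elim(1) \<open>0 < \<epsilon>\<close> unfolding dist_real_def by linarith
    qed
  qed
qed

section \<open>Characteristic functions and a central limit theorem with remainder\<close>

lemma cos_eq_Re_iexp: "cos (a + c) = Re (iexp a * iexp c)"
  by (simp flip: exp_add distrib_left of_real_add) (simp add: Re_exp)

lemma (in prob_space) LINT_cos_eq_char:
  fixes Y :: "'a \<Rightarrow> real^'n"
  assumes [measurable]: "Y \<in> borel_measurable M"
  shows "(LINT \<omega>|M. cos (\<theta> \<bullet> Y \<omega> + c)) = Re ((CLINT \<omega>|M. iexp (\<theta> \<bullet> Y \<omega>)) * iexp c)"
proof -
  have int: "integrable M (\<lambda>\<omega>. iexp (\<theta> \<bullet> Y \<omega>))"
    by (rule integrable_const_bound[where B=1]) auto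
  have "(LINT \<omega>|M. Re (iexp (\<theta> \<bullet> Y \<omega>) * iexp c)) = Re (CLINT \<omega>|M. iexp (\<theta> \<bullet> Y \<omega>) * iexp c)"
    by (rule integral_Re) (use int in \<open>intro integrable_mult_left\<close>)
  also have "(CLINT \<omega>|M. iexp (\<theta> \<bullet> Y \<omega>) * iexp c) = (CLINT \<omega>|M. iexp (\<theta> \<bullet> Y \<omega>)) * iexp c"
    using int by simp
  finally show ?thesis unfolding cos_eq_Re_iexp .
qed

theorem converges_in_distribution_char:
  fixes X :: "nat \<Rightarrow> 'a \<Rightarrow> real^'n"
  assumes M: "prob_space M" and N: "prob_space N" "sets N = sets borel"
    and X: "\<And>n. X n \<in> borel_measurable M"
    and tight: "\<And>\<epsilon>. 0 < \<epsilon> \<Longrightarrow> \<exists>R. \<forall>\<^sub>F n in sequentially. measure M {\<omega> \<in> space M. R < norm (X n \<omega>)} \<le> \<epsilon>"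
    and conv: "\<And>\<theta>. (\<lambda>n. CLINT \<omega>|M. iexp (\<theta> \<bullet> X n \<omega>)) \<longlonglongrightarrow> (CLINT y|N. iexp (\<theta> \<bullet> y))"
  shows "converges_in_distribution M X N"
proof (rule converges_in_distribution_cos[OF M N X tight])
  fix \<theta> c
  have id: "(\<lambda>y. y) \<in> borel_measurable N" using N(2) by (simp cong: measurable_cong_sets)
  show "(\<lambda>n. LINT \<omega>|M. cos (\<theta> \<bullet> X n \<omega> + c)) \<longlonglongrightarrow> (LINT y|N. cos (\<theta> \<bullet> y + c))"
    unfolding prob_space.LINT_cos_eq_char[OF M X] prob_space.LINT_cos_eq_char[OF N(1) id]
    by (intro tendsto_Re tendsto_mult conv tendsto_const)
qed


text \<open>The standard normal coordinates are independent, so the characteristic function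
  factorizes through \<open>transpose A *v \<theta>\<close>. The squared length of this vector is
  the form of \<open>V\<close> at \<theta>, so the chosen factor \<open>A\<close> drops out.\<close>

lemma char_multivariate_normal:
  fixes V :: "real^'n^'n"
  assumes V: "transpose V = V" "\<And>v. 0 \<le> v \<bullet> (V *v v)"
  shows "(CLINT y|multivariate_normal 0 V. iexp (\<theta> \<bullet> y)) = exp (- (\<theta> \<bullet> (V *v \<theta>)) / 2)"
    and "prob_space (multivariate_normal 0 V)" "sets (multivariate_normal 0 V) = sets borel"
proof -
  define A :: "real^'n^'n" where "A = (SOME A. A ** transpose A = V)"
  have A: "A ** transpose A = V"
    unfolding A_def by (rule someI_ex) (use PSD_factorization[OF V] in blast)
  let ?P = "\<Pi>\<^sub>M i\<in>(UNIV::'n set). std_normal_distribution"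
  let ?Y = "\<lambda>z::'n \<Rightarrow> real. A *v (\<chi> i. z i)"
  have eq: "multivariate_normal 0 V = distr ?P borel ?Y"
    by (simp add: multivariate_normal_def A_def)
  interpret S: prob_space std_normal_distribution by (rule prob_space_normal_density) simp
  interpret product_sigma_finite "\<lambda>_::'n. std_normal_distribution" by unfold_locales
  interpret P: prob_space ?P by (intro prob_space_PiM S.prob_space_axioms)
  have comp: "(\<lambda>z. z i) \<in> borel_measurable ?P" for i :: 'n
    using measurable_component_singleton[of i UNIV "\<lambda>_. std_normal_distribution"] by simp
  have Y: "?Y \<in> borel_measurable ?P"
    by (intro borel_measurable_vecI) (simp add: matrix_vector_mult_def borel_measurable_sum comp)
  show "prob_space (multivariate_normal 0 V)" unfolding eq by (rule P.prob_space_distr[OF Y])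
  show "sets (multivariate_normal 0 V) = sets borel" by (simp add: eq)
  define t where "t = transpose A *v \<theta>"
  have inner: "\<theta> \<bullet> ?Y z = (\<Sum>i\<in>UNIV. t $ i * z i)" for z
    unfolding inner_matrix_vector_transpose t_def[symmetric] by (simp add: inner_vec_def)
  have "(CLINT y|multivariate_normal 0 V. iexp (\<theta> \<bullet> y)) = (CLINT z|?P. iexp (\<theta> \<bullet> ?Y z))"
    unfolding eq by (rule integral_distr[OF Y]) measurable
  also have "\<dots> = (CLINT z|?P. \<Prod>i\<in>UNIV. iexp (t $ i * z i))"
    unfolding inner by (simp add: sum_distrib_left exp_sum)
  also have "\<dots> = (\<Prod>i\<in>UNIV. CLINT x|std_normal_distribution. iexp (t $ i * x))"
    by (rule product_integral_prod) (auto intro!: S.integrable_const_bound[where B=1])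
  also have "\<dots> = (\<Prod>i\<in>UNIV. complex_of_real (exp (- (t $ i)\<^sup>2 / 2)))"
    using char_std_normal_distribution unfolding char_def fun_eq_iff by simp
  also have "\<dots> = exp (\<Sum>i\<in>UNIV. - (t $ i)\<^sup>2 / 2)" by (simp add: exp_sum)
  also have "(\<Sum>i\<in>UNIV. - (t $ i)\<^sup>2 / 2) = - (t \<bullet> t) / 2"
    by (simp add: inner_vec_def power2_eq_square sum_negf flip: sum_divide_distrib)
  also have "t \<bullet> t = \<theta> \<bullet> (V *v \<theta>)"
    by (simp add: t_def A[symmetric] inner_matrix_vector_transpose[of \<theta> A] flip: matrix_vector_mul_assoc)
  finally show "(CLINT y|multivariate_normal 0 V. iexp (\<theta> \<bullet> y)) = exp (- (\<theta> \<bullet> (V *v \<theta>)) / 2)" .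
qed

text \<open>The limit is the standard normal characteristic function evaluated at the standard
  deviation. Variance 0 is treated apart, since the normalization would divide by 0; then every
  \<open>Z n\<close> vanishes almost surely.\<close>

lemma (in prob_space) central_limit_char:
  fixes Z :: "nat \<Rightarrow> 'a \<Rightarrow> real"
  assumes indep: "indep_vars (\<lambda>i. borel) Z UNIV"
    and mean: "\<And>n. expectation (Z n) = 0"
    and sq: "\<And>n. integrable M (\<lambda>x. (Z n x)\<^sup>2)"
    and var: "\<And>n. expectation (\<lambda>x. (Z n x)\<^sup>2) = v"
    and dist: "\<And>n. distr M borel (Z n) = \<rho>"
  shows "(\<lambda>n. CLINT x|M. iexp ((\<Sum>i<n. Z i x) / sqrt n)) \<longlonglongrightarrow> exp (- v / 2)"
proof -
  have rv [measurable]: "Z n \<in> borel_measurable M" for n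
    using indep unfolding indep_vars_def2 by simp
  have v0: "0 \<le> v" unfolding var[of 0, symmetric] by simp
  show ?thesis
  proof (cases "v = 0")
    case True
    have "AE x in M. Z n x = 0" for n
    proof -
      have "AE x in M. (Z n x)\<^sup>2 = 0"
        using integral_nonneg_eq_0_iff_AE[OF sq[of n]] var[of n] True by simp
      then show ?thesis by simp
    qed
    then have "AE x in M. \<forall>n. Z n x = 0" by (simp add: AE_all_countable)
    then have "AE x in M. iexp ((\<Sum>i<n. Z i x) / sqrt n) = 1" for n
      by eventually_elim simp
    then have "(CLINT x|M. iexp ((\<Sum>i<n. Z i x) / sqrt n)) = (CLINT x|M. 1)" for n
      by (intro integral_cong_AE) auto
    then show ?thesis using True by (simp add: prob_space)
  next
    case False
    then have v: "0 < v" using v0 by simp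
    define s where "s = sqrt v"
    have s: "0 < s" "s\<^sup>2 = v" using v by (auto simp: s_def)
    let ?W = "\<lambda>n x. (\<Sum>i<n. Z i x) / sqrt (n * s\<^sup>2)"
    have "weak_conv_m (\<lambda>n. distr M borel (?W n)) std_normal_distribution"
      by (rule central_limit_theorem_zero_mean[OF indep mean s(1) sq _ dist]) (simp add: mean var s)
    then have "(\<lambda>n. char (distr M borel (?W n)) s) \<longlonglongrightarrow> char std_normal_distribution s"
      by (intro levy_continuity1 real_distribution_distr real_dist_normal_dist) auto
    moreover have "char (distr M borel (?W n)) s = (CLINT x|M. iexp ((\<Sum>i<n. Z i x) / sqrt n))" for n
    proof -
      have "char (distr M borel (?W n)) s = (CLINT x|M. iexp (s * ?W n x))"
        unfolding char_def by (rule integral_distr) auto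
      also have "(\<lambda>x. s * ?W n x) = (\<lambda>x. (\<Sum>i<n. Z i x) / sqrt n)"
        using s(1) by (simp add: real_sqrt_mult fun_eq_iff)
      finally show ?thesis .
    qed
    ultimately show ?thesis by (simp add: char_std_normal_distribution s)
  qed
qed

lemma le_one_plus_square: "(x::real) \<le> 1 + x\<^sup>2"
  using sum_squares_ge_zero[of "x - 1/2" 0] by (simp add: power2_eq_square algebra_simps)

text \<open>A Slutsky argument. The mean of \<open>min 1\<close> of the distance expresses
  convergence in probability and requires no integrability of \<open>X\<close>;
  \<open>growth\<close> yields tightness by Chebyshev, and the one-dimensional theorem is applied to
  each \<open>\<theta> \<bullet> Y n\<close>.\<close>

theorem (in prob_space) perturbed_central_limit:
  fixes Y :: "nat \<Rightarrow> 'a \<Rightarrow> real^'n" and X :: "nat \<Rightarrow> 'a \<Rightarrow> real^'n"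
  assumes indep: "indep_vars (\<lambda>i. borel) Y UNIV"
    and dist: "\<And>n. distr M borel (Y n) = \<rho>"
    and sq: "\<And>n. integrable M (\<lambda>\<omega>. (norm (Y n \<omega>))\<^sup>2)"
    and mean: "\<And>n. (LINT \<omega>|M. Y n \<omega>) = 0"
    and cov: "\<And>n \<theta>. (LINT \<omega>|M. (\<theta> \<bullet> Y n \<omega>)\<^sup>2) = \<theta> \<bullet> (V *v \<theta>)" and V: "transpose V = V"
    and X: "\<And>n. X n \<in> borel_measurable M"
    and isum: "\<And>n. integrable M (\<lambda>\<omega>. (norm (\<Sum>i<n. Y i \<omega>))\<^sup>2)"
    and growth: "\<And>n. (LINT \<omega>|M. (norm (\<Sum>i<n. Y i \<omega>))\<^sup>2) \<le> c * real n"
    and close: "(\<lambda>n. LINT \<omega>|M. min 1 (norm (X n \<omega> - (\<Sum>i<n. Y i \<omega>) /\<^sub>R sqrt n))) \<longlonglongrightarrow> 0"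
  shows "converges_in_distribution M X (multivariate_normal 0 V)"
proof -
  have Y [measurable]: "Y n \<in> borel_measurable M" for n
    using indep unfolding indep_vars_def2 by simp
  note [measurable] = X
  have V0: "0 \<le> v \<bullet> (V *v v)" for v unfolding cov[of _ 0, symmetric] by simp
  define T where "T n \<omega> = (\<Sum>i<n. Y i \<omega>) /\<^sub>R sqrt n" for n \<omega>
  have T [measurable]: "T n \<in> borel_measurable M" for n unfolding T_def by measurable
  define r where "r n = (LINT \<omega>|M. min 1 (norm (X n \<omega> - T n \<omega>)))" for n
  have r0: "r \<longlonglongrightarrow> 0" using close by (simp add: r_def[abs_def] T_def)
  have ir: "integrable M (\<lambda>\<omega>. min 1 (norm (X n \<omega> - T n \<omega>)))" for n
    by (rule integrable_const_bound[where B=1]) auto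
  have iY: "integrable M (Y n)" for n
    by (rule Bochner_Integration.integrable_bound[where f="\<lambda>\<omega>. 1 + (norm (Y n \<omega>))\<^sup>2"])
      (use sq in \<open>auto intro!: AE_I2 le_one_plus_square\<close>)
  have isq: "integrable M (\<lambda>\<omega>. (\<theta> \<bullet> Y n \<omega>)\<^sup>2)" for n \<theta>
  proof (rule Bochner_Integration.integrable_bound[where f="\<lambda>\<omega>. (norm \<theta>)\<^sup>2 * (norm (Y n \<omega>))\<^sup>2"])
    show "AE \<omega> in M. norm ((\<theta> \<bullet> Y n \<omega>)\<^sup>2) \<le> norm ((norm \<theta>)\<^sup>2 * (norm (Y n \<omega>))\<^sup>2)"
    proof (intro AE_I2)
      fix \<omega>
      have "\<bar>\<theta> \<bullet> Y n \<omega>\<bar>\<^sup>2 \<le> (norm \<theta> * norm (Y n \<omega>))\<^sup>2"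
        by (intro power_mono Cauchy_Schwarz_ineq2) simp
      then show "norm ((\<theta> \<bullet> Y n \<omega>)\<^sup>2) \<le> norm ((norm \<theta>)\<^sup>2 * (norm (Y n \<omega>))\<^sup>2)"
        by (simp add: power_mult_distrib)
    qed
  qed (use sq in auto)
  have charT: "(\<lambda>n. CLINT \<omega>|M. iexp (\<theta> \<bullet> T n \<omega>)) \<longlonglongrightarrow> exp (- (\<theta> \<bullet> (V *v \<theta>)) / 2)" for \<theta>
  proof -
    have "(\<lambda>n. CLINT \<omega>|M. iexp ((\<Sum>i<n. \<theta> \<bullet> Y i \<omega>) / sqrt n)) \<longlonglongrightarrow> exp (- (\<theta> \<bullet> (V *v \<theta>)) / 2)"
    proof (rule central_limit_char[where v="\<theta> \<bullet> (V *v \<theta>)" and \<rho>="distr \<rho> borel (\<lambda>y. \<theta> \<bullet> y)"])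
      show "indep_vars (\<lambda>i. borel) (\<lambda>n \<omega>. \<theta> \<bullet> Y n \<omega>) UNIV"
        by (rule indep_vars_compose2[OF indep]) measurable
      show "(LINT \<omega>|M. \<theta> \<bullet> Y n \<omega>) = 0" for n
        using integral_inner_right[of \<theta> M "Y n"] iY mean by simp
      show "distr M borel (\<lambda>\<omega>. \<theta> \<bullet> Y n \<omega>) = distr \<rho> borel (\<lambda>y. \<theta> \<bullet> y)" for n
        unfolding dist[of n, symmetric] by (subst distr_distr) (auto simp: comp_def)
      show "integrable M (\<lambda>\<omega>. (\<theta> \<bullet> Y n \<omega>)\<^sup>2)" for n by (rule isq)
      show "(LINT \<omega>|M. (\<theta> \<bullet> Y n \<omega>)\<^sup>2) = \<theta> \<bullet> (V *v \<theta>)" for n by (rule cov)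
    qed
    moreover have "\<theta> \<bullet> T n \<omega> = (\<Sum>i<n. \<theta> \<bullet> Y i \<omega>) / sqrt n" for n \<omega>
      unfolding T_def inner_scaleR_right inner_sum_right by (simp only: divide_inverse mult.commute)
    ultimately show ?thesis by (simp only:)
  qed
  have charX: "(\<lambda>n. CLINT \<omega>|M. iexp (\<theta> \<bullet> X n \<omega>)) \<longlonglongrightarrow> exp (- (\<theta> \<bullet> (V *v \<theta>)) / 2)" for \<theta>
  proof -
    \<comment> \<open>The exponentials differ by at most 2 and by at most |\<theta>| times the
      distance; \<open>2 + norm \<theta>\<close> covers both regimes of
      \<open>min 1\<close>.\<close>
    have "norm ((CLINT \<omega>|M. iexp (\<theta> \<bullet> X n \<omega>)) - (CLINT \<omega>|M. iexp (\<theta> \<bullet> T n \<omega>))) \<le> (2 + norm \<theta>) * r n" for n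
    proof -
      have i: "integrable M (\<lambda>\<omega>. iexp (\<theta> \<bullet> X n \<omega>))" "integrable M (\<lambda>\<omega>. iexp (\<theta> \<bullet> T n \<omega>))"
        by (auto intro!: integrable_const_bound[where B=1])
      have "norm ((CLINT \<omega>|M. iexp (\<theta> \<bullet> X n \<omega>)) - (CLINT \<omega>|M. iexp (\<theta> \<bullet> T n \<omega>)))
          = norm (CLINT \<omega>|M. iexp (\<theta> \<bullet> X n \<omega>) - iexp (\<theta> \<bullet> T n \<omega>))" using i by simp
      also have "\<dots> \<le> (LINT \<omega>|M. norm (iexp (\<theta> \<bullet> X n \<omega>) - iexp (\<theta> \<bullet> T n \<omega>)))"
        by (rule integral_norm_bound)
      also have "\<dots> \<le> (LINT \<omega>|M. (2 + norm \<theta>) * min 1 (norm (X n \<omega> - T n \<omega>)))"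
      proof (rule integral_mono)
        fix \<omega>
        let ?a = "\<theta> \<bullet> X n \<omega>" and ?b = "\<theta> \<bullet> T n \<omega>"
        have 1: "norm (iexp ?a - iexp ?b) \<le> 2"
          using norm_triangle_ineq4[of "iexp ?a" "iexp ?b"] by simp
        have "iexp ?a - iexp ?b = iexp ?b * (iexp (?a - ?b) - 1)"
          by (simp add: right_diff_distrib flip: exp_add)
        then have "norm (iexp ?a - iexp ?b) = norm (iexp (?a - ?b) - 1)" by (simp add: norm_mult)
        also have "\<dots> \<le> \<bar>?a - ?b\<bar>" using iexp_approx1[of "?a - ?b" 0] by simp
        also have "\<dots> \<le> norm \<theta> * norm (X n \<omega> - T n \<omega>)"
          unfolding inner_diff_right[symmetric] by (rule Cauchy_Schwarz_ineq2)
        finally have 2: "norm (iexp ?a - iexp ?b) \<le> norm \<theta> * norm (X n \<omega> - T n \<omega>)" .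
        show "norm (iexp ?a - iexp ?b) \<le> (2 + norm \<theta>) * min 1 (norm (X n \<omega> - T n \<omega>))"
        proof (cases "1 \<le> norm (X n \<omega> - T n \<omega>)")
          case True then show ?thesis using 1 by (simp add: min_def add_increasing2)
        next
          case False then show ?thesis using 2 by (simp add: min_def distrib_right add_increasing)
        qed
      qed (use i ir in auto)
      also have "\<dots> = (2 + norm \<theta>) * r n" by (simp add: r_def)
      finally show ?thesis .
    qed
    then have "(\<lambda>n. (CLINT \<omega>|M. iexp (\<theta> \<bullet> X n \<omega>)) - (CLINT \<omega>|M. iexp (\<theta> \<bullet> T n \<omega>))) \<longlonglongrightarrow> 0"
      by (intro Lim_null_comparison[OF always_eventually tendsto_mult_right_zero[OF r0]]) auto
    then show ?thesis using tendsto_add[OF _ charT[of \<theta>]] by fastforce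
  qed
  have tailT: "measure M {\<omega> \<in> space M. R < norm (T n \<omega>)} \<le> c / R\<^sup>2" if "0 < R" "0 < n" for R n
  proof -
    have eq: "(norm (T n \<omega>))\<^sup>2 = (norm (\<Sum>i<n. Y i \<omega>))\<^sup>2 / real n" for \<omega>
      by (simp add: T_def power_mult_distrib divide_inverse power_inverse mult.commute)
    have i: "integrable M (\<lambda>\<omega>. (norm (T n \<omega>))\<^sup>2)" unfolding eq using isum by simp
    have "measure M {\<omega> \<in> space M. R < norm (T n \<omega>)} \<le> measure M {\<omega> \<in> space M. R\<^sup>2 \<le> (norm (T n \<omega>))\<^sup>2}"
      using \<open>0 < R\<close> by (intro finite_measure_mono) (auto intro!: power_mono)
    also have "\<dots> \<le> (LINT \<omega>|M. (norm (T n \<omega>))\<^sup>2) / R\<^sup>2"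
      using integral_Markov_inequality_measure[OF i, of "{}" "R\<^sup>2"] \<open>0 < R\<close> by simp
    also have "\<dots> \<le> c / R\<^sup>2"
      unfolding eq using growth[of n] \<open>0 < n\<close> by (intro divide_right_mono) (simp_all add: field_simps)
    finally show ?thesis .
  qed
  show ?thesis
  proof (rule converges_in_distribution_char[OF prob_space_axioms])
    show "prob_space (multivariate_normal 0 V)" "sets (multivariate_normal 0 V) = sets borel"
      using char_multivariate_normal[OF V V0] by auto
    show "(\<lambda>n. CLINT \<omega>|M. iexp (\<theta> \<bullet> X n \<omega>)) \<longlonglongrightarrow> (CLINT y|multivariate_normal 0 V. iexp (\<theta> \<bullet> y))" for \<theta>
      using charX char_multivariate_normal(1)[OF V V0] by simp
    show "X n \<in> borel_measurable M" for n by (rule X)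
    fix \<epsilon> :: real assume "0 < \<epsilon>"
    \<comment> \<open>Chosen so that \<open>c / R\<^sup>2\<close> is at most \<epsilon> / 2; the
      added 1 keeps \<open>R\<close> positive when \<open>c\<close> is 0.\<close>
    define R where "R = sqrt (2 * (1 + \<bar>c\<bar>) / \<epsilon>)"
    have R: "0 < R" using \<open>0 < \<epsilon>\<close> by (simp add: R_def add_pos_nonneg)
    have R2: "R\<^sup>2 = 2 * (1 + \<bar>c\<bar>) / \<epsilon>" using \<open>0 < \<epsilon>\<close> by (simp add: R_def)
    have "c \<le> \<epsilon> / 2 * R\<^sup>2" unfolding R2 using \<open>0 < \<epsilon>\<close> by simp
    then have cR: "c / R\<^sup>2 \<le> \<epsilon> / 2" using R by (simp add: pos_divide_le_eq)
    have "\<forall>\<^sub>F n in sequentially. r n < \<epsilon> / 2" using order_tendstoD(2)[OF r0, of "\<epsilon> / 2"] \<open>0 < \<epsilon>\<close> by simp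
    then have "\<forall>\<^sub>F n in sequentially. measure M {\<omega> \<in> space M. R + 1 < norm (X n \<omega>)} \<le> \<epsilon>"
      using eventually_gt_at_top[of 0]
    proof eventually_elim
      case (elim n)
      \<comment> \<open>If the norm of \<open>X n\<close> exceeds \<open>R + 1\<close>, then that of
        the normalized sum exceeds \<open>R\<close> or the two are at least 1 apart.\<close>
      let ?A = "{\<omega> \<in> space M. R < norm (T n \<omega>)}" and ?B = "{\<omega> \<in> space M. 1 \<le> min 1 (norm (X n \<omega> - T n \<omega>))}"
      have "{\<omega> \<in> space M. R + 1 < norm (X n \<omega>)} \<subseteq> ?A \<union> ?B"
      proof (intro subsetI)
        fix \<omega> assume "\<omega> \<in> {\<omega> \<in> space M. R + 1 < norm (X n \<omega>)}"
        then show "\<omega> \<in> ?A \<union> ?B" using norm_triangle_sub[of "X n \<omega>" "T n \<omega>"] by auto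
      qed
      then have "prob {\<omega> \<in> space M. R + 1 < norm (X n \<omega>)} \<le> prob (?A \<union> ?B)"
        by (intro finite_measure_mono) auto
      also have "\<dots> \<le> prob ?A + prob ?B" by (intro measure_Un_le) auto
      also have "prob ?B \<le> r n"
        using integral_Markov_inequality_measure[OF ir[of n], of "{}" 1] by (simp add: r_def)
      also have "prob ?A \<le> \<epsilon> / 2" using tailT[OF R elim(2)] cR by linarith
      finally show ?case using elim(1) by simp
    qed
    then show "\<exists>R. \<forall>\<^sub>F n in sequentially. measure M {\<omega> \<in> space M. R < norm (X n \<omega>)} \<le> \<epsilon>" by blast
  qed
qed

section \<open>Square-integrable noise and recursions\<close>

definition L2 :: "'a measure \<Rightarrow> ('a \<Rightarrow> 'b::euclidean_space) \<Rightarrow> bool" where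
  "L2 M X \<longleftrightarrow> X \<in> borel_measurable M \<and> integrable M (\<lambda>\<omega>. (norm (X \<omega>))\<^sup>2)"

lemma L2D:
  assumes "L2 M X"
  shows "X \<in> borel_measurable M" "integrable M (\<lambda>\<omega>. (norm (X \<omega>))\<^sup>2)"
  using assms by (auto simp: L2_def)

lemma norm_add_square_le:
  fixes x y :: "'a::real_normed_vector"
  shows "(norm (x + y))\<^sup>2 \<le> 2 * (norm x)\<^sup>2 + 2 * (norm y)\<^sup>2"
proof -
  have "(norm (x + y))\<^sup>2 \<le> (norm x + norm y)\<^sup>2" by (intro power_mono norm_triangle_ineq) simp
  also have "\<dots> \<le> 2 * (norm x)\<^sup>2 + 2 * (norm y)\<^sup>2"
    using zero_le_power2[of "norm x - norm y"] unfolding power2_diff power2_sum by linarith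
  finally show ?thesis .
qed

lemma L2_bound:
  fixes X :: "'a \<Rightarrow> 'b::euclidean_space" and Y :: "'a \<Rightarrow> 'c::euclidean_space"
  assumes "L2 M Y" "X \<in> borel_measurable M" "\<And>\<omega>. \<omega> \<in> space M \<Longrightarrow> norm (X \<omega>) \<le> norm (Y \<omega>)"
  shows "L2 M X"
  unfolding L2_def
proof
  show "integrable M (\<lambda>\<omega>. (norm (X \<omega>))\<^sup>2)"
    by (rule Bochner_Integration.integrable_bound[OF L2D(2)[OF assms(1)]])
      (use assms in \<open>auto intro!: power_mono\<close>)
qed fact

lemma L2_add:
  assumes "L2 M X" "L2 M Y"
  shows "L2 M (\<lambda>\<omega>. X \<omega> + Y \<omega>)"
  unfolding L2_def
proof
  note [measurable] = L2D(1)[OF assms(1)] L2D(1)[OF assms(2)]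
  show "(\<lambda>\<omega>. X \<omega> + Y \<omega>) \<in> borel_measurable M" by measurable
  have "integrable M (\<lambda>\<omega>. 2 * (norm (X \<omega>))\<^sup>2 + 2 * (norm (Y \<omega>))\<^sup>2)"
    using L2D(2)[OF assms(1)] L2D(2)[OF assms(2)] by simp
  then show "integrable M (\<lambda>\<omega>. (norm (X \<omega> + Y \<omega>))\<^sup>2)"
    by (rule Bochner_Integration.integrable_bound) (auto intro!: AE_I2 order_trans[OF norm_add_square_le])
qed

lemma L2_norm: "L2 M X \<Longrightarrow> L2 M (\<lambda>\<omega>. norm (X \<omega>))"
  by (auto simp: L2_def)

lemma L2_scale: "L2 M X \<Longrightarrow> L2 M (\<lambda>\<omega>. c *\<^sub>R X \<omega>)"
  by (auto simp: L2_def power_mult_distrib)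

lemma L2_diff:
  assumes "L2 M X" "L2 M Y"
  shows "L2 M (\<lambda>\<omega>. X \<omega> - Y \<omega>)"
  using L2_add[OF assms(1) L2_scale[OF assms(2), of "-1"]] by simp

lemma (in finite_measure) L2_const: "L2 M (\<lambda>\<omega>. c)"
  by (simp add: L2_def)

lemma (in finite_measure) L2_sum:
  assumes "finite I" "\<And>i. i \<in> I \<Longrightarrow> L2 M (X i)"
  shows "L2 M (\<lambda>\<omega>. \<Sum>i\<in>I. X i \<omega>)"
  using assms by (induction I) (auto intro: L2_add L2_const)

lemma L2_inner_integrable:
  assumes "L2 M X" "L2 M Y"
  shows "integrable M (\<lambda>\<omega>. X \<omega> \<bullet> Y \<omega>)"
proof -
  note [measurable] = L2D(1)[OF assms(1)] L2D(1)[OF assms(2)]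
  have "integrable M (\<lambda>\<omega>. (norm (X \<omega>))\<^sup>2 + (norm (Y \<omega>))\<^sup>2)"
    using L2D(2)[OF assms(1)] L2D(2)[OF assms(2)] by simp
  then show ?thesis
  proof (rule Bochner_Integration.integrable_bound)
    show "AE \<omega> in M. norm (X \<omega> \<bullet> Y \<omega>) \<le> norm ((norm (X \<omega>))\<^sup>2 + (norm (Y \<omega>))\<^sup>2)"
    proof (intro AE_I2)
      fix \<omega>
      have "2 * (norm (X \<omega>) * norm (Y \<omega>)) \<le> (norm (X \<omega>))\<^sup>2 + (norm (Y \<omega>))\<^sup>2"
        using sum_squares_bound[of "norm (X \<omega>)" "norm (Y \<omega>)"] by simp
      moreover have "0 \<le> norm (X \<omega>) * norm (Y \<omega>)" by simp
      ultimately show "norm (X \<omega> \<bullet> Y \<omega>) \<le> norm ((norm (X \<omega>))\<^sup>2 + (norm (Y \<omega>))\<^sup>2)"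
        using Cauchy_Schwarz_ineq2[of "X \<omega>" "Y \<omega>"] by simp
    qed
  qed measurable
qed

lemma (in finite_measure) L2_integrable:
  assumes "L2 M X"
  shows "integrable M X"
proof -
  note [measurable] = L2D(1)[OF assms]
  have "integrable M (\<lambda>\<omega>. 1 + (norm (X \<omega>))\<^sup>2)" using L2D(2)[OF assms] by simp
  then show ?thesis
    by (rule Bochner_Integration.integrable_bound) (auto intro!: AE_I2 le_one_plus_square)
qed

lemma (in prob_space) integral_norm_le_L2:
  assumes "L2 M X"
  shows "(LINT \<omega>|M. norm (X \<omega>)) \<le> sqrt (LINT \<omega>|M. (norm (X \<omega>))\<^sup>2)"
proof -
  let ?m = "LINT \<omega>|M. norm (X \<omega>)"
  have i: "integrable M (\<lambda>\<omega>. norm (X \<omega>))" "integrable M (\<lambda>\<omega>. (norm (X \<omega>))\<^sup>2)"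
    using L2_integrable[OF assms] L2D[OF assms] by auto
  have "0 \<le> (LINT \<omega>|M. (norm (X \<omega>) - ?m)\<^sup>2)" by simp
  also have "\<dots> = (LINT \<omega>|M. (norm (X \<omega>))\<^sup>2) - ?m\<^sup>2"
    using variance_eq[OF i] by simp
  finally show ?thesis by (intro real_le_rsqrt) simp
qed

text \<open>
  Independence of the sub-sigma-algebra \<open>G\<close> and the random element \<open>Y\<close> of law \<open>P\<close>; the library's
  \<open>indep_var\<close> does not apply because it needs both random elements to have the same type.
\<close>

definition fresh :: "'a measure \<Rightarrow> 'a measure \<Rightarrow> 'x measure \<Rightarrow> ('a \<Rightarrow> 'x) \<Rightarrow> bool" where
  "fresh M G P Y \<longleftrightarrow> subalgebra M G \<and> Y \<in> measurable M P \<and> distr M P Y = P \<and>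
     distr M (G \<Otimes>\<^sub>M P) (\<lambda>\<omega>. (\<omega>, Y \<omega>)) = distr M G (\<lambda>\<omega>. \<omega>) \<Otimes>\<^sub>M P"

section \<open>Integration against a datum independent of the past\<close>

lemma subalgebra_ident: "subalgebra M G \<Longrightarrow> (\<lambda>\<omega>. \<omega>) \<in> measurable M G"
  by (rule measurable_from_subalg[OF _ measurable_ident_sets[OF refl]])

text \<open>Fubini for the pair of past and datum: the datum is integrated first with the past held
  fixed. Conditioning on the past is carried out in this form below.\<close>

lemma (in prob_space) freeze_integral:
  fixes h :: "'a \<times> 'x \<Rightarrow> real"
  assumes fresh: "fresh M G P Y"
    and h[measurable]: "h \<in> borel_measurable (G \<Otimes>\<^sub>M P)" and int: "integrable M (\<lambda>\<omega>. h (\<omega>, Y \<omega>))"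
  shows "(LINT \<omega>|M. h (\<omega>, Y \<omega>)) = (LINT \<omega>|M. LINT d|P. h (\<omega>, d))"
proof -
  have id[measurable]: "(\<lambda>\<omega>. \<omega>) \<in> measurable M G" and Y[measurable]: "Y \<in> measurable M P"
    and law: "distr M P Y = P"
    and eq: "distr M G (\<lambda>\<omega>. \<omega>) \<Otimes>\<^sub>M P = distr M (G \<Otimes>\<^sub>M P) (\<lambda>\<omega>. (\<omega>, Y \<omega>))"
    using fresh by (auto simp: fresh_def intro: subalgebra_ident)
  interpret P: prob_space P using prob_space_distr[OF Y] by (simp add: law)
  interpret Q: prob_space "distr M G (\<lambda>\<omega>. \<omega>)" by (rule prob_space_distr) measurable
  interpret QP: pair_sigma_finite "distr M G (\<lambda>\<omega>. \<omega>)" P ..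
  have pair[measurable]: "(\<lambda>\<omega>. (\<omega>, Y \<omega>)) \<in> measurable M (G \<Otimes>\<^sub>M P)" by measurable
  have i: "integrable (distr M G (\<lambda>\<omega>. \<omega>) \<Otimes>\<^sub>M P) h"
    unfolding eq using int by (subst integrable_distr_eq) auto
  have "(LINT \<omega>|M. h (\<omega>, Y \<omega>)) = integral\<^sup>L (distr M G (\<lambda>\<omega>. \<omega>) \<Otimes>\<^sub>M P) h"
    unfolding eq by (subst integral_distr) auto
  also have "\<dots> = (LINT \<omega>|distr M G (\<lambda>\<omega>. \<omega>). LINT d|P. h (\<omega>, d))"
    by (rule QP.integral_fst'[OF i, symmetric])
  also have "\<dots> = (LINT \<omega>|M. LINT d|P. h (\<omega>, d))"
    by (rule integral_distr) measurable
  finally show ?thesis .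
qed

lemma (in prob_space) integral_mult_fresh:
  fixes a :: "'a \<Rightarrow> real" and b :: "'x \<Rightarrow> real"
  assumes fresh: "fresh M G P Y"
    and a[measurable]: "a \<in> borel_measurable G" and ai: "integrable M a" and b: "integrable P b"
  shows "integrable M (\<lambda>\<omega>. a \<omega> * b (Y \<omega>))"
    and "(LINT \<omega>|M. a \<omega> * b (Y \<omega>)) = (LINT \<omega>|M. a \<omega>) * (LINT d|P. b d)"
proof -
  have id[measurable]: "(\<lambda>\<omega>. \<omega>) \<in> measurable M G" and Y[measurable]: "Y \<in> measurable M P"
    and law: "distr M P Y = P"
    and eq: "distr M G (\<lambda>\<omega>. \<omega>) \<Otimes>\<^sub>M P = distr M (G \<Otimes>\<^sub>M P) (\<lambda>\<omega>. (\<omega>, Y \<omega>))"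
    using fresh by (auto simp: fresh_def intro: subalgebra_ident)
  have [measurable]: "b \<in> borel_measurable P" using b by simp
  interpret P: prob_space P using prob_space_distr[OF Y] by (simp add: law)
  interpret Q: prob_space "distr M G (\<lambda>\<omega>. \<omega>)" by (rule prob_space_distr) measurable
  interpret QP: pair_sigma_finite "distr M G (\<lambda>\<omega>. \<omega>)" P ..
  have pair[measurable]: "(\<lambda>\<omega>. (\<omega>, Y \<omega>)) \<in> measurable M (G \<Otimes>\<^sub>M P)" by measurable
  have "integrable (distr M G (\<lambda>\<omega>. \<omega>)) (\<lambda>\<omega>. \<bar>a \<omega>\<bar> * (LINT d|P. \<bar>b d\<bar>))"
    using ai by (intro integrable_mult_left) (simp add: integrable_distr_eq)
  then have "integrable (distr M G (\<lambda>\<omega>. \<omega>) \<Otimes>\<^sub>M P) (\<lambda>(\<omega>, d). a \<omega> * b d)"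
    using b by (intro QP.Fubini_integrable) (auto simp: abs_mult)
  then have i: "integrable (distr M (G \<Otimes>\<^sub>M P) (\<lambda>\<omega>. (\<omega>, Y \<omega>))) (\<lambda>p. a (fst p) * b (snd p))"
    unfolding eq by (simp add: case_prod_beta')
  then show 1: "integrable M (\<lambda>\<omega>. a \<omega> * b (Y \<omega>))"
    by (subst (asm) integrable_distr_eq) auto
  show "(LINT \<omega>|M. a \<omega> * b (Y \<omega>)) = (LINT \<omega>|M. a \<omega>) * (LINT d|P. b d)"
    using freeze_integral[OF fresh, of "\<lambda>p. a (fst p) * b (snd p)"] 1 by simp
qed

text \<open>With exact solves the iterates are functions of the data, so this is their filtration.
  As a pullback along one tuple, each of its events is the preimage of a product-measurable set,
  which reduces independence of the next datum to that of disjoint groups of data.\<close>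

definition history :: "'a measure \<Rightarrow> 'x measure \<Rightarrow> (nat \<Rightarrow> 'a \<Rightarrow> 'x) \<Rightarrow> nat \<Rightarrow> 'a measure" where
  "history M P \<xi> t = vimage_algebra (space M) (\<lambda>\<omega>. \<lambda>i\<in>{..<t}. \<xi> i \<omega>) (\<Pi>\<^sub>M i\<in>{..<t}. P)"

context
  fixes M :: "'a measure" and P :: "'x measure" and \<xi> :: "nat \<Rightarrow> 'a \<Rightarrow> 'x"
  assumes rv: "\<And>t. \<xi> t \<in> measurable M P"
begin

lemma hist_measurable: "(\<lambda>\<omega>. \<lambda>i\<in>{..<t}. \<xi> i \<omega>) \<in> measurable M (\<Pi>\<^sub>M i\<in>{..<t}. P)"
  by (intro measurable_restrict rv)

lemma subalgebra_history: "subalgebra M (history M P \<xi> t)"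
  unfolding subalgebra_def history_def
  using sets_image_in_sets[OF refl hist_measurable] by simp

lemma measurable_history: "i < t \<Longrightarrow> \<xi> i \<in> measurable (history M P \<xi> t) P"
proof -
  assume i: "i < t"
  have 1: "(\<lambda>\<omega>. \<lambda>i\<in>{..<t}. \<xi> i \<omega>) \<in> measurable (history M P \<xi> t) (\<Pi>\<^sub>M i\<in>{..<t}. P)"
    unfolding history_def using hist_measurable[of t] by (intro measurable_vimage_algebra1) (auto simp: measurable_def)
  have "(\<lambda>f. f i) \<circ> (\<lambda>\<omega>. \<lambda>i\<in>{..<t}. \<xi> i \<omega>) \<in> measurable (history M P \<xi> t) P"
    by (rule measurable_comp[OF 1]) (use i in auto)
  then show ?thesis using i by (simp add: comp_def)
qed

lemma history_mono: "s \<le> t \<Longrightarrow> sets (history M P \<xi> s) \<subseteq> sets (history M P \<xi> t)"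
proof -
  assume s: "s \<le> t"
  have "(\<lambda>\<omega>. \<lambda>i\<in>{..<s}. \<xi> i \<omega>) \<in> measurable (history M P \<xi> t) (\<Pi>\<^sub>M i\<in>{..<s}. P)"
    using s by (intro measurable_restrict measurable_history) auto
  then show ?thesis
    unfolding history_def[of M P \<xi> s] by (intro sets_image_in_sets) (auto simp: history_def)
qed

end

lemma (in prob_space) fresh_history:
  assumes indep: "indep_vars (\<lambda>_. P) \<xi> UNIV" and law: "\<And>t. distr M P (\<xi> t) = P"
  shows "fresh M (history M P \<xi> t) P (\<xi> t)"
proof -
  have rv: "\<xi> t \<in> measurable M P" for t using indep unfolding indep_vars_def2 by simp
  let ?G = "history M P \<xi> t" and ?h = "\<lambda>\<omega>. \<lambda>i\<in>{..<t}. \<xi> i \<omega>"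
  have sub: "subalgebra M ?G" by (rule subalgebra_history[OF rv])
  then have id[measurable]: "(\<lambda>\<omega>. \<omega>) \<in> measurable M ?G"
    by (rule subalgebra_ident)
  note [measurable] = rv
  interpret P: prob_space P using prob_space_distr[OF rv] by (simp add: law)
  interpret Q: prob_space "distr M ?G (\<lambda>\<omega>. \<omega>)" by (rule prob_space_distr) measurable
  interpret QP: pair_sigma_finite "distr M ?G (\<lambda>\<omega>. \<omega>)" P ..
  have "distr M ?G (\<lambda>\<omega>. \<omega>) \<Otimes>\<^sub>M P = distr M (?G \<Otimes>\<^sub>M P) (\<lambda>\<omega>. (\<omega>, \<xi> t \<omega>))"
  proof (rule pair_measure_eqI)
    show "sigma_finite_measure (distr M ?G (\<lambda>\<omega>. \<omega>))" "sigma_finite_measure P" by unfold_locales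
    fix A C assume A: "A \<in> sets (distr M ?G (\<lambda>\<omega>. \<omega>))" and C: "C \<in> sets P"
    have "A \<in> {?h -` A' \<inter> space M | A'. A' \<in> sets (\<Pi>\<^sub>M i\<in>{..<t}. P)}"
      using A hist_measurable[where M=M and P=P and \<xi>=\<xi> and t=t, OF rv]
      by (simp add: history_def sets_vimage_algebra2 measurable_def Pi_iff)
    then obtain A' where A': "A' \<in> sets (\<Pi>\<^sub>M i\<in>{..<t}. P)" "A = ?h -` A' \<inter> space M" by blast
    \<comment> \<open>The new datum is viewed as a function on \<open>{t}\<close>, which gives it
      the same type as the tuple of its predecessors.\<close>
    let ?C = "{f \<in> space (\<Pi>\<^sub>M i\<in>{t}. P). f t \<in> C}"
    have C': "?C \<in> sets (\<Pi>\<^sub>M i\<in>{t}. P)"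
      using C by measurable
    have AM: "A \<in> sets M" using A sub by (auto simp: subalgebra_def)
    have sp: "\<xi> t \<omega> \<in> space P" if "\<omega> \<in> space M" for \<omega> using measurable_space[OF rv that] .
    have "indep_var (\<Pi>\<^sub>M i\<in>{..<t}. P) ?h (\<Pi>\<^sub>M i\<in>{t}. P) (\<lambda>\<omega>. \<lambda>i\<in>{t}. \<xi> i \<omega>)"
      by (rule indep_var_restrict[OF indep]) auto
    from indep_varD[OF this A'(1) C']
    have "prob ((\<lambda>\<omega>. (?h \<omega>, \<lambda>i\<in>{t}. \<xi> i \<omega>)) -` (A' \<times> ?C) \<inter> space M)
      = prob (?h -` A' \<inter> space M) * prob ((\<lambda>\<omega>. \<lambda>i\<in>{t}. \<xi> i \<omega>) -` ?C \<inter> space M)" .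
    also have "(\<lambda>\<omega>. (?h \<omega>, \<lambda>i\<in>{t}. \<xi> i \<omega>)) -` (A' \<times> ?C) \<inter> space M = A \<inter> (\<xi> t -` C \<inter> space M)"
      using sp by (auto simp: A'(2) space_PiM)
    also have "(\<lambda>\<omega>. \<lambda>i\<in>{t}. \<xi> i \<omega>) -` ?C \<inter> space M = \<xi> t -` C \<inter> space M"
      using sp by (auto simp: space_PiM)
    also have "prob (\<xi> t -` C \<inter> space M) = measure P C"
      using measure_distr[OF rv C] law by simp
    finally have "prob (A \<inter> (\<xi> t -` C \<inter> space M)) = prob A * measure P C"
      unfolding A'(2)[symmetric] .
    moreover have "(\<lambda>\<omega>. (\<omega>, \<xi> t \<omega>)) -` (A \<times> C) \<inter> space M = A \<inter> (\<xi> t -` C \<inter> space M)"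
      using sets.sets_into_space[OF AM] by auto
    moreover have AxC: "A \<times> C \<in> sets (?G \<Otimes>\<^sub>M P)" using A C by simp
    moreover have "emeasure (distr M (?G \<Otimes>\<^sub>M P) (\<lambda>\<omega>. (\<omega>, \<xi> t \<omega>))) (A \<times> C) = ennreal (prob ((\<lambda>\<omega>. (\<omega>, \<xi> t \<omega>)) -` (A \<times> C) \<inter> space M))"
      using AxC by (subst emeasure_distr) (auto simp: emeasure_eq_measure)
    moreover have "emeasure (distr M ?G (\<lambda>\<omega>. \<omega>)) A = ennreal (prob A)"
    proof -
      have "(\<lambda>\<omega>. \<omega>) -` A \<inter> space M = A" using sets.sets_into_space[OF AM] by auto
      then show ?thesis using A by (subst emeasure_distr) (auto simp: emeasure_eq_measure)
    qed
    ultimately show "emeasure (distr M ?G (\<lambda>\<omega>. \<omega>)) A * emeasure P C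
      = emeasure (distr M (?G \<Otimes>\<^sub>M P) (\<lambda>\<omega>. (\<omega>, \<xi> t \<omega>))) (A \<times> C)"
      by (simp add: P.emeasure_eq_measure ennreal_mult)
  qed simp
  then show ?thesis using sub rv law by (simp add: fresh_def)
qed

text \<open>Pythagoras: each increment is orthogonal to the sum of its predecessors, so second
  moments add.\<close>

lemma (in prob_space) martingale_norm_square:
  fixes n :: "nat \<Rightarrow> 'a \<Rightarrow> 'b::euclidean_space"
  assumes L: "\<And>t. L2 M (n t)"
    and orth: "\<And>t. (LINT \<omega>|M. (\<Sum>i<t. n i \<omega>) \<bullet> n t \<omega>) = 0"
  shows "(LINT \<omega>|M. (norm (\<Sum>i<t. n i \<omega>))\<^sup>2) = (\<Sum>i<t. LINT \<omega>|M. (norm (n i \<omega>))\<^sup>2)"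
proof (induction t)
  case (Suc t)
  have S: "L2 M (\<lambda>\<omega>. \<Sum>i<t. n i \<omega>)" by (intro L2_sum L) auto
  have eq: "(norm (\<Sum>i<Suc t. n i \<omega>))\<^sup>2
      = (norm (\<Sum>i<t. n i \<omega>))\<^sup>2 + (2 * ((\<Sum>i<t. n i \<omega>) \<bullet> n t \<omega>) + (norm (n t \<omega>))\<^sup>2)" for \<omega>
    by (simp add: power2_norm_eq_inner inner_add_left inner_add_right inner_commute[of "n t \<omega>" "\<Sum>i<t. n i \<omega>"])
  show ?case
    unfolding eq using L2D(2)[OF S] L2D(2)[OF L[of t]] L2_inner_integrable[OF S L[of t]] orth[of t]
    by (simp add: Suc.IH)
qed simp

text \<open>From ln (1 + 1/s) <= 1/s and exp y >= 1 + y. In a unit step s^(-q) loses at most the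
  fraction q/s, so a multiple of it can dominate a recursion that contracts faster.\<close>

lemma powr_Suc_ge:
  fixes s q :: real
  assumes "0 < s" "0 \<le> q"
  shows "s powr (-q) * (1 - q / s) \<le> (s + 1) powr (-q)"
proof -
  have "1 - q / s \<le> 1 - q * ln (1 + 1 / s)"
    using ln_add_one_self_le_self[of "1 / s"] assms by (simp add: mult_left_mono) (metis mult_left_mono mult.right_neutral times_divide_eq_right)
  also have "\<dots> \<le> exp (- q * ln (1 + 1 / s))" using exp_ge_add_one_self[of "- q * ln (1 + 1 / s)"] by simp
  also have "\<dots> = (1 + 1 / s) powr (-q)"
  proof -
    have "0 < 1 + 1 / s" using assms by (simp add: add_pos_pos)
    then show ?thesis by (simp add: powr_def)
  qed
  finally have "s powr (-q) * (1 - q / s) \<le> s powr (-q) * (1 + 1 / s) powr (-q)"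
    by (intro mult_left_mono) auto
  also have "\<dots> = (s + 1) powr (-q)" proof -
    have "s * (1 + 1 / s) = s + 1" using assms by (simp add: distrib_left)
    moreover have "0 \<le> 1 + 1 / s" using assms by simp
    ultimately show ?thesis using assms by (metis less_imp_le powr_mult)
  qed
  finally show ?thesis .
qed

text \<open>Chung's lemma: a multiple of s^(-q) is a supersolution, because the surplus
  \<open>p - q\<close> of contraction absorbs the noise. The bound on \<open>q\<close> by 1 enters
  through 1/s <= s^(-q).\<close>

lemma recursion_rate:
  fixes v :: "nat \<Rightarrow> real"
  assumes q: "0 < q" "q < p" "q \<le> 1" and "0 \<le> c"
    and rec: "\<And>t. m \<le> t \<Longrightarrow> v (Suc t) \<le> (1 - p / real (Suc t)) * v t + c / (real (Suc t))\<^sup>2"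
  obtains C where "0 \<le> C" "\<And>t. m \<le> t \<Longrightarrow> v t \<le> C * real (Suc t) powr (-q)"
proof -
  \<comment> \<open>Beyond \<open>p\<close> the contraction factor is nonnegative, so the induction
    hypothesis may be multiplied by it.\<close>
  define m' where "m' = max m (nat \<lceil>p\<rceil>)"
  \<comment> \<open>The sum dominates all initial values at once; \<open>c / (p - q)\<close> lets
    the surplus of contraction absorb the noise.\<close>
  define C where "C = (\<Sum>t\<le>m'. \<bar>v t\<bar> * real (Suc t) powr q) + c / (p - q)"
  have C1: "c \<le> C * (p - q)" and C0: "0 \<le> C"
  proof -
    have "c / (p - q) \<le> C" unfolding C_def by (simp add: sum_nonneg)
    then show "c \<le> C * (p - q)" using q by (simp add: pos_divide_le_eq)
    show "0 \<le> C" unfolding C_def using q \<open>0 \<le> c\<close> by (intro add_nonneg_nonneg sum_nonneg) auto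
  qed
  have early: "v t \<le> C * real (Suc t) powr (-q)" if "t \<le> m'" for t
  proof -
    have "\<bar>v t\<bar> * real (Suc t) powr q \<le> (\<Sum>t\<le>m'. \<bar>v t\<bar> * real (Suc t) powr q)"
      using that by (intro member_le_sum) auto
    also have "\<dots> \<le> C" unfolding C_def using q \<open>0 \<le> c\<close> by simp
    finally have "\<bar>v t\<bar> * real (Suc t) powr q * real (Suc t) powr (-q) \<le> C * real (Suc t) powr (-q)"
      by (intro mult_right_mono) auto
    moreover have "real (Suc t) powr q * real (Suc t) powr (-q) = 1" by (simp flip: powr_add)
    ultimately have "\<bar>v t\<bar> \<le> C * real (Suc t) powr (-q)" by (simp only: mult.assoc mult_1_right)
    then show ?thesis by linarith
  qed
  have late: "v t \<le> C * real (Suc t) powr (-q)" if "m' \<le> t" for t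
    using that
  proof (induction t rule: dec_induct)
    case base then show ?case by (rule early) simp
  next
    case (step t)
    define s where "s = real (Suc t)"
    have s: "1 \<le> s" by (simp add: s_def)
    have "p \<le> s" using step.hyps unfolding m'_def s_def by linarith
    then have "0 \<le> 1 - p / s" using s by simp
    have "m \<le> t" using step.hyps by (simp add: m'_def)
    have "v (Suc t) \<le> (1 - p / s) * v t + c / s\<^sup>2" using rec[OF \<open>m \<le> t\<close>] by (simp add: s_def)
    also have "\<dots> \<le> (1 - p / s) * (C * s powr (-q)) + c / s\<^sup>2"
      using step.IH \<open>0 \<le> 1 - p / s\<close> by (intro add_right_mono mult_left_mono) (auto simp: s_def)
    also have "c / s\<^sup>2 \<le> C * (p - q) / s * s powr (-q)"
    proof -
      have "s powr (-1) \<le> s powr (-q)" using s q by (intro powr_mono) auto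
      then have "1 / s \<le> s powr (-q)" using s by (simp add: powr_minus_divide)
      have "c / s\<^sup>2 = c / s * (1 / s)" by (simp add: power2_eq_square)
      also have "\<dots> \<le> C * (p - q) / s * s powr (-q)"
        using s C1 \<open>0 \<le> c\<close> \<open>1 / s \<le> s powr (-q)\<close> by (intro mult_mono divide_right_mono) auto
      finally show ?thesis .
    qed
    also have "(1 - p / s) * (C * s powr (-q)) + C * (p - q) / s * s powr (-q) = C * (s powr (-q) * (1 - q / s))"
      using s by (simp add: field_simps)
    also have "\<dots> \<le> C * (s + 1) powr (-q)"
      using C0 powr_Suc_ge[of s q] s q by (intro mult_left_mono) auto
    finally show ?case by (simp add: s_def add.commute)
  qed
  show thesis
    using that[OF C0] early late nat_le_linear by blast
qed

lemma cesaro_null: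
  fixes a :: "nat \<Rightarrow> real"
  assumes "a \<longlonglongrightarrow> 0"
  shows "(\<lambda>n. (\<Sum>i<n. a i) / real n) \<longlonglongrightarrow> 0"
proof (rule LIMSEQ_I)
  fix r :: real assume "0 < r"
  obtain N where N: "\<And>n. N \<le> n \<Longrightarrow> \<bar>a n\<bar> < r / 2"
    using LIMSEQ_D[OF assms, of "r / 2"] \<open>0 < r\<close> by auto
  define K where "K = (\<Sum>i<N. \<bar>a i\<bar>)"
  obtain N' where N': "2 * K / r < real N'" using reals_Archimedean2 by blast
  show "\<exists>no. \<forall>n\<ge>no. norm ((\<Sum>i<n. a i) / real n - 0) < r"
  proof (intro exI[of _ "max (Suc N) N'"] allI impI)
    fix n assume n: "max (Suc N) N' \<le> n"
    then have "real N' \<le> real n" by simp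
    then have "2 * K / r < real n" using N' by linarith
    then have Kn: "K < r / 2 * real n" using \<open>0 < r\<close> by (simp add: field_simps)
    have "\<bar>\<Sum>i<n. a i\<bar> \<le> (\<Sum>i<n. \<bar>a i\<bar>)" by (rule sum_abs)
    also have "\<dots> = K + (\<Sum>i=N..<n. \<bar>a i\<bar>)"
      unfolding K_def using n by (simp add: lessThan_atLeast0 sum.atLeastLessThan_concat)
    also have "(\<Sum>i=N..<n. \<bar>a i\<bar>) \<le> (\<Sum>i=N..<n. r / 2)" using N by (intro sum_mono) (auto intro: less_imp_le)
    also have "\<dots> \<le> r / 2 * real n" using \<open>0 < r\<close> n by (simp add: field_simps)
    finally have "\<bar>\<Sum>i<n. a i\<bar> < r * real n" using Kn by linarith
    then show "norm ((\<Sum>i<n. a i) / real n - 0) < r" using n by (simp add: field_simps)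
  qed
qed

text \<open>Telescoping of 4 s^(1/4): by concavity a step up to s adds at least s^(-3/4). The
  concavity estimate comes from Bernoulli's inequality for the fourth power.\<close>

lemma sum_powr_le: "(\<Sum>t<n. real (Suc t) powr (-3/4)) \<le> 4 * real n powr (1/4)"
proof (induction n)
  case (Suc n)
  define s where "s = real (Suc n)"
  have s: "1 \<le> s" by (simp add: s_def)
  have "1 + real 4 * (- 1 / (4 * s)) \<le> (1 + (- 1 / (4 * s))) ^ 4"
    by (rule Bernoulli_inequality) (use s in \<open>simp add: field_simps\<close>)
  then have "1 - 1 / s \<le> (1 - 1 / (4 * s)) ^ 4" using s by simp
  then have "(1 - 1 / s) powr (1/4) \<le> ((1 - 1 / (4 * s)) ^ 4) powr (1/4)"
    using s by (intro powr_mono2) auto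
  also have "\<dots> = 1 - 1 / (4 * s)"
  proof -
    define y where "y = 1 - 1 / (4 * s)"
    have y: "0 < y" using s by (simp add: y_def field_simps)
    then have "y ^ 4 = y powr 4" by simp
    then have "(y ^ 4) powr (1/4) = y powr (4 * (1/4))" by (simp only: powr_powr)
    then show ?thesis using y by (simp add: y_def)
  qed
  finally have b: "(1 - 1 / s) powr (1/4) \<le> 1 - 1 / (4 * s)" .
  have "real n = s * (1 - 1 / s)" using s by (simp add: s_def field_simps)
  then have "4 * real n powr (1/4) = 4 * (s powr (1/4) * (1 - 1 / s) powr (1/4))"
    using s by (simp add: powr_mult)
  also have "\<dots> \<le> 4 * (s powr (1/4) * (1 - 1 / (4 * s)))" using b by (intro mult_left_mono) auto
  also have "\<dots> = 4 * s powr (1/4) - s powr (1/4) / s" using s by (simp add: field_simps)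
  also have "s powr (1/4) / s = s powr (-3/4)"
    using s powr_diff[of s "1/4" 1] by simp
  finally show ?case using Suc by (simp add: s_def)
qed simp

section \<open>The exact stochastic Newton iteration\<close>

text \<open>By Cramer's rule the solution consists of quotients of determinants, which are
  polynomials in measurable entries.\<close>

lemma borel_measurable_matrix_inv_vec:
  fixes A :: "'a \<Rightarrow> real^'n^'n" and b :: "'a \<Rightarrow> real^'n"
  assumes A: "A \<in> borel_measurable M" and b: "b \<in> borel_measurable M"
    and inv: "\<And>\<omega>. \<omega> \<in> space M \<Longrightarrow> invertible (A \<omega>)"
  shows "(\<lambda>\<omega>. matrix_inv (A \<omega>) *v b \<omega>) \<in> borel_measurable M"
proof -
  have det: "(\<lambda>\<omega>. det (C \<omega>)) \<in> borel_measurable M" if "\<And>i j. (\<lambda>\<omega>. C \<omega> $ i $ j) \<in> borel_measurable M"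
    for C :: "'a \<Rightarrow> real^'n^'n"
    unfolding det_def by (intro borel_measurable_sum borel_measurable_times borel_measurable_const borel_measurable_prod that)
  have Aij: "(\<lambda>\<omega>. A \<omega> $ i $ j) \<in> borel_measurable M" for i j
    by (intro borel_measurable_vec_nth A)
  have bi: "(\<lambda>\<omega>. b \<omega> $ i) \<in> borel_measurable M" for i
    by (intro borel_measurable_vec_nth b)
  have "(\<lambda>\<omega>. \<chi> k. det (\<chi> i j. if j = k then b \<omega> $ i else A \<omega> $ i $ j) / det (A \<omega>)) \<in> borel_measurable M"
  proof (intro borel_measurable_vecI)
    fix k
    have "(\<lambda>\<omega>. det (\<chi> i j. if j = k then b \<omega> $ i else A \<omega> $ i $ j)) \<in> borel_measurable M"
      by (intro det) (use Aij bi in simp)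
    then show "(\<lambda>\<omega>. (\<chi> k. det (\<chi> i j. if j = k then b \<omega> $ i else A \<omega> $ i $ j) / det (A \<omega>)) $ k) \<in> borel_measurable M"
      using det[OF Aij] by simp
  qed
  moreover have "matrix_inv (A \<omega>) *v b \<omega> = (\<chi> k. det (\<chi> i j. if j = k then b \<omega> $ i else A \<omega> $ i $ j) / det (A \<omega>))"
    if "\<omega> \<in> space M" for \<omega>
    using cramer[of "A \<omega>" "matrix_inv (A \<omega>) *v b \<omega>" "b \<omega>"] inv[OF that] matrix_inv_mult_vec(1)[OF inv[OF that]]
    by (simp add: invertible_det_nz)
  ultimately show ?thesis by (simp cong: measurable_cong)
qed

lemma integrable_mult_unit:
  fixes h \<kappa> :: "'a \<Rightarrow> real"
  assumes "integrable M h" "\<kappa> \<in> borel_measurable M" "\<And>\<omega>. 0 \<le> \<kappa> \<omega>" "\<And>\<omega>. \<kappa> \<omega> \<le> 1"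
  shows "integrable M (\<lambda>\<omega>. \<kappa> \<omega> * h \<omega>)"
  by (rule Bochner_Integration.integrable_bound[OF assms(1)])
    (use assms in \<open>auto simp: abs_mult intro!: AE_I2 mult_left_le_one_le\<close>)

text \<open>The iteration with step 1/(t+1), reduced to the inequalities of the analysis: one pair
  \<open>c\<close>, \<open>U\<close> bounds sample and population curvature, and one
  \<open>L\<close> bounds both the Taylor remainder and the variation of \<open>Hf\<close>, the
  latter in the Frobenius norm. The filtration is abstract: earlier data are measurable and the
  current datum is fresh.\<close>

locale stochastic_newton = prob_space M for M :: "'a measure" +
  fixes \<G> :: "nat \<Rightarrow> 'a measure" and P :: "'x measure" and \<xi> :: "nat \<Rightarrow> 'a \<Rightarrow> 'x"
    and G :: "real^'d \<Rightarrow> 'x \<Rightarrow> real^'d" and Hs :: "real^'d \<Rightarrow> 'x \<Rightarrow> real^'d^'d"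
    and f :: "real^'d \<Rightarrow> real" and gf :: "real^'d \<Rightarrow> real^'d" and Hf :: "real^'d \<Rightarrow> real^'d^'d"
    and xs x0 :: "real^'d" and Bs B0 :: "real^'d^'d" and c U L :: real
    and x :: "nat \<Rightarrow> 'a \<Rightarrow> real^'d" and B :: "nat \<Rightarrow> 'a \<Rightarrow> real^'d^'d"
  assumes fresh: "\<And>t. fresh M (\<G> t) P (\<xi> t)"
    and adapted: "\<And>i t. i < t \<Longrightarrow> \<xi> i \<in> measurable (\<G> t) P"
    and filtration: "\<And>s t. s \<le> t \<Longrightarrow> sets (\<G> s) \<subseteq> sets (\<G> t)"
    and G_measurable: "(\<lambda>p. G (fst p) (snd p)) \<in> borel_measurable (borel \<Otimes>\<^sub>M P)"
    and Hs_measurable: "(\<lambda>p. Hs (fst p) (snd p)) \<in> borel_measurable (borel \<Otimes>\<^sub>M P)"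
    and c: "0 < c" and U: "0 < U" and L: "0 \<le> L"
    and G_lip: "\<And>u w d. d \<in> space P \<Longrightarrow> norm (G u d - G w d) \<le> U * norm (u - w)"
    and Hs_sym: "\<And>u d. d \<in> space P \<Longrightarrow> transpose (Hs u d) = Hs u d"
    and Hs_low: "\<And>u d v. d \<in> space P \<Longrightarrow> c * (norm v)\<^sup>2 \<le> v \<bullet> (Hs u d *v v)"
    and Hs_up: "\<And>u d v. d \<in> space P \<Longrightarrow> v \<bullet> (Hs u d *v v) \<le> U * (norm v)\<^sup>2"
    and G_mean: "\<And>u. (LINT d|P. G u d) = gf u"
    and Hs_mean: "\<And>u. (LINT d|P. Hs u d) = Hf u"
    and G_square: "integrable P (\<lambda>d. (norm (G xs d))\<^sup>2)"
    and gf_xs: "gf xs = 0"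
    and gf_lip: "\<And>u w. norm (gf u - gf w) \<le> U * norm (u - w)"
    and gf_mono: "\<And>u w. c * (norm (u - w))\<^sup>2 \<le> (gf u - gf w) \<bullet> (u - w)"
    and f_cont: "continuous_on UNIV f"
    and f_descent: "\<And>u y. f y \<le> f u + (y - u) \<bullet> gf u + U * (norm (y - u))\<^sup>2"
    and f_gap: "\<And>u. c / 4 * (norm (u - xs))\<^sup>2 \<le> f u - f xs"
    and gf_taylor: "\<And>u. norm (gf u - Bs *v (u - xs)) \<le> L * (norm (u - xs))\<^sup>2"
    and Hf_lip: "\<And>u. norm (Hf u - Bs) \<le> L * norm (u - xs)"
    and Bs_low: "\<And>v. c * (norm v)\<^sup>2 \<le> v \<bullet> (Bs *v v)"
    and B0_sym: "transpose B0 = B0" and B0_low: "\<And>v. c * (norm v)\<^sup>2 \<le> v \<bullet> (B0 *v v)"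
    and B0_up: "\<And>v. v \<bullet> (B0 *v v) \<le> U * (norm v)\<^sup>2"
    and x_0: "\<And>\<omega>. \<omega> \<in> space M \<Longrightarrow> x 0 \<omega> = x0"
    and x_Suc: "\<And>t \<omega>. \<omega> \<in> space M \<Longrightarrow>
      x (Suc t) \<omega> = x t \<omega> - (1 / real (Suc t)) *\<^sub>R (matrix_inv (B t \<omega>) *v G (x t \<omega>) (\<xi> t \<omega>))"
    and B_eq: "\<And>t \<omega>. B t \<omega> = (if t = 0 then B0 else (1 / real t) *\<^sub>R (\<Sum>i<t. Hs (x i \<omega>) (\<xi> i \<omega>)))"
begin

section \<open>Measurability and spectral bounds along the iteration\<close>

lemma sub: "subalgebra M (\<G> t)" using fresh by (simp add: fresh_def)
lemma \<xi>_measurable [measurable]: "\<xi> t \<in> measurable M P" using fresh by (simp add: fresh_def)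
lemma \<xi>_space: "\<omega> \<in> space M \<Longrightarrow> \<xi> t \<omega> \<in> space P" using \<xi>_measurable by (rule measurable_space)
lemma \<xi>_law: "distr M P (\<xi> t) = P" using fresh by (simp add: fresh_def)
lemma space_\<G>: "space (\<G> t) = space M" using sub[of t] by (simp add: subalgebra_def)
lemma to_M: "h \<in> measurable (\<G> t) N \<Longrightarrow> h \<in> measurable M N" by (rule measurable_from_subalg[OF sub])
lemma \<G>_mono: "s \<le> t \<Longrightarrow> h \<in> measurable (\<G> s) N \<Longrightarrow> h \<in> measurable (\<G> t) N"
  by (rule measurable_from_subalg[of "\<G> t" "\<G> s"]) (auto simp: subalgebra_def space_\<G> filtration)
lemma prob_space_P: "prob_space P" using prob_space_distr[OF \<xi>_measurable[of 0]] by (simp add: \<xi>_law)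

lemma G_compose:
  assumes "u \<in> borel_measurable N" "h \<in> measurable N P"
  shows "(\<lambda>\<omega>. G (u \<omega>) (h \<omega>)) \<in> borel_measurable N"
  using measurable_compose[OF measurable_Pair[OF assms] G_measurable] by simp

lemma Hs_compose:
  assumes "u \<in> borel_measurable N" "h \<in> measurable N P"
  shows "(\<lambda>\<omega>. Hs (u \<omega>) (h \<omega>)) \<in> borel_measurable N"
  using measurable_compose[OF measurable_Pair[OF assms] Hs_measurable] by simp

lemma B_sym_aux:
  assumes "\<omega> \<in> space M"
  shows "transpose (B t \<omega>) = B t \<omega> \<and> c * (norm v)\<^sup>2 \<le> v \<bullet> (B t \<omega> *v v) \<and> v \<bullet> (B t \<omega> *v v) \<le> U * (norm v)\<^sup>2"
proof (cases "t = 0")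
  case True then show ?thesis using B0_sym B0_low B0_up by (simp add: B_eq)
next
  case False
  define S where "S = (\<Sum>i<t. Hs (x i \<omega>) (\<xi> i \<omega>))"
  have B: "B t \<omega> = (1 / real t) *\<^sub>R S" using False by (simp add: B_eq S_def)
  have "transpose S = (\<Sum>i<t. transpose (Hs (x i \<omega>) (\<xi> i \<omega>)))"
    by (simp add: S_def transpose_def vec_eq_iff)
  then have "transpose S = S" using Hs_sym \<xi>_space[OF assms] by (simp add: S_def)
  then have sym: "transpose (B t \<omega>) = B t \<omega>" unfolding B by (simp add: transpose_def vec_eq_iff)
  have Sv: "v \<bullet> (S *v v) = (\<Sum>i<t. v \<bullet> (Hs (x i \<omega>) (\<xi> i \<omega>) *v v))"
  proof -
    have "S *v v = (\<Sum>i<t. Hs (x i \<omega>) (\<xi> i \<omega>) *v v)"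
      unfolding S_def by (rule linear_sum[OF bounded_linear.linear[OF bounded_linear_matrix_vec_left]])
    then show ?thesis by (simp add: inner_sum_right)
  qed
  have "(\<Sum>i<t. c * (norm v)\<^sup>2) \<le> v \<bullet> (S *v v)" "v \<bullet> (S *v v) \<le> (\<Sum>i<t. U * (norm v)\<^sup>2)"
    unfolding Sv using Hs_low Hs_up \<xi>_space[OF assms] by (intro sum_mono; simp)+
  then show ?thesis
    using False sym unfolding B by (simp add: field_simps flip: scaleR_matrix_vector_assoc)
qed

lemma
  assumes "\<omega> \<in> space M"
  shows B_sym: "transpose (B t \<omega>) = B t \<omega>"
    and B_low: "c * (norm v)\<^sup>2 \<le> v \<bullet> (B t \<omega> *v v)"
    and B_up: "v \<bullet> (B t \<omega> *v v) \<le> U * (norm v)\<^sup>2"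
  using B_sym_aux[OF assms] by auto

lemma norm_B_le: "\<omega> \<in> space M \<Longrightarrow> norm (B t \<omega> *v v) \<le> U * norm v"
  by (rule PSD_norm_le[OF B_sym B_low _ B_up]) (use c U in auto)

lemma B_invertible: "\<omega> \<in> space M \<Longrightarrow> invertible (B t \<omega>)"
  by (rule invertible_if_coercive[OF c B_low])

lemma norm_B_inv_le: "\<omega> \<in> space M \<Longrightarrow> norm (matrix_inv (B t \<omega>) *v v) \<le> norm v / c"
  by (rule norm_matrix_inv_vec_le[OF c B_low])

lemma x_measurable: "x t \<in> borel_measurable (\<G> t)" and B_measurable: "B t \<in> borel_measurable (\<G> t)"
proof -
  \<comment> \<open>\<open>B t\<close> involves only earlier iterates; stated relative to them, this
    lets strong induction on \<open>x\<close> break the mutual dependence.\<close>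
  have B_from: "B t \<in> borel_measurable (\<G> t)" if "\<And>i. i < t \<Longrightarrow> x i \<in> borel_measurable (\<G> i)" for t
  proof (cases "t = 0")
    case True then have "B t = (\<lambda>\<omega>. B0)" by (simp add: B_eq fun_eq_iff)
    then show ?thesis by simp
  next
    case False
    have "(\<lambda>\<omega>. Hs (x i \<omega>) (\<xi> i \<omega>)) \<in> borel_measurable (\<G> t)" if "i < t" for i
      using \<G>_mono[of i t, OF _ \<open>\<And>i. i < t \<Longrightarrow> x i \<in> borel_measurable (\<G> i)\<close>] that adapted by (intro Hs_compose) auto
    then have "(\<lambda>\<omega>. (1 / real t) *\<^sub>R (\<Sum>i<t. Hs (x i \<omega>) (\<xi> i \<omega>))) \<in> borel_measurable (\<G> t)"
      by (intro borel_measurable_scaleR borel_measurable_const borel_measurable_sum) auto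
    moreover have "B t = (\<lambda>\<omega>. (1 / real t) *\<^sub>R (\<Sum>i<t. Hs (x i \<omega>) (\<xi> i \<omega>)))"
      using False by (simp add: B_eq fun_eq_iff)
    ultimately show ?thesis by simp
  qed
  have x: "x t \<in> borel_measurable (\<G> t)" for t
  proof (induction t rule: less_induct)
    case (less t)
    show ?case
    proof (cases t)
      case 0
      have "x 0 \<in> borel_measurable (\<G> 0) \<longleftrightarrow> (\<lambda>\<omega>. x0) \<in> borel_measurable (\<G> 0)"
        by (rule measurable_cong) (simp add: space_\<G> x_0)
      then show ?thesis using 0 by simp
    next
      case (Suc s)
      have xs: "x s \<in> borel_measurable (\<G> t)" using \<G>_mono[of s t] less.IH[of s] Suc by simp
      have Bs: "B s \<in> borel_measurable (\<G> t)" using \<G>_mono[of s t] B_from[of s] less.IH Suc by simp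
      have "(\<lambda>\<omega>. matrix_inv (B s \<omega>) *v G (x s \<omega>) (\<xi> s \<omega>)) \<in> borel_measurable (\<G> t)"
        using Suc by (intro borel_measurable_matrix_inv_vec Bs G_compose xs adapted B_invertible) (auto simp: space_\<G>)
      then have m: "(\<lambda>\<omega>. x s \<omega> - (1 / real (Suc s)) *\<^sub>R (matrix_inv (B s \<omega>) *v G (x s \<omega>) (\<xi> s \<omega>))) \<in> borel_measurable (\<G> t)"
        by (intro borel_measurable_diff xs borel_measurable_scaleR borel_measurable_const)
      have "x t \<in> borel_measurable (\<G> t) \<longleftrightarrow> (\<lambda>\<omega>. x s \<omega> - (1 / real (Suc s)) *\<^sub>R (matrix_inv (B s \<omega>) *v G (x s \<omega>) (\<xi> s \<omega>))) \<in> borel_measurable (\<G> t)"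
        by (rule measurable_cong) (simp only: space_\<G> Suc x_Suc)
      then show ?thesis using m by simp
    qed
  qed
  show "x t \<in> borel_measurable (\<G> t)" by (rule x)
  show "B t \<in> borel_measurable (\<G> t)" by (rule B_from) (rule x)
qed


section \<open>Error, noise and optimality gap\<close>

definition e where "e t \<omega> = x t \<omega> - xs"
definition g where "g t \<omega> = G (x t \<omega>) (\<xi> t \<omega>)"
definition \<eta> where "\<eta> t \<omega> = G xs (\<xi> t \<omega>)"
definition gap where "gap t \<omega> = f (x t \<omega>) - f xs"
definition s2 where "s2 = (LINT d|P. (norm (G xs d))\<^sup>2)"

lemma s2_nonneg: "0 \<le> s2" by (simp add: s2_def)

lemma gf_cont: "continuous_on UNIV gf"
proof (rule lipschitz_on_continuous_on)
  show "U-lipschitz_on UNIV gf" by (rule lipschitz_onI) (use gf_lip U in \<open>auto simp: dist_norm\<close>)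
qed

lemma G_xs_measurable [measurable]: "G xs \<in> borel_measurable P"
  using G_compose[of "\<lambda>_. xs" P "\<lambda>d. d"] by simp

lemma e_measurable: "e t \<in> borel_measurable (\<G> t)"
  unfolding e_def[abs_def] by (intro borel_measurable_diff x_measurable borel_measurable_const)

lemma gfx_measurable: "(\<lambda>\<omega>. gf (x t \<omega>)) \<in> borel_measurable (\<G> t)"
  by (rule borel_measurable_continuous_on[OF gf_cont x_measurable])

lemma gap_measurable: "gap t \<in> borel_measurable (\<G> t)"
  unfolding gap_def[abs_def] by (intro borel_measurable_diff borel_measurable_continuous_on[OF f_cont x_measurable] borel_measurable_const)

lemma g_measurable: "g t \<in> borel_measurable M"
  unfolding g_def[abs_def] by (intro G_compose to_M[OF x_measurable] \<xi>_measurable)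

lemma L2_\<eta>: "L2 M (\<eta> t)"
proof -
  have "integrable M (\<lambda>\<omega>. (norm (G xs (\<xi> t \<omega>)))\<^sup>2)"
    using G_square integrable_distr_eq[OF \<xi>_measurable[of t], of "\<lambda>d. (norm (G xs d))\<^sup>2"] by (simp add: \<xi>_law)
  then show ?thesis by (simp add: L2_def \<eta>_def[abs_def])
qed

lemma norm_g_le:
  assumes "\<omega> \<in> space M"
  shows "norm (g t \<omega>) \<le> norm (\<eta> t \<omega>) + U * norm (e t \<omega>)"
  using norm_triangle_sub[of "g t \<omega>" "\<eta> t \<omega>"] G_lip[OF \<xi>_space[OF assms], of "x t \<omega>" t xs]
  unfolding g_def \<eta>_def e_def by linarith

lemma norm_g_square_le:
  assumes "\<omega> \<in> space M"
  shows "(norm (g t \<omega>))\<^sup>2 \<le> 2 * (norm (\<eta> t \<omega>))\<^sup>2 + 2 * U\<^sup>2 * (norm (e t \<omega>))\<^sup>2"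
proof -
  have "(norm (g t \<omega>))\<^sup>2 \<le> (norm (\<eta> t \<omega>) + U * norm (e t \<omega>))\<^sup>2"
    by (intro power_mono norm_g_le assms) simp
  also have "\<dots> \<le> 2 * (norm (\<eta> t \<omega>))\<^sup>2 + 2 * (U * norm (e t \<omega>))\<^sup>2"
    using norm_add_square_le[of "norm (\<eta> t \<omega>)" "U * norm (e t \<omega>)"] by simp
  finally show ?thesis by (simp add: power_mult_distrib)
qed

lemma e_Suc:
  assumes "\<omega> \<in> space M"
  shows "e (Suc t) \<omega> = e t \<omega> - (1 / real (Suc t)) *\<^sub>R (matrix_inv (B t \<omega>) *v g t \<omega>)"
  unfolding e_def g_def x_Suc[OF assms] by simp

lemma L2_g_if: "L2 M (e t) \<Longrightarrow> L2 M (g t)"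
  by (rule L2_bound[OF L2_add[OF L2_norm[OF L2_\<eta>[of t]] L2_scale[OF L2_norm, of M "e t" U]]])
    (use g_measurable norm_g_le in \<open>auto intro: order_trans[OF _ abs_ge_self]\<close>)

lemma Binv_measurable:
  assumes "v \<in> borel_measurable M"
  shows "(\<lambda>\<omega>. matrix_inv (B t \<omega>) *v v \<omega>) \<in> borel_measurable M"
  by (intro borel_measurable_matrix_inv_vec to_M[OF B_measurable] assms B_invertible)

lemma L2_Binv:
  assumes "L2 M v"
  shows "L2 M (\<lambda>\<omega>. matrix_inv (B t \<omega>) *v v \<omega>)"
  by (rule L2_bound[OF L2_scale[OF assms, of "1 / c"]])
    (use c norm_B_inv_le Binv_measurable L2D(1)[OF assms] in auto)

lemma L2_e: "L2 M (e t)"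
proof (induction t)
  case 0
  show ?case
    by (rule L2_bound[OF L2_const[of "x0 - xs"] to_M[OF e_measurable]]) (simp add: e_def x_0)
next
  case (Suc t)
  have "L2 M (\<lambda>\<omega>. e t \<omega> - (1 / real (Suc t)) *\<^sub>R (matrix_inv (B t \<omega>) *v g t \<omega>))"
    by (intro L2_diff Suc L2_scale L2_Binv L2_g_if)
  then show ?case
    by (rule L2_bound[OF _ to_M[OF e_measurable]]) (simp add: e_Suc)
qed

lemma L2_g: "L2 M (g t)" by (rule L2_g_if[OF L2_e])

lemma norm_gf_le: "norm (gf (x t \<omega>)) \<le> U * norm (e t \<omega>)"
  using gf_lip[of "x t \<omega>" xs] by (simp add: gf_xs e_def)

lemma L2_gf: "L2 M (\<lambda>\<omega>. gf (x t \<omega>))"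
  by (rule L2_bound[OF L2_scale[OF L2_e[of t], of U] to_M[OF gfx_measurable]])
    (use norm_gf_le U in auto)

lemma G_integrable: "integrable P (G u)"
proof -
  interpret P: prob_space P by (rule prob_space_P)
  have m: "G u \<in> borel_measurable P" using G_compose[of "\<lambda>_. u" P "\<lambda>d. d"] by simp
  have "L2 P (G xs)" using G_square by (simp add: L2_def)
  from P.L2_integrable[OF this] have "integrable P (\<lambda>d. norm (G xs d) + U * norm (u - xs))"
    by simp
  then show ?thesis
  proof (rule Bochner_Integration.integrable_bound[OF _ m])
    show "AE d in P. norm (G u d) \<le> norm (norm (G xs d) + U * norm (u - xs))"
    proof (intro AE_I2)
      fix d assume "d \<in> space P"
      then show "norm (G u d) \<le> norm (norm (G xs d) + U * norm (u - xs))"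
        using norm_triangle_sub[of "G u d" "G xs d"] G_lip[of d u xs] by simp
    qed
  qed
qed

text \<open>With the past frozen, \<open>\<psi> \<omega>\<close> has mean zero under
  \<open>P\<close> while \<open>v \<omega>\<close> is constant. This removes the cross terms with
  gradient noise, Hessian noise and the summands of the limit theorem.\<close>

lemma orthogonal_fresh:
  fixes v :: "'a \<Rightarrow> 'v::euclidean_space"
  assumes v: "v \<in> borel_measurable (\<G> t)" "L2 M v"
    and \<psi>: "(\<lambda>p. \<psi> (fst p) (snd p)) \<in> borel_measurable (\<G> t \<Otimes>\<^sub>M P)"
    and mean: "\<And>\<omega>. \<omega> \<in> space M \<Longrightarrow> integrable P (\<psi> \<omega>)" "\<And>\<omega>. \<omega> \<in> space M \<Longrightarrow> (LINT d|P. \<psi> \<omega> d) = 0"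
    and L2: "L2 M (\<lambda>\<omega>. \<psi> \<omega> (\<xi> t \<omega>))"
  shows "(LINT \<omega>|M. v \<omega> \<bullet> \<psi> \<omega> (\<xi> t \<omega>)) = 0"
proof -
  note [measurable] = v(1) \<psi>
  have "(\<lambda>p. v (fst p) \<bullet> \<psi> (fst p) (snd p)) \<in> borel_measurable (\<G> t \<Otimes>\<^sub>M P)"
    by (intro borel_measurable_inner \<psi>) measurable
  from freeze_integral[OF fresh this]
  have "(LINT \<omega>|M. v \<omega> \<bullet> \<psi> \<omega> (\<xi> t \<omega>)) = (LINT \<omega>|M. LINT d|P. v \<omega> \<bullet> \<psi> \<omega> d)"
    using L2_inner_integrable[OF v(2) L2] by simp
  also have "\<dots> = (LINT \<omega>|M. 0)"
    by (rule Bochner_Integration.integral_cong) (use mean in auto)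
  finally show ?thesis by simp
qed

lemma orthogonal_noise:
  assumes v: "v \<in> borel_measurable (\<G> t)" "L2 M v"
  shows "(LINT \<omega>|M. v \<omega> \<bullet> g t \<omega>) = (LINT \<omega>|M. v \<omega> \<bullet> gf (x t \<omega>))"
proof -
  interpret P: prob_space P by (rule prob_space_P)
  define \<psi> where "\<psi> \<omega> d = G (x t \<omega>) d - gf (x t \<omega>)" for \<omega> d
  have "(LINT \<omega>|M. v \<omega> \<bullet> \<psi> \<omega> (\<xi> t \<omega>)) = 0"
  proof (rule orthogonal_fresh[OF v])
    note [measurable] = x_measurable gfx_measurable
    have "(\<lambda>p. G (x t (fst p)) (snd p)) \<in> borel_measurable (\<G> t \<Otimes>\<^sub>M P)"
      by (rule G_compose) measurable
    then show "(\<lambda>p. \<psi> (fst p) (snd p)) \<in> borel_measurable (\<G> t \<Otimes>\<^sub>M P)"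
      unfolding \<psi>_def by measurable
    show "integrable P (\<psi> \<omega>)" for \<omega> unfolding \<psi>_def using G_integrable by simp
    show "(LINT d|P. \<psi> \<omega> d) = 0" for \<omega>
      unfolding \<psi>_def using G_integrable by (simp add: G_mean P.prob_space)
    show "L2 M (\<lambda>\<omega>. \<psi> \<omega> (\<xi> t \<omega>))"
      unfolding \<psi>_def using L2_diff[OF L2_g L2_gf] by (simp add: g_def)
  qed
  then have "(LINT \<omega>|M. v \<omega> \<bullet> g t \<omega> - v \<omega> \<bullet> gf (x t \<omega>)) = 0"
    by (simp add: \<psi>_def g_def inner_diff_right)
  then show ?thesis
    using L2_inner_integrable[OF v(2) L2_g[of t]] L2_inner_integrable[OF v(2) L2_gf[of t]] by simp
qed

lemma integral_mult_\<eta>: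
  assumes "a \<in> borel_measurable (\<G> t)" "integrable M a"
  shows "integrable M (\<lambda>\<omega>. a \<omega> * (norm (\<eta> t \<omega>))\<^sup>2)"
    and "(LINT \<omega>|M. a \<omega> * (norm (\<eta> t \<omega>))\<^sup>2) = (LINT \<omega>|M. a \<omega>) * s2"
  using integral_mult_fresh[OF fresh assms G_square] by (auto simp: \<eta>_def s2_def)

lemma gap_le: "gap t \<omega> \<le> U * (norm (e t \<omega>))\<^sup>2"
  using f_descent[of "x t \<omega>" xs] by (simp add: gap_def e_def gf_xs)

lemma gap_ge: "c / 4 * (norm (e t \<omega>))\<^sup>2 \<le> gap t \<omega>"
  using f_gap[of "x t \<omega>"] by (simp add: gap_def e_def)

lemma gap_nonneg: "0 \<le> gap t \<omega>"
  by (rule order_trans[OF _ gap_ge]) (use c in simp)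

lemma gap_integrable: "integrable M (gap t)"
proof (rule Bochner_Integration.integrable_bound)
  show "integrable M (\<lambda>\<omega>. U * (norm (e t \<omega>))\<^sup>2)" using L2D(2)[OF L2_e] by simp
  show "AE \<omega> in M. norm (gap t \<omega>) \<le> norm (U * (norm (e t \<omega>))\<^sup>2)"
    using gap_le gap_nonneg U by auto
qed (rule to_M[OF gap_measurable])

lemma norm_gf_ge: "c * norm (e t \<omega>) \<le> norm (gf (x t \<omega>))"
proof -
  have "norm (e t \<omega>) * (c * norm (e t \<omega>)) \<le> gf (x t \<omega>) \<bullet> e t \<omega>"
    using gf_mono[of "x t \<omega>" xs] by (simp add: gf_xs e_def power2_eq_square algebra_simps)
  also have "\<dots> \<le> norm (e t \<omega>) * norm (gf (x t \<omega>))"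
    using norm_cauchy_schwarz[of "gf (x t \<omega>)" "e t \<omega>"] by (simp add: mult.commute)
  finally show ?thesis
    by (cases "norm (e t \<omega>) = 0") auto
qed

section \<open>Descent of the optimality gap\<close>

definition dir where "dir t \<omega> = matrix_inv (B t \<omega>) *v gf (x t \<omega>)"

text \<open>Three losses multiply: \<open>c / U\<^sup>2\<close> from the inverse of
  \<open>B t\<close>, \<open>c\<^sup>2\<close> from gradient against error, and \<open>1 / U\<close>
  from squared error against gap.\<close>

definition rate where "rate = c ^ 3 / U ^ 3"
text \<open>The two parts of the bound for the squared step: the noise at the minimizer, and the
  squared error converted into the gap by the factor \<open>4 / c\<close>. One constant majorizes
  both.\<close>

definition noise_const where "noise_const = 2 * U * s2 / c\<^sup>2 + 8 * U ^ 3 / c ^ 3"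

lemma rate_pos: "0 < rate" and noise_const_nonneg: "0 \<le> noise_const"
  using c U s2_nonneg by (auto simp: rate_def noise_const_def)

lemma dir_gf_ge:
  assumes "\<omega> \<in> space M"
  shows "rate * gap t \<omega> \<le> dir t \<omega> \<bullet> gf (x t \<omega>)"
proof -
  have "rate * gap t \<omega> \<le> rate * (U * (norm (e t \<omega>))\<^sup>2)"
    using rate_pos by (intro mult_left_mono gap_le) simp
  also have "\<dots> = c / U\<^sup>2 * (c * norm (e t \<omega>))\<^sup>2"
    using U by (simp add: rate_def power2_eq_square power3_eq_cube)
  also have "\<dots> \<le> c / U\<^sup>2 * (norm (gf (x t \<omega>)))\<^sup>2"
    using c by (intro mult_left_mono power_mono norm_gf_ge) auto
  also have "\<dots> \<le> gf (x t \<omega>) \<bullet> (matrix_inv (B t \<omega>) *v gf (x t \<omega>))"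
    by (rule matrix_inv_coercive[OF c U B_low[OF assms] norm_B_le[OF assms]])
  finally show ?thesis by (simp add: dir_def inner_commute)
qed

lemma dir_measurable: "dir t \<in> borel_measurable (\<G> t)"
  unfolding dir_def[abs_def]
  by (intro borel_measurable_matrix_inv_vec B_measurable gfx_measurable B_invertible) (simp add: space_\<G>)

lemma L2_dir: "L2 M (dir t)"
  unfolding dir_def[abs_def] by (rule L2_Binv[OF L2_gf])

lemma norm_step_square_le:
  assumes "\<omega> \<in> space M"
  shows "(norm (matrix_inv (B t \<omega>) *v g t \<omega>))\<^sup>2 \<le> (2 * (norm (\<eta> t \<omega>))\<^sup>2 + 2 * U\<^sup>2 * (norm (e t \<omega>))\<^sup>2) / c\<^sup>2"
proof -
  have "(norm (matrix_inv (B t \<omega>) *v g t \<omega>))\<^sup>2 \<le> (norm (g t \<omega>) / c)\<^sup>2"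
    by (intro power_mono norm_B_inv_le assms) simp
  also have "\<dots> = (norm (g t \<omega>))\<^sup>2 / c\<^sup>2" by (simp add: power_divide)
  also have "\<dots> \<le> (2 * (norm (\<eta> t \<omega>))\<^sup>2 + 2 * U\<^sup>2 * (norm (e t \<omega>))\<^sup>2) / c\<^sup>2"
    by (intro divide_right_mono norm_g_square_le assms) simp
  finally show ?thesis .
qed

lemma gap_step:
  assumes "\<omega> \<in> space M"
  shows "gap (Suc t) \<omega> \<le> gap t \<omega> - 1 / real (Suc t) * (dir t \<omega> \<bullet> g t \<omega>)
    + U / (real (Suc t))\<^sup>2 * ((2 * (norm (\<eta> t \<omega>))\<^sup>2 + 2 * U\<^sup>2 * (norm (e t \<omega>))\<^sup>2) / c\<^sup>2)"
proof -
  define a where "a = 1 / real (Suc t)"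
  let ?w = "matrix_inv (B t \<omega>) *v g t \<omega>"
  have x: "x (Suc t) \<omega> - x t \<omega> = - (a *\<^sub>R ?w)" by (simp add: x_Suc[OF assms] g_def a_def)
  have "dir t \<omega> \<bullet> g t \<omega> = gf (x t \<omega>) \<bullet> ?w"
    unfolding dir_def
    using inner_symmetric_matrix[OF transpose_matrix_inv[OF B_invertible[OF assms] B_sym[OF assms]]] by simp
  then have "f (x (Suc t) \<omega>) \<le> f (x t \<omega>) - a * (dir t \<omega> \<bullet> g t \<omega>) + U * (norm (a *\<^sub>R ?w))\<^sup>2"
    using f_descent[of "x (Suc t) \<omega>" "x t \<omega>"] unfolding x by (simp add: inner_commute)
  also have "U * (norm (a *\<^sub>R ?w))\<^sup>2 = U * a\<^sup>2 * (norm ?w)\<^sup>2" by (simp add: power_mult_distrib)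
  also have "U * a\<^sup>2 * (norm ?w)\<^sup>2 \<le> U * a\<^sup>2 * ((2 * (norm (\<eta> t \<omega>))\<^sup>2 + 2 * U\<^sup>2 * (norm (e t \<omega>))\<^sup>2) / c\<^sup>2)"
    using U by (intro mult_left_mono norm_step_square_le assms) simp
  finally show ?thesis by (simp add: gap_def a_def power_divide)
qed

text \<open>A weight that depends on the past only can be carried through the step without spoiling
  the centring of the noise. Weight 1 gives the global recursion, an indicator gives the maximal
  inequality.\<close>

lemma weighted_gap_step:
  assumes k: "k \<in> borel_measurable (\<G> t)" "\<And>\<omega>. 0 \<le> k \<omega>" "\<And>\<omega>. k \<omega> \<le> 1"
  shows "(LINT \<omega>|M. k \<omega> * gap (Suc t) \<omega>) \<le>
    (1 - rate / real (Suc t) + noise_const / (real (Suc t))\<^sup>2) * (LINT \<omega>|M. k \<omega> * gap t \<omega>)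
    + noise_const / (real (Suc t))\<^sup>2 * (LINT \<omega>|M. k \<omega>)"
proof -
  define a where "a = 1 / real (Suc t)"
  have kM: "k \<in> borel_measurable M" by (rule to_M[OF k(1)])
  have ik: "integrable M k" by (rule integrable_const_bound[where B=1]) (use k kM in auto)
  have iv: "L2 M (\<lambda>\<omega>. k \<omega> *\<^sub>R dir t \<omega>)"
    by (rule L2_bound[OF L2_dir[of t]]) (use k kM L2D(1)[OF L2_dir] in \<open>auto intro: mult_left_le_one_le\<close>)
  have mv: "(\<lambda>\<omega>. k \<omega> *\<^sub>R dir t \<omega>) \<in> borel_measurable (\<G> t)"
    by (intro borel_measurable_scaleR k dir_measurable)
  have i: "integrable M (\<lambda>\<omega>. k \<omega> * gap t \<omega>)" "integrable M (\<lambda>\<omega>. k \<omega> * gap (Suc t) \<omega>)"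
      "integrable M (\<lambda>\<omega>. k \<omega> * (norm (e t \<omega>))\<^sup>2)"
    by (intro integrable_mult_unit gap_integrable kM k L2D(2)[OF L2_e])+
  have i\<eta>: "integrable M (\<lambda>\<omega>. k \<omega> * (norm (\<eta> t \<omega>))\<^sup>2)" by (rule integral_mult_\<eta>(1)[OF k(1) ik])
  have ig: "integrable M (\<lambda>\<omega>. k \<omega> * (dir t \<omega> \<bullet> g t \<omega>))" "integrable M (\<lambda>\<omega>. k \<omega> * (dir t \<omega> \<bullet> gf (x t \<omega>)))"
    using L2_inner_integrable[OF iv L2_g[of t]] L2_inner_integrable[OF iv L2_gf[of t]] by auto
  define E where "E = (LINT \<omega>|M. k \<omega> * gap t \<omega>)"
  have 1: "(LINT \<omega>|M. k \<omega> * (dir t \<omega> \<bullet> g t \<omega>)) \<ge> rate * E"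
  proof -
    have "rate * E = (LINT \<omega>|M. rate * (k \<omega> * gap t \<omega>))" by (simp add: E_def)
    also have "\<dots> \<le> (LINT \<omega>|M. k \<omega> * (dir t \<omega> \<bullet> gf (x t \<omega>)))"
    proof (rule integral_mono)
      show "rate * (k \<omega> * gap t \<omega>) \<le> k \<omega> * (dir t \<omega> \<bullet> gf (x t \<omega>))" if "\<omega> \<in> space M" for \<omega>
        using mult_left_mono[OF dir_gf_ge[OF that, of t] k(2)[of \<omega>]] by (simp add: mult_ac)
    qed (use i ig in auto)
    also have "\<dots> = (LINT \<omega>|M. k \<omega> * (dir t \<omega> \<bullet> g t \<omega>))"
      using orthogonal_noise[OF mv iv] by simp
    finally show ?thesis .
  qed
  have 2: "c / 4 * (LINT \<omega>|M. k \<omega> * (norm (e t \<omega>))\<^sup>2) \<le> E"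
  proof -
    have "c / 4 * (LINT \<omega>|M. k \<omega> * (norm (e t \<omega>))\<^sup>2) = (LINT \<omega>|M. c / 4 * (k \<omega> * (norm (e t \<omega>))\<^sup>2))" by simp
    also have "\<dots> \<le> E" unfolding E_def
    proof (rule integral_mono)
      show "c / 4 * (k \<omega> * (norm (e t \<omega>))\<^sup>2) \<le> k \<omega> * gap t \<omega>" for \<omega>
        using mult_left_mono[OF gap_ge[of t \<omega>] k(2)[of \<omega>]] by (simp add: mult_ac)
    qed (use i in auto)
    finally show ?thesis .
  qed
  have "(LINT \<omega>|M. k \<omega> * gap (Suc t) \<omega>) \<le> (LINT \<omega>|M. k \<omega> * gap t \<omega> - a * (k \<omega> * (dir t \<omega> \<bullet> g t \<omega>))
      + (2 * U * a\<^sup>2 / c\<^sup>2) * (k \<omega> * (norm (\<eta> t \<omega>))\<^sup>2) + (2 * U ^ 3 * a\<^sup>2 / c\<^sup>2) * (k \<omega> * (norm (e t \<omega>))\<^sup>2))"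
  proof (rule integral_mono)
    fix \<omega> assume "\<omega> \<in> space M"
    from mult_left_mono[OF gap_step[OF this, of t] k(2)[of \<omega>]]
    have "k \<omega> * gap (Suc t) \<omega> \<le> k \<omega> * (gap t \<omega> - a * (dir t \<omega> \<bullet> g t \<omega>)
      + U * a\<^sup>2 * ((2 * (norm (\<eta> t \<omega>))\<^sup>2 + 2 * U\<^sup>2 * (norm (e t \<omega>))\<^sup>2) / c\<^sup>2))"
      by (simp add: a_def power_divide)
    also have "\<dots> = k \<omega> * gap t \<omega> - a * (k \<omega> * (dir t \<omega> \<bullet> g t \<omega>))
      + (2 * U * a\<^sup>2 / c\<^sup>2) * (k \<omega> * (norm (\<eta> t \<omega>))\<^sup>2) + (2 * U ^ 3 * a\<^sup>2 / c\<^sup>2) * (k \<omega> * (norm (e t \<omega>))\<^sup>2)"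
      by (simp add: algebra_simps power2_eq_square power3_eq_cube add_divide_distrib)
    finally show "k \<omega> * gap (Suc t) \<omega> \<le> k \<omega> * gap t \<omega> - a * (k \<omega> * (dir t \<omega> \<bullet> g t \<omega>))
      + (2 * U * a\<^sup>2 / c\<^sup>2) * (k \<omega> * (norm (\<eta> t \<omega>))\<^sup>2) + (2 * U ^ 3 * a\<^sup>2 / c\<^sup>2) * (k \<omega> * (norm (e t \<omega>))\<^sup>2)" .
  qed (use i ig i\<eta> in \<open>auto intro!: Bochner_Integration.integrable_add Bochner_Integration.integrable_diff integrable_mult_right\<close>)
  also have "\<dots> = E - a * (LINT \<omega>|M. k \<omega> * (dir t \<omega> \<bullet> g t \<omega>))
      + (2 * U * a\<^sup>2 / c\<^sup>2) * ((LINT \<omega>|M. k \<omega>) * s2) + (2 * U ^ 3 * a\<^sup>2 / c\<^sup>2) * (LINT \<omega>|M. k \<omega> * (norm (e t \<omega>))\<^sup>2)"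
    using i ig i\<eta> unfolding E_def integral_mult_\<eta>(2)[OF k(1) ik, symmetric] by simp
  also have "\<dots> \<le> E - a * (rate * E) + (2 * U * a\<^sup>2 / c\<^sup>2) * ((LINT \<omega>|M. k \<omega>) * s2) + (2 * U ^ 3 * a\<^sup>2 / c\<^sup>2) * (4 / c * E)"
  proof -
    have "a * (rate * E) \<le> a * (LINT \<omega>|M. k \<omega> * (dir t \<omega> \<bullet> g t \<omega>))" using 1 by (intro mult_left_mono) (auto simp: a_def)
    moreover have "(LINT \<omega>|M. k \<omega> * (norm (e t \<omega>))\<^sup>2) \<le> 4 / c * E" using 2 c by (simp add: field_simps)
    then have "(2 * U ^ 3 * a\<^sup>2 / c\<^sup>2) * (LINT \<omega>|M. k \<omega> * (norm (e t \<omega>))\<^sup>2) \<le> (2 * U ^ 3 * a\<^sup>2 / c\<^sup>2) * (4 / c * E)"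
      using U by (intro mult_left_mono) auto
    ultimately show ?thesis by linarith
  qed
  also have "\<dots> = (1 - rate * a) * E + a\<^sup>2 * ((8 * U ^ 3 / c ^ 3) * E) + a\<^sup>2 * ((2 * U * s2 / c\<^sup>2) * (LINT \<omega>|M. k \<omega>))"
    using c by (simp add: algebra_simps power2_eq_square power3_eq_cube)
  also have "\<dots> \<le> (1 - rate * a) * E + a\<^sup>2 * (noise_const * E) + a\<^sup>2 * (noise_const * (LINT \<omega>|M. k \<omega>))"
  proof -
    have "0 \<le> E" unfolding E_def by (intro Bochner_Integration.integral_nonneg) (use k gap_nonneg in simp)
    moreover have "0 \<le> (LINT \<omega>|M. k \<omega>)" by (intro Bochner_Integration.integral_nonneg) (use k in simp)
    ultimately show ?thesis
      unfolding noise_const_def using c U s2_nonneg by (intro add_mono order_refl mult_left_mono mult_right_mono) auto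
  qed
  finally show ?thesis by (simp add: E_def a_def power_divide algebra_simps)
qed

lemma gap_tendsto_0: "(\<lambda>t. LINT \<omega>|M. gap t \<omega>) \<longlonglongrightarrow> 0"
proof -
  define v where "v t = (LINT \<omega>|M. gap t \<omega>)" for t
  have v0: "0 \<le> v t" for t unfolding v_def by (intro Bochner_Integration.integral_nonneg gap_nonneg)
  \<comment> \<open>From here on half of the contraction absorbs the second-order term, which leaves
    \<open>rate / 2\<close>.\<close>
  define m where "m = nat \<lceil>2 * noise_const / rate\<rceil>"
  have half: "a / b = (a / 2) / b + (a / 2) / b" for a b :: real by (cases "b = 0") (simp_all add: field_simps)
  have rec: "v (Suc t) \<le> (1 - (rate / 2) / real (Suc t)) * v t + noise_const / (real (Suc t))\<^sup>2" if "m \<le> t" for t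
  proof -
    let ?s = "real (Suc t)"
    have "2 * noise_const / rate \<le> ?s" using that unfolding m_def by linarith
    then have "noise_const \<le> rate / 2 * ?s" using rate_pos by (simp add: field_simps)
    then have "noise_const / ?s\<^sup>2 \<le> (rate / 2 * ?s) / ?s\<^sup>2" by (intro divide_right_mono) auto
    also have "\<dots> = (rate / 2) / ?s" by (simp add: power2_eq_square)
    finally have "noise_const / ?s\<^sup>2 \<le> (rate / 2) / ?s" .
    moreover have "rate / ?s = (rate / 2) / ?s + (rate / 2) / ?s" by (rule half)
    ultimately have "1 - rate / ?s + noise_const / ?s\<^sup>2 \<le> 1 - (rate / 2) / ?s" by linarith
    then have "(1 - rate / ?s + noise_const / ?s\<^sup>2) * v t \<le> (1 - (rate / 2) / ?s) * v t"
      using v0 by (rule mult_right_mono)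
    moreover have "v (Suc t) \<le> (1 - rate / ?s + noise_const / ?s\<^sup>2) * v t + noise_const / ?s\<^sup>2"
      using weighted_gap_step[of "\<lambda>_. 1" t] by (simp add: v_def prob_space)
    ultimately show ?thesis by linarith
  qed
  \<comment> \<open>Some positive exponent below \<open>rate / 2\<close> and at most 1; the
    resulting decay may be very slow.\<close>
  define q where "q = min (rate / 4) 1"
  have q: "0 < q" "q < rate / 2" "q \<le> 1" using rate_pos by (auto simp: q_def)
  obtain C where C: "0 \<le> C" "\<And>t. m \<le> t \<Longrightarrow> v t \<le> C * real (Suc t) powr (-q)"
    using recursion_rate[OF q noise_const_nonneg rec] by blast
  have "LIM t sequentially. real (Suc t) :> at_top"
    by (rule filterlim_compose[OF filterlim_real_sequentially filterlim_Suc])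
  then have "(\<lambda>t. real (Suc t) powr (-q)) \<longlonglongrightarrow> 0"
    by (rule tendsto_neg_powr[rotated]) (use q in simp)
  then have lim: "(\<lambda>t. C * real (Suc t) powr (-q)) \<longlonglongrightarrow> 0"
    by (rule tendsto_mult_right_zero)
  have "v \<longlonglongrightarrow> 0"
  proof (rule tendsto_sandwich[OF _ _ tendsto_const lim])
    show "\<forall>\<^sub>F t in sequentially. 0 \<le> v t" using v0 by simp
    show "\<forall>\<^sub>F t in sequentially. v t \<le> C * real (Suc t) powr (-q)"
      using C(2) by (auto simp: eventually_sequentially)
  qed
  then show ?thesis by (simp add: v_def[abs_def])
qed

section \<open>Confinement near the minimizer\<close>

definition good where "good \<epsilon> m n \<omega> = (if \<forall>s\<in>{m..n}. gap s \<omega> < \<epsilon> then 1 else 0 :: real)"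

lemma good_range: "0 \<le> good \<epsilon> m n \<omega>" "good \<epsilon> m n \<omega> \<le> 1"
  by (auto simp: good_def)

lemma good_measurable: "good \<epsilon> m n \<in> borel_measurable (\<G> n)"
proof -
  have "gap s \<in> borel_measurable (\<G> n)" if "s \<le> n" for s
    using \<G>_mono[OF that gap_measurable] .
  then have "{\<omega> \<in> space (\<G> n). \<forall>s\<in>{m..n}. gap s \<omega> < \<epsilon>} \<in> sets (\<G> n)"
    by (intro sets.sets_Collect_finite_All) (auto intro: borel_measurable_less)
  then show ?thesis unfolding good_def[abs_def] by (intro measurable_If) auto
qed

lemma good_integrable: "integrable M (good \<epsilon> m n)"
  by (rule integrable_const_bound[where B=1]) (use good_range to_M[OF good_measurable] in auto)

lemma good_antimono: "n \<le> n' \<Longrightarrow> good \<epsilon> m n' \<omega> \<le> good \<epsilon> m n \<omega>"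
  by (auto simp: good_def)

text \<open>A maximal inequality in the manner of Doob: the gap is a supermartingale up to summable
  noise, and mass that leaves the event carries a gap of at least \<open>\<epsilon>\<close>. The
  event is phrased through the gap because that is what descends, and as a real-valued indicator so
  that it can serve as a weight.\<close>

lemma good_maximal:
  assumes "0 < \<epsilon>" "0 < m" "noise_const \<le> rate * real m" "m \<le> n"
  shows "\<epsilon> * (1 - (LINT \<omega>|M. good \<epsilon> m n \<omega>)) + (LINT \<omega>|M. good \<epsilon> m n \<omega> * gap n \<omega>)
    \<le> (LINT \<omega>|M. gap m \<omega>) + noise_const * (1 / real m - 1 / real n)"
  using \<open>m \<le> n\<close>
proof (induction n rule: dec_induct)
  case base
  have ii: "integrable M (\<lambda>\<omega>. good \<epsilon> m m \<omega> * gap m \<omega>)"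
    by (intro integrable_mult_unit gap_integrable to_M[OF good_measurable] good_range)
  have "\<epsilon> * (1 - (LINT \<omega>|M. good \<epsilon> m m \<omega>)) + (LINT \<omega>|M. good \<epsilon> m m \<omega> * gap m \<omega>)
      = (LINT \<omega>|M. \<epsilon> * (1 - good \<epsilon> m m \<omega>) + good \<epsilon> m m \<omega> * gap m \<omega>)"
    using good_integrable ii by (simp add: prob_space)
  also have "\<dots> \<le> (LINT \<omega>|M. gap m \<omega>)"
  proof (rule integral_mono)
    show "\<epsilon> * (1 - good \<epsilon> m m \<omega>) + good \<epsilon> m m \<omega> * gap m \<omega> \<le> gap m \<omega>" for \<omega>
      by (auto simp: good_def)
  qed (use good_integrable ii gap_integrable in auto)
  finally show ?case by simp
next
  case (step n)
  let ?k = "good \<epsilon> m n" and ?k' = "good \<epsilon> m (Suc n)" and ?s = "real (Suc n)"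
  have ii: "integrable M (\<lambda>\<omega>. ?k' \<omega> * gap (Suc n) \<omega>)" "integrable M (\<lambda>\<omega>. ?k \<omega> * gap (Suc n) \<omega>)"
      "integrable M (\<lambda>\<omega>. ?k \<omega> * gap n \<omega>)"
    by (intro integrable_mult_unit gap_integrable to_M[OF good_measurable] good_range)+
  have "\<epsilon> * ((LINT \<omega>|M. ?k \<omega>) - (LINT \<omega>|M. ?k' \<omega>)) + (LINT \<omega>|M. ?k' \<omega> * gap (Suc n) \<omega>)
      = (LINT \<omega>|M. \<epsilon> * (?k \<omega> - ?k' \<omega>) + ?k' \<omega> * gap (Suc n) \<omega>)"
    using good_integrable ii by simp
  also have "\<dots> \<le> (LINT \<omega>|M. ?k \<omega> * gap (Suc n) \<omega>)"
  proof (rule integral_mono)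
    show "\<epsilon> * (?k \<omega> - ?k' \<omega>) + ?k' \<omega> * gap (Suc n) \<omega> \<le> ?k \<omega> * gap (Suc n) \<omega>" for \<omega>
    proof (cases "gap (Suc n) \<omega> < \<epsilon>")
      case True
      then have "?k' \<omega> = ?k \<omega>" using step.hyps by (auto simp: good_def le_Suc_eq)
      then show ?thesis by simp
    next
      case False
      then have "?k' \<omega> = 0" using step.hyps by (auto simp: good_def)
      then show ?thesis using False mult_right_mono[of \<epsilon> "gap (Suc n) \<omega>", OF _ good_range(1)[of \<epsilon> m n \<omega>]]
        by (simp add: mult.commute)
    qed
  qed (use good_integrable ii in auto)
  also have "\<dots> \<le> (1 - rate / ?s + noise_const / ?s\<^sup>2) * (LINT \<omega>|M. ?k \<omega> * gap n \<omega>) + noise_const / ?s\<^sup>2 * (LINT \<omega>|M. ?k \<omega>)"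
    by (rule weighted_gap_step[OF good_measurable good_range])
  also have "\<dots> \<le> 1 * (LINT \<omega>|M. ?k \<omega> * gap n \<omega>) + noise_const / ?s\<^sup>2 * 1"
  proof (intro add_mono mult_right_mono mult_left_mono)
    \<comment> \<open>By the assumption on \<open>m\<close>, contraction outweighs the
      multiplicative noise term from time \<open>m\<close> on, so the factor is at most 1.\<close>
    have "rate * real m \<le> rate * ?s" using step.hyps rate_pos by (intro mult_left_mono) auto
    then have "noise_const / ?s\<^sup>2 \<le> (rate * ?s) / ?s\<^sup>2" using assms(3) by (intro divide_right_mono) auto
    then show "1 - rate / ?s + noise_const / ?s\<^sup>2 \<le> 1" by (simp add: power2_eq_square)
    show "0 \<le> (LINT \<omega>|M. ?k \<omega> * gap n \<omega>)" by (intro Bochner_Integration.integral_nonneg mult_nonneg_nonneg good_range gap_nonneg)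
    have "(LINT \<omega>|M. ?k \<omega>) \<le> (LINT \<omega>|M. 1)" by (intro integral_mono good_integrable good_range) auto
    then show "(LINT \<omega>|M. ?k \<omega>) \<le> 1" by (simp add: prob_space)
  qed (use noise_const_nonneg in auto)
  \<comment> \<open>Since 1/s^2 <= 1/(s-1) - 1/s, the noise contributions telescope.\<close>
  also have "noise_const / ?s\<^sup>2 * 1 \<le> noise_const * (1 / real n - 1 / ?s)"
  proof -
    have n: "0 < real n" using step.hyps \<open>0 < m\<close> by simp
    have "1 / ?s\<^sup>2 \<le> 1 / (real n * ?s)" using n by (intro divide_left_mono) (auto simp: power2_eq_square)
    also have "\<dots> = 1 / real n - 1 / ?s" using n by (simp add: field_simps)
    finally show ?thesis using noise_const_nonneg mult_left_mono[of "1 / ?s\<^sup>2" _ noise_const] by simp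
  qed
  finally show ?case using step.IH by (simp add: algebra_simps)
qed

text \<open>For late \<open>m\<close> both terms of the maximal inequality are small, uniformly in
  \<open>n\<close>: the mean gap tends to 0 and the remaining noise is at most
  \<open>noise_const / m\<close>. Convergence without a rate suffices here, so the slow descent does
  no harm.\<close>

lemma good_probability:
  assumes "0 < \<epsilon>" "0 < \<delta>"
  shows "\<exists>m>0. \<forall>n\<ge>m. 1 - (LINT \<omega>|M. good \<epsilon> m n \<omega>) \<le> \<delta>"
proof -
  have "\<forall>\<^sub>F m in sequentially. (LINT \<omega>|M. gap m \<omega>) < \<epsilon> * \<delta> / 2"
    by (rule order_tendstoD(2)[OF gap_tendsto_0]) (use assms in simp)
  moreover have "(\<lambda>m. noise_const * (1 / real m)) \<longlonglongrightarrow> noise_const * 0"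
    by (intro tendsto_mult tendsto_const lim_1_over_n)
  then have "\<forall>\<^sub>F m in sequentially. noise_const * (1 / real m) < \<epsilon> * \<delta> / 2"
    by (intro order_tendstoD(2)) (use assms in auto)
  moreover have "\<forall>\<^sub>F m in sequentially. noise_const \<le> rate * real m"
    using eventually_ge_at_top[of "nat \<lceil>noise_const / rate\<rceil>"]
  proof eventually_elim
    case (elim m)
    then have "noise_const / rate \<le> real m" by linarith
    then show ?case using rate_pos by (simp add: field_simps)
  qed
  ultimately have "\<forall>\<^sub>F m in sequentially. 0 < m \<and> (\<forall>n\<ge>m. 1 - (LINT \<omega>|M. good \<epsilon> m n \<omega>) \<le> \<delta>)"
    using eventually_gt_at_top[of 0]
  proof eventually_elim
    case (elim m)
    have "1 - (LINT \<omega>|M. good \<epsilon> m n \<omega>) \<le> \<delta>" if "m \<le> n" for n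
    proof -
      have "0 \<le> (LINT \<omega>|M. good \<epsilon> m n \<omega> * gap n \<omega>)" by (intro Bochner_Integration.integral_nonneg mult_nonneg_nonneg good_range gap_nonneg)
      then have "\<epsilon> * (1 - (LINT \<omega>|M. good \<epsilon> m n \<omega>)) \<le> (LINT \<omega>|M. gap m \<omega>) + noise_const * (1 / real m - 1 / real n)"
        using good_maximal[OF \<open>0 < \<epsilon>\<close> elim(4) elim(3) that] by linarith
      also have "\<dots> \<le> (LINT \<omega>|M. gap m \<omega>) + noise_const * (1 / real m)"
        using noise_const_nonneg by (intro add_left_mono mult_left_mono) auto
      also have "\<dots> \<le> \<epsilon> * \<delta>" using elim by linarith
      finally show ?thesis using \<open>0 < \<epsilon>\<close> by simp
    qed
    then show ?case using elim by simp
  qed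
  then show ?thesis by (auto simp: eventually_sequentially)
qed

end

lemma norm_sum_square_le:
  fixes a :: "nat \<Rightarrow> 'a::real_normed_vector"
  shows "(norm (\<Sum>i<n. a i))\<^sup>2 \<le> real n * (\<Sum>i<n. (norm (a i))\<^sup>2)"
proof -
  have "(norm (\<Sum>i<n. a i))\<^sup>2 \<le> (\<Sum>i<n. norm (a i))\<^sup>2" by (intro power_mono norm_sum) simp
  also have "\<dots> \<le> (\<Sum>i<n. 1\<^sup>2) * (\<Sum>i<n. (norm (a i))\<^sup>2)"
    using Cauchy_Schwarz_ineq_sum[of "\<lambda>_. 1" "\<lambda>i. norm (a i)" "{..<n}"] by simp
  finally show ?thesis by simp
qed

context stochastic_newton
begin

section \<open>Error of the averaged Hessian\<close>

definition H_bound where "H_bound = real CARD('d) * real CARD('d) * U"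

lemma norm_Hs_le:
  assumes "d \<in> space P"
  shows "norm (Hs u d) \<le> H_bound"
proof -
  have "norm (Hs u d *v v) \<le> U * norm v" for v
    by (rule PSD_norm_le[OF Hs_sym Hs_low _ Hs_up]) (use assms c U in auto)
  then have "spectral_norm (Hs u d) \<le> U"
    unfolding spectral_norm_def by (rule onorm_le)
  then have "real CARD('d) * real CARD('d) * spectral_norm (Hs u d) \<le> H_bound"
    unfolding H_bound_def by (intro mult_left_mono) auto
  then show ?thesis using norm_matrix_le_spectral_norm[of "Hs u d"] by linarith
qed

lemma Hs_integrable: "integrable P (Hs u)"
proof -
  interpret P: prob_space P by (rule prob_space_P)
  have m: "Hs u \<in> borel_measurable P" using Hs_compose[of "\<lambda>_. u" P "\<lambda>d. d"] by simp
  show ?thesis by (rule P.integrable_const_bound[where B=H_bound]) (use m norm_Hs_le in auto)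
qed

lemma norm_Hf_le: "norm (Hf u) \<le> H_bound"
proof -
  interpret P: prob_space P by (rule prob_space_P)
  have "norm (Hf u) \<le> (LINT d|P. norm (Hs u d))"
    unfolding Hs_mean[symmetric] by (rule integral_norm_bound)
  also have "\<dots> \<le> (LINT d|P. H_bound)"
    by (intro integral_mono integrable_norm Hs_integrable norm_Hs_le) auto
  finally show ?thesis by (simp add: P.prob_space)
qed

lemma Hf_measurable: "Hf \<in> borel_measurable borel"
proof -
  interpret P: prob_space P by (rule prob_space_P)
  have "(\<lambda>u. LINT d|P. Hs u d) \<in> borel_measurable borel"
    by (rule P.borel_measurable_lebesgue_integral) (use Hs_measurable in \<open>simp add: case_prod_beta'\<close>)
  then show ?thesis by (simp add: Hs_mean)
qed

definition Hnoise where "Hnoise t \<omega> = Hs (x t \<omega>) (\<xi> t \<omega>) - Hf (x t \<omega>)"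

lemma Hfx_measurable: "(\<lambda>\<omega>. Hf (x t \<omega>)) \<in> borel_measurable (\<G> t)"
  using measurable_compose[OF x_measurable Hf_measurable] .

lemma Hnoise_measurable: "s < t \<Longrightarrow> Hnoise s \<in> borel_measurable (\<G> t)"
  unfolding Hnoise_def[abs_def]
  by (intro borel_measurable_diff Hs_compose \<G>_mono[OF _ x_measurable] \<G>_mono[OF _ Hfx_measurable] adapted) auto

lemma norm_Hnoise_le: "\<omega> \<in> space M \<Longrightarrow> norm (Hnoise t \<omega>) \<le> 2 * H_bound"
  using norm_triangle_ineq4[of "Hs (x t \<omega>) (\<xi> t \<omega>)" "Hf (x t \<omega>)"] norm_Hf_le[of "x t \<omega>"]
    norm_Hs_le[OF \<xi>_space, of \<omega> "x t \<omega>" t]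
  by (simp add: Hnoise_def)

lemma H_bound_nonneg: "0 \<le> H_bound" using U by (simp add: H_bound_def)

lemma L2_Hnoise: "L2 M (Hnoise t)"
  by (rule L2_bound[OF L2_const[of "2 * H_bound"] to_M[OF Hnoise_measurable[of t "Suc t"]]])
    (use norm_Hnoise_le H_bound_nonneg in auto)

text \<open>The centred sample Hessians are bounded orthogonal increments, so the second moment of
  their sum grows linearly, and averaging leaves 1/t.\<close>

lemma Hnoise_sum: "(LINT \<omega>|M. (norm (\<Sum>i<t. Hnoise i \<omega>))\<^sup>2) \<le> 4 * H_bound\<^sup>2 * real t"
proof -
  interpret P: prob_space P by (rule prob_space_P)
  have "(LINT \<omega>|M. (\<Sum>i<t. Hnoise i \<omega>) \<bullet> Hnoise t \<omega>) = 0" for t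
  proof -
    define \<psi> where "\<psi> \<omega> d = Hs (x t \<omega>) d - Hf (x t \<omega>)" for \<omega> d
    have "(LINT \<omega>|M. (\<Sum>i<t. Hnoise i \<omega>) \<bullet> \<psi> \<omega> (\<xi> t \<omega>)) = 0"
    proof (rule orthogonal_fresh)
      show "(\<lambda>\<omega>. \<Sum>i<t. Hnoise i \<omega>) \<in> borel_measurable (\<G> t)"
        by (intro borel_measurable_sum Hnoise_measurable) auto
      show "L2 M (\<lambda>\<omega>. \<Sum>i<t. Hnoise i \<omega>)" by (intro L2_sum L2_Hnoise) auto
      note [measurable] = x_measurable Hfx_measurable
      have "(\<lambda>p. Hs (x t (fst p)) (snd p)) \<in> borel_measurable (\<G> t \<Otimes>\<^sub>M P)"
        by (rule Hs_compose) measurable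
      then show "(\<lambda>p. \<psi> (fst p) (snd p)) \<in> borel_measurable (\<G> t \<Otimes>\<^sub>M P)"
        unfolding \<psi>_def by measurable
      show "integrable P (\<psi> \<omega>)" for \<omega> unfolding \<psi>_def using Hs_integrable by simp
      show "(LINT d|P. \<psi> \<omega> d) = 0" for \<omega>
        unfolding \<psi>_def using Hs_integrable by (simp add: Hs_mean P.prob_space)
      show "L2 M (\<lambda>\<omega>. \<psi> \<omega> (\<xi> t \<omega>))" using L2_Hnoise[of t] by (simp add: \<psi>_def Hnoise_def[abs_def])
    qed
    then show ?thesis by (simp add: \<psi>_def Hnoise_def)
  qed
  then have "(LINT \<omega>|M. (norm (\<Sum>i<t. Hnoise i \<omega>))\<^sup>2) = (\<Sum>i<t. LINT \<omega>|M. (norm (Hnoise i \<omega>))\<^sup>2)"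
    by (rule martingale_norm_square[OF L2_Hnoise])
  also have "\<dots> \<le> (\<Sum>i<t. LINT \<omega>|M. (2 * H_bound)\<^sup>2)"
    by (intro sum_mono integral_mono L2D(2)[OF L2_Hnoise] power_mono norm_Hnoise_le) auto
  finally show ?thesis by (simp add: prob_space power_mult_distrib mult_ac)
qed

definition Berr where "Berr t \<omega> = norm (B t \<omega> - Bs)"

lemma Berr_measurable: "Berr t \<in> borel_measurable (\<G> t)"
  unfolding Berr_def[abs_def]
  by (rule measurable_compose[OF _ borel_measurable_norm]) (intro borel_measurable_diff B_measurable borel_measurable_const)

text \<open>\<open>B t \<omega> - Bs\<close> splits into averaged Hessian noise and the averaged
  bias \<open>Hf (x i \<omega>) - Bs\<close>, which is at most \<open>L\<close> times the error at
  time \<open>i\<close>. The matrix error is thus governed by the average of the past squared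
  errors, not by the last one.\<close>

lemma Berr_square_le:
  assumes "0 < t"
  shows "(Berr t \<omega>)\<^sup>2 \<le> 2 / (real t)\<^sup>2 * (norm (\<Sum>i<t. Hnoise i \<omega>))\<^sup>2 + 2 * L\<^sup>2 / real t * (\<Sum>i<t. (norm (e i \<omega>))\<^sup>2)"
proof -
  define S where "S = (\<Sum>i<t. Hf (x i \<omega>) - Bs)"
  have "(\<Sum>i<t. Hs (x i \<omega>) (\<xi> i \<omega>)) = (\<Sum>i<t. Hnoise i \<omega>) + S + real t *\<^sub>R Bs"
    by (simp add: S_def Hnoise_def sum_subtractf sum_constant_scaleR del: sum_constant)
  then have "B t \<omega> - Bs = (1 / real t) *\<^sub>R (\<Sum>i<t. Hnoise i \<omega>) + (1 / real t) *\<^sub>R S"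
    using assms by (simp add: B_eq scaleR_add_right)
  then have "(Berr t \<omega>)\<^sup>2 \<le> 2 * (norm ((1 / real t) *\<^sub>R (\<Sum>i<t. Hnoise i \<omega>)))\<^sup>2 + 2 * (norm ((1 / real t) *\<^sub>R S))\<^sup>2"
    unfolding Berr_def by (simp only: norm_add_square_le)
  also have "\<dots> = 2 / (real t)\<^sup>2 * (norm (\<Sum>i<t. Hnoise i \<omega>))\<^sup>2 + 2 / (real t)\<^sup>2 * (norm S)\<^sup>2"
    by (simp add: power_mult_distrib power_divide)
  also have "(norm S)\<^sup>2 \<le> real t * (\<Sum>i<t. (L * norm (e i \<omega>))\<^sup>2)"
  proof -
    have "(norm S)\<^sup>2 \<le> real t * (\<Sum>i<t. (norm (Hf (x i \<omega>) - Bs))\<^sup>2)"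
      unfolding S_def by (rule norm_sum_square_le)
    also have "\<dots> \<le> real t * (\<Sum>i<t. (L * norm (e i \<omega>))\<^sup>2)"
      using Hf_lip by (intro mult_left_mono sum_mono power_mono) (auto simp: e_def)
    finally show ?thesis .
  qed
  also have "2 / (real t)\<^sup>2 * (real t * (\<Sum>i<t. (L * norm (e i \<omega>))\<^sup>2)) = 2 * L\<^sup>2 / real t * (\<Sum>i<t. (norm (e i \<omega>))\<^sup>2)"
  proof -
    have "(\<Sum>i<t. (L * norm (e i \<omega>))\<^sup>2) = L\<^sup>2 * (\<Sum>i<t. (norm (e i \<omega>))\<^sup>2)"
      by (simp add: power_mult_distrib sum_distrib_left)
    then show ?thesis using assms by (simp add: power2_eq_square)
  qed
  finally show ?thesis by (simp add: divide_right_mono)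
qed

text \<open>A crude deterministic bound for the sake of integrability; \<open>norm B0\<close> covers
  time 0.\<close>

lemma norm_B_inv_diff: "\<omega> \<in> space M \<Longrightarrow> Berr t \<omega> \<le> 2 * H_bound + norm B0 + norm Bs"
proof -
  assume \<omega>: "\<omega> \<in> space M"
  have "norm (B t \<omega>) \<le> H_bound + norm B0"
  proof (cases "t = 0")
    case True then show ?thesis using H_bound_nonneg by (simp add: B_eq)
  next
    case False
    have "norm (\<Sum>i<t. Hs (x i \<omega>) (\<xi> i \<omega>)) \<le> (\<Sum>i<t. H_bound)"
      by (intro sum_norm_le norm_Hs_le \<xi>_space \<omega>)
    then have "norm (B t \<omega>) \<le> H_bound" using False by (simp add: B_eq field_simps)
    then show ?thesis using norm_ge_zero[of B0] by linarith
  qed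
  then show ?thesis
    using norm_triangle_ineq4[of "B t \<omega>" Bs] H_bound_nonneg unfolding Berr_def by linarith
qed

lemma L2_Berr: "L2 M (Berr t)"
  by (rule L2_bound[OF L2_const[of "2 * H_bound + norm B0 + norm Bs"] to_M[OF Berr_measurable]])
    (use norm_B_inv_diff H_bound_nonneg in \<open>auto simp: Berr_def\<close>)

lemma Berr_square_integrable: "integrable M (\<lambda>\<omega>. (Berr t \<omega>)\<^sup>2)"
  using L2D(2)[OF L2_Berr] by simp

lemma weighted_Berr:
  assumes k: "k \<in> borel_measurable M" "\<And>\<omega>. 0 \<le> k \<omega>" "\<And>\<omega>. k \<omega> \<le> 1" and "0 < t"
  shows "(LINT \<omega>|M. k \<omega> * (Berr t \<omega>)\<^sup>2) \<le> 8 * H_bound\<^sup>2 / real t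
    + 2 * L\<^sup>2 / real t * (\<Sum>i<t. LINT \<omega>|M. k \<omega> * (norm (e i \<omega>))\<^sup>2)"
proof -
  have ie: "integrable M (\<lambda>\<omega>. k \<omega> * (norm (e i \<omega>))\<^sup>2)" for i
    by (intro integrable_mult_unit k L2D(2)[OF L2_e])
  have iS: "integrable M (\<lambda>\<omega>. (norm (\<Sum>i<t. Hnoise i \<omega>))\<^sup>2)"
    by (intro L2D(2) L2_sum L2_Hnoise) auto
  have "(LINT \<omega>|M. k \<omega> * (Berr t \<omega>)\<^sup>2) \<le> (LINT \<omega>|M. 2 / (real t)\<^sup>2 * (norm (\<Sum>i<t. Hnoise i \<omega>))\<^sup>2
      + 2 * L\<^sup>2 / real t * (\<Sum>i<t. k \<omega> * (norm (e i \<omega>))\<^sup>2))"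
  proof (rule integral_mono)
    fix \<omega>
    let ?a = "2 / (real t)\<^sup>2 * (norm (\<Sum>i<t. Hnoise i \<omega>))\<^sup>2" and ?b = "2 * L\<^sup>2 / real t * (\<Sum>i<t. (norm (e i \<omega>))\<^sup>2)"
    have "k \<omega> * (Berr t \<omega>)\<^sup>2 \<le> k \<omega> * (?a + ?b)"
      by (intro mult_left_mono Berr_square_le k assms)
    also have "\<dots> = k \<omega> * ?a + k \<omega> * ?b" by (rule distrib_left)
    \<comment> \<open>The weight is dropped from the noise sum: it may depend on the data in that
      sum and would destroy the orthogonality behind \<open>Hnoise_sum\<close>.\<close>
    also have "k \<omega> * ?a \<le> 1 * ?a" by (intro mult_right_mono k) simp
    also have "k \<omega> * ?b = 2 * L\<^sup>2 / real t * (\<Sum>i<t. k \<omega> * (norm (e i \<omega>))\<^sup>2)"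
      by (simp add: sum_distrib_left mult_ac)
    finally show "k \<omega> * (Berr t \<omega>)\<^sup>2 \<le> ?a + 2 * L\<^sup>2 / real t * (\<Sum>i<t. k \<omega> * (norm (e i \<omega>))\<^sup>2)" by simp
  qed (use ie iS Berr_square_integrable k in \<open>auto intro!: Bochner_Integration.integrable_add integrable_mult_right Bochner_Integration.integrable_sum integrable_mult_unit\<close>)
  also have "\<dots> = 2 / (real t)\<^sup>2 * (LINT \<omega>|M. (norm (\<Sum>i<t. Hnoise i \<omega>))\<^sup>2)
      + 2 * L\<^sup>2 / real t * (\<Sum>i<t. LINT \<omega>|M. k \<omega> * (norm (e i \<omega>))\<^sup>2)"
    using ie iS by (subst Bochner_Integration.integral_add) auto
  also have "2 / (real t)\<^sup>2 * (LINT \<omega>|M. (norm (\<Sum>i<t. Hnoise i \<omega>))\<^sup>2) \<le> 2 / (real t)\<^sup>2 * (4 * H_bound\<^sup>2 * real t)"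
    by (intro mult_left_mono Hnoise_sum) simp
  also have "\<dots> = 8 * H_bound\<^sup>2 / real t" using \<open>0 < t\<close> by (simp add: power2_eq_square)
  finally show ?thesis by simp
qed

definition E_e2 where "E_e2 t = (LINT \<omega>|M. (norm (e t \<omega>))\<^sup>2)"

lemma e_square_tendsto_0: "E_e2 \<longlonglongrightarrow> 0"
proof (rule tendsto_sandwich[OF _ _ tendsto_const tendsto_mult_right_zero[OF gap_tendsto_0]])
  show "\<forall>\<^sub>F t in sequentially. 0 \<le> E_e2 t" by (simp add: E_e2_def)
  show "\<forall>\<^sub>F t in sequentially. E_e2 t \<le> 4 / c * (LINT \<omega>|M. gap t \<omega>)"
  proof (intro always_eventually allI)
    fix t
    have "c / 4 * E_e2 t = (LINT \<omega>|M. c / 4 * (norm (e t \<omega>))\<^sup>2)" by (simp add: E_e2_def)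
    also have "\<dots> \<le> (LINT \<omega>|M. gap t \<omega>)"
      by (intro integral_mono gap_integrable gap_ge) (use L2D(2)[OF L2_e] in simp)
    finally show "E_e2 t \<le> 4 / c * (LINT \<omega>|M. gap t \<omega>)" using c by (simp add: field_simps)
  qed
qed

lemma Berr_square_tendsto_0: "(\<lambda>t. LINT \<omega>|M. (Berr t \<omega>)\<^sup>2) \<longlonglongrightarrow> 0"
proof (rule tendsto_sandwich[OF _ _ tendsto_const])
  show "\<forall>\<^sub>F t in sequentially. 0 \<le> (LINT \<omega>|M. (Berr t \<omega>)\<^sup>2)" by simp
  show "\<forall>\<^sub>F t in sequentially. (LINT \<omega>|M. (Berr t \<omega>)\<^sup>2) \<le> 8 * H_bound\<^sup>2 * (1 / real t) + 2 * L\<^sup>2 * ((\<Sum>i<t. E_e2 i) / real t)"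
    using eventually_gt_at_top[of 0]
  proof eventually_elim
    case (elim t)
    then show ?case using weighted_Berr[of "\<lambda>_. 1" t] by (simp add: E_e2_def)
  qed
  have "(\<lambda>t. 8 * H_bound\<^sup>2 * (1 / real t) + 2 * L\<^sup>2 * ((\<Sum>i<t. E_e2 i) / real t)) \<longlonglongrightarrow> 8 * H_bound\<^sup>2 * 0 + 2 * L\<^sup>2 * 0"
    by (intro tendsto_add tendsto_mult tendsto_const lim_1_over_n cesaro_null e_square_tendsto_0)
  then show "(\<lambda>t. 8 * H_bound\<^sup>2 * (1 / real t) + 2 * L\<^sup>2 * ((\<Sum>i<t. E_e2 i) / real t)) \<longlonglongrightarrow> 0" by simp
qed

text \<open>The deviation of the mean step from the ideal step, which would remove the whole error.
  It is the inverse of \<open>B t\<close> applied to the matrix error times \<open>e t\<close>,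
  minus the Taylor remainder of \<open>gf\<close>, and so of second order.\<close>

definition drift where "drift t \<omega> = e t \<omega> - matrix_inv (B t \<omega>) *v gf (x t \<omega>)"

lemma norm_drift_le:
  assumes "\<omega> \<in> space M"
  shows "norm (drift t \<omega>) \<le> (Berr t \<omega> * norm (e t \<omega>) + L * (norm (e t \<omega>))\<^sup>2) / c"
proof -
  let ?y = "B t \<omega> *v e t \<omega> - gf (x t \<omega>)"
  have "drift t \<omega> = matrix_inv (B t \<omega>) *v ?y"
    by (simp add: drift_def matrix_vector_mult_diff_distrib matrix_inv_mult_vec(2)[OF B_invertible[OF assms]])
  then have "norm (drift t \<omega>) \<le> norm ?y / c" using norm_B_inv_le[OF assms] by simp
  also have "?y = (B t \<omega> - Bs) *v e t \<omega> - (gf (x t \<omega>) - Bs *v e t \<omega>)"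
    by (simp add: matrix_vector_mult_diff_rdistrib)
  also have "norm \<dots> / c \<le> (Berr t \<omega> * norm (e t \<omega>) + L * (norm (e t \<omega>))\<^sup>2) / c"
  proof (rule divide_right_mono)
    have "norm ((B t \<omega> - Bs) *v e t \<omega>) \<le> Berr t \<omega> * norm (e t \<omega>)"
      unfolding Berr_def by (rule norm_matrix_vector_le)
    moreover have "norm (gf (x t \<omega>) - Bs *v e t \<omega>) \<le> L * (norm (e t \<omega>))\<^sup>2"
      using gf_taylor[of "x t \<omega>"] by (simp add: e_def)
    ultimately show "norm ((B t \<omega> - Bs) *v e t \<omega> - (gf (x t \<omega>) - Bs *v e t \<omega>)) \<le> Berr t \<omega> * norm (e t \<omega>) + L * (norm (e t \<omega>))\<^sup>2"
      using norm_triangle_ineq4 order_trans add_mono by meson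
  qed (use c in simp)
  finally show ?thesis .
qed

lemma L2_drift: "L2 M (drift t)"
  unfolding drift_def[abs_def] using L2_dir[unfolded dir_def[abs_def]] by (intro L2_diff L2_e)

end

section \<open>Localized convergence rate\<close>

context stochastic_newton
begin

definition loc_e where "loc_e \<epsilon> m t = (LINT \<omega>|M. good \<epsilon> m t \<omega> * (norm (e t \<omega>))\<^sup>2)"
definition loc_B where "loc_B \<epsilon> m t = (LINT \<omega>|M. good \<epsilon> m t \<omega> * (Berr t \<omega>)\<^sup>2)"
text \<open>The sum starts at \<open>m\<close> because the event restricts the iterates only from
  then on; the earlier terms go into \<open>loc_const\<close>.\<close>

definition loc_avg where "loc_avg \<epsilon> m t = (\<Sum>i=m..<t. loc_e \<epsilon> m i) / real t"

lemma good_integrable_mult: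
  assumes "integrable M h"
  shows "integrable M (\<lambda>\<omega>. good \<epsilon> m t \<omega> * h \<omega>)"
  by (intro integrable_mult_unit assms to_M[OF good_measurable] good_range)

lemma loc_nonneg: "0 \<le> loc_e \<epsilon> m t" "0 \<le> loc_B \<epsilon> m t" "0 \<le> loc_avg \<epsilon> m t"
proof -
  show 1: "0 \<le> loc_e \<epsilon> m t" for t
    unfolding loc_e_def by (intro Bochner_Integration.integral_nonneg mult_nonneg_nonneg good_range) simp
  show "0 \<le> loc_B \<epsilon> m t"
    unfolding loc_B_def by (intro Bochner_Integration.integral_nonneg mult_nonneg_nonneg good_range) simp
  show "0 \<le> loc_avg \<epsilon> m t" unfolding loc_avg_def by (intro divide_nonneg_nonneg sum_nonneg 1) simp
qed

definition loc_const where "loc_const m = 8 * H_bound\<^sup>2 + 2 * L\<^sup>2 * (\<Sum>i<m. E_e2 i)"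

lemma loc_const_nonneg: "0 \<le> loc_const m"
  unfolding loc_const_def E_e2_def
  by (intro add_nonneg_nonneg mult_nonneg_nonneg sum_nonneg) auto

lemma loc_B_le:
  assumes "0 < m" "m \<le> t"
  shows "loc_B \<epsilon> m t \<le> loc_const m / real t + 2 * L\<^sup>2 * loc_avg \<epsilon> m t"
proof -
  have t: "0 < t" using assms by simp
  have early: "(LINT \<omega>|M. good \<epsilon> m t \<omega> * (norm (e i \<omega>))\<^sup>2) \<le> E_e2 i" for i
    unfolding E_e2_def
    by (intro integral_mono good_integrable_mult L2D(2)[OF L2_e] mult_left_le_one_le good_range) auto
  \<comment> \<open>The indicator decreases in time, so the one at time \<open>t\<close> lies below
    the one that belongs to \<open>i\<close>.\<close>
  have late: "(LINT \<omega>|M. good \<epsilon> m t \<omega> * (norm (e i \<omega>))\<^sup>2) \<le> loc_e \<epsilon> m i" if "i < t" for i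
    unfolding loc_e_def using that
    by (intro integral_mono good_integrable_mult L2D(2)[OF L2_e] mult_right_mono good_antimono) auto
  have "(\<Sum>i<t. LINT \<omega>|M. good \<epsilon> m t \<omega> * (norm (e i \<omega>))\<^sup>2)
      = (\<Sum>i<m. LINT \<omega>|M. good \<epsilon> m t \<omega> * (norm (e i \<omega>))\<^sup>2) + (\<Sum>i=m..<t. LINT \<omega>|M. good \<epsilon> m t \<omega> * (norm (e i \<omega>))\<^sup>2)"
    using assms by (simp add: lessThan_atLeast0 sum.atLeastLessThan_concat)
  also have "\<dots> \<le> (\<Sum>i<m. E_e2 i) + (\<Sum>i=m..<t. loc_e \<epsilon> m i)"
    by (intro add_mono sum_mono early late) auto
  finally have s: "(\<Sum>i<t. LINT \<omega>|M. good \<epsilon> m t \<omega> * (norm (e i \<omega>))\<^sup>2) \<le> (\<Sum>i<m. E_e2 i) + (\<Sum>i=m..<t. loc_e \<epsilon> m i)" .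
  have "loc_B \<epsilon> m t \<le> 8 * H_bound\<^sup>2 / real t + 2 * L\<^sup>2 / real t * (\<Sum>i<t. LINT \<omega>|M. good \<epsilon> m t \<omega> * (norm (e i \<omega>))\<^sup>2)"
    unfolding loc_B_def by (intro weighted_Berr to_M[OF good_measurable] good_range t)
  also have "\<dots> \<le> 8 * H_bound\<^sup>2 / real t + 2 * L\<^sup>2 / real t * ((\<Sum>i<m. E_e2 i) + (\<Sum>i=m..<t. loc_e \<epsilon> m i))"
    by (intro add_left_mono mult_left_mono s) simp
  also have "\<dots> = loc_const m / real t + 2 * L\<^sup>2 * loc_avg \<epsilon> m t"
    by (simp add: loc_const_def loc_avg_def add_divide_distrib distrib_left)
  finally show ?thesis .
qed

text \<open>The radius \<open>2 * sqrt (\<epsilon> / c)\<close> of the ball times the constant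
  \<open>(1 + L) / c\<close> of the drift bound; it tends to 0 with
  \<open>\<epsilon>\<close>.\<close>

definition slack where "slack \<epsilon> = 2 * sqrt (\<epsilon> / c) * (1 + L) / c"

lemma good_radius:
  assumes "0 < \<epsilon>" "gap t \<omega> < \<epsilon>"
  shows "norm (e t \<omega>) \<le> 2 * sqrt (\<epsilon> / c)"
proof -
  have "(norm (e t \<omega>))\<^sup>2 \<le> 4 * (\<epsilon> / c)"
    using gap_ge[of t \<omega>] assms c by (simp add: field_simps)
  then have "norm (e t \<omega>) \<le> sqrt (4 * (\<epsilon> / c))" by (rule real_le_rsqrt)
  also have "sqrt (4 * (\<epsilon> / c)) = 2 * sqrt (\<epsilon> / c)" unfolding real_sqrt_mult by simp
  finally show ?thesis .
qed

text \<open>The purpose of the localization: the product of error and drift is cubic, and bounding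
  one factor |e| by the radius of the ball leaves \<open>slack \<epsilon>\<close> times a sum of
  squares.\<close>

lemma contraction:
  assumes "0 < \<epsilon>" "\<omega> \<in> space M" "m \<le> t"
  shows "good \<epsilon> m t \<omega> * ((1 - slack \<epsilon>) * (norm (e t \<omega>))\<^sup>2 - slack \<epsilon> * (Berr t \<omega>)\<^sup>2)
    \<le> good \<epsilon> m t \<omega> * (e t \<omega> \<bullet> dir t \<omega>)"
proof (cases "gap t \<omega> < \<epsilon>")
  case False
  then have "good \<epsilon> m t \<omega> = 0" using \<open>m \<le> t\<close> by (auto simp: good_def)
  then show ?thesis by simp
next
  case True
  define r where "r = 2 * sqrt (\<epsilon> / c)"
  let ?n = "norm (e t \<omega>)" and ?b = "Berr t \<omega>"
  have n: "?n \<le> r" "0 \<le> ?n" using good_radius[OF assms(1) True] by (auto simp: r_def)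
  then have r: "0 \<le> r" by linarith
  have b: "0 \<le> ?b" by (simp add: Berr_def)
  have "e t \<omega> \<bullet> dir t \<omega> = ?n\<^sup>2 - e t \<omega> \<bullet> drift t \<omega>"
    by (simp add: drift_def dir_def inner_diff_right power2_norm_eq_inner)
  moreover have "e t \<omega> \<bullet> drift t \<omega> \<le> slack \<epsilon> * (?n\<^sup>2 + ?b\<^sup>2)"
  proof -
    have "e t \<omega> \<bullet> drift t \<omega> \<le> ?n * norm (drift t \<omega>)" by (rule norm_cauchy_schwarz)
    also have "\<dots> \<le> r * ((?b * ?n + L * ?n\<^sup>2) / c)"
      using n r by (intro mult_mono norm_drift_le assms) auto
    also have "\<dots> \<le> r * (((?n\<^sup>2 + ?b\<^sup>2) + L * (?n\<^sup>2 + ?b\<^sup>2)) / c)"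
    proof (intro mult_left_mono divide_right_mono add_mono)
      have "2 * (?b * ?n) \<le> ?n\<^sup>2 + ?b\<^sup>2" using sum_squares_bound[of ?b ?n] by simp
      moreover have "0 \<le> ?b * ?n" using n b by simp
      ultimately show "?b * ?n \<le> ?n\<^sup>2 + ?b\<^sup>2" by linarith
    qed (use r c L in auto)
    also have "\<dots> = slack \<epsilon> * (?n\<^sup>2 + ?b\<^sup>2)" by (simp add: slack_def r_def algebra_simps)
    finally show ?thesis .
  qed
  ultimately show ?thesis by (intro mult_left_mono good_range) (simp add: algebra_simps)
qed

text \<open>The mean step of an ideal Newton method would contract the squared error by about
  2/(t+1); the deviation from it is charged to \<open>slack \<epsilon>\<close>, in part against the
  matrix error.\<close>

lemma loc_e_step:
  assumes "0 < \<epsilon>" "m \<le> t"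
  shows "loc_e \<epsilon> m (Suc t) \<le> (1 - 2 * (1 - slack \<epsilon>) / real (Suc t) + 2 * U\<^sup>2 / c\<^sup>2 / (real (Suc t))\<^sup>2) * loc_e \<epsilon> m t
    + 2 * slack \<epsilon> / real (Suc t) * loc_B \<epsilon> m t + 2 * s2 / c\<^sup>2 / (real (Suc t))\<^sup>2"
proof -
  define a where "a = 1 / real (Suc t)"
  have a: "0 < a" by (simp add: a_def)
  let ?k = "good \<epsilon> m t"
  have kM: "?k \<in> borel_measurable M" by (rule to_M[OF good_measurable])
  \<comment> \<open>By symmetry the inverse moves onto the error, so the cross term pairs the raw
    gradient with a vector known from the past.\<close>
  define v where "v \<omega> = matrix_inv (B t \<omega>) *v e t \<omega>" for \<omega>
  have mv: "v \<in> borel_measurable (\<G> t)" unfolding v_def[abs_def]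
    by (intro borel_measurable_matrix_inv_vec B_measurable e_measurable B_invertible) (simp add: space_\<G>)
  have Lv: "L2 M v" unfolding v_def[abs_def] by (rule L2_Binv[OF L2_e])
  have mkv: "(\<lambda>\<omega>. ?k \<omega> *\<^sub>R v \<omega>) \<in> borel_measurable (\<G> t)"
    by (intro borel_measurable_scaleR good_measurable mv)
  have Lkv: "L2 M (\<lambda>\<omega>. ?k \<omega> *\<^sub>R v \<omega>)"
    by (rule L2_bound[OF Lv to_M[OF mkv]]) (use good_range in \<open>auto intro: mult_left_le_one_le\<close>)
  have vdot: "v \<omega> \<bullet> y = e t \<omega> \<bullet> (matrix_inv (B t \<omega>) *v y)" if "\<omega> \<in> space M" for \<omega> y
    unfolding v_def
    using inner_symmetric_matrix[OF transpose_matrix_inv[OF B_invertible[OF that] B_sym[OF that]]] by simp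
  have ie: "integrable M (\<lambda>\<omega>. ?k \<omega> * (norm (e t \<omega>))\<^sup>2)"
    by (intro good_integrable_mult L2D(2)[OF L2_e])
  have iB: "integrable M (\<lambda>\<omega>. ?k \<omega> * (Berr t \<omega>)\<^sup>2)" by (intro good_integrable_mult Berr_square_integrable)
  have i\<eta>: "integrable M (\<lambda>\<omega>. ?k \<omega> * (norm (\<eta> t \<omega>))\<^sup>2)"
    by (rule integral_mult_\<eta>(1)[OF good_measurable good_integrable])
  have ig: "integrable M (\<lambda>\<omega>. ?k \<omega> * (v \<omega> \<bullet> g t \<omega>))" and igf: "integrable M (\<lambda>\<omega>. ?k \<omega> * (v \<omega> \<bullet> gf (x t \<omega>)))"
    using L2_inner_integrable[OF Lkv L2_g[of t]] L2_inner_integrable[OF Lkv L2_gf[of t]] by auto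
  have cross: "(LINT \<omega>|M. ?k \<omega> * (v \<omega> \<bullet> g t \<omega>)) \<ge> (1 - slack \<epsilon>) * loc_e \<epsilon> m t - slack \<epsilon> * loc_B \<epsilon> m t"
  proof -
    have "(1 - slack \<epsilon>) * loc_e \<epsilon> m t - slack \<epsilon> * loc_B \<epsilon> m t
        = (LINT \<omega>|M. (1 - slack \<epsilon>) * (?k \<omega> * (norm (e t \<omega>))\<^sup>2) - slack \<epsilon> * (?k \<omega> * (Berr t \<omega>)\<^sup>2))"
      unfolding loc_e_def loc_B_def using ie iB by simp
    also have "\<dots> \<le> (LINT \<omega>|M. ?k \<omega> * (v \<omega> \<bullet> gf (x t \<omega>)))"
    proof (rule integral_mono)
      show "(1 - slack \<epsilon>) * (?k \<omega> * (norm (e t \<omega>))\<^sup>2) - slack \<epsilon> * (?k \<omega> * (Berr t \<omega>)\<^sup>2) \<le> ?k \<omega> * (v \<omega> \<bullet> gf (x t \<omega>))"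
        if "\<omega> \<in> space M" for \<omega>
        using contraction[OF assms(1) that assms(2)] vdot[OF that, of "gf (x t \<omega>)"]
        by (simp add: dir_def algebra_simps)
    qed (use ie iB igf in auto)
    also have "\<dots> = (LINT \<omega>|M. ?k \<omega> * (v \<omega> \<bullet> g t \<omega>))"
      using orthogonal_noise[OF mkv Lkv] by simp
    finally show ?thesis .
  qed
  have "loc_e \<epsilon> m (Suc t) \<le> (LINT \<omega>|M. ?k \<omega> * (norm (e t \<omega>))\<^sup>2 - 2 * a * (?k \<omega> * (v \<omega> \<bullet> g t \<omega>))
      + (2 * a\<^sup>2 / c\<^sup>2) * (?k \<omega> * (norm (\<eta> t \<omega>))\<^sup>2) + (2 * U\<^sup>2 * a\<^sup>2 / c\<^sup>2) * (?k \<omega> * (norm (e t \<omega>))\<^sup>2))"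
    unfolding loc_e_def
  proof (rule integral_mono)
    fix \<omega> assume \<omega>: "\<omega> \<in> space M"
    let ?w = "matrix_inv (B t \<omega>) *v g t \<omega>"
    have "(norm (e (Suc t) \<omega>))\<^sup>2 = (norm (e t \<omega> - a *\<^sub>R ?w))\<^sup>2"
      by (simp add: e_Suc[OF \<omega>] a_def)
    also have "\<dots> = (norm (e t \<omega>))\<^sup>2 - 2 * a * (e t \<omega> \<bullet> ?w) + a\<^sup>2 * (norm ?w)\<^sup>2"
      unfolding power2_norm_eq_inner
      by (simp add: inner_diff_left inner_diff_right inner_commute[of ?w "e t \<omega>"] power2_eq_square algebra_simps)
    also have "a\<^sup>2 * (norm ?w)\<^sup>2 \<le> a\<^sup>2 * ((2 * (norm (\<eta> t \<omega>))\<^sup>2 + 2 * U\<^sup>2 * (norm (e t \<omega>))\<^sup>2) / c\<^sup>2)"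
      by (intro mult_left_mono norm_step_square_le \<omega>) simp
    finally have le: "(norm (e (Suc t) \<omega>))\<^sup>2 \<le> (norm (e t \<omega>))\<^sup>2 - 2 * a * (v \<omega> \<bullet> g t \<omega>)
        + a\<^sup>2 * ((2 * (norm (\<eta> t \<omega>))\<^sup>2 + 2 * U\<^sup>2 * (norm (e t \<omega>))\<^sup>2) / c\<^sup>2)"
      by (simp add: vdot[OF \<omega>])
    \<comment> \<open>Passing to the earlier indicator makes the weight a function of the past
      before the noise is averaged out.\<close>
    have "good \<epsilon> m (Suc t) \<omega> * (norm (e (Suc t) \<omega>))\<^sup>2 \<le> ?k \<omega> * (norm (e (Suc t) \<omega>))\<^sup>2"
      by (intro mult_right_mono good_antimono) auto
    also have "\<dots> \<le> ?k \<omega> * ((norm (e t \<omega>))\<^sup>2 - 2 * a * (v \<omega> \<bullet> g t \<omega>)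
        + a\<^sup>2 * ((2 * (norm (\<eta> t \<omega>))\<^sup>2 + 2 * U\<^sup>2 * (norm (e t \<omega>))\<^sup>2) / c\<^sup>2))"
      by (intro mult_left_mono le good_range)
    also have "\<dots> = ?k \<omega> * (norm (e t \<omega>))\<^sup>2 - 2 * a * (?k \<omega> * (v \<omega> \<bullet> g t \<omega>))
      + (2 * a\<^sup>2 / c\<^sup>2) * (?k \<omega> * (norm (\<eta> t \<omega>))\<^sup>2) + (2 * U\<^sup>2 * a\<^sup>2 / c\<^sup>2) * (?k \<omega> * (norm (e t \<omega>))\<^sup>2)"
      by (simp add: algebra_simps add_divide_distrib)
    finally show "good \<epsilon> m (Suc t) \<omega> * (norm (e (Suc t) \<omega>))\<^sup>2 \<le> ?k \<omega> * (norm (e t \<omega>))\<^sup>2 - 2 * a * (?k \<omega> * (v \<omega> \<bullet> g t \<omega>))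
      + (2 * a\<^sup>2 / c\<^sup>2) * (?k \<omega> * (norm (\<eta> t \<omega>))\<^sup>2) + (2 * U\<^sup>2 * a\<^sup>2 / c\<^sup>2) * (?k \<omega> * (norm (e t \<omega>))\<^sup>2)" .
  qed (use ie ig i\<eta> in \<open>auto intro!: Bochner_Integration.integrable_add Bochner_Integration.integrable_diff integrable_mult_right good_integrable_mult L2D(2)[OF L2_e]\<close>)
  also have "\<dots> = loc_e \<epsilon> m t - 2 * a * (LINT \<omega>|M. ?k \<omega> * (v \<omega> \<bullet> g t \<omega>))
      + (2 * a\<^sup>2 / c\<^sup>2) * ((LINT \<omega>|M. ?k \<omega>) * s2) + (2 * U\<^sup>2 * a\<^sup>2 / c\<^sup>2) * loc_e \<epsilon> m t"
    using ie ig i\<eta> unfolding loc_e_def integral_mult_\<eta>(2)[OF good_measurable good_integrable, symmetric] by simp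
  also have "\<dots> \<le> loc_e \<epsilon> m t - 2 * a * ((1 - slack \<epsilon>) * loc_e \<epsilon> m t - slack \<epsilon> * loc_B \<epsilon> m t)
      + (2 * a\<^sup>2 / c\<^sup>2) * (1 * s2) + (2 * U\<^sup>2 * a\<^sup>2 / c\<^sup>2) * loc_e \<epsilon> m t"
  proof -
    have "(LINT \<omega>|M. ?k \<omega>) \<le> (LINT \<omega>|M. 1)" by (intro integral_mono good_integrable good_range) auto
    then have "(LINT \<omega>|M. ?k \<omega>) \<le> 1" by (simp add: prob_space)
    then have "(2 * a\<^sup>2 / c\<^sup>2) * ((LINT \<omega>|M. ?k \<omega>) * s2) \<le> (2 * a\<^sup>2 / c\<^sup>2) * (1 * s2)"
      using s2_nonneg by (intro mult_left_mono mult_right_mono) auto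
    moreover have "2 * a * ((1 - slack \<epsilon>) * loc_e \<epsilon> m t - slack \<epsilon> * loc_B \<epsilon> m t) \<le> 2 * a * (LINT \<omega>|M. ?k \<omega> * (v \<omega> \<bullet> g t \<omega>))"
      using a by (intro mult_left_mono cross) simp
    ultimately show ?thesis by linarith
  qed
  also have "\<dots> = (1 - 2 * (1 - slack \<epsilon>) * a + 2 * U\<^sup>2 / c\<^sup>2 * a\<^sup>2) * loc_e \<epsilon> m t + 2 * slack \<epsilon> * a * loc_B \<epsilon> m t + 2 * s2 / c\<^sup>2 * a\<^sup>2"
    by (simp add: algebra_simps)
  finally show ?thesis by (simp add: a_def power_divide)
qed

lemma loc_avg_step:
  assumes "0 < m" "m \<le> t"
  shows "loc_avg \<epsilon> m (Suc t) = (1 - 1 / real (Suc t)) * loc_avg \<epsilon> m t + 1 / real (Suc t) * loc_e \<epsilon> m t"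
proof -
  define S where "S = (\<Sum>i=m..<t. loc_e \<epsilon> m i)"
  have "(\<Sum>i=m..<Suc t. loc_e \<epsilon> m i) = S + loc_e \<epsilon> m t" using assms by (simp add: S_def)
  moreover have "(1 - 1 / real (Suc t)) * (S / real t) = S / real (Suc t)"
    using assms by (simp add: divide_simps)
  ultimately show ?thesis by (simp only: loc_avg_def add_divide_distrib S_def[symmetric]) simp
qed

text \<open>The error contracts at nearly 2, but the running average only at 1 while being fed by
  the error. The thresholds 1/16 and 1/256 give the error the rate 11/8 and a feedback 1/64 from the
  average. In error plus 1/8 of the average, the former keeps 11/8 - 1/8 and the latter 1 - 1/8, so
  the sum contracts at 7/8, above the target 3/4.\<close>

lemma localized_rate:
  assumes \<epsilon>: "0 < \<epsilon>" and small: "slack \<epsilon> \<le> 1 / 16" "slack \<epsilon> * L\<^sup>2 \<le> 1 / 256" and "0 < m"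
  obtains C m1 where "0 \<le> C" "m \<le> m1" "\<And>t. m1 \<le> t \<Longrightarrow> loc_e \<epsilon> m t + loc_B \<epsilon> m t \<le> C * real (Suc t) powr (-3/4)"
proof -
  define k where "k = slack \<epsilon>"
  have k0: "0 \<le> k" using c L \<epsilon> by (simp add: k_def slack_def)
  define K where "K = 2 * U\<^sup>2 / c\<^sup>2"
  have K0: "0 \<le> K" using c by (simp add: K_def)
  define C1 where "C1 = loc_const m"
  have C10: "0 \<le> C1" using loc_const_nonneg by (simp add: C1_def)
  define C2 where "C2 = 4 * k * C1 + 2 * s2 / c\<^sup>2"
  have C20: "0 \<le> C2" using k0 C10 s2_nonneg by (simp add: C2_def)
  \<comment> \<open>From here on \<open>K * a\<close> is at most 1/2, so the second-order term costs
    at most 1/2 of the contraction rate.\<close>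
  define m1 where "m1 = max m (nat \<lceil>2 * K\<rceil>)"
  define l where "l t = loc_e \<epsilon> m t + loc_avg \<epsilon> m t / 8" for t
  have rec: "l (Suc t) \<le> (1 - (7/8) / real (Suc t)) * l t + C2 / (real (Suc t))\<^sup>2" if "m1 \<le> t" for t
  proof -
    define a where "a = 1 / real (Suc t)"
    have t: "m \<le> t" "0 < t" using that \<open>0 < m\<close> unfolding m1_def by auto
    have "2 * K \<le> real t" using that unfolding m1_def by linarith
    have a: "0 < a" "a \<le> 1" "K * a \<le> 1/2"
    proof -
      show "0 < a" "a \<le> 1" by (auto simp: a_def)
      have "2 * K \<le> real (Suc t)" using \<open>2 * K \<le> real t\<close> by simp
      then show "K * a \<le> 1/2" by (simp add: a_def field_simps)
    qed
    let ?u = "loc_e \<epsilon> m t" and ?w = "loc_avg \<epsilon> m t" and ?b = "loc_B \<epsilon> m t"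
    note nn = loc_nonneg[of \<epsilon> m t]
    have "1 / real t \<le> 2 * a" using t by (simp add: a_def field_simps)
    then have "C1 * (1 / real t) \<le> C1 * (2 * a)" using C10 by (rule mult_left_mono)
    then have b: "?b \<le> 2 * C1 * a + 2 * L\<^sup>2 * ?w"
      using loc_B_le[OF \<open>0 < m\<close> t(1), of \<epsilon>] by (simp add: C1_def)
    have "loc_e \<epsilon> m (Suc t) \<le> (1 - 2 * (1 - k) * a + K * a\<^sup>2) * ?u + 2 * k * a * ?b + 2 * s2 / c\<^sup>2 * a\<^sup>2"
      using loc_e_step[OF \<epsilon> t(1)] by (simp add: k_def K_def a_def power_divide)
    also have "\<dots> \<le> (1 - 2 * (1 - k) * a + K * a\<^sup>2) * ?u + 2 * k * a * (2 * C1 * a + 2 * L\<^sup>2 * ?w) + 2 * s2 / c\<^sup>2 * a\<^sup>2"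
      using k0 a by (intro add_mono mult_left_mono b order_refl) auto
    also have "\<dots> = (1 - 2 * (1 - k) * a + (K * a) * a) * ?u + (4 * (k * L\<^sup>2) * a) * ?w + C2 * a\<^sup>2"
      by (simp add: C2_def power2_eq_square algebra_simps)
    also have "\<dots> \<le> (1 - 2 * (1 - 1/16) * a + (1/2) * a) * ?u + (4 * (1/256) * a) * ?w + C2 * a\<^sup>2"
      using small a nn by (intro add_mono mult_right_mono mult_left_mono order_refl diff_mono) (auto simp: k_def)
    finally have 1: "loc_e \<epsilon> m (Suc t) \<le> (1 - 11/8 * a) * ?u + (1/64 * a) * ?w + C2 * a\<^sup>2" by simp
    have 2: "loc_avg \<epsilon> m (Suc t) = (1 - a) * ?w + a * ?u"
      using loc_avg_step[OF \<open>0 < m\<close> t(1)] by (simp add: a_def)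
    have "l (Suc t) \<le> (1 - 11/8 * a) * ?u + (1/64 * a) * ?w + C2 * a\<^sup>2 + ((1 - a) * ?w + a * ?u) / 8"
      unfolding l_def 2 using 1 by simp
    also have "\<dots> = (1 - 10/8 * a) * ?u + (1 - 7/8 * a) * (?w / 8) + C2 * a\<^sup>2"
      by (simp add: algebra_simps add_divide_distrib diff_divide_distrib)
    also have "\<dots> \<le> (1 - 7/8 * a) * ?u + (1 - 7/8 * a) * (?w / 8) + C2 * a\<^sup>2"
      using a nn by (intro add_mono mult_right_mono order_refl) auto
    also have "\<dots> = (1 - 7/8 * a) * l t + C2 * a\<^sup>2" by (simp add: l_def distrib_left)
    finally show ?thesis by (simp add: a_def power_divide)
  qed
  obtain C where C: "0 \<le> C" "\<And>t. m1 \<le> t \<Longrightarrow> l t \<le> C * real (Suc t) powr (-(3/4))"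
    using recursion_rate[of "3/4" "7/8" C2 m1 l] C20 rec by auto
  define C' where "C' = C + (2 * C1 + 16 * L\<^sup>2 * C)"
  have "loc_e \<epsilon> m t + loc_B \<epsilon> m t \<le> C' * real (Suc t) powr (-3/4)" if "m1 \<le> t" for t
  proof -
    let ?p = "real (Suc t) powr (-3/4)"
    have t: "m \<le> t" "0 < t" using that \<open>0 < m\<close> unfolding m1_def by auto
    note nn = loc_nonneg[of \<epsilon> m t]
    have l: "l t \<le> C * ?p" using C(2)[OF that] by simp
    then have u: "loc_e \<epsilon> m t \<le> C * ?p" and w: "loc_avg \<epsilon> m t \<le> 8 * (C * ?p)"
      using nn unfolding l_def by linarith+
    have "1 / real (Suc t) = real (Suc t) powr (-1)" by (simp add: powr_minus_divide)
    also have "\<dots> \<le> ?p" by (intro powr_mono) auto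
    finally have "1 / real (Suc t) \<le> ?p" .
    moreover have "1 / real t \<le> 2 * (1 / real (Suc t))" using t by (simp add: field_simps)
    ultimately have "1 / real t \<le> 2 * ?p" by linarith
    then have "C1 * (1 / real t) \<le> C1 * (2 * ?p)" using C10 by (rule mult_left_mono)
    moreover have "2 * L\<^sup>2 * loc_avg \<epsilon> m t \<le> 2 * L\<^sup>2 * (8 * (C * ?p))" using w by (intro mult_left_mono) auto
    moreover have "loc_B \<epsilon> m t \<le> C1 * (1 / real t) + 2 * L\<^sup>2 * loc_avg \<epsilon> m t"
      using loc_B_le[OF \<open>0 < m\<close> t(1), of \<epsilon>] by (simp add: C1_def)
    ultimately have "loc_B \<epsilon> m t \<le> C1 * (2 * ?p) + 2 * L\<^sup>2 * (8 * (C * ?p))" by linarith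
    then have "loc_e \<epsilon> m t + loc_B \<epsilon> m t \<le> C * ?p + (C1 * (2 * ?p) + 2 * L\<^sup>2 * (8 * (C * ?p)))" using u by linarith
    also have "\<dots> = C' * ?p" by (simp add: C'_def algebra_simps)
    finally show ?thesis .
  qed
  moreover have "0 \<le> C'" using C(1) C10 by (simp add: C'_def)
  ultimately show thesis using that[of C' m1] by (simp add: m1_def)
qed

end

section \<open>Asymptotic normality\<close>

context stochastic_newton
begin

text \<open>Noise at the minimizer under the limiting inverse, minus the actual noise under the
  current inverse: the error of replacing the latter by i.i.d. summands.\<close>

definition mart where
  "mart t \<omega> = matrix_inv Bs *v \<eta> t \<omega> - matrix_inv (B t \<omega>) *v (g t \<omega> - gf (x t \<omega>))"

text \<open>The step 1/(n+1) is exactly what makes this telescope: multiplying by n + 1 leaves one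
  extra copy of \<open>e n \<omega>\<close>, which combines with the mean step to the drift.\<close>

lemma error_decomposition:
  assumes "\<omega> \<in> space M"
  shows "real n *\<^sub>R e n \<omega> = (\<Sum>t<n. - (matrix_inv Bs *v \<eta> t \<omega>)) + ((\<Sum>t<n. mart t \<omega>) + (\<Sum>t<n. drift t \<omega>))"
proof (induction n)
  case (Suc n)
  have "real (Suc n) *\<^sub>R e (Suc n) \<omega> = real (Suc n) *\<^sub>R e n \<omega> - matrix_inv (B n \<omega>) *v g n \<omega>"
    by (simp add: e_Suc[OF assms] scaleR_diff_right del: of_nat_Suc)
  also have "\<dots> = real n *\<^sub>R e n \<omega> + (- (matrix_inv Bs *v \<eta> n \<omega>) + (mart n \<omega> + drift n \<omega>))"
    by (simp add: mart_def drift_def matrix_vector_mult_diff_distrib scaleR_add_left)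
  finally show ?case by (simp add: Suc.IH)
qed simp

lemma Bs_invertible: "invertible Bs" by (rule invertible_if_coercive[OF c Bs_low])

lemma norm_Bs_inv_le: "norm (matrix_inv Bs *v v) \<le> norm v / c"
  by (rule norm_matrix_inv_vec_le[OF c Bs_low])

lemma L2_Bs_inv_\<eta>: "L2 M (\<lambda>\<omega>. matrix_inv Bs *v \<eta> t \<omega>)"
proof (rule L2_bound[OF L2_scale[OF L2_\<eta>, of "1 / c"]])
  show "(\<lambda>\<omega>. matrix_inv Bs *v \<eta> t \<omega>) \<in> borel_measurable M"
    by (intro borel_measurable_matrix_inv_vec L2D(1)[OF L2_\<eta>] Bs_invertible) simp
qed (use c norm_Bs_inv_le in auto)

lemma L2_mart: "L2 M (mart t)"
  unfolding mart_def[abs_def] by (intro L2_diff L2_Bs_inv_\<eta> L2_Binv L2_g L2_gf)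

lemma mart_measurable: "s < t \<Longrightarrow> mart s \<in> borel_measurable (\<G> t)"
  unfolding mart_def[abs_def] \<eta>_def g_def
  by (intro borel_measurable_diff borel_measurable_matrix_inv_vec G_compose adapted borel_measurable_const
      \<G>_mono[OF _ x_measurable] \<G>_mono[OF _ B_measurable] \<G>_mono[OF _ gfx_measurable] Bs_invertible B_invertible)
    (auto simp: space_\<G>)

lemma mart_orthogonal: "(LINT \<omega>|M. (\<Sum>i<t. mart i \<omega>) \<bullet> mart t \<omega>) = 0"
proof -
  interpret P: prob_space P by (rule prob_space_P)
  define \<psi> where "\<psi> \<omega> d = matrix_inv Bs *v G xs d - matrix_inv (B t \<omega>) *v (G (x t \<omega>) d - gf (x t \<omega>))" for \<omega> d
  have bl: "bounded_linear (\<lambda>v. A *v v)" for A :: "real^'d^'d" by (rule matrix_vector_mul_bounded_linear)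
  have "(LINT \<omega>|M. (\<Sum>i<t. mart i \<omega>) \<bullet> \<psi> \<omega> (\<xi> t \<omega>)) = 0"
  proof (rule orthogonal_fresh)
    show "(\<lambda>\<omega>. \<Sum>i<t. mart i \<omega>) \<in> borel_measurable (\<G> t)" by (intro borel_measurable_sum mart_measurable) auto
    show "L2 M (\<lambda>\<omega>. \<Sum>i<t. mart i \<omega>)" by (intro L2_sum L2_mart) auto
    have fst: "fst \<in> measurable (\<G> t \<Otimes>\<^sub>M P) (\<G> t)" and snd: "snd \<in> measurable (\<G> t \<Otimes>\<^sub>M P) P" by simp_all
    have xm: "(\<lambda>p. x t (fst p)) \<in> borel_measurable (\<G> t \<Otimes>\<^sub>M P)" by (rule measurable_compose[OF fst x_measurable])
    have Bm: "(\<lambda>p. B t (fst p)) \<in> borel_measurable (\<G> t \<Otimes>\<^sub>M P)" by (rule measurable_compose[OF fst B_measurable])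
    have gm: "(\<lambda>p. gf (x t (fst p))) \<in> borel_measurable (\<G> t \<Otimes>\<^sub>M P)" by (rule measurable_compose[OF fst gfx_measurable])
    show "(\<lambda>p. \<psi> (fst p) (snd p)) \<in> borel_measurable (\<G> t \<Otimes>\<^sub>M P)"
      unfolding \<psi>_def
      by (intro borel_measurable_diff borel_measurable_matrix_inv_vec G_compose snd xm Bm gm borel_measurable_const Bs_invertible B_invertible)
        (auto simp: space_pair_measure space_\<G>)
    show "integrable P (\<psi> \<omega>)" for \<omega>
      unfolding \<psi>_def using G_integrable
      by (intro Bochner_Integration.integrable_diff integrable_bounded_linear[OF bl]) auto
    show "(LINT d|P. \<psi> \<omega> d) = 0" for \<omega>
    proof -
      have i: "integrable P (\<lambda>d. G (x t \<omega>) d - gf (x t \<omega>))" using G_integrable by simp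
      have "(LINT d|P. G (x t \<omega>) d - gf (x t \<omega>)) = 0" using G_integrable by (simp add: G_mean P.prob_space)
      moreover have "(LINT d|P. \<psi> \<omega> d) = matrix_inv Bs *v (LINT d|P. G xs d)
          - matrix_inv (B t \<omega>) *v (LINT d|P. G (x t \<omega>) d - gf (x t \<omega>))"
        unfolding \<psi>_def
        using integral_bounded_linear[OF bl G_integrable, of "matrix_inv Bs" xs]
          integral_bounded_linear[OF bl i, of "matrix_inv (B t \<omega>)"]
          integrable_bounded_linear[OF bl G_integrable] integrable_bounded_linear[OF bl i]
        by (subst Bochner_Integration.integral_diff) auto
      ultimately show ?thesis by (simp add: G_mean gf_xs)
    qed
    show "L2 M (\<lambda>\<omega>. \<psi> \<omega> (\<xi> t \<omega>))" using L2_mart[of t] by (simp add: \<psi>_def mart_def[abs_def] \<eta>_def g_def)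
  qed
  then show ?thesis by (simp add: \<psi>_def mart_def \<eta>_def g_def)
qed

text \<open>By the resolvent identity the difference of the two inverses contains the factor
  \<open>B t \<omega> - Bs\<close>, which gives the first term. The rest is the change of the noise
  between \<open>x t\<close> and \<open>xs\<close>, bounded by the Lipschitz estimates.\<close>

lemma norm_mart_square_le:
  assumes "\<omega> \<in> space M"
  shows "(norm (mart t \<omega>))\<^sup>2 \<le> 2 / c ^ 4 * ((Berr t \<omega>)\<^sup>2 * (norm (\<eta> t \<omega>))\<^sup>2) + 8 * U\<^sup>2 / c\<^sup>2 * (norm (e t \<omega>))\<^sup>2"
proof -
  let ?Bi = "matrix_inv (B t \<omega>)" and ?y = "matrix_inv Bs *v \<eta> t \<omega>"
  let ?p = "?Bi *v ((B t \<omega> - Bs) *v ?y)" and ?q = "?Bi *v (g t \<omega> - \<eta> t \<omega> - gf (x t \<omega>))"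
  have "?p = ?y - ?Bi *v \<eta> t \<omega>"
    by (simp add: matrix_vector_mult_diff_rdistrib matrix_vector_mult_diff_distrib
        matrix_inv_mult_vec(2)[OF B_invertible[OF assms]] matrix_inv_mult_vec(1)[OF Bs_invertible])
  then have "mart t \<omega> = ?p + (- ?q)" by (simp add: mart_def matrix_vector_mult_diff_distrib)
  then have "(norm (mart t \<omega>))\<^sup>2 \<le> 2 * (norm ?p)\<^sup>2 + 2 * (norm ?q)\<^sup>2"
    using norm_add_square_le[of ?p "- ?q"] by simp
  also have "\<dots> \<le> 2 * (Berr t \<omega> * norm (\<eta> t \<omega>) / c\<^sup>2)\<^sup>2 + 2 * (2 * U * norm (e t \<omega>) / c)\<^sup>2"
  proof (intro add_mono mult_left_mono power_mono)
    have "norm ?p \<le> norm ((B t \<omega> - Bs) *v ?y) / c" by (rule norm_B_inv_le[OF assms])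
    also have "\<dots> \<le> Berr t \<omega> * norm ?y / c"
      unfolding Berr_def using c by (intro divide_right_mono norm_matrix_vector_le) simp
    also have "\<dots> \<le> Berr t \<omega> * (norm (\<eta> t \<omega>) / c) / c"
      using c by (intro divide_right_mono mult_left_mono norm_Bs_inv_le) (auto simp: Berr_def)
    finally show "norm ?p \<le> Berr t \<omega> * norm (\<eta> t \<omega>) / c\<^sup>2" by (simp add: power2_eq_square)
    have "norm (g t \<omega> - \<eta> t \<omega>) \<le> U * norm (e t \<omega>)"
      unfolding g_def \<eta>_def e_def by (rule G_lip[OF \<xi>_space[OF assms]])
    then have "norm (g t \<omega> - \<eta> t \<omega> - gf (x t \<omega>)) \<le> 2 * U * norm (e t \<omega>)"
      using norm_gf_le[of t \<omega>] norm_triangle_ineq4[of "g t \<omega> - \<eta> t \<omega>" "gf (x t \<omega>)"] by linarith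
    then show "norm ?q \<le> 2 * U * norm (e t \<omega>) / c"
      using norm_B_inv_le[OF assms, of t "g t \<omega> - \<eta> t \<omega> - gf (x t \<omega>)"] c by (meson divide_right_mono less_imp_le order_trans)
  qed auto
  also have "\<dots> = 2 / c ^ 4 * ((Berr t \<omega>)\<^sup>2 * (norm (\<eta> t \<omega>))\<^sup>2) + 8 * U\<^sup>2 / c\<^sup>2 * (norm (e t \<omega>))\<^sup>2"
    by (simp add: power_mult_distrib power_divide flip: power_mult)
  finally show ?thesis .
qed

text \<open>The matrix error belongs to the past and \<open>\<eta> t\<close> is fresh, so the mean
  of the product of their squares factorizes and no fourth moments arise.\<close>

lemma mart_square_tendsto_0: "(\<lambda>t. LINT \<omega>|M. (norm (mart t \<omega>))\<^sup>2) \<longlonglongrightarrow> 0"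
proof (rule tendsto_sandwich[OF _ _ tendsto_const])
  show "\<forall>\<^sub>F t in sequentially. 0 \<le> (LINT \<omega>|M. (norm (mart t \<omega>))\<^sup>2)" by simp
  show "\<forall>\<^sub>F t in sequentially. (LINT \<omega>|M. (norm (mart t \<omega>))\<^sup>2)
      \<le> 2 / c ^ 4 * ((LINT \<omega>|M. (Berr t \<omega>)\<^sup>2) * s2) + 8 * U\<^sup>2 / c\<^sup>2 * E_e2 t"
  proof (intro always_eventually allI)
    fix t
    have m: "(\<lambda>\<omega>. (Berr t \<omega>)\<^sup>2) \<in> borel_measurable (\<G> t)" by (intro borel_measurable_power Berr_measurable)
    note prod = integral_mult_\<eta>[OF m Berr_square_integrable]
    have ie: "integrable M (\<lambda>\<omega>. (norm (e t \<omega>))\<^sup>2)" by (rule L2D(2)[OF L2_e])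
    have "(LINT \<omega>|M. (norm (mart t \<omega>))\<^sup>2) \<le> (LINT \<omega>|M. 2 / c ^ 4 * ((Berr t \<omega>)\<^sup>2 * (norm (\<eta> t \<omega>))\<^sup>2) + 8 * U\<^sup>2 / c\<^sup>2 * (norm (e t \<omega>))\<^sup>2)"
      by (intro integral_mono L2D(2)[OF L2_mart] norm_mart_square_le Bochner_Integration.integrable_add integrable_mult_right prod(1) ie)
    also have "\<dots> = 2 / c ^ 4 * ((LINT \<omega>|M. (Berr t \<omega>)\<^sup>2) * s2) + 8 * U\<^sup>2 / c\<^sup>2 * E_e2 t"
      unfolding prod(2)[symmetric] E_e2_def using prod(1) ie by simp
    finally show "(LINT \<omega>|M. (norm (mart t \<omega>))\<^sup>2) \<le> 2 / c ^ 4 * ((LINT \<omega>|M. (Berr t \<omega>)\<^sup>2) * s2) + 8 * U\<^sup>2 / c\<^sup>2 * E_e2 t" .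
  qed
  have "(\<lambda>t. 2 / c ^ 4 * ((LINT \<omega>|M. (Berr t \<omega>)\<^sup>2) * s2) + 8 * U\<^sup>2 / c\<^sup>2 * E_e2 t)
      \<longlonglongrightarrow> 2 / c ^ 4 * (0 * s2) + 8 * U\<^sup>2 / c\<^sup>2 * 0"
    by (intro tendsto_add tendsto_mult tendsto_const Berr_square_tendsto_0 e_square_tendsto_0)
  then show "(\<lambda>t. 2 / c ^ 4 * ((LINT \<omega>|M. (Berr t \<omega>)\<^sup>2) * s2) + 8 * U\<^sup>2 / c\<^sup>2 * E_e2 t) \<longlonglongrightarrow> 0" by simp
qed

lemma mart_sum_tendsto_0: "(\<lambda>n. (LINT \<omega>|M. norm (\<Sum>t<n. mart t \<omega>)) / sqrt n) \<longlonglongrightarrow> 0"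
proof (rule tendsto_sandwich[OF _ _ tendsto_const])
  show "\<forall>\<^sub>F n in sequentially. 0 \<le> (LINT \<omega>|M. norm (\<Sum>t<n. mart t \<omega>)) / sqrt n" by simp
  show "\<forall>\<^sub>F n in sequentially. (LINT \<omega>|M. norm (\<Sum>t<n. mart t \<omega>)) / sqrt n
      \<le> sqrt ((\<Sum>t<n. LINT \<omega>|M. (norm (mart t \<omega>))\<^sup>2) / real n)"
  proof (intro always_eventually allI)
    fix n
    have "L2 M (\<lambda>\<omega>. \<Sum>t<n. mart t \<omega>)" by (intro L2_sum L2_mart) auto
    from integral_norm_le_L2[OF this]
    have "(LINT \<omega>|M. norm (\<Sum>t<n. mart t \<omega>)) \<le> sqrt (\<Sum>t<n. LINT \<omega>|M. (norm (mart t \<omega>))\<^sup>2)"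
      using martingale_norm_square[OF L2_mart mart_orthogonal] by simp
    then show "(LINT \<omega>|M. norm (\<Sum>t<n. mart t \<omega>)) / sqrt n \<le> sqrt ((\<Sum>t<n. LINT \<omega>|M. (norm (mart t \<omega>))\<^sup>2) / real n)"
      by (simp add: real_sqrt_divide divide_right_mono)
  qed
  show "(\<lambda>n. sqrt ((\<Sum>t<n. LINT \<omega>|M. (norm (mart t \<omega>))\<^sup>2) / real n)) \<longlonglongrightarrow> 0"
    using tendsto_real_sqrt[OF cesaro_null[OF mart_square_tendsto_0]] by simp
qed

text \<open>The indicator at time \<open>n\<close> lies below each earlier one, so the localized
  rate applies term by term; summing t^(-3/4) gives n^(1/4).\<close>

lemma drift_sum_bound:
  assumes \<epsilon>: "0 < \<epsilon>" and small: "slack \<epsilon> \<le> 1 / 16" "slack \<epsilon> * L\<^sup>2 \<le> 1 / 256" and m: "0 < m"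
  obtains C n0 where "\<And>n. n0 \<le> n \<Longrightarrow>
    (LINT \<omega>|M. good \<epsilon> m n \<omega> * norm (\<Sum>t<n. drift t \<omega>)) \<le> C + C * real n powr (1/4)"
proof -
  obtain C m1 where C: "0 \<le> C" "m \<le> m1"
    and rate: "\<And>t. m1 \<le> t \<Longrightarrow> loc_e \<epsilon> m t + loc_B \<epsilon> m t \<le> C * real (Suc t) powr (-3/4)"
    using localized_rate[OF \<epsilon> small m] by metis
  have iD: "integrable M (\<lambda>\<omega>. norm (drift t \<omega>))" for t
    using L2_integrable[OF L2_drift] by simp
  define C0 where "C0 = (\<Sum>t<m1. LINT \<omega>|M. norm (drift t \<omega>))"
  have C00: "0 \<le> C0" unfolding C0_def by (intro sum_nonneg) simp
  have late: "(LINT \<omega>|M. good \<epsilon> m t \<omega> * norm (drift t \<omega>)) \<le> (1 + L) / c * (C * real (Suc t) powr (-3/4))" if "m1 \<le> t" for t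
  proof -
    have ie: "integrable M (\<lambda>\<omega>. good \<epsilon> m t \<omega> * (norm (e t \<omega>))\<^sup>2)"
      by (intro good_integrable_mult L2D(2)[OF L2_e])
    have iB: "integrable M (\<lambda>\<omega>. good \<epsilon> m t \<omega> * (Berr t \<omega>)\<^sup>2)" by (intro good_integrable_mult Berr_square_integrable)
    have "(LINT \<omega>|M. good \<epsilon> m t \<omega> * norm (drift t \<omega>))
        \<le> (LINT \<omega>|M. (1 + L) / c * (good \<epsilon> m t \<omega> * (norm (e t \<omega>))\<^sup>2 + good \<epsilon> m t \<omega> * (Berr t \<omega>)\<^sup>2))"
    proof (rule integral_mono)
      fix \<omega> assume \<omega>: "\<omega> \<in> space M"
      let ?n = "norm (e t \<omega>)" and ?b = "Berr t \<omega>"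
      have b: "0 \<le> ?b" by (simp add: Berr_def)
      have "2 * (?b * ?n) \<le> ?n\<^sup>2 + ?b\<^sup>2" using sum_squares_bound[of ?b ?n] by simp
      moreover have "0 \<le> ?b * ?n" using b by simp
      ultimately have 1: "?b * ?n \<le> ?n\<^sup>2 + ?b\<^sup>2" by linarith
      have 2: "L * ?n\<^sup>2 \<le> L * (?n\<^sup>2 + ?b\<^sup>2)" using L by (intro mult_left_mono) auto
      have "norm (drift t \<omega>) \<le> (?b * ?n + L * ?n\<^sup>2) / c" by (rule norm_drift_le[OF \<omega>])
      also have "\<dots> \<le> ((?n\<^sup>2 + ?b\<^sup>2) + L * (?n\<^sup>2 + ?b\<^sup>2)) / c"
        using c 1 2 by (intro divide_right_mono add_mono) auto
      also have "\<dots> = (1 + L) / c * (?n\<^sup>2 + ?b\<^sup>2)" by (simp add: distrib_right)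
      finally have "norm (drift t \<omega>) \<le> (1 + L) / c * (?n\<^sup>2 + ?b\<^sup>2)" .
      from mult_left_mono[OF this good_range(1)[of \<epsilon> m t \<omega>]]
      show "good \<epsilon> m t \<omega> * norm (drift t \<omega>) \<le> (1 + L) / c * (good \<epsilon> m t \<omega> * ?n\<^sup>2 + good \<epsilon> m t \<omega> * ?b\<^sup>2)"
        by (simp add: algebra_simps)
    qed (use iD ie iB good_integrable_mult in auto)
    also have "\<dots> = (1 + L) / c * (loc_e \<epsilon> m t + loc_B \<epsilon> m t)"
      using ie iB by (simp add: loc_e_def loc_B_def)
    also have "\<dots> \<le> (1 + L) / c * (C * real (Suc t) powr (-3/4))"
      using c L by (intro mult_left_mono rate that) auto
    finally show ?thesis .
  qed
  define C' where "C' = C0 + (1 + L) / c * C * 4"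
  have "(LINT \<omega>|M. good \<epsilon> m n \<omega> * norm (\<Sum>t<n. drift t \<omega>)) \<le> C' + C' * real n powr (1/4)" if "m1 \<le> n" for n
  proof -
    let ?k = "good \<epsilon> m n"
    have iS: "integrable M (\<lambda>\<omega>. ?k \<omega> * norm (\<Sum>t<n. drift t \<omega>))"
      using L2_integrable[OF L2_sum[OF _ L2_drift, of "{..<n}"]] by (intro good_integrable_mult) simp
    have "(LINT \<omega>|M. ?k \<omega> * norm (\<Sum>t<n. drift t \<omega>)) \<le> (LINT \<omega>|M. (\<Sum>t<n. ?k \<omega> * norm (drift t \<omega>)))"
    proof (rule integral_mono[OF iS])
      show "?k \<omega> * norm (\<Sum>t<n. drift t \<omega>) \<le> (\<Sum>t<n. ?k \<omega> * norm (drift t \<omega>))" for \<omega>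
        unfolding sum_distrib_left[symmetric] by (intro mult_left_mono norm_sum good_range)
    qed (intro Bochner_Integration.integrable_sum good_integrable_mult iD)
    also have "\<dots> = (\<Sum>t<n. LINT \<omega>|M. ?k \<omega> * norm (drift t \<omega>))"
      by (intro Bochner_Integration.integral_sum good_integrable_mult iD)
    also have "\<dots> = (\<Sum>t<m1. LINT \<omega>|M. ?k \<omega> * norm (drift t \<omega>)) + (\<Sum>t=m1..<n. LINT \<omega>|M. ?k \<omega> * norm (drift t \<omega>))"
      using that by (simp add: lessThan_atLeast0 sum.atLeastLessThan_concat)
    also have "\<dots> \<le> C0 + (\<Sum>t=m1..<n. (1 + L) / c * (C * real (Suc t) powr (-3/4)))"
      unfolding C0_def
    proof (intro add_mono sum_mono)
      fix t
      show "(LINT \<omega>|M. ?k \<omega> * norm (drift t \<omega>)) \<le> (LINT \<omega>|M. norm (drift t \<omega>))"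
        by (intro integral_mono good_integrable_mult iD mult_left_le_one_le good_range) auto
      assume t: "t \<in> {m1..<n}"
      have "(LINT \<omega>|M. ?k \<omega> * norm (drift t \<omega>)) \<le> (LINT \<omega>|M. good \<epsilon> m t \<omega> * norm (drift t \<omega>))"
        using t by (intro integral_mono good_integrable_mult iD mult_right_mono good_antimono) auto
      also have "\<dots> \<le> (1 + L) / c * (C * real (Suc t) powr (-3/4))" using t by (intro late) simp
      finally show "(LINT \<omega>|M. ?k \<omega> * norm (drift t \<omega>)) \<le> (1 + L) / c * (C * real (Suc t) powr (-3/4))" .
    qed
    also have "\<dots> = C0 + (1 + L) / c * C * (\<Sum>t=m1..<n. real (Suc t) powr (-3/4))"
      by (simp add: sum_distrib_left mult.assoc)
    also have "\<dots> \<le> C0 + (1 + L) / c * C * (4 * real n powr (1/4))"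
    proof (intro add_left_mono mult_left_mono)
      have "(\<Sum>t=m1..<n. real (Suc t) powr (-3/4)) \<le> (\<Sum>t<n. real (Suc t) powr (-3/4))"
        by (intro sum_mono2) auto
      then show "(\<Sum>t=m1..<n. real (Suc t) powr (-3/4)) \<le> 4 * real n powr (1/4)" using sum_powr_le[of n] by linarith
    qed (use c L C in auto)
    also have "\<dots> \<le> C' + C' * real n powr (1/4)"
    proof -
      have "0 \<le> (1 + L) / c * C * 4" using c L C by simp
      then have "C0 \<le> C'" "(1 + L) / c * C * 4 \<le> C'" using C00 by (auto simp: C'_def)
      then have "(1 + L) / c * C * 4 * real n powr (1/4) \<le> C' * real n powr (1/4)" by (intro mult_right_mono) auto
      then show ?thesis using \<open>C0 \<le> C'\<close> by (simp add: mult.assoc)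
    qed
    finally show ?thesis .
  qed
  then show thesis using that by blast
qed

lemma exists_small_slack: "\<exists>\<epsilon>>0. slack \<epsilon> \<le> 1 / 16 \<and> slack \<epsilon> * L\<^sup>2 \<le> 1 / 256"
proof -
  \<comment> \<open>With \<open>\<epsilon> = c * s\<^sup>2\<close> the slack is linear in
    \<open>s\<close>, and this \<open>s\<close> makes it \<open>1 / (256 * (1 + L\<^sup>2))\<close>,
    which meets both bounds.\<close>
  define s where "s = c / (512 * (1 + L) * (1 + L\<^sup>2))"
  have s: "0 < s" using c L by (simp add: s_def add_pos_nonneg)
  have "slack (c * s\<^sup>2) = 2 * s * (1 + L) / c" using c s by (simp add: slack_def)
  also have "\<dots> = 1 / (256 * (1 + L\<^sup>2))"
  proof -
    have "0 < 1 + L" "0 < 1 + L\<^sup>2" using L by (auto simp: add_pos_nonneg)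
    then show ?thesis using c unfolding s_def by (simp add: divide_simps) (simp add: algebra_simps)
  qed
  finally have eq: "slack (c * s\<^sup>2) = 1 / (256 * (1 + L\<^sup>2))" .
  have "0 < 1 + L\<^sup>2" by (simp add: add_pos_nonneg)
  then have "slack (c * s\<^sup>2) \<le> 1 / 16" "slack (c * s\<^sup>2) * L\<^sup>2 \<le> 1 / 256"
    unfolding eq by (auto simp: divide_simps)
  then show ?thesis using c s by (intro exI[of _ "c * s\<^sup>2"]) auto
qed

lemma remainder_tendsto_0:
  "(\<lambda>n. LINT \<omega>|M. min 1 (norm (sqrt (real n) *\<^sub>R e n \<omega> - (\<Sum>t<n. - (matrix_inv Bs *v \<eta> t \<omega>)) /\<^sub>R sqrt (real n)))) \<longlonglongrightarrow> 0"
proof (rule LIMSEQ_I)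
  fix r :: real assume r: "0 < r"
  obtain \<epsilon> where \<epsilon>: "0 < \<epsilon>" "slack \<epsilon> \<le> 1 / 16" "slack \<epsilon> * L\<^sup>2 \<le> 1 / 256"
    using exists_small_slack by blast
  obtain m where m: "0 < m" "\<And>n. m \<le> n \<Longrightarrow> 1 - (LINT \<omega>|M. good \<epsilon> m n \<omega>) \<le> r / 4"
  proof -
    have "0 < r / 4" using r by simp
    from good_probability[OF \<epsilon>(1) this] show thesis using that by blast
  qed
  obtain C n0 where C: "\<And>n. n0 \<le> n \<Longrightarrow>
      (LINT \<omega>|M. good \<epsilon> m n \<omega> * norm (\<Sum>t<n. drift t \<omega>)) \<le> C + C * real n powr (1/4)"
    by (rule drift_sum_bound[OF \<epsilon> m(1)]) blast
  have "(\<lambda>n. C * real n powr (-(1/2)) + C * real n powr (-(1/4))) \<longlonglongrightarrow> C * 0 + C * 0"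
    by (intro tendsto_add tendsto_mult tendsto_const tendsto_neg_powr filterlim_real_sequentially) auto
  then have "\<forall>\<^sub>F n in sequentially. C * real n powr (-(1/2)) + C * real n powr (-(1/4)) < r / 4"
    by (intro order_tendstoD(2)) (use r in auto)
  moreover have "\<forall>\<^sub>F n in sequentially. (LINT \<omega>|M. norm (\<Sum>t<n. mart t \<omega>)) / sqrt n < r / 4"
    by (rule order_tendstoD(2)[OF mart_sum_tendsto_0]) (use r in simp)
  ultimately have "\<forall>\<^sub>F n in sequentially. norm ((LINT \<omega>|M. min 1 (norm (sqrt (real n) *\<^sub>R e n \<omega>
      - (\<Sum>t<n. - (matrix_inv Bs *v \<eta> t \<omega>)) /\<^sub>R sqrt (real n)))) - 0) < r"
    using eventually_ge_at_top[of n0] eventually_ge_at_top[of m]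
  proof eventually_elim
    case (elim n)
    define X where "X \<omega> = sqrt (real n) *\<^sub>R e n \<omega> - (\<Sum>t<n. - (matrix_inv Bs *v \<eta> t \<omega>)) /\<^sub>R sqrt (real n)" for \<omega>
    let ?S = "\<lambda>\<omega>. \<Sum>t<n. mart t \<omega>" and ?R = "\<lambda>\<omega>. \<Sum>t<n. drift t \<omega>" and ?k = "good \<epsilon> m n"
    have n: "0 < n" using elim(4) m(1) by simp
    have iS: "integrable M (\<lambda>\<omega>. norm (?S \<omega>))"
      using L2_integrable[OF L2_sum[OF _ L2_mart, of "{..<n}"]] by simp
    have iR: "integrable M (\<lambda>\<omega>. ?k \<omega> * norm (?R \<omega>))"
      using L2_integrable[OF L2_sum[OF _ L2_drift, of "{..<n}"]] by (intro good_integrable_mult) simp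
    have mX: "X \<in> borel_measurable M"
      unfolding X_def[abs_def]
      by (intro borel_measurable_diff borel_measurable_scaleR borel_measurable_const to_M[OF e_measurable]
          borel_measurable_sum borel_measurable_uminus L2D(1)[OF L2_Bs_inv_\<eta>])
    have iX: "integrable M (\<lambda>\<omega>. min 1 (norm (X \<omega>)))"
      by (rule integrable_const_bound[where B=1]) (use mX in auto)
    \<comment> \<open>Off the good event the truncation bounds the left side by 1; on it the exact
      decomposition applies. Each of the three resulting means is eventually at most r/4.\<close>
    have bound: "min 1 (norm (X \<omega>)) \<le> (1 - ?k \<omega>) + norm (?S \<omega>) / sqrt n + ?k \<omega> * norm (?R \<omega>) / sqrt n"
      if \<omega>: "\<omega> \<in> space M" for \<omega>
    proof (cases "?k \<omega> = 0")
      case True then show ?thesis by (simp add: min.coboundedI1 add_increasing2)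
    next
      case False
      then have k: "?k \<omega> = 1" by (simp add: good_def split: if_splits)
      have "sqrt (real n) *\<^sub>R e n \<omega> = (real n *\<^sub>R e n \<omega>) /\<^sub>R sqrt (real n)"
        using n by (simp add: real_div_sqrt flip: divide_inverse_commute)
      then have "X \<omega> = (?S \<omega> + ?R \<omega>) /\<^sub>R sqrt (real n)"
        unfolding X_def error_decomposition[OF \<omega>] by (simp add: scaleR_add_right)
      then have "norm (X \<omega>) = norm (?S \<omega> + ?R \<omega>) / sqrt n" by (simp add: divide_inverse mult.commute)
      also have "\<dots> \<le> (norm (?S \<omega>) + norm (?R \<omega>)) / sqrt n"
        by (intro divide_right_mono norm_triangle_ineq) simp
      finally show ?thesis using k by (simp add: min.coboundedI2 add_divide_distrib)
    qed
    have "(LINT \<omega>|M. min 1 (norm (X \<omega>))) \<le> (LINT \<omega>|M. (1 - ?k \<omega>) + norm (?S \<omega>) / sqrt n + ?k \<omega> * norm (?R \<omega>) / sqrt n)"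
      by (rule integral_mono[OF iX _ bound]) (use iS iR good_integrable in simp)
    also have "\<dots> = (1 - (LINT \<omega>|M. ?k \<omega>)) + (LINT \<omega>|M. norm (?S \<omega>)) / sqrt n + (LINT \<omega>|M. ?k \<omega> * norm (?R \<omega>)) / sqrt n"
      using iS iR good_integrable by (simp add: prob_space)
    also have "(LINT \<omega>|M. ?k \<omega> * norm (?R \<omega>)) / sqrt n \<le> (C + C * real n powr (1/4)) / sqrt n"
      by (intro divide_right_mono C elim) simp
    also have "(C + C * real n powr (1/4)) / sqrt n = C * real n powr (-(1/2)) + C * real n powr (-(1/4))"
    proof -
      have sq: "sqrt (real n) = real n powr (1/2)" using n by (simp add: powr_half_sqrt)
      have "1 / real n powr (1/2) = real n powr (-(1/2))" by (simp add: powr_minus_divide)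
      moreover have "real n powr (1/4) / real n powr (1/2) = real n powr (-(1/4))"
        using n powr_diff[of "real n" "1/4" "1/2"] by simp
      moreover have "(C + C * real n powr (1/4)) / real n powr (1/2)
          = C * (1 / real n powr (1/2)) + C * (real n powr (1/4) / real n powr (1/2))"
        by (simp add: add_divide_distrib)
      ultimately show ?thesis unfolding sq by (simp only:)
    qed
    finally have "(LINT \<omega>|M. min 1 (norm (X \<omega>))) < r" using elim(1,2) m(2)[OF elim(4)] r by linarith
    moreover have "0 \<le> (LINT \<omega>|M. min 1 (norm (X \<omega>)))" by simp
    ultimately show ?case unfolding X_def by simp
  qed
  then show "\<exists>no. \<forall>n\<ge>no. norm ((LINT \<omega>|M. min 1 (norm (sqrt (real n) *\<^sub>R e n \<omega>
      - (\<Sum>t<n. - (matrix_inv Bs *v \<eta> t \<omega>)) /\<^sub>R sqrt (real n)))) - 0) < r"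
    by (simp add: eventually_sequentially)
qed

theorem normality:
  assumes indep: "indep_vars (\<lambda>_. P) \<xi> UNIV"
    and V: "transpose V = V" "\<And>\<theta>. (LINT d|P. (\<theta> \<bullet> (matrix_inv Bs *v G xs d))\<^sup>2) = \<theta> \<bullet> (V *v \<theta>)"
  shows "converges_in_distribution M (\<lambda>n \<omega>. sqrt (real n) *\<^sub>R (x n \<omega> - xs)) (multivariate_normal 0 V)"
proof -
  interpret P: prob_space P by (rule prob_space_P)
  define h where "h d = - (matrix_inv Bs *v G xs d)" for d
  define Y where "Y t \<omega> = - (matrix_inv Bs *v \<eta> t \<omega>)" for t \<omega>
  have Yh: "Y t = (\<lambda>\<omega>. h (\<xi> t \<omega>))" for t by (simp add: Y_def h_def \<eta>_def fun_eq_iff)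
  have hm: "h \<in> borel_measurable P"
    unfolding h_def[abs_def]
    by (intro borel_measurable_uminus borel_measurable_matrix_inv_vec borel_measurable_const G_xs_measurable Bs_invertible)
  have LY: "L2 M (Y t)" for t
    unfolding Y_def[abs_def] using L2_scale[OF L2_Bs_inv_\<eta>[of t], of "-1"] by simp
  have law: "(LINT \<omega>|M. q (Y t \<omega>)) = (LINT d|P. q (h d))" if "q \<in> borel_measurable borel"
    for q :: "real^'d \<Rightarrow> 'q::{banach, second_countable_topology}" and t
    unfolding Yh using integral_distr[OF \<xi>_measurable[of t] measurable_compose[OF hm that]] by (simp add: \<xi>_law)
  have mean: "(LINT \<omega>|M. Y t \<omega>) = 0" for t
  proof -
    have bl: "bounded_linear (\<lambda>v. - (matrix_inv Bs *v v))"
      by (intro bounded_linear_minus matrix_vector_mul_bounded_linear)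
    have "(LINT \<omega>|M. Y t \<omega>) = (LINT d|P. h d)" by (rule law) simp
    also have "\<dots> = - (matrix_inv Bs *v (LINT d|P. G xs d))"
      unfolding h_def by (rule integral_bounded_linear[OF bl G_integrable])
    finally show ?thesis by (simp add: G_mean gf_xs)
  qed
  define s where "s = (LINT d|P. (norm (h d))\<^sup>2)"
  have var: "(LINT \<omega>|M. (norm (Y t \<omega>))\<^sup>2) = s" for t
    unfolding s_def by (rule law) simp
  have orth: "(LINT \<omega>|M. (\<Sum>i<t. Y i \<omega>) \<bullet> Y t \<omega>) = 0" for t
  proof -
    have "(LINT \<omega>|M. (\<Sum>i<t. Y i \<omega>) \<bullet> h (\<xi> t \<omega>)) = 0"
    proof (rule orthogonal_fresh)
      show "(\<lambda>\<omega>. \<Sum>i<t. Y i \<omega>) \<in> borel_measurable (\<G> t)"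
        unfolding Yh by (intro borel_measurable_sum measurable_compose[OF adapted hm]) auto
      show "L2 M (\<lambda>\<omega>. \<Sum>i<t. Y i \<omega>)" by (intro L2_sum LY) auto
      show "(\<lambda>p. h (snd p)) \<in> borel_measurable (\<G> t \<Otimes>\<^sub>M P)" by (rule measurable_compose[OF measurable_snd hm])
      show "L2 M (\<lambda>\<omega>. h (\<xi> t \<omega>))" using LY[of t] by (simp add: Yh)
      show "integrable P h"
        unfolding h_def[abs_def]
        by (intro Bochner_Integration.integrable_minus integrable_bounded_linear[OF matrix_vector_mul_bounded_linear] G_integrable)
      show "(LINT d|P. h d) = 0" using mean[of 0] law[of "\<lambda>y. y" 0] by simp
    qed
    then show ?thesis by (simp add: Yh)
  qed
  have "converges_in_distribution M (\<lambda>n \<omega>. sqrt (real n) *\<^sub>R e n \<omega>) (multivariate_normal 0 V)"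
  proof (rule perturbed_central_limit[where Y=Y and c=s and \<rho>="distr P borel h"])
    show "indep_vars (\<lambda>i. borel) Y UNIV"
      unfolding Yh by (rule indep_vars_compose2[OF indep hm])
    show "distr M borel (Y n) = distr P borel h" for n
      unfolding Yh using distr_distr[OF hm \<xi>_measurable[of n]] by (simp add: \<xi>_law comp_def)
    show "integrable M (\<lambda>\<omega>. (norm (Y n \<omega>))\<^sup>2)" for n by (rule L2D(2)[OF LY])
    show "(LINT \<omega>|M. Y n \<omega>) = 0" for n by (rule mean)
    show "(LINT \<omega>|M. (\<theta> \<bullet> Y n \<omega>)\<^sup>2) = \<theta> \<bullet> (V *v \<theta>)" for n \<theta>
    proof -
      have "(LINT \<omega>|M. (\<theta> \<bullet> Y n \<omega>)\<^sup>2) = (LINT d|P. (\<theta> \<bullet> h d)\<^sup>2)" by (rule law) simp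
      then show ?thesis by (simp add: h_def V(2))
    qed
    show "transpose V = V" by (rule V)
    show "(\<lambda>\<omega>. sqrt (real n) *\<^sub>R e n \<omega>) \<in> borel_measurable M" for n
      by (intro borel_measurable_scaleR borel_measurable_const to_M[OF e_measurable])
    show "integrable M (\<lambda>\<omega>. (norm (\<Sum>i<n. Y i \<omega>))\<^sup>2)" for n by (intro L2D(2) L2_sum LY) auto
    show "(LINT \<omega>|M. (norm (\<Sum>i<n. Y i \<omega>))\<^sup>2) \<le> s * real n" for n
      unfolding martingale_norm_square[OF LY orth] by (simp add: var)
    show "(\<lambda>n. LINT \<omega>|M. min 1 (norm (sqrt (real n) *\<^sub>R e n \<omega> - (\<Sum>i<n. Y i \<omega>) /\<^sub>R sqrt (real n)))) \<longlonglongrightarrow> 0"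
      unfolding Y_def by (rule remainder_tendsto_0)
  qed
  then show ?thesis by (simp add: e_def)
qed

end

section \<open>Population and sample objective\<close>

text \<open>Rounding the point down to a grid of mesh 1/(n+1) leaves countably many points, at each
  of which \<open>F\<close> is measurable in the datum; by continuity the rounded functions
  converge.\<close>

lemma caratheodory_measurable:
  fixes F :: "real^'d \<Rightarrow> 'x \<Rightarrow> real"
  assumes meas: "\<And>u. F u \<in> borel_measurable P"
    and cont: "\<And>d. d \<in> space P \<Longrightarrow> continuous_on UNIV (\<lambda>u. F u d)"
  shows "(\<lambda>p. F (fst p) (snd p)) \<in> borel_measurable (borel \<Otimes>\<^sub>M P)"
proof -
  define r :: "nat \<Rightarrow> ('d \<Rightarrow> int) \<Rightarrow> real^'d" where "r n z = (\<chi> i. of_int (z i) / real (Suc n))" for n z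
  define q :: "nat \<Rightarrow> real^'d \<Rightarrow> real^'d" where "q n u = r n (\<lambda>i. \<lfloor>real (Suc n) * u $ i\<rfloor>)" for n u
  have q_lim: "(\<lambda>n. q n u) \<longlonglongrightarrow> u" for u
  proof (rule vec_tendstoI)
    fix i
    have "\<bar>q n u $ i - u $ i\<bar> \<le> 1 / real (Suc n)" for n
    proof -
      let ?k = "real (Suc n)"
      have "\<bar>of_int \<lfloor>?k * u $ i\<rfloor> - ?k * u $ i\<bar> \<le> 1" by linarith
      then have "\<bar>of_int \<lfloor>?k * u $ i\<rfloor> - ?k * u $ i\<bar> / ?k \<le> 1 / ?k" by (intro divide_right_mono) auto
      also have "\<bar>of_int \<lfloor>?k * u $ i\<rfloor> - ?k * u $ i\<bar> / ?k = \<bar>(of_int \<lfloor>?k * u $ i\<rfloor> - ?k * u $ i) / ?k\<bar>"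
        by (simp add: abs_divide)
      also have "(of_int \<lfloor>?k * u $ i\<rfloor> - ?k * u $ i) / ?k = q n u $ i - u $ i"
        by (simp add: q_def r_def diff_divide_distrib del: of_nat_Suc)
      finally show ?thesis .
    qed
    then have "(\<lambda>n. q n u $ i - u $ i) \<longlonglongrightarrow> 0"
      by (intro Lim_null_comparison[OF always_eventually LIMSEQ_Suc[OF lim_1_over_n]]) auto
    then show "(\<lambda>n. q n u $ i) \<longlonglongrightarrow> u $ i" by (simp add: LIM_zero_iff)
  qed
  have q_meas: "q n \<in> borel_measurable borel" for n
    unfolding q_def[abs_def] r_def by (intro borel_measurable_vecI) simp
  have "(\<lambda>p::(real^'d) \<times> 'x. F (q n (fst p)) (snd p)) \<in> borel_measurable (borel \<Otimes>\<^sub>M P)" for n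
  proof (rule measurable_compose_countable'[where f="\<lambda>i (p::(real^'d) \<times> 'x). F i (snd p)" and g="\<lambda>p::(real^'d) \<times> 'x. q n (fst p)" and I="range (r n)"])
    show cnt: "countable (range (r n))" by (intro countable_image countableI_type)
    show "(\<lambda>p. F u (snd p)) \<in> borel_measurable (borel \<Otimes>\<^sub>M P)" for u
      by (rule measurable_compose[OF measurable_snd meas])
    have qf: "(\<lambda>p::(real^'d) \<times> 'x. q n (fst p)) \<in> borel_measurable (borel \<Otimes>\<^sub>M P)"
      by (rule measurable_compose[OF measurable_fst q_meas])
    show "(\<lambda>p. q n (fst p)) \<in> measurable (borel \<Otimes>\<^sub>M P) (count_space (range (r n)))"
      unfolding measurable_count_space_eq_countable[OF cnt]
      using measurable_sets[OF qf] by (auto simp: q_def)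
  qed
  then show ?thesis
  proof (rule borel_measurable_LIMSEQ_metric)
    fix p :: "(real^'d) \<times> 'x" assume "p \<in> space (borel \<Otimes>\<^sub>M P)"
    then have "snd p \<in> space P" by (auto simp: space_pair_measure)
    from continuous_on_tendsto_compose[OF cont[OF this] q_lim]
    show "(\<lambda>n. F (q n (fst p)) (snd p)) \<longlonglongrightarrow> F (fst p) (snd p)" by simp
  qed
qed

lemma directional_limit_measurable:
  fixes \<phi> \<psi> :: "real^'d \<Rightarrow> 'x \<Rightarrow> real"
  assumes \<phi>: "(\<lambda>p. \<phi> (fst p) (snd p)) \<in> borel_measurable (borel \<Otimes>\<^sub>M P)"
    and lim: "\<And>u d. d \<in> space P \<Longrightarrow>
      (\<lambda>n. real (Suc n) * (\<phi> (u + (1 / real (Suc n)) *\<^sub>R v) d - \<phi> u d)) \<longlonglongrightarrow> \<psi> u d"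
  shows "(\<lambda>p. \<psi> (fst p) (snd p)) \<in> borel_measurable (borel \<Otimes>\<^sub>M P)"
proof (rule borel_measurable_LIMSEQ_metric)
  fix n
  have "(\<lambda>p. (fst p + (1 / real (Suc n)) *\<^sub>R v, snd p)) \<in> measurable (borel \<Otimes>\<^sub>M P) (borel \<Otimes>\<^sub>M P)"
    by measurable
  from measurable_compose[OF this \<phi>]
  have "(\<lambda>p. \<phi> (fst p + (1 / real (Suc n)) *\<^sub>R v) (snd p)) \<in> borel_measurable (borel \<Otimes>\<^sub>M P)" by simp
  then show "(\<lambda>p. real (Suc n) * (\<phi> (fst p + (1 / real (Suc n)) *\<^sub>R v) (snd p) - \<phi> (fst p) (snd p))) \<in> borel_measurable (borel \<Otimes>\<^sub>M P)"
    using \<phi> by (intro borel_measurable_times borel_measurable_diff borel_measurable_const)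
next
  fix p assume "p \<in> space (borel \<Otimes>\<^sub>M P :: ((real^'d) \<times> 'x) measure)"
  then have "snd p \<in> space P" by (auto simp: space_pair_measure)
  then show "(\<lambda>n. real (Suc n) * (\<phi> (fst p + (1 / real (Suc n)) *\<^sub>R v) (snd p) - \<phi> (fst p) (snd p))) \<longlonglongrightarrow> \<psi> (fst p) (snd p)"
    by (rule lim)
qed

text \<open>Differentiation under the integral by dominated convergence. It yields the means of
  sampled gradient and Hessian at every fixed point, as freezing the past requires.\<close>

lemma directional_derivative_mean:
  fixes \<phi> :: "real^'d \<Rightarrow> 'x \<Rightarrow> real"
  assumes int: "\<And>u. integrable P (\<phi> u)" and w: "integrable P w"
    and lim: "\<And>d. d \<in> space P \<Longrightarrow>
      (\<lambda>n. real (Suc n) * (\<phi> (u + (1 / real (Suc n)) *\<^sub>R v) d - \<phi> u d)) \<longlonglongrightarrow> \<psi> d"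
    and \<psi>: "\<psi> \<in> borel_measurable P"
    and bound: "\<And>d n. d \<in> space P \<Longrightarrow> \<bar>\<phi> (u + (1 / real (Suc n)) *\<^sub>R v) d - \<phi> u d\<bar> \<le> 1 / real (Suc n) * w d"
    and mean_lim: "(\<lambda>n. real (Suc n) * ((LINT d|P. \<phi> (u + (1 / real (Suc n)) *\<^sub>R v) d) - (LINT d|P. \<phi> u d))) \<longlonglongrightarrow> l"
  shows "(LINT d|P. \<psi> d) = l"
proof -
  have "(\<lambda>n. LINT d|P. real (Suc n) * (\<phi> (u + (1 / real (Suc n)) *\<^sub>R v) d - \<phi> u d)) \<longlonglongrightarrow> (LINT d|P. \<psi> d)"
  proof (rule integral_dominated_convergence[where w=w])
    show "AE d in P. norm (real (Suc n) * (\<phi> (u + (1 / real (Suc n)) *\<^sub>R v) d - \<phi> u d)) \<le> w d" for n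
    proof (intro AE_I2)
      fix d assume "d \<in> space P"
      from mult_left_mono[OF bound[OF this, of n], of "real (Suc n)"]
      show "norm (real (Suc n) * (\<phi> (u + (1 / real (Suc n)) *\<^sub>R v) d - \<phi> u d)) \<le> w d"
        by (simp add: abs_mult del: of_nat_Suc)
    qed
    show "(\<lambda>d. real (Suc n) * (\<phi> (u + (1 / real (Suc n)) *\<^sub>R v) d - \<phi> u d)) \<in> borel_measurable P" for n
      by (intro borel_measurable_times borel_measurable_diff borel_measurable_const borel_measurable_integrable int)
  qed (use w \<psi> lim in auto)
  moreover have "(LINT d|P. real (Suc n) * (\<phi> (u + (1 / real (Suc n)) *\<^sub>R v) d - \<phi> u d))
      = real (Suc n) * ((LINT d|P. \<phi> (u + (1 / real (Suc n)) *\<^sub>R v) d) - (LINT d|P. \<phi> u d))" for n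
    using int by simp
  ultimately show ?thesis using mean_lim by (auto intro: LIMSEQ_unique)
qed

section \<open>Regularity of sampled and population derivatives\<close>

locale smooth_sample = prob_space P for P :: "'x measure" +
  fixes F :: "real^'d \<Rightarrow> 'x \<Rightarrow> real" and c U :: real
  assumes F_integrable: "\<And>u. integrable P (F u)"
    and F_smooth: "\<And>d. d \<in> space P \<Longrightarrow> twice_continuously_differentiable (\<lambda>u. F u d)"
    and c: "0 < c" "c < U"
    and eig_low: "\<And>u d. d \<in> space P \<Longrightarrow> c \<le> lambda_min (hessian (\<lambda>u. F u d) u)"
    and eig_up: "\<And>u d. d \<in> space P \<Longrightarrow> lambda_max (hessian (\<lambda>u. F u d) u) \<le> U"
begin

definition G where "G u d = gradient (\<lambda>u. F u d) u"
definition Hs where "Hs u d = hessian (\<lambda>u. F u d) u"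

lemma Upos: "0 < U" using c by simp

lemma F_deriv: "d \<in> space P \<Longrightarrow> ((\<lambda>u. F u d) has_derivative (\<lambda>h. h \<bullet> G u d)) (at u)"
  unfolding G_def by (rule tcd_has_derivative[OF F_smooth])

lemma G_deriv: "d \<in> space P \<Longrightarrow> ((\<lambda>u. G u d) has_derivative (\<lambda>h. Hs u d *v h)) (at u)"
  using tcd_gradient_has_derivative[OF F_smooth, of d u] by (simp add: G_def[abs_def] Hs_def)

lemma Hs_sym: "d \<in> space P \<Longrightarrow> transpose (Hs u d) = Hs u d"
  unfolding Hs_def by (rule transpose_hessian[OF F_smooth])

lemma Hs_low: "d \<in> space P \<Longrightarrow> c * (norm v)\<^sup>2 \<le> v \<bullet> (Hs u d *v v)"
  using lambda_min_le(1)[OF Hs_sym, of d u v] mult_right_mono[OF eig_low[of d u], of "(norm v)\<^sup>2"]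
  by (simp add: Hs_def)

lemma Hs_up: "d \<in> space P \<Longrightarrow> v \<bullet> (Hs u d *v v) \<le> U * (norm v)\<^sup>2"
  using lambda_max_ge[OF Hs_sym, of d v u] mult_right_mono[OF eig_up[of d u], of "(norm v)\<^sup>2"]
  by (simp add: Hs_def)

lemma norm_Hs_vec_le: "d \<in> space P \<Longrightarrow> norm (Hs u d *v v) \<le> U * norm v"
  by (rule PSD_norm_le[OF Hs_sym Hs_low _ Hs_up]) (use c Upos in auto)

lemma G_lip: "d \<in> space P \<Longrightarrow> norm (G u d - G w d) \<le> U * norm (u - w)"
  by (rule lipschitz_of_derivative_bound[of "\<lambda>u. G u d" "\<lambda>u. Hs u d"]) (auto intro: G_deriv norm_Hs_vec_le)

lemma G_mono: "d \<in> space P \<Longrightarrow> c * (norm (u - w))\<^sup>2 \<le> (G u d - G w d) \<bullet> (u - w)"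
  by (rule monotone_of_derivative_bound[of "\<lambda>u. G u d" "\<lambda>u. Hs u d"]) (auto intro: G_deriv Hs_low)

lemma F_measurable: "(\<lambda>p. F (fst p) (snd p)) \<in> borel_measurable (borel \<Otimes>\<^sub>M P)"
proof (rule caratheodory_measurable)
  show "F u \<in> borel_measurable P" for u using F_integrable by simp
  show "continuous_on UNIV (\<lambda>u. F u d)" if "d \<in> space P" for d
    by (rule has_derivative_continuous_on) (use F_deriv[OF that] in simp)
qed

lemma F_quotient:
  "d \<in> space P \<Longrightarrow> (\<lambda>n. real (Suc n) * (F (u + (1 / real (Suc n)) *\<^sub>R axis i 1) d - F u d)) \<longlonglongrightarrow> G u d $ i"
  using directional_difference_quotient[OF F_deriv, of d u "axis i 1"] by (simp add: inner_axis')

lemma G_quotient: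
  "d \<in> space P \<Longrightarrow> (\<lambda>n. real (Suc n) * (G (u + (1 / real (Suc n)) *\<^sub>R axis j 1) d $ i - G u d $ i)) \<longlonglongrightarrow> Hs u d $ i $ j"
  using tendsto_vec_nth[OF directional_difference_quotient[OF G_deriv, of d u "axis j 1"], of i]
  by (simp add: matrix_vector_mult_basis column_def)

lemma G_measurable: "(\<lambda>p. G (fst p) (snd p)) \<in> borel_measurable (borel \<Otimes>\<^sub>M P)"
  by (rule borel_measurable_vecI) (rule directional_limit_measurable[OF F_measurable F_quotient])

lemma Hs_measurable: "(\<lambda>p. Hs (fst p) (snd p)) \<in> borel_measurable (borel \<Otimes>\<^sub>M P)"
  by (intro borel_measurable_vecI)
    (rule directional_limit_measurable[OF borel_measurable_vec_nth[OF G_measurable] G_quotient])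

lemma G_measurable_P: "G u \<in> borel_measurable P"
proof -
  have "(\<lambda>d. (u, d)) \<in> measurable P (borel \<Otimes>\<^sub>M P)" by measurable
  from measurable_compose[OF this G_measurable] show ?thesis by simp
qed

lemma Hs_measurable_P: "Hs u \<in> borel_measurable P"
proof -
  have "(\<lambda>d. (u, d)) \<in> measurable P (borel \<Otimes>\<^sub>M P)" by measurable
  from measurable_compose[OF this Hs_measurable] show ?thesis by simp
qed

text \<open>Integrating the conditional bound removes the conditioning, and a moment of order
  \<open>q\<close> above 2 dominates the second since n^2 <= 1 + n^q. The constant bound fits time
  0, where the iterate is a fixed point.\<close>

lemma square_integrable_of_moment:
  fixes a :: "real^'d"
  assumes M: "prob_space M" and sub: "subalgebra M \<F>" and Y[measurable]: "Y \<in> measurable M P"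
    and law: "distr M P Y = P" and q: "2 < q"
    and moment: "AE \<omega> in M. nn_cond_exp M \<F> (\<lambda>w. ennreal (norm (G z (Y w) - a) powr q)) \<omega> \<le> ennreal C"
  shows "integrable P (\<lambda>d. (norm (G z d))\<^sup>2)"
proof -
  interpret M: prob_space M by fact
  interpret S: finite_measure_subalgebra M \<F> by unfold_locales (rule sub)
  note [measurable] = G_measurable_P
  let ?h = "\<lambda>d. norm (G z d - a) powr q"
  have hm: "(\<lambda>w. ennreal (?h (Y w))) \<in> borel_measurable M" by measurable
  have "(\<integral>\<^sup>+d. ennreal (?h d) \<partial>P) = (\<integral>\<^sup>+d. ennreal (?h d) \<partial>distr M P Y)" by (simp add: law)
  also have "\<dots> = (\<integral>\<^sup>+w. ennreal (?h (Y w)) \<partial>M)" by (rule nn_integral_distr) measurable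
  also have "\<dots> = (\<integral>\<^sup>+w. nn_cond_exp M \<F> (\<lambda>w. ennreal (?h (Y w))) w \<partial>M)"
    using S.nn_cond_exp_intg[of "\<lambda>_. 1", OF _ hm] by simp
  also have "\<dots> \<le> (\<integral>\<^sup>+w. ennreal C \<partial>M)" by (rule nn_integral_mono_AE[OF moment])
  also have "\<dots> < \<infinity>" by (simp add: M.emeasure_space_1)
  finally have "integrable P ?h" by (intro integrableI_bounded) auto
  then have "integrable P (\<lambda>d. 2 * (1 + ?h d) + 2 * (norm a)\<^sup>2)" by simp
  then show ?thesis
  proof (rule Bochner_Integration.integrable_bound)
    show "AE d in P. norm ((norm (G z d))\<^sup>2) \<le> norm (2 * (1 + ?h d) + 2 * (norm a)\<^sup>2)"
    proof (intro AE_I2)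
      fix d
      let ?n = "norm (G z d - a)"
      have "?n\<^sup>2 \<le> 1 + ?n powr q"
      proof (cases "?n \<le> 1")
        case True
        then have "?n\<^sup>2 \<le> 1" by (simp add: power_le_one)
        then show ?thesis by (simp add: add_increasing2)
      next
        case False
        then have "?n powr 2 \<le> ?n powr q" using q by (intro powr_mono) auto
        then show ?thesis using False by (simp add: powr_numeral)
      qed
      moreover have "(norm (G z d))\<^sup>2 \<le> 2 * ?n\<^sup>2 + 2 * (norm a)\<^sup>2"
        using norm_add_square_le[of "G z d - a" a] by simp
      ultimately show "norm ((norm (G z d))\<^sup>2) \<le> norm (2 * (1 + ?h d) + 2 * (norm a)\<^sup>2)" by simp
    qed
  qed measurable
qed

end

text \<open>\<open>z\<close> is a reference point where the sampled gradient is square integrable;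
  the Lipschitz bound carries this to every point, in particular to \<open>xs\<close>.\<close>

locale sampled_objective = smooth_sample P F c U for P :: "'x measure"
    and F :: "real^'d \<Rightarrow> 'x \<Rightarrow> real" and c U :: real +
  fixes f :: "real^'d \<Rightarrow> real" and K :: real and xs z :: "real^'d"
  assumes f_def: "f = (\<lambda>u. LINT d|P. F u d)"
    and f_smooth: "twice_continuously_differentiable f"
    and hessian_lip: "\<And>u w. spectral_norm (hessian f u - hessian f w) \<le> K * norm (u - w)"
    and xs: "is_arg_min f (\<lambda>_. True) xs"
    and square_z: "integrable P (\<lambda>d. (norm (G z d))\<^sup>2)"
begin

definition Bs where "Bs = hessian f xs"

lemma L2_G: "L2 P (G u)"
proof -
  have "L2 P (G z)" using square_z G_measurable_P by (simp add: L2_def)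
  then have "L2 P (\<lambda>d. norm (G z d) + U * norm (u - z))"
    by (intro L2_add L2_norm L2_const)
  then show ?thesis
  proof (rule L2_bound[OF _ G_measurable_P])
    fix d assume "d \<in> space P"
    then show "norm (G u d) \<le> norm (norm (G z d) + U * norm (u - z))"
      using norm_triangle_sub[of "G u d" "G z d"] G_lip[of d u z] by simp
  qed
qed

lemma G_integrable: "integrable P (G u)" by (rule L2_integrable[OF L2_G])

lemma G_mean: "(LINT d|P. G u d) = gradient f u"
proof -
  have "(LINT d|P. G u d $ i) = gradient f u $ i" for i
  proof (rule directional_derivative_mean[OF F_integrable _ F_quotient])
    \<comment> \<open>A displacement of length at most 1 changes the sampled gradient by at most
      \<open>U\<close>, so this function dominates all difference quotients.\<close>
    show "integrable P (\<lambda>d. norm (G u d) + U)" using G_integrable by simp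
    show "(\<lambda>d. G u d $ i) \<in> borel_measurable P" by (intro borel_measurable_vec_nth G_measurable_P)
    show "\<bar>F (u + (1 / real (Suc n)) *\<^sub>R axis i 1) d - F u d\<bar> \<le> 1 / real (Suc n) * (norm (G u d) + U)"
      if d: "d \<in> space P" for d n
    proof -
      define h where "h = 1 / real (Suc n)"
      have h: "0 < h" "h \<le> 1" by (auto simp: h_def)
      let ?v = "h *\<^sub>R axis i 1 :: real^'d"
      obtain s where s: "0 < s" "s < 1" "F (u + ?v) d - F u d = ((u + ?v) - u) \<bullet> G (u + s *\<^sub>R ((u + ?v) - u)) d"
        using segment_mvt[OF F_deriv[OF d]] by metis
      have nv: "norm ?v = h" using h by (simp add: norm_axis_1)
      have "norm (G (u + s *\<^sub>R ?v) d) \<le> norm (G u d) + U * norm (s *\<^sub>R ?v)"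
        using norm_triangle_sub[of "G (u + s *\<^sub>R ?v) d" "G u d"] G_lip[OF d, of "u + s *\<^sub>R ?v" u] by simp
      also have "norm (s *\<^sub>R ?v) \<le> 1" using s h nv by (simp add: mult_le_one)
      finally have "norm (G (u + s *\<^sub>R ?v) d) \<le> norm (G u d) + U" using Upos by simp
      then have "h * norm (G (u + s *\<^sub>R ?v) d) \<le> h * (norm (G u d) + U)" using h by (intro mult_left_mono) auto
      moreover have "\<bar>F (u + ?v) d - F u d\<bar> \<le> norm ?v * norm (G (u + s *\<^sub>R ?v) d)"
        using s(3) Cauchy_Schwarz_ineq2[of ?v "G (u + s *\<^sub>R ?v) d"] by simp
      ultimately show ?thesis unfolding nv by (simp add: h_def)
    qed
    show "(\<lambda>n. real (Suc n) * ((LINT d|P. F (u + (1 / real (Suc n)) *\<^sub>R axis i 1) d) - (LINT d|P. F u d))) \<longlonglongrightarrow> gradient f u $ i"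
      using directional_difference_quotient[OF tcd_has_derivative[OF f_smooth], of u "axis i 1"]
      by (simp add: f_def inner_axis')
  qed
  moreover have "(LINT d|P. G u d) $ i = (LINT d|P. G u d $ i)" for i
    by (rule integral_bounded_linear[OF bounded_linear_vec_nth G_integrable, symmetric])
  ultimately show ?thesis by (simp add: vec_eq_iff)
qed

lemma Hs_integrable: "integrable P (Hs u)"
proof (rule integrable_const_bound[where B="real CARD('d) * real CARD('d) * U"])
  show "AE d in P. norm (Hs u d) \<le> real CARD('d) * real CARD('d) * U"
  proof (intro AE_I2)
    fix d assume d: "d \<in> space P"
    have "spectral_norm (Hs u d) \<le> U"
      unfolding spectral_norm_def by (rule onorm_le) (rule norm_Hs_vec_le[OF d])
    then have "real CARD('d) * real CARD('d) * spectral_norm (Hs u d) \<le> real CARD('d) * real CARD('d) * U"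
      by (intro mult_left_mono) auto
    then show "norm (Hs u d) \<le> real CARD('d) * real CARD('d) * U"
      using norm_matrix_le_spectral_norm[of "Hs u d"] by linarith
  qed
qed (rule Hs_measurable_P)

lemma Hs_mean: "(LINT d|P. Hs u d) = hessian f u"
proof -
  have Gi: "integrable P (\<lambda>d. G u d $ i)" for u i
    by (rule integrable_bounded_linear[OF bounded_linear_vec_nth G_integrable])
  have Gm: "(LINT d|P. G u d $ i) = gradient f u $ i" for u i
    using integral_bounded_linear[OF bounded_linear_vec_nth[of i] G_integrable[of u]] by (simp add: G_mean)
  have "(LINT d|P. Hs u d $ i $ j) = hessian f u $ i $ j" for i j
  proof (rule directional_derivative_mean[OF Gi _ G_quotient])
    show "integrable P (\<lambda>d. U)" by simp
    show "(\<lambda>d. Hs u d $ i $ j) \<in> borel_measurable P" by (intro borel_measurable_vec_nth Hs_measurable_P)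
    show "\<bar>G (u + (1 / real (Suc n)) *\<^sub>R axis j 1) d $ i - G u d $ i\<bar> \<le> 1 / real (Suc n) * U"
      if d: "d \<in> space P" for d n
      using component_le_norm_cart[of "G (u + (1 / real (Suc n)) *\<^sub>R axis j 1) d - G u d" i]
        G_lip[OF d, of "u + (1 / real (Suc n)) *\<^sub>R axis j 1" u]
      by (simp add: norm_axis_1)
    show "(\<lambda>n. real (Suc n) * ((LINT d|P. G (u + (1 / real (Suc n)) *\<^sub>R axis j 1) d $ i) - (LINT d|P. G u d $ i)))
        \<longlonglongrightarrow> hessian f u $ i $ j"
      using tendsto_vec_nth[OF directional_difference_quotient[OF tcd_gradient_has_derivative[OF f_smooth], of u "axis j 1"], of i]
      by (simp add: Gm matrix_vector_mult_basis column_def)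
  qed
  moreover have "(LINT d|P. Hs u d) $ i $ j = (LINT d|P. Hs u d $ i $ j)" for i j
  proof -
    have "bounded_linear (\<lambda>A::real^'d^'d. A $ i $ j)"
      by (rule bounded_linear_compose[OF bounded_linear_vec_nth bounded_linear_vec_nth])
    from integral_bounded_linear[OF this Hs_integrable] show ?thesis by simp
  qed
  ultimately show ?thesis by (simp add: vec_eq_iff)
qed

lemma gradient_lip: "norm (gradient f u - gradient f w) \<le> U * norm (u - w)"
proof -
  have "norm (gradient f u - gradient f w) = norm (LINT d|P. G u d - G w d)"
    using G_integrable by (simp add: G_mean)
  also have "\<dots> \<le> (LINT d|P. norm (G u d - G w d))" by (rule integral_norm_bound)
  also have "\<dots> \<le> (LINT d|P. U * norm (u - w))"
    by (intro integral_mono) (use G_integrable G_lip in auto)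
  finally show ?thesis by (simp add: prob_space)
qed

lemma gradient_mono: "c * (norm (u - w))\<^sup>2 \<le> (gradient f u - gradient f w) \<bullet> (u - w)"
proof -
  have bl: "bounded_linear (\<lambda>y. y \<bullet> (u - w))" by (rule bounded_linear_inner_left)
  have i: "integrable P (\<lambda>d. G u d - G w d)" using G_integrable by simp
  have "c * (norm (u - w))\<^sup>2 = (LINT d|P. c * (norm (u - w))\<^sup>2)" by (simp add: prob_space)
  also have "\<dots> \<le> (LINT d|P. (G u d - G w d) \<bullet> (u - w))"
    by (intro integral_mono integrable_bounded_linear[OF bl i] G_mono) auto
  also have "\<dots> = (LINT d|P. G u d - G w d) \<bullet> (u - w)" by (rule integral_bounded_linear[OF bl i])
  also have "(LINT d|P. G u d - G w d) = gradient f u - gradient f w" using G_integrable by (simp add: G_mean)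
  finally show ?thesis .
qed

lemma gradient_xs: "gradient f xs = 0" by (rule gradient_at_arg_min[OF f_smooth xs])

lemma transpose_Bs: "transpose Bs = Bs" unfolding Bs_def by (rule transpose_hessian[OF f_smooth])

text \<open>Strong monotonicity of the population gradient, passed to the limit of difference
  quotients.\<close>

lemma Bs_low: "c * (norm v)\<^sup>2 \<le> v \<bullet> (Bs *v v)"
proof -
  have "(\<lambda>n. v \<bullet> (real (Suc n) *\<^sub>R (gradient f (xs + (1 / real (Suc n)) *\<^sub>R v) - gradient f xs))) \<longlonglongrightarrow> v \<bullet> (Bs *v v)"
    unfolding Bs_def
    by (intro tendsto_inner tendsto_const directional_difference_quotient[OF tcd_gradient_has_derivative[OF f_smooth]])
  moreover have "c * (norm v)\<^sup>2 \<le> v \<bullet> (real (Suc n) *\<^sub>R (gradient f (xs + (1 / real (Suc n)) *\<^sub>R v) - gradient f xs))" for n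
  proof -
    define s where "s = real (Suc n)"
    have s: "0 < s" by (simp add: s_def)
    let ?D = "gradient f (xs + (1 / s) *\<^sub>R v) - gradient f xs"
    have "c * (norm ((1 / s) *\<^sub>R v))\<^sup>2 \<le> ?D \<bullet> ((1 / s) *\<^sub>R v)"
      using gradient_mono[of "xs + (1 / s) *\<^sub>R v" xs] by simp
    then have "s\<^sup>2 * (c * (norm ((1 / s) *\<^sub>R v))\<^sup>2) \<le> s\<^sup>2 * (?D \<bullet> ((1 / s) *\<^sub>R v))"
      by (rule mult_left_mono) simp
    also have "s\<^sup>2 * (c * (norm ((1 / s) *\<^sub>R v))\<^sup>2) = c * (norm v)\<^sup>2"
      using s by (simp add: power_mult_distrib power_divide)
    also have "s\<^sup>2 * (?D \<bullet> ((1 / s) *\<^sub>R v)) = v \<bullet> (s *\<^sub>R ?D)"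
      using s by (simp add: power2_eq_square inner_commute)
    finally show ?thesis by (simp add: s_def)
  qed
  ultimately show ?thesis by (intro LIMSEQ_le_const) auto
qed

lemma K_nonneg: "0 \<le> K"
proof -
  have "0 \<le> spectral_norm (hessian f (axis undefined 1) - hessian f 0)"
    unfolding spectral_norm_def by (rule onorm_pos_le) (rule matrix_vector_mul_bounded_linear)
  also have "\<dots> \<le> K * norm (axis undefined 1 - 0 :: real^'d)" by (rule hessian_lip)
  finally show ?thesis by (simp add: norm_axis_1)
qed

text \<open>The mean value theorem is paired with the remainder itself, and the Hessian at the
  intermediate point is compared with that at \<open>xs\<close>; integration would give half the
  constant.\<close>

lemma gradient_taylor: "norm (gradient f u - Bs *v (u - xs)) \<le> K * (norm (u - xs))\<^sup>2"
proof -
  let ?z = "gradient f u - Bs *v (u - xs)"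
  obtain s where s: "0 < s" "s < 1" "(gradient f u - gradient f xs) \<bullet> ?z = (hessian f (xs + s *\<^sub>R (u - xs)) *v (u - xs)) \<bullet> ?z"
    using vector_mvt[OF tcd_gradient_has_derivative[OF f_smooth]] by metis
  let ?H = "hessian f (xs + s *\<^sub>R (u - xs)) - hessian f xs"
  have "?z \<bullet> ?z = (?H *v (u - xs)) \<bullet> ?z"
    using s(3) by (simp add: gradient_xs Bs_def matrix_vector_mult_diff_rdistrib inner_diff_left)
  also have "\<dots> \<le> norm (?H *v (u - xs)) * norm ?z" by (rule norm_cauchy_schwarz)
  also have "norm (?H *v (u - xs)) \<le> K * (norm (u - xs))\<^sup>2"
  proof -
    have "norm (?H *v (u - xs)) \<le> spectral_norm ?H * norm (u - xs)"
      unfolding spectral_norm_def by (rule onorm) (rule matrix_vector_mul_bounded_linear)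
    also have "\<dots> \<le> (K * norm (s *\<^sub>R (u - xs))) * norm (u - xs)"
      using hessian_lip[of "xs + s *\<^sub>R (u - xs)" xs] by (intro mult_right_mono) auto
    also have "\<dots> = s * (K * (norm (u - xs))\<^sup>2)" using s by (simp add: power2_eq_square)
    also have "\<dots> \<le> 1 * (K * (norm (u - xs))\<^sup>2)" using s K_nonneg by (intro mult_right_mono) auto
    finally show ?thesis by simp
  qed
  finally have "norm ?z * norm ?z \<le> K * (norm (u - xs))\<^sup>2 * norm ?z"
    by (simp add: mult_right_mono power2_norm_eq_inner flip: power2_eq_square)
  then show ?thesis using K_nonneg by (cases "norm ?z = 0") auto
qed

lemma hessian_close: "norm (hessian f u - Bs) \<le> real CARD('d) * real CARD('d) * K * norm (u - xs)"
proof -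
  have "real CARD('d) * real CARD('d) * spectral_norm (hessian f u - Bs) \<le> real CARD('d) * real CARD('d) * (K * norm (u - xs))"
    unfolding Bs_def by (intro mult_left_mono hessian_lip) auto
  then have "norm (hessian f u - Bs) \<le> real CARD('d) * real CARD('d) * (K * norm (u - xs))"
    using norm_matrix_le_spectral_norm[of "hessian f u - Bs"] by linarith
  then show ?thesis by (simp only: mult.assoc)
qed

text \<open>Identifies the variance of a projected summand of the central limit theorem; the minus
  sign of the summand disappears in the square.\<close>

lemma Omega_props:
  defines "Om \<equiv> Omega_star P F Bs xs"
  shows "transpose Om = Om"
    and "(LINT d|P. (\<theta> \<bullet> (matrix_inv Bs *v G xs d))\<^sup>2) = \<theta> \<bullet> (Om *v \<theta>)"
proof -
  define C where "C = (LINT d|P. outer (G xs d) (G xs d))"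
  have Om: "Om = matrix_inv Bs ** C ** matrix_inv Bs" by (simp add: Om_def Omega_star_def C_def G_def)
  have inv: "transpose (matrix_inv Bs) = matrix_inv Bs"
    by (rule transpose_matrix_inv[OF invertible_if_coercive[OF c(1) Bs_low] transpose_Bs])
  have i: "integrable P (\<lambda>d. outer (G xs d) (G xs d))"
  proof (rule Bochner_Integration.integrable_bound)
    show "integrable P (\<lambda>d. real CARD('d) * real CARD('d) * (norm (G xs d))\<^sup>2)" using L2D(2)[OF L2_G] by simp
    show "(\<lambda>d. outer (G xs d) (G xs d)) \<in> borel_measurable P"
    proof (intro borel_measurable_vecI)
      fix i j
      have "(\<lambda>d. G xs d $ i * G xs d $ j) \<in> borel_measurable P"
        by (intro borel_measurable_times borel_measurable_vec_nth G_measurable_P)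
      then show "(\<lambda>d. outer (G xs d) (G xs d) $ i $ j) \<in> borel_measurable P" by (simp add: outer_def)
    qed
    show "AE d in P. norm (outer (G xs d) (G xs d)) \<le> norm (real CARD('d) * real CARD('d) * (norm (G xs d))\<^sup>2)"
    proof (intro AE_I2)
      fix d
      have "norm (outer (G xs d) (G xs d)) \<le> (\<Sum>i\<in>(UNIV::'d set). \<Sum>j\<in>(UNIV::'d set). (norm (G xs d))\<^sup>2)"
        by (rule order_trans[OF norm_matrix_le_sum], intro sum_mono)
          (simp add: outer_def abs_mult power2_eq_square mult_mono component_le_norm_cart)
      then show "norm (outer (G xs d) (G xs d)) \<le> norm (real CARD('d) * real CARD('d) * (norm (G xs d))\<^sup>2)" by simp
    qed
  qed
  have tr: "bounded_linear (\<lambda>A::real^'d^'d. transpose A)"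
    unfolding linear_conv_bounded_linear[symmetric]
    by (rule linearI) (simp_all add: transpose_def vec_eq_iff)
  have "transpose C = (LINT d|P. transpose (outer (G xs d) (G xs d)))"
    unfolding C_def by (rule integral_bounded_linear[OF tr i, symmetric])
  also have "\<dots> = C" unfolding C_def
    by (intro Bochner_Integration.integral_cong refl) (simp add: outer_def transpose_def vec_eq_iff mult.commute)
  finally have symC: "transpose C = C" .
  show "transpose Om = Om" unfolding Om by (simp add: matrix_transpose_mul inv symC matrix_mul_assoc)
  define w where "w = matrix_inv Bs *v \<theta>"
  have "\<theta> \<bullet> (Om *v \<theta>) = w \<bullet> (C *v w)"
    by (simp add: Om w_def inner_symmetric_matrix[OF inv] flip: matrix_vector_mul_assoc)
  also have "\<dots> = (LINT d|P. w \<bullet> (outer (G xs d) (G xs d) *v w))"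
    unfolding C_def
    by (rule integral_bounded_linear[OF bounded_linear_compose[OF bounded_linear_inner_right bounded_linear_matrix_vec_left] i, symmetric])
  also have "\<dots> = (LINT d|P. (\<theta> \<bullet> (matrix_inv Bs *v G xs d))\<^sup>2)"
  proof (intro Bochner_Integration.integral_cong refl)
    fix d
    have "outer (G xs d) (G xs d) *v w = (G xs d \<bullet> w) *\<^sub>R G xs d"
      by (simp add: outer_def matrix_vector_mult_def inner_vec_def vec_eq_iff sum_distrib_left mult_ac)
    moreover have "w \<bullet> G xs d = \<theta> \<bullet> (matrix_inv Bs *v G xs d)"
      by (simp add: w_def inner_symmetric_matrix[OF inv])
    ultimately show "w \<bullet> (outer (G xs d) (G xs d) *v w) = (\<theta> \<bullet> (matrix_inv Bs *v G xs d))\<^sup>2"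
      by (simp add: power2_eq_square inner_commute)
  qed
  finally show "(LINT d|P. (\<theta> \<bullet> (matrix_inv Bs *v G xs d))\<^sup>2) = \<theta> \<bullet> (Om *v \<theta>)" by simp
qed

end

section \<open>The theorem\<close>

lemma (in sketch_law) Z_star_positive:
  fixes B0 :: "real^'d^'d" and T :: "'a \<Rightarrow> real^'s^'d"
  assumes M: "prob_space M" and sub: "subalgebra M \<F>"
    and T: "T \<in> borel_measurable M" "distr M borel T = D"
    and B0: "transpose B0 = B0" "invertible B0" and B: "invertible B" and "0 < \<gamma>"
    and low: "AE \<omega> in M. loewner_le (\<gamma> *\<^sub>R mat 1) (cond_Z M \<F> (\<lambda>_. B0) T \<omega>)"
    and v: "v \<noteq> 0"
  shows "v \<bullet> (Z_star D B *v v) \<noteq> 0"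
proof
  assume "v \<bullet> (Z_star D B *v v) = 0"
  then have "(LINT S|D. (norm (Ztilde B S *v v))\<^sup>2) = 0" by (simp add: Z_star_inner)
  then have "AE S in D. (norm (Ztilde B S *v v))\<^sup>2 = 0"
    by (subst (asm) integral_nonneg_eq_0_iff_AE[OF Z_star_inner(2)]) auto
  then have kernel: "AE S in D. transpose S *v (B *v v) = 0"
    by eventually_elim (simp add: Ztilde_vec_eq_0_iff[OF sym])
  define w where "w = matrix_inv B0 *v (B *v v)"
  have B0w: "B0 *v w = B *v v" by (simp add: w_def matrix_inv_mult_vec[OF B0(2)])
  interpret M: prob_space M by fact
  interpret F: finite_measure_subalgebra M \<F> by unfold_locales (rule sub)
  have "AE S in D. Ztilde B0 S *v w = 0"
    using kernel by eventually_elim (simp add: Ztilde_vec_eq_0_iff[OF B0(1)] B0w)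
  then have zero: "AE \<omega> in M. Ztilde B0 (T \<omega>) *v w = 0"
    unfolding T(2)[symmetric] by (rule AE_distrD[OF T(1)])
  have Zm: "(\<lambda>\<omega>. Ztilde B0 (T \<omega>)) \<in> borel_measurable M"
    by (rule measurable_compose[OF T(1) Ztilde_measurable[OF B0(1)]])
  have int: "integrable M (\<lambda>\<omega>. Ztilde B0 (T \<omega>) $ i $ j)" for i j
  proof (rule M.integrable_const_bound[where B="(real CARD('d))\<^sup>2"])
    show "AE \<omega> in M. norm (Ztilde B0 (T \<omega>) $ i $ j) \<le> (real CARD('d))\<^sup>2"
      by (intro AE_I2) (auto intro: order_trans[OF matrix_entry_le_norm norm_matrix_le_of_contraction] Ztilde_inner(2)[OF B0(1)])
  qed (intro borel_measurable_vec_nth Zm)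
  let ?Z = "cond_Z M \<F> (\<lambda>_. B0) T"
  have "AE \<omega> in M. (?Z \<omega> *v w) $ i = 0" for i
  proof -
    \<comment> \<open>\<open>cond_Z\<close> is defined entrywise, so that it annihilates
      \<open>w\<close> is shown row by row, by linearity of the real conditional
      expectation.\<close>
    let ?f = "\<lambda>j \<omega>. w $ j * Ztilde B0 (T \<omega>) $ i $ j"
    have "AE \<omega> in M. real_cond_exp M \<F> (\<lambda>\<omega>. \<Sum>j\<in>UNIV. ?f j \<omega>) \<omega> = (\<Sum>j\<in>UNIV. real_cond_exp M \<F> (?f j) \<omega>)"
      by (rule F.real_cond_exp_sum) (use int in simp)
    moreover have "AE \<omega> in M. \<forall>j. real_cond_exp M \<F> (?f j) \<omega> = w $ j * real_cond_exp M \<F> (\<lambda>\<omega>. Ztilde B0 (T \<omega>) $ i $ j) \<omega>"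
      unfolding AE_all_countable by (intro allI F.real_cond_exp_cmult int)
    moreover have "AE \<omega> in M. real_cond_exp M \<F> (\<lambda>\<omega>. \<Sum>j\<in>UNIV. ?f j \<omega>) \<omega> = real_cond_exp M \<F> (\<lambda>\<omega>. 0) \<omega>"
    proof (rule F.real_cond_exp_cong)
      show "AE \<omega> in M. (\<Sum>j\<in>UNIV. ?f j \<omega>) = 0"
        using zero
      proof eventually_elim
        case (elim \<omega>)
        then have "(Ztilde B0 (T \<omega>) *v w) $ i = 0" by simp
        then show ?case by (simp add: matrix_vector_mult_def mult.commute)
      qed
    qed (use int in auto)
    moreover have "AE \<omega> in M. real_cond_exp M \<F> (\<lambda>\<omega>. 0) \<omega> = 0"
      by (rule F.real_cond_exp_F_meas) auto
    ultimately show ?thesis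
    proof eventually_elim
      case (elim \<omega>)
      then show ?case by (simp add: cond_Z_def cond_exp_mat_def matrix_vector_mult_def mult.commute)
    qed
  qed
  then have "AE \<omega> in M. \<forall>i. (?Z \<omega> *v w) $ i = 0" by (simp add: AE_all_countable)
  then have "AE \<omega> in M. w = 0"
    using low
  proof eventually_elim
    case (elim \<omega>)
    then have "?Z \<omega> *v w = 0" by (simp add: vec_eq_iff)
    moreover have "0 \<le> w \<bullet> ((?Z \<omega> - \<gamma> *\<^sub>R mat 1) *v w)" using elim(2) by (simp add: loewner_le_def)
    ultimately have "\<gamma> * (w \<bullet> w) \<le> 0"
      by (simp add: matrix_vector_mult_diff_rdistrib flip: scaleR_matrix_vector_assoc)
    then have "w \<bullet> w \<le> 0" using \<open>0 < \<gamma>\<close> by (simp add: mult_le_0_iff)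
    then show "w = 0" using inner_ge_zero[of w] by (metis inner_eq_zero_iff order_antisym)
  qed
  then have "w = 0" by simp
  then have "B *v v = 0" using B0w by simp
  then have "v = 0" using matrix_inv_mult_vec(2)[OF B, of v] by simp
  then show False using v by simp
qed

lemma subalgebra_past_0: "subalgebra M (past M P \<xi> S \<tau> 0)"
proof -
  have "past M P \<xi> S \<tau> 0 = sigma (space M) {}" by (simp add: past_def events_of_def)
  then show ?thesis using sets.sigma_sets_subset[of "{}" M] by (simp add: subalgebra_def)
qed

lemma lambda_min_mat_1: "lambda_min (mat 1 :: real^'d^'d) = 1"
proof -
  have "real_eigenvalues (mat 1 :: real^'d^'d) = {1}"
  proof -
    have "\<exists>v::real^'d. v \<noteq> 0" by (metis axis_eq_0_iff zero_neq_one)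
    moreover have "l = 1" if "v \<noteq> 0" "v = l *\<^sub>R v" for l and v :: "real^'d"
    proof -
      have "(1 - l) *\<^sub>R v = 0" using that(2) by (simp add: scaleR_diff_left)
      then show ?thesis using that(1) by simp
    qed
    ultimately show ?thesis by (auto simp: real_eigenvalues_def)
  qed
  then show ?thesis by (simp add: lambda_min_def)
qed

lemma solves_lyapunov_0_iff:
  "solves_lyapunov 0 \<zeta> G X \<longleftrightarrow> (2 * (1 - \<zeta>)) *\<^sub>R X = (G :: real^'d^'d)"
proof -
  have "(mat 1 - 0) - \<zeta> *\<^sub>R mat 1 = (1 - \<zeta>) *\<^sub>R (mat 1 :: real^'d^'d)" by (simp add: scaleR_diff_left)
  moreover have "((1 - \<zeta>) *\<^sub>R (mat 1 :: real^'d^'d)) ** X = (1 - \<zeta>) *\<^sub>R X"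
    by (simp flip: scalar_matrix_assoc)
  moreover have "X ** ((1 - \<zeta>) *\<^sub>R (mat 1 :: real^'d^'d)) = (1 - \<zeta>) *\<^sub>R X"
    unfolding matrix_scalar_ac by (simp flip: scalar_matrix_assoc)
  ultimately have "solves_lyapunov 0 \<zeta> G X \<longleftrightarrow> (1 - \<zeta>) *\<^sub>R X + (1 - \<zeta>) *\<^sub>R X = G"
    unfolding solves_lyapunov_def by simp
  also have "(1 - \<zeta>) *\<^sub>R X + (1 - \<zeta>) *\<^sub>R X = (2 * (1 - \<zeta>)) *\<^sub>R X"
    by (simp only: scaleR_add_left[symmetric] mult_2)
  finally show ?thesis .
qed

lemma loewner_le_scaled_identity:
  shows "loewner_le (a *\<^sub>R mat 1) A \<Longrightarrow> a * (norm v)\<^sup>2 \<le> v \<bullet> (A *v v)"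
    and "loewner_le A (a *\<^sub>R mat 1) \<Longrightarrow> v \<bullet> (A *v v) \<le> a * (norm v)\<^sup>2"
proof -
  have 1: "(a *\<^sub>R mat 1) *v v = a *\<^sub>R v" for v :: "real^'b" by (simp flip: scaleR_matrix_vector_assoc)
  show "loewner_le (a *\<^sub>R mat 1) A \<Longrightarrow> a * (norm v)\<^sup>2 \<le> v \<bullet> (A *v v)"
    unfolding loewner_le_def by (auto simp: matrix_vector_mult_diff_rdistrib inner_diff_right power2_norm_eq_inner simp flip: scaleR_matrix_vector_assoc dest: spec[of _ v])
  show "loewner_le A (a *\<^sub>R mat 1) \<Longrightarrow> v \<bullet> (A *v v) \<le> a * (norm v)\<^sup>2"
    unfolding loewner_le_def by (auto simp: matrix_vector_mult_diff_rdistrib inner_diff_right power2_norm_eq_inner simp flip: scaleR_matrix_vector_assoc dest: spec[of _ v])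
qed

theorem proposition4p4:
  fixes M :: "'a measure"
    and P :: "'x measure"
    and D :: "(real^'s^'d) measure"
    and F :: "real^'d \<Rightarrow> 'x \<Rightarrow> real"
    and f :: "real^'d \<Rightarrow> real"
    and \<xi> :: "nat \<Rightarrow> 'a \<Rightarrow> 'x"
    and S :: "nat \<Rightarrow> nat \<Rightarrow> 'a \<Rightarrow> real^'s^'d"
    and \<tau> :: nat
    and x0 xs :: "real^'d"
    and B0 :: "real^'d^'d"
    and x g :: "nat \<Rightarrow> 'a \<Rightarrow> real^'d"
    and H B Z :: "nat \<Rightarrow> 'a \<Rightarrow> real^'d^'d"
    and \<mu> \<nu> :: "nat \<Rightarrow> 'a \<Rightarrow> real"
    and \<gamma>H UH UL qg Cg1 Cg2 CH1 CH2 \<gamma>S US \<phi> C\<phi> \<zeta> \<mu>s \<nu>s \<gamma>s :: real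
    and step :: "nat \<Rightarrow> real"
    and Bs Om Sig :: "real^'d^'d"
    and \<F> :: "nat \<Rightarrow> 'a measure"
    and N :: "(nat \<Rightarrow> real^'s^'d) measure"
    and Kt Ct :: "(nat \<Rightarrow> real^'s^'d) \<Rightarrow> real^'d^'d"
  assumes prob: "prob_space M"
    and tau: "\<tau> \<ge> 1"
    and xi_indep: "prob_space.indep_vars M (\<lambda>_. P) \<xi> UNIV"
    and xi_law: "\<And>t. distr M P (\<xi> t) = P"
    and S_indep: "prob_space.indep_vars M (\<lambda>_. borel) (\<lambda>(t, j). S t j) (UNIV \<times> {..<\<tau>})"
    and S_law: "\<And>t j. j < \<tau> \<Longrightarrow> distr M borel (S t j) = D"
    and S_xi_indep: "prob_space.indep_set M
          (sigma_sets (space M) (events_of M UNIV \<xi> P))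
          (sigma_sets (space M) (events_of M (UNIV \<times> {..<\<tau>}) (\<lambda>(t, j). S t j) borel))"
    and F_integrable: "\<And>u. integrable P (F u)"
    and f_def: "f = (\<lambda>u. LINT d|P. F u d)"
    and xs: "is_arg_min f (\<lambda>_. True) xs"
    and g_def: "g = (\<lambda>t \<omega>. gradient (\<lambda>u. F u (\<xi> t \<omega>)) (x t \<omega>))"
    and H_def: "H = (\<lambda>t \<omega>. hessian (\<lambda>u. F u (\<xi> t \<omega>)) (x t \<omega>))"
    and B_def: "B = (\<lambda>t \<omega>. if t = 0 then B0 else (1 / real t) *\<^sub>R (\<Sum>i<t. H i \<omega>))"
    and B_init: "transpose B0 = B0" "loewner_le (\<gamma>H *\<^sub>R mat 1) B0" "loewner_le B0 (UH *\<^sub>R mat 1)"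
    and past_def: "\<F> = past M P \<xi> S \<tau>"
    and Z_def: "Z = (\<lambda>t. cond_Z M (\<F> t) (B t) (S t 0))"
    and mu_def: "\<mu> = (\<lambda>t \<omega>. mu_of (Z t \<omega>))"
    and nu_def: "\<nu> = (\<lambda>t \<omega>. nu_of (cond_ZZinvZ M (\<F> t) (B t) (S t 0) \<omega>) (Z t \<omega>))"
    and phi: "1/2 < \<phi>" "\<phi> \<le> 1" "C\<phi> > 0"
    and step_def: "step = (\<lambda>t. C\<phi> / (real t + 1) powr \<phi>)"
    and x_init: "\<And>\<omega>. \<omega> \<in> space M \<Longrightarrow> x 0 \<omega> = x0"
    and Bs_def: "Bs = hessian f xs"
    and Om_def: "Om = Omega_star P F Bs xs"
    and zeta_def: "\<zeta> = (if \<phi> = 1 then 1 / (2 * C\<phi>) else 0)"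
    and mus_def: "\<mu>s = mu_of (Z_star D Bs)"
    and nus_def: "\<nu>s = nu_of (ZZinvZ_star D Bs) (Z_star D Bs)"
    and gammas_def: "\<gamma>s = gamma_of \<mu>s \<nu>s"
    and Kt_def: "Kt = Ktilde (alpha_of \<mu>s \<nu>s) (beta_of \<mu>s \<nu>s) \<gamma>s Bs \<tau>"
    and Ct_def: "Ct = plain_prod Bs \<tau>"
    and law_def: "N = sketches D \<tau>"
    and i_const: "0 < \<gamma>H" "\<gamma>H < UH"
    and i_smooth: "twice_continuously_differentiable f"
          "\<And>d. d \<in> space P \<Longrightarrow> twice_continuously_differentiable (\<lambda>u. F u d)"
    and i_eig: "\<And>u d. d \<in> space P \<Longrightarrow> \<gamma>H \<le> lambda_min (hessian (\<lambda>u. F u d) u)"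
          "\<And>u d. d \<in> space P \<Longrightarrow>
             lambda_min (hessian (\<lambda>u. F u d) u) \<le> lambda_max (hessian (\<lambda>u. F u d) u)"
          "\<And>u d. d \<in> space P \<Longrightarrow> lambda_max (hessian (\<lambda>u. F u d) u) \<le> UH"
    and i_lip: "\<And>u w. spectral_norm (hessian f u - hessian f w) \<le> UL * norm (u - w)"
    and ii_const: "qg > 2" "Cg1 > 0" "Cg2 > 0"
    and ii_mean: "\<And>t. AE \<omega> in M.
          cond_exp_vec M (\<F> t) (g t) \<omega> = gradient f (x t \<omega>)"
    and ii_moment: "\<And>t. AE \<omega> in M.
          nn_cond_exp M (\<F> t)
             (\<lambda>w. ennreal (norm (g t w - gradient f (x t w)) powr qg)) \<omega>
          \<le> ennreal (Cg1 * norm (x t \<omega> - xs) powr qg + Cg2)"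
    and iii_const: "CH1 > 0" "CH2 > 0"
    and iii_mean: "\<And>t. AE \<omega> in M.
          cond_exp_mat M (\<F> t) (H t) \<omega> = hessian f (x t \<omega>)"
    and iii_moment: "\<And>t. AE \<omega> in M.
          nn_cond_exp M (\<F> t)
             (\<lambda>w. ennreal ((spectral_norm (H t w - hessian f (x t w)))\<^sup>2)) \<omega>
          \<le> ennreal (CH1 * (norm (x t \<omega> - xs))\<^sup>2 + CH2)"
  shows
    "(\<comment> \<open>(a) exact solves\<close>
      (\<forall>t. \<forall>\<omega>\<in>space M. x (Suc t) \<omega> = x t \<omega> - step t *\<^sub>R (matrix_inv (B t \<omega>) *v g t \<omega>)) \<and>
      (\<phi> = 1 \<longrightarrow> C\<phi> > (1/2) / lambda_min (mat 1 - (0 :: real^'d^'d)))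
      \<longrightarrow>
      (solves_lyapunov 0 \<zeta> (Gamma_of N (\<lambda>_. 0) Om) Sig \<longrightarrow>
         (\<phi> < 1 \<longrightarrow> Sig = (1/2) *\<^sub>R Om) \<and>
         (\<phi> = 1 \<longrightarrow> Sig = (C\<phi> / (2 * C\<phi> - 1)) *\<^sub>R Om)) \<and>
      (\<phi> = 1 \<and> C\<phi> = 1 \<longrightarrow>
         converges_in_distribution M (\<lambda>t \<omega>. sqrt (real t) *\<^sub>R (x t \<omega> - xs))
           (multivariate_normal 0 Om)))
     \<and>
     (\<comment> \<open>(b) accelerated sketched solves\<close>
      (\<forall>t. \<forall>\<omega>\<in>space M. x (Suc t) \<omega> = x t \<omega> + step t *\<^sub>R
           fst (solver (alpha_of (\<mu> t \<omega>) (\<nu> t \<omega>)) (beta_of (\<mu> t \<omega>) (\<nu> t \<omega>))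
                  (gamma_of (\<mu> t \<omega>) (\<nu> t \<omega>)) (B t \<omega>) (g t \<omega>) (\<lambda>j. S t j \<omega>) \<tau>)) \<and>
      (\<phi> = 1 \<longrightarrow> C\<phi> > (1/2) / lambda_min (mat 1 - mean_of N Kt)) \<and>
      \<gamma>S > 0 \<and> US > 0 \<and>
      (\<forall>t. AE \<omega> in M. loewner_le (\<gamma>S *\<^sub>R mat 1) (Z t \<omega>)) \<and>
      (\<integral>\<^sup>+ s. ennreal (spectral_norm s * spectral_norm (pinv s)) \<partial>D) \<le> ennreal US \<and>
      (\<forall>t. AE \<omega> in M.
         ereal (real \<tau>) * epowi (1 - sqrt (\<mu> t \<omega> / \<nu> t \<omega>)) (int \<tau> - 2) \<le> ereal (\<gamma>H / (4 * UH))) \<and>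
      solves_lyapunov (mean_of N Kt) \<zeta> (Gamma_of N Kt Om) Sig \<and>
      \<gamma>s = 1
      \<longrightarrow>
      solves_lyapunov (mean_of N Ct) \<zeta> (Gamma_of N Ct Om) Sig \<and>
      (\<forall>X. solves_lyapunov (mean_of N Ct) \<zeta> (Gamma_of N Ct Om) X
            \<longrightarrow> X = Sig))"
proof -
  interpret M: prob_space M by (rule prob)
  have xi_rv: "\<xi> t \<in> measurable M P" for t
    using xi_indep unfolding M.indep_vars_def2 by simp
  have prob_P: "prob_space P" using M.prob_space_distr[OF xi_rv[of 0]] by (simp add: xi_law)
  have S_rv: "S t j \<in> borel_measurable M" if "j < \<tau>" for t j
    using S_indep that unfolding M.indep_vars_def2 by auto
  have "0 < \<tau>" using tau by simp
  have prob_D: "prob_space D" using M.prob_space_distr[OF S_rv[OF \<open>0 < \<tau>\<close>, of 0]] S_law[OF \<open>0 < \<tau>\<close>] by simp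
  have sets_D: "sets D = sets borel" using S_law[OF \<open>0 < \<tau>\<close>, of 0] by (metis sets_distr)
  interpret N: prob_space N
    unfolding law_def sketches_def by (intro prob_space_PiM prob_D)
  interpret S: smooth_sample P F \<gamma>H UH
    using prob_P F_integrable i_smooth(2) i_const i_eig
    by (intro smooth_sample.intro smooth_sample_axioms.intro) auto
  have square_x0: "integrable P (\<lambda>d. (norm (S.G x0 d))\<^sup>2)"
  proof (rule S.square_integrable_of_moment[OF prob subalgebra_past_0 xi_rv xi_law ii_const(1)])
    let ?f = "\<lambda>w. ennreal (norm (g 0 w - gradient f (x 0 w)) powr qg)"
      and ?f' = "\<lambda>w. ennreal (norm (S.G x0 (\<xi> 0 w) - gradient f x0) powr qg)"
    \<comment> \<open>\<open>x_init\<close> fixes \<open>x 0\<close> on \<open>space M\<close> only,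
      so the integrands agree there and the conditional expectations almost everywhere.\<close>
    have eq: "?f w = ?f' w" if "w \<in> space M" for w
      using x_init[OF that] by (simp add: g_def S.G_def)
    have f'_meas: "?f' \<in> borel_measurable M"
      using measurable_compose[OF xi_rv S.G_measurable_P] by measurable
    then have f_meas: "?f \<in> borel_measurable M"
      by (subst measurable_cong[OF eq])
    interpret F0: finite_measure_subalgebra M "\<F> 0"
      unfolding past_def by unfold_locales (rule subalgebra_past_0)
    have "AE \<omega> in M. nn_cond_exp M (\<F> 0) ?f \<omega> = nn_cond_exp M (\<F> 0) ?f' \<omega>"
      by (rule F0.nn_cond_exp_cong[OF AE_I2[OF eq] f_meas f'_meas])
    then have "AE \<omega> in M. nn_cond_exp M (\<F> 0) ?f' \<omega> \<le> ennreal (Cg1 * norm (x 0 \<omega> - xs) powr qg + Cg2)"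
      using ii_moment[of 0] by eventually_elim simp
    then show "AE \<omega> in M. nn_cond_exp M (past M P \<xi> S \<tau> 0) ?f' \<omega> \<le> ennreal (Cg1 * norm (x0 - xs) powr qg + Cg2)"
      unfolding past_def using x_init by (auto elim!: AE_mp)
  qed
  interpret O: sampled_objective P F \<gamma>H UH f UL xs x0
    using f_def i_smooth(1) i_lip xs square_x0 by unfold_locales auto
  have Bs_eq: "Bs = O.Bs" by (simp add: Bs_def O.Bs_def)
  have UH: "0 < UH" using i_const by simp

  have a1: "(\<phi> < 1 \<longrightarrow> Sig = (1/2) *\<^sub>R Om) \<and> (\<phi> = 1 \<longrightarrow> Sig = (C\<phi> / (2 * C\<phi> - 1)) *\<^sub>R Om)"
    if iv: "\<phi> = 1 \<longrightarrow> C\<phi> > (1/2) / lambda_min (mat 1 - (0 :: real^'d^'d))"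
      and lyap: "solves_lyapunov 0 \<zeta> (Gamma_of N (\<lambda>_. 0) Om) Sig"
  proof -
    have "Gamma_of N (\<lambda>_. 0) Om = Om" by (simp add: Gamma_of_def N.prob_space transpose_mat)
    then have eq: "(2 * (1 - \<zeta>)) *\<^sub>R Sig = Om" using lyap solves_lyapunov_0_iff by metis
    show ?thesis
    proof (intro conjI impI)
      assume "\<phi> < 1"
      then show "Sig = (1/2) *\<^sub>R Om" using eq[symmetric] by (simp add: zeta_def)
    next
      assume 1: "\<phi> = 1"
      then have C: "C\<phi> > 1/2" using iv by (simp add: lambda_min_mat_1)
      have "2 * (1 - \<zeta>) = (2 * C\<phi> - 1) / C\<phi>" using 1 C by (simp add: zeta_def field_simps)
      then show "Sig = (C\<phi> / (2 * C\<phi> - 1)) *\<^sub>R Om" using eq[symmetric] C by simp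
    qed
  qed

  have a2: "converges_in_distribution M (\<lambda>t \<omega>. sqrt (real t) *\<^sub>R (x t \<omega> - xs)) (multivariate_normal 0 Om)"
    if exact: "\<And>t \<omega>. \<omega> \<in> space M \<Longrightarrow> x (Suc t) \<omega> = x t \<omega> - step t *\<^sub>R (matrix_inv (B t \<omega>) *v g t \<omega>)"
      and "\<phi> = 1" "C\<phi> = 1"
  proof -
    \<comment> \<open>The factor turns the spectral Lipschitz bound into one for the Frobenius norm.
      It is at least 1, so the same \<open>L\<close> serves for the Taylor remainder.\<close>
    define L where "L = real CARD('d) * real CARD('d) * UL"
    have card: "1 \<le> real CARD('d) * real CARD('d)"
      using mult_mono[of 1 "real CARD('d)" 1 "real CARD('d)"] zero_less_card_finite[where 'a='d] by simp
    have L: "0 \<le> L" "UL \<le> L" using mult_right_mono[OF card O.K_nonneg] O.K_nonneg by (auto simp: L_def)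
    have step: "step t = 1 / real (Suc t)" for t
      using that(2,3) by (simp add: step_def add.commute)
    interpret SN: stochastic_newton M "history M P \<xi>" P \<xi> S.G S.Hs f "gradient f" "hessian f" xs x0 Bs B0 \<gamma>H UH L x B
    proof unfold_locales
      show "fresh M (history M P \<xi> t) P (\<xi> t)" for t by (rule M.fresh_history[OF xi_indep xi_law])
      show "\<xi> i \<in> measurable (history M P \<xi> t) P" if "i < t" for i t by (rule measurable_history[OF xi_rv that])
      show "sets (history M P \<xi> s) \<subseteq> sets (history M P \<xi> t)" if "s \<le> t" for s t by (rule history_mono[OF xi_rv that])
      show "(\<lambda>p. S.G (fst p) (snd p)) \<in> borel_measurable (borel \<Otimes>\<^sub>M P)" by (rule S.G_measurable)
      show "(\<lambda>p. S.Hs (fst p) (snd p)) \<in> borel_measurable (borel \<Otimes>\<^sub>M P)" by (rule S.Hs_measurable)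
      show "0 < \<gamma>H" "0 < UH" "0 \<le> L" using i_const L by auto
      show "norm (S.G u d - S.G w d) \<le> UH * norm (u - w)" if "d \<in> space P" for u w d by (rule S.G_lip[OF that])
      show "transpose (S.Hs u d) = S.Hs u d" if "d \<in> space P" for u d by (rule S.Hs_sym[OF that])
      show "\<gamma>H * (norm v)\<^sup>2 \<le> v \<bullet> (S.Hs u d *v v)" if "d \<in> space P" for u d v by (rule S.Hs_low[OF that])
      show "v \<bullet> (S.Hs u d *v v) \<le> UH * (norm v)\<^sup>2" if "d \<in> space P" for u d v by (rule S.Hs_up[OF that])
      show "(LINT d|P. S.G u d) = gradient f u" for u by (rule O.G_mean)
      show "(LINT d|P. S.Hs u d) = hessian f u" for u by (rule O.Hs_mean)
      show "integrable P (\<lambda>d. (norm (S.G xs d))\<^sup>2)" by (rule L2D(2)[OF O.L2_G])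
      show "gradient f xs = 0" by (rule O.gradient_xs)
      show lip: "norm (gradient f u - gradient f w) \<le> UH * norm (u - w)" for u w by (rule O.gradient_lip)
      show mono: "\<gamma>H * (norm (u - w))\<^sup>2 \<le> (gradient f u - gradient f w) \<bullet> (u - w)" for u w by (rule O.gradient_mono)
      have der: "(f has_derivative (\<lambda>h. h \<bullet> gradient f y)) (at y)" for y by (rule tcd_has_derivative[OF i_smooth(1)])
      show "continuous_on UNIV f" by (rule has_derivative_continuous_on) (use der in simp)
      show "f y \<le> f u + (y - u) \<bullet> gradient f u + UH * (norm (y - u))\<^sup>2" for u y
        by (rule descent_bound[OF der lip]) (use UH in simp)
      show "\<gamma>H / 4 * (norm (u - xs))\<^sup>2 \<le> f u - f xs" for u
        by (rule strong_convexity_gap[OF der mono]) (use i_const O.gradient_xs xs in \<open>auto simp: is_arg_min_def not_less\<close>)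
      show "norm (gradient f u - Bs *v (u - xs)) \<le> L * (norm (u - xs))\<^sup>2" for u
        using O.gradient_taylor[of u] mult_right_mono[OF L(2), of "(norm (u - xs))\<^sup>2"] by (simp add: Bs_eq)
      show "norm (hessian f u - Bs) \<le> L * norm (u - xs)" for u
        unfolding L_def Bs_eq by (rule O.hessian_close)
      show "\<gamma>H * (norm v)\<^sup>2 \<le> v \<bullet> (Bs *v v)" for v unfolding Bs_eq by (rule O.Bs_low)
      show "transpose B0 = B0" by (rule B_init(1))
      show "\<gamma>H * (norm v)\<^sup>2 \<le> v \<bullet> (B0 *v v)" for v by (rule loewner_le_scaled_identity(1)[OF B_init(2)])
      show "v \<bullet> (B0 *v v) \<le> UH * (norm v)\<^sup>2" for v by (rule loewner_le_scaled_identity(2)[OF B_init(3)])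
      show "x 0 \<omega> = x0" if "\<omega> \<in> space M" for \<omega> by (rule x_init[OF that])
      show "x (Suc t) \<omega> = x t \<omega> - (1 / real (Suc t)) *\<^sub>R (matrix_inv (B t \<omega>) *v S.G (x t \<omega>) (\<xi> t \<omega>))"
        if "\<omega> \<in> space M" for t \<omega>
        using exact[OF that, of t] by (simp add: step g_def S.G_def)
      show "B t \<omega> = (if t = 0 then B0 else (1 / real t) *\<^sub>R (\<Sum>i<t. S.Hs (x i \<omega>) (\<xi> i \<omega>)))" for t \<omega>
        by (simp add: B_def H_def S.Hs_def)
    qed
    show ?thesis
    proof (rule SN.normality[OF xi_indep])
      show "transpose Om = Om" unfolding Om_def Bs_eq by (rule O.Omega_props(1))
      show "(LINT d|P. (\<theta> \<bullet> (matrix_inv Bs *v S.G xs d))\<^sup>2) = \<theta> \<bullet> (Om *v \<theta>)" for \<theta>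
        unfolding Om_def Bs_eq by (rule O.Omega_props(2))
    qed
  qed

  have b: "solves_lyapunov (mean_of N Ct) \<zeta> (Gamma_of N Ct Om) Sig \<and>
      (\<forall>X. solves_lyapunov (mean_of N Ct) \<zeta> (Gamma_of N Ct Om) X \<longrightarrow> X = Sig)"
    if iv: "\<phi> = 1 \<longrightarrow> C\<phi> > (1/2) / lambda_min (mat 1 - mean_of N Kt)"
      and "\<gamma>S > 0" and Z_low: "AE \<omega> in M. loewner_le (\<gamma>S *\<^sub>R mat 1) (Z 0 \<omega>)"
      and lyap: "solves_lyapunov (mean_of N Kt) \<zeta> (Gamma_of N Kt Om) Sig" and "\<gamma>s = 1"
  proof -
    have KC: "Kt = Ct" by (simp add: Kt_def Ct_def \<open>\<gamma>s = 1\<close> Ktilde_gamma_1 fun_eq_iff)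
    interpret D: sketch_law D Bs
      using prob_D sets_D O.transpose_Bs by (intro sketch_law.intro sketch_law_axioms.intro) (simp_all add: Bs_eq)
    have Z_pos: "v \<bullet> (Z_star D Bs *v v) \<noteq> 0" if "v \<noteq> 0" for v
    proof (rule D.Z_star_positive[OF prob subalgebra_past_0 S_rv[OF \<open>0 < \<tau>\<close>] S_law[OF \<open>0 < \<tau>\<close>] B_init(1) _ _ \<open>\<gamma>S > 0\<close> _ that])
      show "invertible B0"
        by (rule invertible_if_coercive[OF i_const(1) loewner_le_scaled_identity(1)[OF B_init(2)]])
      show "invertible Bs" unfolding Bs_eq by (rule invertible_if_coercive[OF i_const(1) O.Bs_low])
      show "AE \<omega> in M. loewner_le (\<gamma>S *\<^sub>R mat 1) (cond_Z M (past M P \<xi> S \<tau> 0) (\<lambda>_. B0) (S 0 0) \<omega>)"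
        \<comment> \<open>At time 0 the averaged Hessian is the constant \<open>B0\<close>.\<close>
        using Z_low by (simp add: Z_def past_def B_def)
    qed
    define K where "K = mean_of N Ct"
    have K: "K = rev_prod (\<lambda>_. mat 1 - Z_star D Bs) \<tau>"
      unfolding K_def law_def Ct_def by (rule D.mean_plain_prod)
    have K_lt: "v \<bullet> (K *v v) < v \<bullet> v" if "v \<noteq> 0" for v
      unfolding K by (rule D.W_power_coercive[OF Z_pos tau that])
    have "transpose K = K" unfolding K by (rule D.transpose_W_power)
    then have sym: "transpose (mat 1 - K) = mat 1 - K"
      by (simp add: transpose_def mat_def vec_eq_iff)
    have quad: "v \<bullet> ((mat 1 - K) *v v) = v \<bullet> v - v \<bullet> (K *v v)" for v
      by (simp add: matrix_vector_mult_diff_rdistrib inner_diff_right)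
    have pos: "0 < v \<bullet> (((mat 1 - K) - \<zeta> *\<^sub>R mat 1) *v v)" if "v \<noteq> 0" for v
    proof -
      have eq: "v \<bullet> (((mat 1 - K) - \<zeta> *\<^sub>R mat 1) *v v) = v \<bullet> ((mat 1 - K) *v v) - \<zeta> * (v \<bullet> v)"
        by (simp add: matrix_vector_mult_diff_rdistrib inner_diff_right flip: scaleR_matrix_vector_assoc)
      show ?thesis
      proof (cases "\<phi> = 1")
        case False then show ?thesis unfolding eq quad using K_lt[OF that] by (simp add: zeta_def)
      next
        case True
        define l where "l = lambda_min (mat 1 - K)"
        \<comment> \<open>Assumption (iv) divides by \<open>l\<close>, so it bounds \<zeta> only
          once \<open>l\<close> is known to be positive; an eigenvector for \<open>l\<close> shows
          this.\<close>
        obtain y where y: "y \<noteq> 0" "(mat 1 - K) *v y = l *\<^sub>R y"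
          using lambda_min_le(2)[OF sym] by (auto simp: real_eigenvalues_def l_def)
        have "0 < l * (y \<bullet> y)" using K_lt[OF y(1)] quad[of y] y(2) by simp
        moreover have "0 < y \<bullet> y" using y(1) by simp
        ultimately have l: "0 < l" by (rule zero_less_mult_pos2)
        have "C\<phi> > (1/2) / l" using iv True by (simp add: l_def K_def KC)
        then have "\<zeta> < l" using l phi(3) True by (simp add: zeta_def field_simps)
        then have "\<zeta> * (v \<bullet> v) < l * (v \<bullet> v)" using that by simp
        also have "\<dots> \<le> v \<bullet> ((mat 1 - K) *v v)"
          using lambda_min_le(1)[OF sym, of v] by (simp add: l_def power2_norm_eq_inner)
        finally show ?thesis unfolding eq by simp
      qed
    qed
    have Sig: "solves_lyapunov K \<zeta> (Gamma_of N Ct Om) Sig" using lyap by (simp add: KC K_def)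
    have "X = Sig" if "solves_lyapunov K \<zeta> (Gamma_of N Ct Om) X" for X
    proof (rule lyapunov_unique[OF pos])
      show "(mat 1 - K - \<zeta> *\<^sub>R mat 1) ** X + X ** (mat 1 - K - \<zeta> *\<^sub>R mat 1)
          = (mat 1 - K - \<zeta> *\<^sub>R mat 1) ** Sig + Sig ** (mat 1 - K - \<zeta> *\<^sub>R mat 1)"
        using that Sig unfolding solves_lyapunov_def by (simp only:)
    qed
    then show ?thesis using Sig unfolding K_def by blast
  qed
  show ?thesis using a1 a2 b by blast
qed

end
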